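(* Let $k$ be an algebraically closed field and let $H$ be a cosemisimple Hopf algebra over $k$. Assume that $H$ contains a simple subcoalgebra $C$ of dimension $9$ and that $H$ has no simple subcoalgebras of even dimension. Then one of the following conditions must hold: (i) $H$ contains a grouplike element of order $2$ or $3$; (ii) $H$ has two families of simple subcoalgebras $\{C_{2n+1} : n \geq 1\}$ and $\{D_{2n+1} : n \geq 1\}$ with $\dim C_{2n+1} = \dim D_{2n+1} = (2n+1)^2$ such that, writing $C_1 = k1$, $$C_{2n+1}C_{3} = C_{2n-1}+D_{2n+1}+C_{2n+3}$$ for each $n \geq 1$.
   Context: $H$ is not assumed finite dimensional. A coalgebra is simple if it is nonzero and has no proper nonzero subcoalgebras; $H$ is cosemisimple if it is the sum of its simple subcoalgebras. For subcoalgebras $A, B$ of $H$, $AB$ denotes the linear span of the products $ab$ with $a\in A$, $b\in B$, and $A+B$ is the sum of subspaces. The order of a grouplike element is its order in the group of grouplike elements of $H$. $k1$ is the one-dimensional subcoalgebra spanned by the unit of $H$. *)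

theory Defs
  imports
    "HOL-Computational_Algebra.Polynomial"
    "HOL-Algebra.Multiplicative_Group"
    "HOL-Library.Function_Algebras"
    "HOL-Library.Set_Algebras"
begin

section \<open>Tensor products\<close>

text \<open>
  The tensor product of a vector space \<open>H\<close> with itself is realised inside the space of
  scalar-valued functions on the set of bilinear forms on \<open>H\<close>: the pure tensor of \<open>x\<close> and \<open>y\<close>
  is evaluation of bilinear forms at \<open>(x, y)\<close>, and the tensor product is the span of the pure
  tensors. (The pure tensor is set to \<open>0\<close> on functions that are not bilinear forms.)
  The lemmas \<open>bilinear_map_tensor\<close>, \<open>tlift_tensor\<close>, \<open>tlift_add\<close>, \<open>tlift_scale\<close> and
  \<open>tlift_unique\<close> below give the universal property of the tensor product.
\<close>

definition fscale :: "'k::field \<Rightarrow> ('i \<Rightarrow> 'k) \<Rightarrow> 'i \<Rightarrow> 'k" where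
  "fscale c t = (\<lambda>i. c * t i)"

lemma vector_space_fscale: "vector_space (fscale :: 'k::field \<Rightarrow> ('i \<Rightarrow> 'k) \<Rightarrow> 'i \<Rightarrow> 'k)"
  by unfold_locales (auto simp: fscale_def fun_eq_iff algebra_simps)

lemma vector_space_field: "vector_space ((*) :: 'k::field \<Rightarrow> 'k \<Rightarrow> 'k)"
  by unfold_locales (auto simp: algebra_simps)

lemma sum_list_fun_apply: "(\<Sum>p\<leftarrow>ps. F p) i = (\<Sum>p\<leftarrow>ps. F p i)"
  for F :: "'p \<Rightarrow> 'i \<Rightarrow> 'k::field"
  by (induction ps) auto

lemma sum_list_cong': "(\<And>p. p \<in> set ps \<Longrightarrow> F p = G p) \<Longrightarrow> (\<Sum>p\<leftarrow>ps. F p) = (\<Sum>p\<leftarrow>ps. G p)"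
  by (induction ps) auto

lemma linear_sum_list:
  assumes "Vector_Spaces.linear s1 s2 f"
  shows "f (\<Sum>p\<leftarrow>ps. F p) = (\<Sum>p\<leftarrow>ps. f (F p))"
proof -
  interpret Vector_Spaces.linear s1 s2 f by fact
  show ?thesis by (induction ps) (auto simp: zero add)
qed

lemma linearI':
  assumes "vector_space s1" "vector_space s2"
    and "\<And>x y. f (x + y) = f x + f y" "\<And>c x. f (s1 c x) = s2 c (f x)"
  shows "Vector_Spaces.linear s1 s2 f"
  using assms by (simp add: Vector_Spaces.linear_iff)

lemma separating_functional:
  assumes "vector_space s" "w \<noteq> 0"
  obtains \<phi> where "Vector_Spaces.linear s (*) \<phi>" "\<phi> w \<noteq> 0"
proof -
  interpret p: vector_space_pair s "(*)"
    using assms(1) vector_space_field by (rule vector_space_pair.intro)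
  have ind: "p.vs1.independent {w}" using assms(2) by simp
  show ?thesis
  proof (rule that)
    show "Vector_Spaces.linear s (*) (p.construct {w} (\<lambda>_. 1))"
      by (rule p.linear_construct[OF ind])
    show "p.construct {w} (\<lambda>_. 1) w \<noteq> 0"
      using p.construct_basis[OF ind, of w "\<lambda>_. 1"] by simp
  qed
qed

locale kspace = vector_space scale
  for scale :: "'a::field \<Rightarrow> 'b::ab_group_add \<Rightarrow> 'b"
begin

text \<open>\<open>dim\<close> is \<open>0\<close> on infinite-dimensional subspaces, hence even there.\<close>

definition fin_dim :: "'b set \<Rightarrow> bool" where
  "fin_dim V \<longleftrightarrow> (\<exists>B. finite B \<and> span B = V)"

definition bilinear_map :: "('a \<Rightarrow> 'c::ab_group_add \<Rightarrow> 'c) \<Rightarrow> ('b \<Rightarrow> 'b \<Rightarrow> 'c) \<Rightarrow> bool" where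
  "bilinear_map s f \<longleftrightarrow>
     (\<forall>x. Vector_Spaces.linear scale s (\<lambda>y. f x y)) \<and>
     (\<forall>y. Vector_Spaces.linear scale s (\<lambda>x. f x y))"

definition trilinear_map ::
  "('a \<Rightarrow> 'c::ab_group_add \<Rightarrow> 'c) \<Rightarrow> ('b \<Rightarrow> 'b \<Rightarrow> 'b \<Rightarrow> 'c) \<Rightarrow> bool" where
  "trilinear_map s f \<longleftrightarrow>
     (\<forall>x y. Vector_Spaces.linear scale s (\<lambda>z. f x y z)) \<and>
     (\<forall>x z. Vector_Spaces.linear scale s (\<lambda>y. f x y z)) \<and>
     (\<forall>y z. Vector_Spaces.linear scale s (\<lambda>x. f x y z))"

definition tensor :: "'b \<Rightarrow> 'b \<Rightarrow> ('b \<Rightarrow> 'b \<Rightarrow> 'a) \<Rightarrow> 'a" (infix \<open>\<otimes>\<^sub>t\<close> 78) where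
  "x \<otimes>\<^sub>t y = (\<lambda>\<beta>. if bilinear_map (*) \<beta> then \<beta> x y else 0)"

definition tensor3 :: "'b \<Rightarrow> 'b \<Rightarrow> 'b \<Rightarrow> ('b \<Rightarrow> 'b \<Rightarrow> 'b \<Rightarrow> 'a) \<Rightarrow> 'a" where
  "tensor3 x y z = (\<lambda>\<tau>. if trilinear_map (*) \<tau> then \<tau> x y z else 0)"

text \<open>
  \<open>tensor_space A B\<close> is the tensor product of subspaces \<open>A\<close> and \<open>B\<close>, identified with its image
  in \<open>tensor_space UNIV UNIV\<close>; over a field the canonical map is injective.
\<close>

definition tensor_space :: "'b set \<Rightarrow> 'b set \<Rightarrow> (('b \<Rightarrow> 'b \<Rightarrow> 'a) \<Rightarrow> 'a) set" where
  "tensor_space A B = module.span fscale {x \<otimes>\<^sub>t y | x y. x \<in> A \<and> y \<in> B}"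

text \<open>
  \<open>tlift f\<close> is the linear map on the tensor product induced by a bilinear map \<open>f\<close>. In Sweedler's
  notation, where \<open>t\<close> is the sum of the pure tensors of \<open>t\<^sub>1\<close> and \<open>t\<^sub>2\<close>, the element
  \<open>tlift f t\<close> is the sum of the \<open>f t\<^sub>1 t\<^sub>2\<close>.
\<close>

definition tlift :: "('b \<Rightarrow> 'b \<Rightarrow> 'c::ab_group_add) \<Rightarrow> (('b \<Rightarrow> 'b \<Rightarrow> 'a) \<Rightarrow> 'a) \<Rightarrow> 'c" where
  "tlift f t = (THE w. \<exists>ps. t = (\<Sum>(x, y)\<leftarrow>ps. x \<otimes>\<^sub>t y) \<and> w = (\<Sum>(x, y)\<leftarrow>ps. f x y))"

lemma bilinear_map_vs: "bilinear_map s f \<Longrightarrow> vector_space s"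
  unfolding bilinear_map_def by (auto simp: Vector_Spaces.linear_iff)

lemma bilinear_mapD:
  assumes "bilinear_map s f"
  shows "f (x + x') y = f x y + f x' y" "f x (y + y') = f x y + f x y'"
    "f (scale c x) y = s c (f x y)" "f x (scale c y) = s c (f x y)"
  using assms unfolding bilinear_map_def by (auto simp: Vector_Spaces.linear_iff)

lemma bilinear_mapI:
  assumes "vector_space s"
    "\<And>x x' y. f (x + x') y = f x y + f x' y" "\<And>x y y'. f x (y + y') = f x y + f x y'"
    "\<And>c x y. f (scale c x) y = s c (f x y)" "\<And>c x y. f x (scale c y) = s c (f x y)"
  shows "bilinear_map s f"
  using assms vector_space_axioms unfolding bilinear_map_def
  by (auto simp: Vector_Spaces.linear_iff)

lemma trilinear_mapD:
  assumes "trilinear_map s f"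
  shows "f (x + x') y z = f x y z + f x' y z" "f x (y + y') z = f x y z + f x y' z"
    "f x y (z + z') = f x y z + f x y z'"
    "f (scale c x) y z = s c (f x y z)" "f x (scale c y) z = s c (f x y z)"
    "f x y (scale c z) = s c (f x y z)"
  using assms unfolding trilinear_map_def by (auto simp: Vector_Spaces.linear_iff)

lemma bilinear_map_tensor: "bilinear_map fscale (\<otimes>\<^sub>t)"
  by (rule bilinear_mapI[OF vector_space_fscale])
     (auto simp: tensor_def fscale_def fun_eq_iff bilinear_mapD)

lemma trilinear_map_tensor3: "trilinear_map fscale tensor3"
  unfolding trilinear_map_def
  by (auto simp: Vector_Spaces.linear_iff vector_space_axioms vector_space_fscale
      tensor3_def fscale_def fun_eq_iff trilinear_mapD)

lemma linear_bilinear_map: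
  assumes "bilinear_map s f" "Vector_Spaces.linear s s' \<phi>"
  shows "bilinear_map s' (\<lambda>x y. \<phi> (f x y))"
  using assms by (intro bilinear_mapI) (auto simp: Vector_Spaces.linear_iff bilinear_mapD)

lemma tensor_sum_cong:
  assumes f: "bilinear_map s f"
    and eq: "(\<Sum>(x, y)\<leftarrow>ps. x \<otimes>\<^sub>t y) = (\<Sum>(x, y)\<leftarrow>qs. x \<otimes>\<^sub>t y)"
  shows "(\<Sum>(x, y)\<leftarrow>ps. f x y) = (\<Sum>(x, y)\<leftarrow>qs. f x y)"
proof (rule ccontr)
  assume "\<not> ?thesis"
  then have "(\<Sum>(x, y)\<leftarrow>ps. f x y) - (\<Sum>(x, y)\<leftarrow>qs. f x y) \<noteq> 0" by simp
  from separating_functional[OF bilinear_map_vs[OF f] this]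
  obtain \<phi> where \<phi>: "Vector_Spaces.linear s (*) \<phi>"
    and ne: "\<phi> ((\<Sum>(x, y)\<leftarrow>ps. f x y) - (\<Sum>(x, y)\<leftarrow>qs. f x y)) \<noteq> 0" by blast
  have bil: "bilinear_map (*) (\<lambda>x y. \<phi> (f x y))" by (rule linear_bilinear_map[OF f \<phi>])
  have *: "(\<Sum>(x, y)\<leftarrow>rs. x \<otimes>\<^sub>t y) (\<lambda>x y. \<phi> (f x y)) = \<phi> (\<Sum>(x, y)\<leftarrow>rs. f x y)" for rs
    unfolding linear_sum_list[OF \<phi>] sum_list_fun_apply
    by (rule sum_list_cong') (auto simp: tensor_def bil)
  interpret Vector_Spaces.linear s "(*)" \<phi> by fact
  show False using ne *[of ps] *[of qs] eq by (simp add: diff)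
qed

lemma tensor3_sum_cong:
  assumes f: "trilinear_map s f" and s: "vector_space s"
    and eq: "(\<Sum>(x, y, z)\<leftarrow>ps. tensor3 x y z) = (\<Sum>(x, y, z)\<leftarrow>qs. tensor3 x y z)"
  shows "(\<Sum>(x, y, z)\<leftarrow>ps. f x y z) = (\<Sum>(x, y, z)\<leftarrow>qs. f x y z)"
proof (rule ccontr)
  assume "\<not> ?thesis"
  then have "(\<Sum>(x, y, z)\<leftarrow>ps. f x y z) - (\<Sum>(x, y, z)\<leftarrow>qs. f x y z) \<noteq> 0" by simp
  from separating_functional[OF s this]
  obtain \<phi> where \<phi>: "Vector_Spaces.linear s (*) \<phi>"
    and ne: "\<phi> ((\<Sum>(x, y, z)\<leftarrow>ps. f x y z) - (\<Sum>(x, y, z)\<leftarrow>qs. f x y z)) \<noteq> 0" by blast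
  have tri: "trilinear_map (*) (\<lambda>x y z. \<phi> (f x y z))"
    using f \<phi> unfolding trilinear_map_def by (auto simp: Vector_Spaces.linear_iff)
  have *: "(\<Sum>(x, y, z)\<leftarrow>rs. tensor3 x y z) (\<lambda>x y z. \<phi> (f x y z)) = \<phi> (\<Sum>(x, y, z)\<leftarrow>rs. f x y z)" for rs
    unfolding linear_sum_list[OF \<phi>] sum_list_fun_apply
    by (rule sum_list_cong') (auto simp: tensor3_def tri)
  interpret Vector_Spaces.linear s "(*)" \<phi> by fact
  show False using ne *[of ps] *[of qs] eq by (simp add: diff)
qed

lemma tlift_sum_tensor:
  assumes "bilinear_map s f"
  shows "tlift f (\<Sum>(x, y)\<leftarrow>ps. x \<otimes>\<^sub>t y) = (\<Sum>(x, y)\<leftarrow>ps. f x y)"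
  unfolding tlift_def
  by (rule the_equality) (auto intro: tensor_sum_cong[OF assms])

lemma tlift_tensor: "bilinear_map s f \<Longrightarrow> tlift f (x \<otimes>\<^sub>t y) = f x y"
  using tlift_sum_tensor[of s f "[(x, y)]"] by simp

lemma fscale_tensor: "fscale c (x \<otimes>\<^sub>t y) = scale c x \<otimes>\<^sub>t y"
  using bilinear_mapD(3)[OF bilinear_map_tensor] by metis

lemma fscale_sum_tensor:
  "fscale c (\<Sum>(x, y)\<leftarrow>ps. x \<otimes>\<^sub>t y) = (\<Sum>(x, y)\<leftarrow>map (\<lambda>(x, y). (scale c x, y)) ps. x \<otimes>\<^sub>t y)"
proof (induction ps)
  case Nil
  then show ?case by (simp add: fscale_def fun_eq_iff)
next
  case (Cons p ps)
  interpret f: vector_space "fscale :: 'a \<Rightarrow> (('b \<Rightarrow> 'b \<Rightarrow> 'a) \<Rightarrow> 'a) \<Rightarrow> _"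
    by (rule vector_space_fscale)
  from Cons show ?case
    by (cases p) (simp add: f.scale_right_distrib fscale_tensor del: plus_fun_apply)
qed

lemma tensor_space_sum:
  assumes "t \<in> tensor_space A B" "subspace A"
  obtains ps where "t = (\<Sum>(x, y)\<leftarrow>ps. x \<otimes>\<^sub>t y)" "set ps \<subseteq> A \<times> B"
proof -
  interpret f: vector_space "fscale :: 'a \<Rightarrow> (('b \<Rightarrow> 'b \<Rightarrow> 'a) \<Rightarrow> 'a) \<Rightarrow> _"
    by (rule vector_space_fscale)
  from assms(1) have "t \<in> f.span {x \<otimes>\<^sub>t y | x y. x \<in> A \<and> y \<in> B}"
    by (simp add: tensor_space_def)
  then have "\<exists>ps. t = (\<Sum>(x, y)\<leftarrow>ps. x \<otimes>\<^sub>t y) \<and> set ps \<subseteq> A \<times> B"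
  proof (induction rule: f.span_induct_alt)
    case base
    then show ?case by (intro exI[of _ "[]"]) simp
  next
    case (step c w t)
    then obtain ps x y where "t = (\<Sum>(x, y)\<leftarrow>ps. x \<otimes>\<^sub>t y)" "set ps \<subseteq> A \<times> B"
      "w = x \<otimes>\<^sub>t y" "x \<in> A" "y \<in> B" by blast
    then show ?case
      by (intro exI[of _ "(scale c x, y) # ps"])
         (auto simp: fscale_tensor subspace_scale[OF assms(2)])
  qed
  then show ?thesis using that by blast
qed

lemma tlift_add:
  assumes f: "bilinear_map s f" and "t \<in> tensor_space UNIV UNIV" "u \<in> tensor_space UNIV UNIV"
  shows "tlift f (t + u) = tlift f t + tlift f u"
proof -
  obtain ps where ps: "t = (\<Sum>(x, y)\<leftarrow>ps. x \<otimes>\<^sub>t y)" using assms(2) tensor_space_sum subspace_UNIV by metis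
  obtain qs where qs: "u = (\<Sum>(x, y)\<leftarrow>qs. x \<otimes>\<^sub>t y)" using assms(3) tensor_space_sum subspace_UNIV by metis
  have "t + u = (\<Sum>(x, y)\<leftarrow>ps @ qs. x \<otimes>\<^sub>t y)" by (simp add: ps qs)
  then have "tlift f (t + u) = (\<Sum>(x, y)\<leftarrow>ps @ qs. f x y)"
    by (simp only: tlift_sum_tensor[OF f])
  then show ?thesis by (simp add: ps qs tlift_sum_tensor[OF f])
qed

lemma tlift_scale:
  assumes f: "bilinear_map s f" and "t \<in> tensor_space UNIV UNIV"
  shows "tlift f (fscale c t) = s c (tlift f t)"
proof -
  interpret s: vector_space s by (rule bilinear_map_vs[OF f])
  obtain ps where ps: "t = (\<Sum>(x, y)\<leftarrow>ps. x \<otimes>\<^sub>t y)" using assms(2) tensor_space_sum subspace_UNIV by metis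
  have "(\<Sum>(x, y)\<leftarrow>map (\<lambda>(x, y). (scale c x, y)) ps. f x y) = s c (\<Sum>(x, y)\<leftarrow>ps. f x y)" for ps
    by (induction ps) (auto simp: s.scale_right_distrib bilinear_mapD[OF f])
  then show ?thesis
    unfolding ps fscale_sum_tensor tlift_sum_tensor[OF f] .
qed

lemma tlift_unique:
  assumes f: "bilinear_map s f" and t: "t \<in> tensor_space UNIV UNIV"
    and add: "\<And>u v. u \<in> tensor_space UNIV UNIV \<Longrightarrow> v \<in> tensor_space UNIV UNIV \<Longrightarrow> g (u + v) = g u + g v"
    and g: "\<And>x y. g (x \<otimes>\<^sub>t y) = f x y"
  shows "g t = tlift f t"
proof -
  interpret v: vector_space "fscale :: 'a \<Rightarrow> (('b \<Rightarrow> 'b \<Rightarrow> 'a) \<Rightarrow> 'a) \<Rightarrow> _"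
    by (rule vector_space_fscale)
  obtain ps where ps: "t = (\<Sum>(x, y)\<leftarrow>ps. x \<otimes>\<^sub>t y)" using t tensor_space_sum subspace_UNIV by metis
  have pure: "x \<otimes>\<^sub>t y \<in> tensor_space UNIV UNIV" for x y
    unfolding tensor_space_def by (rule v.span_base) blast
  have zero: "0 \<in> tensor_space UNIV UNIV"
    unfolding tensor_space_def by (rule v.span_zero)
  have "g 0 = 0" using add[OF zero zero] by simp
  moreover have "(\<Sum>(x, y)\<leftarrow>qs. x \<otimes>\<^sub>t y) \<in> tensor_space UNIV UNIV" for qs
  proof (induction qs)
    case Nil
    show ?case using zero by (simp del: zero_fun_apply)
  next
    case (Cons q qs)
    have "u \<in> tensor_space UNIV UNIV \<Longrightarrow> v \<in> tensor_space UNIV UNIV \<Longrightarrow> u + v \<in> tensor_space UNIV UNIV"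
      for u v unfolding tensor_space_def by (rule v.span_add)
    from this[OF pure Cons] show ?case
      by (simp add: case_prod_unfold del: plus_fun_apply)
  qed
  ultimately have "g (\<Sum>(x, y)\<leftarrow>qs. x \<otimes>\<^sub>t y) = (\<Sum>(x, y)\<leftarrow>qs. f x y)" for qs
    by (induction qs) (auto simp: add pure g)
  then show ?thesis by (simp add: ps tlift_sum_tensor[OF f])
qed

end


section \<open>Coalgebras and Hopf algebras\<close>

locale coalgebra = kspace scale
  for scale :: "'k::field \<Rightarrow> 'h::ab_group_add \<Rightarrow> 'h" +
  fixes \<Delta> :: "'h \<Rightarrow> ('h \<Rightarrow> 'h \<Rightarrow> 'k) \<Rightarrow> 'k"
    and \<epsilon> :: "'h \<Rightarrow> 'k"
  assumes comult_linear: "Vector_Spaces.linear scale fscale \<Delta>"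
    and comult_in_tensor: "\<Delta> h \<in> tensor_space UNIV UNIV"
    and counit_linear: "Vector_Spaces.linear scale (*) \<epsilon>"
    and coassoc: "tlift (\<lambda>x y. tlift (\<lambda>a b. tensor3 a b y) (\<Delta> x)) (\<Delta> h)
                = tlift (\<lambda>x y. tlift (\<lambda>a b. tensor3 x a b) (\<Delta> y)) (\<Delta> h)"
    and counit_left: "tlift (\<lambda>x y. scale (\<epsilon> x) y) (\<Delta> h) = h"
    and counit_right: "tlift (\<lambda>x y. scale (\<epsilon> y) x) (\<Delta> h) = h"
begin

definition subcoalgebra :: "'h set \<Rightarrow> bool" where
  "subcoalgebra C \<longleftrightarrow> subspace C \<and> (\<forall>c\<in>C. \<Delta> c \<in> tensor_space C C)"

definition simple_subcoalgebra :: "'h set \<Rightarrow> bool" where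
  "simple_subcoalgebra C \<longleftrightarrow> subcoalgebra C \<and> C \<noteq> {0} \<and>
     (\<forall>D. subcoalgebra D \<and> D \<subseteq> C \<longrightarrow> D = {0} \<or> D = C)"

definition cosemisimple :: bool where
  "cosemisimple \<longleftrightarrow> span (\<Union>{C. simple_subcoalgebra C}) = UNIV"

definition grouplike :: "'h \<Rightarrow> bool" where
  "grouplike g \<longleftrightarrow> \<Delta> g = g \<otimes>\<^sub>t g \<and> \<epsilon> g = 1"

end

locale unital_algebra = kspace scale
  for scale :: "'k::field \<Rightarrow> 'h::ring_1 \<Rightarrow> 'h" +
  assumes scale_mult_left: "scale c x * y = scale c (x * y)"
    and scale_mult_right: "x * scale c y = scale c (x * y)"
begin

definition subspace_prod :: "'h set \<Rightarrow> 'h set \<Rightarrow> 'h set" (infixl \<open>\<cdot>\<close> 70) where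
  "A \<cdot> B = span {a * b | a b. a \<in> A \<and> b \<in> B}"

end

locale bialgebra = unital_algebra scale + coalgebra scale \<Delta> \<epsilon>
  for scale :: "'k::field \<Rightarrow> 'h::ring_1 \<Rightarrow> 'h" and \<Delta> \<epsilon> +
  assumes comult_one: "\<Delta> 1 = 1 \<otimes>\<^sub>t 1"
    and comult_mult:
      "\<Delta> (g * h) = tlift (\<lambda>a b. tlift (\<lambda>c d. (a * c) \<otimes>\<^sub>t (b * d)) (\<Delta> h)) (\<Delta> g)"
    and counit_one: "\<epsilon> 1 = 1"
    and counit_mult: "\<epsilon> (g * h) = \<epsilon> g * \<epsilon> h"

locale hopf_algebra = bialgebra scale \<Delta> \<epsilon>
  for scale :: "'k::field \<Rightarrow> 'h::ring_1 \<Rightarrow> 'h" and \<Delta> \<epsilon> +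
  fixes S :: "'h \<Rightarrow> 'h"
  assumes antipode_linear: "Vector_Spaces.linear scale scale S"
    and antipode_left: "tlift (\<lambda>x y. S x * y) (\<Delta> h) = scale (\<epsilon> h) 1"
    and antipode_right: "tlift (\<lambda>x y. x * S y) (\<Delta> h) = scale (\<epsilon> h) 1"

context bialgebra
begin

definition grouplike_group :: "'h monoid" where
  "grouplike_group = \<lparr>carrier = {g. grouplike g}, mult = (*), one = 1\<rparr>"

lemma comult_sum:
  obtains ps where "\<Delta> h = (\<Sum>(x, y)\<leftarrow>ps. x \<otimes>\<^sub>t y)"
  using comult_in_tensor tensor_space_sum subspace_UNIV by metis

lemma bilinear_map_mult_tensor: "bilinear_map fscale (\<lambda>c d. (a * c) \<otimes>\<^sub>t (b * d))"
  by (rule bilinear_mapI[OF vector_space_fscale])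
     (simp_all add: distrib_left scale_mult_right bilinear_mapD[OF bilinear_map_tensor])

lemma comult_grouplike_mult:
  assumes "grouplike g" "\<Delta> h = (\<Sum>(x, y)\<leftarrow>ps. x \<otimes>\<^sub>t y)"
  shows "\<Delta> (g * h) = (\<Sum>(x, y)\<leftarrow>ps. (g * x) \<otimes>\<^sub>t (g * y))"
proof -
  interpret f: vector_space "fscale :: 'k \<Rightarrow> (('h \<Rightarrow> 'h \<Rightarrow> 'k) \<Rightarrow> 'k) \<Rightarrow> _"
    by (rule vector_space_fscale)
  have eq: "tlift (\<lambda>c d. (a * c) \<otimes>\<^sub>t (b * d)) (\<Delta> h) = (\<Sum>(x, y)\<leftarrow>ps. (a * x) \<otimes>\<^sub>t (b * y))" for a b
    unfolding assms(2) by (rule tlift_sum_tensor[OF bilinear_map_mult_tensor])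
  have scale: "(\<Sum>(x, y)\<leftarrow>ps. scale c (a * x) \<otimes>\<^sub>t (b * y)) = fscale c (\<Sum>(x, y)\<leftarrow>ps. (a * x) \<otimes>\<^sub>t (b * y))"
    "(\<Sum>(x, y)\<leftarrow>ps. (a * x) \<otimes>\<^sub>t scale c (b * y)) = fscale c (\<Sum>(x, y)\<leftarrow>ps. (a * x) \<otimes>\<^sub>t (b * y))"
    for a b c
    by (induction ps)
       (auto simp: f.scale_right_distrib bilinear_mapD[OF bilinear_map_tensor])
  have add: "(\<Sum>(x, y)\<leftarrow>ps. ((a + a') * x) \<otimes>\<^sub>t (b * y)) =
      (\<Sum>(x, y)\<leftarrow>ps. (a * x) \<otimes>\<^sub>t (b * y)) + (\<Sum>(x, y)\<leftarrow>ps. (a' * x) \<otimes>\<^sub>t (b * y))"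
    "(\<Sum>(x, y)\<leftarrow>ps. (a * x) \<otimes>\<^sub>t ((b + b') * y)) =
      (\<Sum>(x, y)\<leftarrow>ps. (a * x) \<otimes>\<^sub>t (b * y)) + (\<Sum>(x, y)\<leftarrow>ps. (a * x) \<otimes>\<^sub>t (b' * y))"
    for a a' b b'
    by (induction ps)
       (auto simp: distrib_right bilinear_mapD[OF bilinear_map_tensor] add_ac)
  have "bilinear_map fscale (\<lambda>a b. (\<Sum>(x, y)\<leftarrow>ps. (a * x) \<otimes>\<^sub>t (b * y)))"
    by (rule bilinear_mapI[OF vector_space_fscale]) (auto simp only: add scale scale_mult_left)
  from tlift_tensor[OF this, of g g] show ?thesis
    using assms(1) by (simp add: comult_mult eq grouplike_def)
qed

end

lemma (in hopf_algebra) group_grouplike_group: "group grouplike_group"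
proof -
  have one: "grouplike 1"
    by (simp add: grouplike_def comult_one counit_one)
  have mult: "grouplike (g * h)" if "grouplike g" "grouplike h" for g h
    using comult_grouplike_mult[OF that(1), of h "[(h, h)]"] that
    by (simp add: grouplike_def counit_mult)
  have inv: "S g * g = 1" "g * S g = 1" if g: "grouplike g" for g
  proof -
    note S = antipode_linear[unfolded Vector_Spaces.linear_iff]
    have "bilinear_map scale (\<lambda>x y. S x * y)"
      by (rule bilinear_mapI[OF vector_space_axioms])
         (simp_all add: S algebra_simps scale_mult_left scale_mult_right)
    from tlift_tensor[OF this, of g g] show "S g * g = 1"
      using g antipode_left[of g] by (simp add: grouplike_def)
    have "bilinear_map scale (\<lambda>x y. x * S y)"
      by (rule bilinear_mapI[OF vector_space_axioms])
         (simp_all add: S algebra_simps scale_mult_left scale_mult_right)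
    from tlift_tensor[OF this, of g g] show "g * S g = 1"
      using g antipode_right[of g] by (simp add: grouplike_def)
  qed
  have S: "grouplike (S g)" if g: "grouplike g" for g
  proof -
    obtain ps where ps: "\<Delta> (S g) = (\<Sum>(x, y)\<leftarrow>ps. x \<otimes>\<^sub>t y)" by (rule comult_sum)
    note bil = bilinear_map_mult_tensor[of "S g" "S g"]
    have cancel: "S g * (g * x) = x" for x
      by (simp add: inv[OF g] mult.assoc[symmetric])
    have shift: "(\<Sum>(x, y)\<leftarrow>ps. (g * x) \<otimes>\<^sub>t (g * y)) =
      (\<Sum>(x, y)\<leftarrow>map (\<lambda>(x, y). (g * x, g * y)) ps. x \<otimes>\<^sub>t y)"
      by (simp add: o_def case_prod_unfold)
    have "tlift (\<lambda>c d. (S g * c) \<otimes>\<^sub>t (S g * d)) (\<Delta> (g * S g)) = \<Delta> (S g)"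
      unfolding comult_grouplike_mult[OF g ps] shift tlift_sum_tensor[OF bil]
      by (simp add: ps o_def case_prod_unfold cancel)
    moreover have "tlift (\<lambda>c d. (S g * c) \<otimes>\<^sub>t (S g * d)) (\<Delta> (g * S g)) = S g \<otimes>\<^sub>t S g"
      using tlift_tensor[OF bil, of 1 1] by (simp add: inv[OF g] comult_one)
    moreover have "\<epsilon> (S g) = 1"
      using counit_mult[of "S g" g] g by (simp add: inv[OF g] counit_one grouplike_def)
    ultimately show ?thesis by (simp add: grouplike_def)
  qed
  show ?thesis
    by (rule groupI) (auto simp: grouplike_group_def one mult mult.assoc intro: S inv)
qed

end

theory Submission
  imports Defs "Jordan_Normal_Form.Char_Poly" "HOL-Library.Multiset" "HOL-Algebra.Sylow"
begin

text \<open>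
  Over an algebraically closed field, a simple subcoalgebra of dimension \<open>n\<^sup>2\<close> is spanned by the entries of an irreducible
  \<open>n\<close> by \<open>n\<close> matrix comodule, unique up to isomorphism, and the product of two such subcoalgebras is the sum of those that
  belong to the constituents of the Kronecker product of the matrices (\<open>simple_subcoalgebra_irr\<close>, \<open>coeff_simple\<close>,
  \<open>coeff_dec\<close>, \<open>coeff_kron\<close>). So the assertion concerns the decomposition of tensor products. The Haar functional, which
  exists because \<open>H\<close> is cosemisimple, makes comodules completely reducible and identifies an irreducible comodule with its
  double dual; together with the adjunctions between tensoring with \<open>b\<close> and with its dual this gives Frobenius
  reciprocity (\<open>fusion_rules\<close>).

  Suppose that no grouplike element has order \<open>2\<close> or \<open>3\<close>; all degrees are odd by hypothesis. The irreducibles of degree \<open>1\<close> in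
  \<open>x \<otimes> x*\<close> form the stabilizer of \<open>x\<close>, a finite group of grouplike elements, of order prime to \<open>6\<close>. For \<open>x\<close> of degree \<open>3\<close> this
  forces \<open>x \<otimes> x* = 1 + u + r\<close> with degrees \<open>1, 3, 5\<close> (\<open>degree_three_square\<close>), and \<open>u\<close> is self-dual, so that
  \<open>u \<otimes> u = 1 + p + q\<close> in the same way. Make the irreducibles into a graph, \<open>v\<close> being joined to the constituents of
  \<open>v \<otimes> u\<close>. The families are a path \<open>c 0 = 1, c 1 = u, c 2 = q, \<dots>\<close> with additional neighbours \<open>d n\<close> of \<open>c n\<close>. The path
  can be prolonged at \<open>c n\<close> unless \<open>c n\<close> has a further neighbour of smaller degree. In that case a walk along neighbours of
  least degree ends at some \<open>v\<close> with \<open>v \<otimes> c k = c n\<close> (\<open>descent\<close>). Counting degrees excludes \<open>deg v > 1\<close>, and for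
  \<open>deg v = 1\<close> it leaves only \<open>n = 2\<close>, with \<open>q \<otimes> u\<close> the sum of the translates of \<open>u\<close> under a stabilizer of order \<open>5\<close>
  (\<open>chain_step\<close>).

  The last case is excluded by the multiplication of the matrix algebra \<open>u \<otimes> u*\<close>, which is a homomorphism of comodules
  (\<open>contraction_hom\<close>). Let \<open>A\<close> be its component of type \<open>1 + q\<close> and \<open>W\<close> its component of type \<open>p\<close>, of dimensions
  \<open>6\<close> and \<open>3\<close>. In the exceptional case \<open>p\<close> does not occur in \<open>q \<otimes> q\<close>, and \<open>q\<close> does not occur in \<open>q \<otimes> p\<close> or \<open>p \<otimes> q\<close>, so \<open>A\<close> is a
  subalgebra of the \<open>3\<close> by \<open>3\<close> matrices, and \<open>W\<close> is closed under multiplication by \<open>A\<close> on both sides. Linear algebra shows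
  that there are no such \<open>A\<close> and \<open>W\<close> (\<open>split_subalgebra\<close>).
\<close>

section \<open>Matrices over a field\<close>

lemma sum_div_mod:
  "(\<Sum>k<p*q. h (k div q) (k mod q)) = (\<Sum>a<p. \<Sum>b<q. h a b)" for p q :: nat
proof (induction p)
  case (Suc p)
  have split: "{..<Suc p * q} = {..<p*q} \<union> (\<lambda>b. p*q + b) ` {..<q}"
  proof (intro equalityI subsetI)
    fix x assume "x \<in> {..<Suc p * q}"
    then show "x \<in> {..<p*q} \<union> (\<lambda>b. p*q + b) ` {..<q}"
      by (cases "x < p*q") (auto intro!: image_eqI[of _ _ "x - p*q"])
  qed auto
  have "(\<Sum>k<Suc p*q. h (k div q) (k mod q)) =
      (\<Sum>k<p*q. h (k div q) (k mod q)) + (\<Sum>k\<in>(\<lambda>b. p*q + b) ` {..<q}. h (k div q) (k mod q))"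
    unfolding split by (rule sum.union_disjoint) auto
  also have "(\<Sum>k\<in>(\<lambda>b. p*q + b) ` {..<q}. h (k div q) (k mod q)) = (\<Sum>b<q. h p b)"
    by (subst sum.reindex) (auto simp: inj_on_def intro!: sum.cong)
  finally show ?case using Suc by simp
qed simp

lemma div_mod_lt:
  fixes i p q :: nat
  assumes "i < p * q"
  shows "i div q < p" "i mod q < q"
  using assms by (auto simp: less_mult_imp_div_less) (cases q; auto)

lemma pair_index_lt: "a * q + b < p * q" if "a < p" "b < q" for a b p q :: nat
proof -
  have "a * q + b < Suc a * q" using that by simp
  also have "\<dots> \<le> p * q" using that by (intro mult_le_mono1) simp
  finally show ?thesis .
qed

lemma mult_index:
  assumes "A \<in> carrier_mat m n" "B \<in> carrier_mat n p" "i < m" "j < p"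
  shows "(A * B) $$ (i,j) = (\<Sum>k<n. A $$ (i,k) * B $$ (k,j))"
  using assms by (auto simp: scalar_prod_def atLeast0LessThan intro!: sum.cong)

lemma mat_assoc:
  fixes A B C :: "'a::semiring_0 mat"
  shows "dim_col A = dim_row B \<Longrightarrow> dim_col B = dim_row C \<Longrightarrow> A * B * C = A * (B * C)"
  by (rule assoc_mult_mat[of _ "dim_row A" "dim_col A" _ "dim_col B" _ "dim_col C"]) auto

text \<open>The basis of the kernel of a row obtained by solving for the variable at the pivot position \<open>k\<close>.\<close>

lemma kernel_split_row:
  fixes y :: "'a::field mat"
  assumes y: "y \<in> carrier_mat 1 (Suc d)" and k: "k \<le> d" and yk: "y $$ (0,k) \<noteq> 0"
  shows "\<exists>B L N. B \<in> carrier_mat (Suc d) d \<and> L \<in> carrier_mat d (Suc d) \<and> N \<in> carrier_mat (Suc d) 1 \<and>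
     y * B = 0\<^sub>m 1 d \<and> L * B = 1\<^sub>m d \<and> B * L + N * y = 1\<^sub>m (Suc d)"
proof -
  define s where "s = (\<lambda>j. if j < k then j else Suc j)"
  have s_lt: "s j < Suc d" if "j < d" for j using that by (auto simp: s_def)
  have s_ne: "s j \<noteq> k" for j by (auto simp: s_def)
  have s_inj: "s i = s j \<longleftrightarrow> i = j" for i j by (auto simp: s_def split: if_splits)
  define B where "B = mat (Suc d) d (\<lambda>(i,j). if i = s j then 1 else if i = k then - y $$ (0, s j) / y $$ (0,k) else 0)"
  define L where "L = mat d (Suc d) (\<lambda>(j,i). if i = s j then 1 else (0::'a))"
  define N where "N = mat (Suc d) 1 (\<lambda>(i,j). if i = k then 1 / y $$ (0,k) else 0)"
  have B: "B \<in> carrier_mat (Suc d) d" and L: "L \<in> carrier_mat d (Suc d)" and N: "N \<in> carrier_mat (Suc d) 1"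
    by (auto simp: B_def L_def N_def)
  have "y * B = 0\<^sub>m 1 d"
  proof (rule eq_matI)
    fix i j assume "i < dim_row (0\<^sub>m 1 d :: 'a mat)" "j < dim_col (0\<^sub>m 1 d :: 'a mat)"
    then have [simp]: "i = 0" and j: "j < d" by auto
    have "(y * B) $$ (i,j) = (\<Sum>l<Suc d. y $$ (0,l) * B $$ (l,j))"
      using mult_index[OF y B _ j, of 0] by simp
    also have "\<dots> = (\<Sum>l\<in>{s j, k}. y $$ (0,l) * B $$ (l,j))"
      using s_lt[OF j] k j by (intro sum.mono_neutral_right) (auto simp: B_def)
    also have "\<dots> = 0" using s_ne[of j] s_lt[OF j] j k yk by (auto simp: B_def)
    finally show "(y * B) $$ (i,j) = (0\<^sub>m 1 d :: 'a mat) $$ (i,j)" using j by simp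
  qed (use y B in auto)
  moreover have "L * B = 1\<^sub>m d"
  proof (rule eq_matI)
    fix i j assume "i < dim_row (1\<^sub>m d :: 'a mat)" "j < dim_col (1\<^sub>m d :: 'a mat)"
    then have i: "i < d" and j: "j < d" by auto
    have "(L * B) $$ (i,j) = (\<Sum>l<Suc d. L $$ (i,l) * B $$ (l,j))"
      using mult_index[OF L B i j] .
    also have "\<dots> = (\<Sum>l\<in>{s i}. L $$ (i,l) * B $$ (l,j))"
      using s_lt[OF i] i by (intro sum.mono_neutral_right) (auto simp: L_def)
    also have "\<dots> = (if i = j then 1 else 0)" using s_lt[OF i] i j s_ne[of i] s_inj[of i j] by (auto simp: B_def L_def)
    finally show "(L * B) $$ (i,j) = (1\<^sub>m d :: 'a mat) $$ (i,j)" using i j by simp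
  qed (use L B in auto)
  moreover have "B * L + N * y = 1\<^sub>m (Suc d)"
  proof (rule eq_matI)
    fix i j assume "i < dim_row (1\<^sub>m (Suc d) :: 'a mat)" "j < dim_col (1\<^sub>m (Suc d) :: 'a mat)"
    then have i: "i < Suc d" and j: "j < Suc d" by auto
    have BL: "(B * L) $$ (i,j) = (\<Sum>l<d. B $$ (i,l) * L $$ (l,j))"
      using mult_index[OF B L i j] .
    have Ny: "(N * y) $$ (i,j) = (if i = k then y $$ (0,j) / y $$ (0,k) else 0)"
      using mult_index[OF N y i j] i by (simp add: N_def)
    show "(B * L + N * y) $$ (i,j) = (1\<^sub>m (Suc d) :: 'a mat) $$ (i,j)"
    proof (cases "j = k")
      case True
      then have "(B * L) $$ (i,j) = 0"
        unfolding BL using s_ne j by (intro sum.neutral) (auto simp: L_def)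
      then show ?thesis using Ny True i j yk N y B L by auto
    next
      case False
      define l where "l = (if j < k then j else j - 1)"
      have l: "l < d" "s l = j" using False j k by (auto simp: l_def s_def)
      have "(B * L) $$ (i,j) = (\<Sum>l\<in>{l}. B $$ (i,l) * L $$ (l,j))"
        unfolding BL using l j by (intro sum.mono_neutral_right) (auto simp: L_def s_inj)
      then have "(B * L) $$ (i,j) = B $$ (i,l)" using l j by (simp add: L_def)
      then show ?thesis using Ny False i j yk N y B L l by (auto simp: B_def)
    qed
  qed (use B L N y in auto)
  ultimately show ?thesis using B L N by blast
qed

text \<open>
  The columns of \<open>B\<close> form a basis of the kernel of \<open>M\<close>, with coordinate functions \<open>L\<close>, and \<open>N\<close> is a generalized inverse of
  \<open>M\<close>. In the induction over the rows, the last row is restricted to the kernel of the others.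
\<close>

lemma kernel_split:
  fixes M :: "'a::field mat"
  assumes "M \<in> carrier_mat m n"
  shows "\<exists>d B L N. B \<in> carrier_mat n d \<and> L \<in> carrier_mat d n \<and> N \<in> carrier_mat n m \<and>
     M * B = 0\<^sub>m m d \<and> L * B = 1\<^sub>m d \<and> B * L + N * M = 1\<^sub>m n \<and> n \<le> d + m"
  using assms
proof (induction m arbitrary: M)
  case 0
  have "0\<^sub>m n 0 * M = 0\<^sub>m n n" using 0 by (intro left_mult_zero_mat) auto
  moreover have "M * 1\<^sub>m n = 0\<^sub>m 0 n" using 0 by (intro eq_matI) auto
  ultimately show ?case using 0
    by (intro exI[of _ n] exI[of _ "1\<^sub>m n"] exI[of _ "0\<^sub>m n 0"]) auto
next
  case (Suc m)
  define M' where "M' = mat m n (\<lambda>(i,j). M $$ (i,j))"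
  define v where "v = mat 1 n (\<lambda>(i,j). M $$ (m,j))"
  have M': "M' \<in> carrier_mat m n" and v: "v \<in> carrier_mat 1 n" by (auto simp: M'_def v_def)
  \<comment> \<open>\<open>M\<close> is the matrix \<open>M'\<close> followed by the row \<open>v\<close>; both facts below express block multiplication.\<close>
  have zeroI: "M * X = 0\<^sub>m (Suc m) d" if X: "X \<in> carrier_mat n d" and "M' * X = 0\<^sub>m m d" "v * X = 0\<^sub>m 1 d" for X d
  proof (rule eq_matI)
    fix i j assume "i < dim_row (0\<^sub>m (Suc m) d :: 'a mat)" "j < dim_col (0\<^sub>m (Suc m) d :: 'a mat)"
    then have i: "i < Suc m" and j: "j < d" by auto
    have MX: "(M * X) $$ (i,j) = (\<Sum>k<n. M $$ (i,k) * X $$ (k,j))"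
      using mult_index[OF Suc.prems X i j] .
    show "(M * X) $$ (i,j) = (0\<^sub>m (Suc m) d :: 'a mat) $$ (i,j)"
    proof (cases "i < m")
      case True
      have "(M' * X) $$ (i,j) = 0" using that True j by simp
      then show ?thesis using mult_index[OF M' X True j] MX True i j by (simp add: M'_def)
    next
      case False
      have "(v * X) $$ (0,j) = 0" using that j by simp
      then show ?thesis using mult_index[OF v X _ j, of 0] MX False i j by (simp add: v_def less_Suc_eq)
    qed
  qed (use Suc.prems X in auto)
  have joinE: "mat n (Suc m) (\<lambda>(i,j). if j < m then N1 $$ (i,j) else N2 $$ (i,0)) * M = N1 * M' + N2 * v" (is "?N * M = _")
    if N1: "N1 \<in> carrier_mat n m" and N2: "N2 \<in> carrier_mat n 1" for N1 N2
  proof (rule eq_matI)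
    fix i j assume "i < dim_row (N1 * M' + N2 * v)" "j < dim_col (N1 * M' + N2 * v)"
    then have i: "i < n" and j: "j < n" using N1 N2 v M' by auto
    have "(?N * M) $$ (i,j) = (\<Sum>k<Suc m. ?N $$ (i,k) * M $$ (k,j))"
      by (rule mult_index[OF _ Suc.prems i j]) auto
    also have "\<dots> = (\<Sum>k<m. N1 $$ (i,k) * M' $$ (k,j)) + N2 $$ (i,0) * v $$ (0,j)"
      using i j by (auto simp: M'_def v_def)
    also have "\<dots> = (N1 * M' + N2 * v) $$ (i,j)"
      using mult_index[OF N1 M' i j] mult_index[OF N2 v i j] i j N1 N2 M' v by auto
    finally show "(?N * M) $$ (i,j) = (N1 * M' + N2 * v) $$ (i,j)" .
  qed (use Suc.prems N1 N2 M' v in auto)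
  obtain d B L N where B: "B \<in> carrier_mat n d" and L: "L \<in> carrier_mat d n" and N: "N \<in> carrier_mat n m"
    and MB: "M' * B = 0\<^sub>m m d" and LB: "L * B = 1\<^sub>m d" and BL: "B * L + N * M' = 1\<^sub>m n" and d: "n \<le> d + m"
    using Suc.IH[OF M'] by blast
  define y where "y = v * B"
  have y: "y \<in> carrier_mat 1 d" using v B by (simp add: y_def)
  show ?case
  proof (cases "y = 0\<^sub>m 1 d")
    case True
    have "0\<^sub>m n 1 * v = 0\<^sub>m n n" using v by (intro left_mult_zero_mat) auto
    then have "B * L + (N * M' + 0\<^sub>m n 1 * v) = 1\<^sub>m n"
      using BL N M' by auto
    then show ?thesis using B L LB d zeroI[OF B MB] True joinE[OF N, of "0\<^sub>m n 1"]
      by (intro exI[of _ d] exI[of _ B] exI[of _ L]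
          exI[of _ "mat n (Suc m) (\<lambda>(i,j). if j < m then N $$ (i,j) else 0\<^sub>m n 1 $$ (i,0))"])
         (auto simp: y_def)
  next
    case False
    then obtain k where k: "k < d" "y $$ (0,k) \<noteq> 0"
      using y by (metis (no_types, lifting) carrier_matD eq_matI index_zero_mat less_one)
    then obtain e where de: "d = Suc e" by (cases d) auto
    obtain B2 L2 N2 where B2: "B2 \<in> carrier_mat d e" and L2: "L2 \<in> carrier_mat e d" and N2: "N2 \<in> carrier_mat d 1"
      and yB2: "y * B2 = 0\<^sub>m 1 e" and LB2: "L2 * B2 = 1\<^sub>m e" and BL2: "B2 * L2 + N2 * y = 1\<^sub>m d"
      using kernel_split_row[of y e k] y k de by auto
    define NN where "NN = N - B * N2 * (v * N)"
    have NN: "NN \<in> carrier_mat n m" unfolding NN_def using N B N2 v by (intro minus_carrier_mat mult_carrier_mat) auto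
    have BN2: "B * N2 \<in> carrier_mat n 1" using B N2 by simp
    have vNM: "v * (N * M') = v - y * L"
    proof -
      have "v * (B * L + N * M') = v" using BL v by simp
      moreover have "v * (B * L + N * M') = v * (B * L) + v * (N * M')"
        using v B L N M' by (intro mult_add_distrib_mat) auto
      moreover have "v * (B * L) = y * L" using v B L by (simp add: y_def assoc_mult_mat)
      ultimately have *: "y * L + v * (N * M') = v" by simp
      show ?thesis
      proof (rule eq_matI)
        fix i j assume "i < dim_row (v - y * L)" "j < dim_col (v - y * L)"
        then have "i < 1" "j < n" using L y v by auto
        then have "(y * L + v * (N * M')) $$ (i,j) = (y * L) $$ (i,j) + (v * (N * M')) $$ (i,j)"
          using v N M' y L by (subst index_add_mat) auto
        then show "(v * (N * M')) $$ (i,j) = (v - y * L) $$ (i,j)"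
          using * \<open>i < 1\<close> \<open>j < n\<close> v y L by (subst index_minus_mat) (auto simp: algebra_simps)
      qed (use v y L M' in auto)
    qed
    have "B * B2 * (L2 * L) + (NN * M' + B * N2 * v) = 1\<^sub>m n"
    proof -
      have e1: "B * B2 * (L2 * L) = B * L - B * N2 * (y * L)"
      proof -
        have B2L2: "B2 * L2 = 1\<^sub>m d - N2 * y"
        proof (rule eq_matI)
          fix i j assume "i < dim_row (1\<^sub>m d - N2 * y)" "j < dim_col (1\<^sub>m d - N2 * y)"
          then have ij: "i < d" "j < d" using N2 y by auto
          have "(B2 * L2 + N2 * y) $$ (i,j) = (1\<^sub>m d :: 'a mat) $$ (i,j)" using BL2 by simp
          then show "(B2 * L2) $$ (i,j) = (1\<^sub>m d - N2 * y) $$ (i,j)"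
            using ij B2 L2 N2 y by (simp add: algebra_simps)
        qed (use B2 L2 N2 y in auto)
        have "B * B2 * (L2 * L) = B * ((B2 * L2) * L)"
          using B B2 L2 L by (simp add: mat_assoc)
        also have "(B2 * L2) * L = L - N2 * (y * L)"
          using N2 y L by (simp add: B2L2 minus_mult_distrib_mat[of _ d d] assoc_mult_mat[of _ d 1])
        also have "B * (L - N2 * (y * L)) = B * L - B * (N2 * (y * L))"
          using B L N2 y by (intro mult_minus_distrib_mat) auto
        also have "B * (N2 * (y * L)) = B * N2 * (y * L)"
          using B N2 y L by (intro assoc_mult_mat[symmetric, of _ n d _ 1 _ n]) auto
        finally show ?thesis .
      qed
      have e2: "NN * M' = N * M' - (B * N2 * v - B * N2 * (y * L))"
      proof -
        have "NN * M' = N * M' - B * N2 * (v * N) * M'"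
          unfolding NN_def using N B N2 v M' by (intro minus_mult_distrib_mat) auto
        also have "B * N2 * (v * N) * M' = B * N2 * (v * (N * M'))"
          using assoc_mult_mat[OF BN2 mult_carrier_mat[OF v N] M'] assoc_mult_mat[OF v N M'] by simp
        also have "\<dots> = B * N2 * v - B * N2 * (y * L)"
          unfolding vNM using BN2 v y L by (intro mult_minus_distrib_mat) auto
        finally show ?thesis .
      qed
      show ?thesis
        unfolding e1 e2 BL[symmetric] using B L N M' BN2 v y by (intro eq_matI) auto
    qed
    moreover have "M * (B * B2) = 0\<^sub>m (Suc m) e"
    proof (rule zeroI)
      have "M' * (B * B2) = (M' * B) * B2" using M' B B2 by (simp add: assoc_mult_mat)
      also have "\<dots> = 0\<^sub>m m e" unfolding MB using B2 by simp
      finally show "M' * (B * B2) = 0\<^sub>m m e" .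
      have "v * (B * B2) = y * B2" unfolding y_def using v B B2 by (simp add: assoc_mult_mat)
      then show "v * (B * B2) = 0\<^sub>m 1 e" using yB2 by simp
    qed (use B B2 in auto)
    moreover have "L2 * L * (B * B2) = 1\<^sub>m e"
    proof -
      have "L2 * L * (B * B2) = L2 * ((L * B) * B2)"
        using L2 L B B2 by (simp add: mat_assoc)
      then show ?thesis using LB LB2 B2 by simp
    qed
    ultimately show ?thesis using joinE[OF NN BN2] B L B2 L2 d de
      by (intro exI[of _ e] exI[of _ "B * B2"] exI[of _ "L2 * L"]
          exI[of _ "mat n (Suc m) (\<lambda>(i,j). if j < m then NN $$ (i,j) else (B * N2) $$ (i,0))"])
         auto
  qed
qed

lemma wide_matrix_kernel:
  fixes M :: "'a::field mat"
  assumes "M \<in> carrier_mat m n" "m < n"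
  obtains v where "v \<in> carrier_mat n 1" "v \<noteq> 0\<^sub>m n 1" "M * v = 0\<^sub>m m 1"
proof -
  obtain d B L N where B: "B \<in> carrier_mat n d" and L: "L \<in> carrier_mat d n"
    and MB: "M * B = 0\<^sub>m m d" and LB: "L * B = 1\<^sub>m d" and d: "n \<le> d + m"
    using kernel_split[OF assms(1)] by blast
  have "0 < d" using d assms by simp
  define e where "e = mat d 1 (\<lambda>(i,j). if i = 0 then 1 else (0::'a))"
  have e: "e \<in> carrier_mat d 1" by (simp add: e_def)
  have "L * (B * e) = e" using L B e LB assoc_mult_mat[OF L B e] by simp
  moreover have "e $$ (0,0) = 1" using \<open>0 < d\<close> by (simp add: e_def)
  ultimately have "B * e \<noteq> 0\<^sub>m n 1" using L \<open>0 < d\<close> by auto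
  moreover have "M * (B * e) = 0\<^sub>m m 1" using assoc_mult_mat[OF assms(1) B e] MB e by simp
  ultimately show ?thesis using that[of "B * e"] B e by auto
qed

lemma two_sided_inverse_imp_square:
  fixes A :: "'a::field mat"
  assumes A: "A \<in> carrier_mat m n" and B: "B \<in> carrier_mat n m" and "A * B = 1\<^sub>m m" "B * A = 1\<^sub>m n"
  shows "m = n"
proof -
  have le: "n \<le> m" if A: "A \<in> carrier_mat m n" and B: "B \<in> carrier_mat n m" and BA: "B * A = 1\<^sub>m n"
    for A B :: "'a mat" and m n
  proof (rule ccontr)
    assume "\<not> n \<le> m"
    then obtain v where v: "v \<in> carrier_mat n 1" "v \<noteq> 0\<^sub>m n 1" "A * v = 0\<^sub>m m 1"
      using wide_matrix_kernel[OF A] by auto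
    then have "B * A * v = 0\<^sub>m n 1" using A B assoc_mult_mat[OF B A v(1)] by simp
    then show False using BA v by simp
  qed
  show ?thesis using le[OF A B] le[OF B A] assms by auto
qed

lemma eigenvector_exists:
  fixes T :: "'a::alg_closed_field mat"
  assumes T: "T \<in> carrier_mat n n" and n: "0 < n"
  obtains c v where "v \<in> carrier_mat n 1" "v \<noteq> 0\<^sub>m n 1" "T * v = c \<cdot>\<^sub>m v"
proof -
  have "degree (char_poly T) > 0" using degree_monic_char_poly[OF T] n by simp
  then obtain c where "poly (char_poly T) c = 0" using alg_closed_imp_poly_has_root by blast
  then have "eigenvalue T c" using eigenvalue_root_char_poly[OF T] by simp
  then obtain w where w: "w \<in> carrier_vec n" "w \<noteq> 0\<^sub>v n" "T *\<^sub>v w = c \<cdot>\<^sub>v w"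
    using T unfolding eigenvalue_def eigenvector_def by auto
  define v where "v = mat n 1 (\<lambda>(i,j). w $ i)"
  have v: "v \<in> carrier_mat n 1" by (simp add: v_def)
  have "v \<noteq> 0\<^sub>m n 1"
  proof
    assume *: "v = 0\<^sub>m n 1"
    have "w $ i = 0" if "i < n" for i using that arg_cong[OF *, of "\<lambda>M. M $$ (i,0)"] by (simp add: v_def)
    then have "w = 0\<^sub>v n" using w by (intro eq_vecI) auto
    then show False using w by simp
  qed
  moreover have "T * v = c \<cdot>\<^sub>m v"
  proof (rule eq_matI)
    fix i j assume "i < dim_row (c \<cdot>\<^sub>m v)" "j < dim_col (c \<cdot>\<^sub>m v)"
    then have ij: "i < n" "j = 0" by (auto simp: v_def)
    have "(T * v) $$ (i,j) = (\<Sum>k<n. T $$ (i,k) * w $ k)"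
      using mult_index[OF T v, of i j] ij by (simp add: v_def)
    also have "\<dots> = (T *\<^sub>v w) $ i" using T w(1) ij by (auto simp: scalar_prod_def atLeast0LessThan)
    finally show "(T * v) $$ (i,j) = (c \<cdot>\<^sub>m v) $$ (i,j)" using w ij by (simp add: v_def)
  qed (use T v in auto)
  ultimately show ?thesis using that v by blast
qed

lemma idempotent_split:
  fixes e :: "'a::field mat"
  assumes e: "e \<in> carrier_mat n n" and "e * e = e"
  obtains d B L where "B \<in> carrier_mat n d" "L \<in> carrier_mat d n" "B * L = e" "L * B = 1\<^sub>m d"
proof -
  have M: "1\<^sub>m n - e \<in> carrier_mat n n" using e by (intro minus_carrier_mat)
  obtain d B L N where B: "B \<in> carrier_mat n d" and L: "L \<in> carrier_mat d n" and N: "N \<in> carrier_mat n n"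
    and MB: "(1\<^sub>m n - e) * B = 0\<^sub>m n d" and LB: "L * B = 1\<^sub>m d" and BL: "B * L + N * (1\<^sub>m n - e) = 1\<^sub>m n"
    using kernel_split[OF M] by blast
  have "B - e * B = 0\<^sub>m n d" using MB B e by (simp add: minus_mult_distrib_mat[of _ n n])
  then have eB: "e * B = B"
  proof -
    assume *: "B - e * B = 0\<^sub>m n d"
    show ?thesis
    proof (rule eq_matI)
      fix i j assume "i < dim_row B" "j < dim_col B"
      then show "(e * B) $$ (i,j) = B $$ (i,j)" using arg_cong[OF *, of "\<lambda>M. M $$ (i,j)"] B e by simp
    qed (use B e in auto)
  qed
  have "(1\<^sub>m n - e) * e = 0\<^sub>m n n" using e assms(2) by (simp add: minus_mult_distrib_mat[of _ n n])
  then have "N * (1\<^sub>m n - e) * e = 0\<^sub>m n n" using assoc_mult_mat[OF N M e] N by simp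
  then have "B * L * e = (B * L + N * (1\<^sub>m n - e)) * e"
    using B L N M e by (subst add_mult_distrib_mat[of _ n n]) auto
  then have "B * (L * e) = e" using BL e assoc_mult_mat[OF B L e] by simp
  moreover have "L * e * B = 1\<^sub>m d" using assoc_mult_mat[OF L e B] eB LB by simp
  ultimately show ?thesis using that[of B d "L * e"] B L e by auto
qed

section \<open>Kronecker products\<close>

definition kron :: "'a::times mat \<Rightarrow> 'a mat \<Rightarrow> 'a mat" (infixl \<open>\<boxtimes>\<close> 75) where
  "A \<boxtimes> B = mat (dim_row A * dim_row B) (dim_col A * dim_col B)
     (\<lambda>(i,j). A $$ (i div dim_row B, j div dim_col B) * B $$ (i mod dim_row B, j mod dim_col B))"

lemma kron_carrier [simp]:
  "A \<in> carrier_mat m n \<Longrightarrow> B \<in> carrier_mat p q \<Longrightarrow> A \<boxtimes> B \<in> carrier_mat (m * p) (n * q)"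
  by (simp add: kron_def)

lemma dim_kron [simp]:
  "dim_row (A \<boxtimes> B) = dim_row A * dim_row B" "dim_col (A \<boxtimes> B) = dim_col A * dim_col B"
  by (simp_all add: kron_def)

lemma kron_index:
  assumes "A \<in> carrier_mat m n" "B \<in> carrier_mat p q" "i < m * p" "j < n * q"
  shows "(A \<boxtimes> B) $$ (i,j) = A $$ (i div p, j div q) * B $$ (i mod p, j mod q)"
  using assms by (auto simp: kron_def)

text \<open>
  The commutation hypothesis is what the interchange law needs over a noncommutative ring; it holds for scalar matrices.
\<close>

lemma kron_mult:
  fixes A :: "'a::semiring_0 mat"
  assumes A: "A \<in> carrier_mat m n" and C: "C \<in> carrier_mat n p"
    and B: "B \<in> carrier_mat m' n'" and D: "D \<in> carrier_mat n' p'"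
    and comm: "\<And>i k k' j. i < m' \<Longrightarrow> k < n' \<Longrightarrow> k' < n \<Longrightarrow> j < p \<Longrightarrow> B $$ (i,k) * C $$ (k',j) = C $$ (k',j) * B $$ (i,k)"
  shows "(A \<boxtimes> B) * (C \<boxtimes> D) = (A * C) \<boxtimes> (B * D)"
proof (rule eq_matI)
  fix i j assume "i < dim_row ((A * C) \<boxtimes> (B * D))" "j < dim_col ((A * C) \<boxtimes> (B * D))"
  then have i: "i < m * m'" and j: "j < p * p'" using A B C D by auto
  note i' = div_mod_lt[OF i] and j' = div_mod_lt[OF j]
  have "((A \<boxtimes> B) * (C \<boxtimes> D)) $$ (i,j) = (\<Sum>k<n*n'. (A \<boxtimes> B) $$ (i,k) * (C \<boxtimes> D) $$ (k,j))"
    using i j by (intro mult_index[of _ "m * m'" "n * n'" _ "p * p'"] kron_carrier A B C D)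
  also have "\<dots> = (\<Sum>k<n*n'. (\<lambda>a b. (A $$ (i div m', a) * B $$ (i mod m', b)) *
      (C $$ (a, j div p') * D $$ (b, j mod p'))) (k div n') (k mod n'))"
    by (intro sum.cong refl) (simp add: kron_index[OF A B i] kron_index[OF C D _ j])
  also have "\<dots> = (\<Sum>a<n. \<Sum>b<n'. (A $$ (i div m', a) * B $$ (i mod m', b)) *
      (C $$ (a, j div p') * D $$ (b, j mod p')))"
    by (rule sum_div_mod)
  also have "\<dots> = (\<Sum>a<n. \<Sum>b<n'. (A $$ (i div m', a) * C $$ (a, j div p')) * (B $$ (i mod m', b) * D $$ (b, j mod p')))"
    using comm[OF i'(2) _ _ j'(1)] by (intro sum.cong refl) (metis (no_types, lifting) lessThan_iff mult.assoc)
  also have "\<dots> = (\<Sum>a<n. A $$ (i div m', a) * C $$ (a, j div p')) * (\<Sum>b<n'. B $$ (i mod m', b) * D $$ (b, j mod p'))"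
    by (simp add: sum_product)
  also have "\<dots> = ((A * C) \<boxtimes> (B * D)) $$ (i,j)"
    using kron_index[of "A * C" m p "B * D" m' p' i j] i j A B C D
      mult_index[OF A C i'(1) j'(1)] mult_index[OF B D i'(2) j'(2)] by simp
  finally show "((A \<boxtimes> B) * (C \<boxtimes> D)) $$ (i,j) = ((A * C) \<boxtimes> (B * D)) $$ (i,j)" .
qed (use A B C D in auto)

lemma kron_assoc: "(A \<boxtimes> B) \<boxtimes> C = A \<boxtimes> (B \<boxtimes> C)" for A :: "'a::semigroup_mult mat"
proof (rule eq_matI)
  fix i j assume "i < dim_row (A \<boxtimes> (B \<boxtimes> C))" "j < dim_col (A \<boxtimes> (B \<boxtimes> C))"
  then have i: "i < dim_row A * dim_row B * dim_row C" and j: "j < dim_col A * dim_col B * dim_col C"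
    by (auto simp: mult.assoc)
  have *: "x div (b * c) = x div c div b" "x mod (b * c) div c = x div c mod b" "x mod (b * c) mod c = x mod c"
    for x b c :: nat
    by (cases "c = 0"; simp add: mult.commute[of b c] div_mult2_eq mod_mult2_eq)+
  show "(A \<boxtimes> B \<boxtimes> C) $$ (i,j) = (A \<boxtimes> (B \<boxtimes> C)) $$ (i,j)"
    using i j div_mod_lt[OF i] div_mod_lt[OF j]
    by (simp add: kron_def * mult.assoc div_mod_lt)
qed (auto simp: mult.assoc)

lemma kron_one_left: "1\<^sub>m 1 \<boxtimes> A = A" for A :: "'a::semiring_1 mat"
  by (rule eq_matI) (auto simp: kron_def)

lemma kron_one_right: "A \<boxtimes> 1\<^sub>m 1 = A" for A :: "'a::semiring_1 mat"
  by (rule eq_matI) (auto simp: kron_def)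

lemma kron_one_one: "1\<^sub>m m \<boxtimes> 1\<^sub>m n = (1\<^sub>m (m * n) :: 'a::semiring_1 mat)"
proof (rule eq_matI)
  fix i j assume "i < dim_row (1\<^sub>m (m * n) :: 'a mat)" "j < dim_col (1\<^sub>m (m * n) :: 'a mat)"
  then have i: "i < m * n" and j: "j < m * n" by auto
  have "i = j \<longleftrightarrow> i div n = j div n \<and> i mod n = j mod n"
    by (metis div_mult_mod_eq)
  then show "(1\<^sub>m m \<boxtimes> 1\<^sub>m n) $$ (i,j) = (1\<^sub>m (m * n) :: 'a mat) $$ (i,j)"
    using i j div_mod_lt[OF i] div_mod_lt[OF j] by (auto simp: kron_def)
qed auto

lemma kron_add_left:
  "A \<in> carrier_mat m n \<Longrightarrow> A' \<in> carrier_mat m n \<Longrightarrow> (A + A') \<boxtimes> B = A \<boxtimes> B + A' \<boxtimes> B"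
  for A :: "'a::semiring_0 mat"
  by (rule eq_matI) (auto simp: kron_def distrib_right div_mod_lt)

lemma kron_add_right:
  "B \<in> carrier_mat m n \<Longrightarrow> B' \<in> carrier_mat m n \<Longrightarrow> A \<boxtimes> (B + B') = A \<boxtimes> B + A \<boxtimes> B'"
  for A :: "'a::semiring_0 mat"
  by (rule eq_matI) (auto simp: kron_def distrib_left div_mod_lt)

lemma kron_zero_left: "0\<^sub>m m n \<boxtimes> B = 0\<^sub>m (m * dim_row B) (n * dim_col B)" for B :: "'a::semiring_0 mat"
  by (rule eq_matI) (auto simp: kron_def div_mod_lt)

lemma kron_zero_right: "B \<boxtimes> 0\<^sub>m m n = 0\<^sub>m (dim_row B * m) (dim_col B * n)" for B :: "'a::semiring_0 mat"
  by (rule eq_matI) (auto simp: kron_def div_mod_lt)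

section \<open>Tensors and the Haar functional\<close>

context kspace
begin

lemma tensor_in_tensor_space: "x \<in> A \<Longrightarrow> y \<in> B \<Longrightarrow> x \<otimes>\<^sub>t y \<in> tensor_space A B"
proof -
  interpret f: vector_space "fscale :: 'a \<Rightarrow> (('b \<Rightarrow> 'b \<Rightarrow> 'a) \<Rightarrow> 'a) \<Rightarrow> _"
    by (rule vector_space_fscale)
  show "x \<in> A \<Longrightarrow> y \<in> B \<Longrightarrow> x \<otimes>\<^sub>t y \<in> tensor_space A B"
    unfolding tensor_space_def by (rule f.span_base) blast
qed

lemma sum_in_tensor_space:
  "(\<And>i. i \<in> I \<Longrightarrow> X i \<in> tensor_space A B) \<Longrightarrow> (\<Sum>i\<in>I. X i) \<in> tensor_space A B"
proof -
  interpret f: vector_space "fscale :: 'a \<Rightarrow> (('b \<Rightarrow> 'b \<Rightarrow> 'a) \<Rightarrow> 'a) \<Rightarrow> _"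
    by (rule vector_space_fscale)
  show "(\<And>i. i \<in> I \<Longrightarrow> X i \<in> tensor_space A B) \<Longrightarrow> (\<Sum>i\<in>I. X i) \<in> tensor_space A B"
    unfolding tensor_space_def by (rule f.span_sum)
qed

lemma tensor_UNIV [simp]: "x \<otimes>\<^sub>t y \<in> tensor_space UNIV UNIV"
  by (rule tensor_in_tensor_space) auto

lemma tlift_zero: "bilinear_map s f \<Longrightarrow> tlift f 0 = 0"
  using tlift_sum_tensor[of s f "[]"] by simp

lemma tlift_sum:
  assumes f: "bilinear_map s f" and X: "\<And>i. i \<in> I \<Longrightarrow> X i \<in> tensor_space UNIV UNIV"
  shows "tlift f (\<Sum>i\<in>I. X i) = (\<Sum>i\<in>I. tlift f (X i))"
  using X
proof (induction I rule: infinite_finite_induct)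
  case (insert i I)
  have "tlift f (X i + sum X I) = tlift f (X i) + tlift f (sum X I)"
    by (rule tlift_add[OF f]) (use insert in \<open>auto intro!: sum_in_tensor_space\<close>)
  then show ?case using insert by (simp del: plus_fun_apply)
qed (auto simp: tlift_zero[OF f] simp del: zero_fun_apply)

lemma tlift_sum_pure:
  assumes "bilinear_map s f"
  shows "tlift f (\<Sum>i\<in>I. x i \<otimes>\<^sub>t y i) = (\<Sum>i\<in>I. f (x i) (y i))"
  using assms by (simp add: tlift_sum tlift_tensor)

lemma bilinear_map_sum:
  assumes f: "bilinear_map s f"
  shows "f (\<Sum>i\<in>I. x i) y = (\<Sum>i\<in>I. f (x i) y)" "f z (\<Sum>i\<in>I. x i) = (\<Sum>i\<in>I. f z (x i))"
proof -
  interpret l: Vector_Spaces.linear scale s "\<lambda>x. f x y" using f by (simp add: bilinear_map_def)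
  show "f (\<Sum>i\<in>I. x i) y = (\<Sum>i\<in>I. f (x i) y)" by (rule l.sum)
  interpret r: Vector_Spaces.linear scale s "\<lambda>x. f z x" using f by (simp add: bilinear_map_def)
  show "f z (\<Sum>i\<in>I. x i) = (\<Sum>i\<in>I. f z (x i))" by (rule r.sum)
qed

lemma bilinear_map_zero: "bilinear_map s f \<Longrightarrow> f 0 y = 0" "bilinear_map s f \<Longrightarrow> f x 0 = 0"
  using bilinear_map_sum(1)[where I = "{}"] bilinear_map_sum(2)[where I = "{}"] by auto

abbreviation linear_functional :: "('b \<Rightarrow> 'a) \<Rightarrow> bool" where
  "linear_functional f \<equiv> Vector_Spaces.linear scale (*) f"

lemma linear_functionalD:
  assumes "linear_functional f"
  shows "f (x + y) = f x + f y" "f (scale c x) = c * f x" "f 0 = 0" "f (\<Sum>i\<in>I. g i) = (\<Sum>i\<in>I. f (g i))"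
proof -
  interpret Vector_Spaces.linear scale "(*)" f by fact
  show "f (x + y) = f x + f y" "f (scale c x) = c * f x" "f 0 = 0" "f (\<Sum>i\<in>I. g i) = (\<Sum>i\<in>I. f (g i))"
    by (rule add scale zero sum)+
qed

lemma functional_separating_subspace:
  assumes "subspace B" "v \<notin> B"
  obtains f where "linear_functional f" "f v = 1" "\<And>b. b \<in> B \<Longrightarrow> f b = 0"
proof -
  interpret p: vector_space_pair scale "(*)"
    using vector_space_axioms vector_space_field by (rule vector_space_pair.intro)
  obtain E where E: "E \<subseteq> B" "independent E" "B \<subseteq> span E"
    using maximal_independent_subset[of B] by blast
  have "span E = B" using E assms(1) by (metis span_subspace)
  then have ind: "independent (insert v E)" using E assms(2) by (simp add: independent_insert)
  define f where "f = p.construct (insert v E) (\<lambda>x. if x = v then 1 else 0)"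
  have lin: "linear_functional f" unfolding f_def by (rule p.linear_construct[OF ind])
  have fE: "f e = (if e = v then 1 else 0)" if "e \<in> insert v E" for e
    unfolding f_def by (rule p.construct_basis[OF ind that])
  show ?thesis
  proof (rule that[OF lin])
    show "f v = 1" using fE[of v] by simp
    fix b assume "b \<in> B"
    then have b: "b \<in> span E" using E by blast
    show "f b = 0"
    proof (rule p.linear_eq_0_on_span[OF lin _ b])
      fix x assume "x \<in> E"
      then show "f x = 0" using fE[of x] E assms(2) by auto
    qed
  qed
qed

text \<open>Application of a functional to one of the two tensor factors.\<close>

definition slice_right :: "('b \<Rightarrow> 'a) \<Rightarrow> (('b \<Rightarrow> 'b \<Rightarrow> 'a) \<Rightarrow> 'a) \<Rightarrow> 'b" where
  "slice_right f = tlift (\<lambda>x y. scale (f y) x)"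

definition slice_left :: "('b \<Rightarrow> 'a) \<Rightarrow> (('b \<Rightarrow> 'b \<Rightarrow> 'a) \<Rightarrow> 'a) \<Rightarrow> 'b" where
  "slice_left f = tlift (\<lambda>x y. scale (f x) y)"

lemma bilinear_slice:
  assumes "linear_functional f"
  shows "bilinear_map scale (\<lambda>x y. scale (f y) x)" "bilinear_map scale (\<lambda>x y. scale (f x) y)"
  by (rule bilinear_mapI[OF vector_space_axioms];
      simp add: linear_functionalD[OF assms] scale_right_distrib scale_left_distrib mult.commute)+

lemma slice_in:
  assumes f: "linear_functional f" and A: "subspace A" and B: "subspace B" and t: "t \<in> tensor_space A B"
  shows "slice_right f t \<in> A" "slice_left f t \<in> B"
proof -
  obtain ps where ps: "t = (\<Sum>(x, y)\<leftarrow>ps. x \<otimes>\<^sub>t y)" "set ps \<subseteq> A \<times> B"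
    using tensor_space_sum[OF t A] .
  have *: "(\<Sum>p\<leftarrow>qs. F p) \<in> V" if "subspace V" "\<And>p. p \<in> set qs \<Longrightarrow> F p \<in> V"
    for F :: "'b \<times> 'b \<Rightarrow> 'b" and V qs
    using that(2) by (induction qs) (auto simp: subspace_0[OF that(1)] intro: subspace_add[OF that(1)])
  show "slice_right f t \<in> A"
    unfolding slice_right_def ps(1) tlift_sum_tensor[OF bilinear_slice(1)[OF f]]
    by (rule *[OF A]) (use ps(2) in \<open>auto intro: subspace_scale[OF A]\<close>)
  show "slice_left f t \<in> B"
    unfolding slice_left_def ps(1) tlift_sum_tensor[OF bilinear_slice(2)[OF f]]
    by (rule *[OF B]) (use ps(2) in \<open>auto intro: subspace_scale[OF B]\<close>)
qed

text \<open>
  A functional may vanish on \<open>A\<close> without vanishing on the whole space; slicing sees only its values on \<open>A\<close>.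
\<close>

lemma slice_vanish:
  assumes f: "linear_functional f" and A: "subspace A" and t: "t \<in> tensor_space A A" and "\<And>a. a \<in> A \<Longrightarrow> f a = 0"
  shows "slice_right f t = 0" "slice_left f t = 0"
proof -
  obtain ps where ps: "t = (\<Sum>(x, y)\<leftarrow>ps. x \<otimes>\<^sub>t y)" "set ps \<subseteq> A \<times> A"
    using tensor_space_sum[OF t A] .
  have *: "(\<Sum>p\<leftarrow>qs. F p) = 0" if "\<And>p. p \<in> set qs \<Longrightarrow> F p = 0"
    for F :: "'b \<times> 'b \<Rightarrow> 'b" and qs
    using that by (induction qs) auto
  show "slice_right f t = 0"
    unfolding slice_right_def ps(1) tlift_sum_tensor[OF bilinear_slice(1)[OF f]]
    by (rule *) (use ps(2) assms(4) in auto)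
  show "slice_left f t = 0"
    unfolding slice_left_def ps(1) tlift_sum_tensor[OF bilinear_slice(2)[OF f]]
    by (rule *) (use ps(2) assms(4) in auto)
qed

end

context coalgebra
begin

lemma comult_simps:
  "\<Delta> (x + y) = \<Delta> x + \<Delta> y" "\<Delta> (scale c x) = fscale c (\<Delta> x)" "\<Delta> 0 = 0" "\<Delta> (\<Sum>i\<in>I. g i) = (\<Sum>i\<in>I. \<Delta> (g i))"
proof -
  interpret Vector_Spaces.linear scale fscale \<Delta> by (rule comult_linear)
  show "\<Delta> (x + y) = \<Delta> x + \<Delta> y" "\<Delta> (scale c x) = fscale c (\<Delta> x)" "\<Delta> 0 = 0" "\<Delta> (\<Sum>i\<in>I. g i) = (\<Sum>i\<in>I. \<Delta> (g i))"
    by (rule add scale zero sum)+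
qed

lemma linear_tlift_comult:
  assumes "bilinear_map s f"
  shows "Vector_Spaces.linear scale s (\<lambda>h. tlift f (\<Delta> h))"
proof (rule linearI'[OF vector_space_axioms bilinear_map_vs[OF assms]])
  fix x y c
  show "tlift f (\<Delta> (x + y)) = tlift f (\<Delta> x) + tlift f (\<Delta> y)"
    using tlift_add[OF assms comult_in_tensor comult_in_tensor] by (simp only: comult_simps)
  show "tlift f (\<Delta> (scale c x)) = s c (tlift f (\<Delta> x))"
    using tlift_scale[OF assms comult_in_tensor] by (simp only: comult_simps)
qed

lemma linear_slice_comult:
  assumes "linear_functional f"
  shows "Vector_Spaces.linear scale scale (\<lambda>h. slice_right f (\<Delta> h))"
    "Vector_Spaces.linear scale scale (\<lambda>h. slice_left f (\<Delta> h))"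
  unfolding slice_right_def slice_left_def
  by (rule linear_tlift_comult bilinear_slice assms)+

lemma counit_simps:
  "\<epsilon> (x + y) = \<epsilon> x + \<epsilon> y" "\<epsilon> (scale c x) = c * \<epsilon> x" "\<epsilon> 0 = 0" "\<epsilon> (\<Sum>i\<in>I. g i) = (\<Sum>i\<in>I. \<epsilon> (g i))"
  by (rule linear_functionalD[OF counit_linear])+

lemma subcoalgebraD: "subcoalgebra C \<Longrightarrow> subspace C" "subcoalgebra C \<Longrightarrow> c \<in> C \<Longrightarrow> \<Delta> c \<in> tensor_space C C"
  by (auto simp: subcoalgebra_def)

end

locale cosemisimple_hopf_algebra = hopf_algebra scale \<Delta> \<epsilon> S
  for scale :: "'k::alg_closed_field \<Rightarrow> 'h::ring_1 \<Rightarrow> 'h" and \<Delta> \<epsilon> S +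
  assumes cosemisimple: "cosemisimple"
begin

lemma fscale_tensor_space: "t \<in> tensor_space A B \<Longrightarrow> fscale c t \<in> tensor_space A B"
proof -
  interpret f: vector_space "fscale :: 'k \<Rightarrow> (('h \<Rightarrow> 'h \<Rightarrow> 'k) \<Rightarrow> 'k) \<Rightarrow> _"
    by (rule vector_space_fscale)
  show "t \<in> tensor_space A B \<Longrightarrow> fscale c t \<in> tensor_space A B"
    unfolding tensor_space_def by (rule f.span_scale)
qed

lemma subcoalgebra_span_one: "subcoalgebra (span {1})"
proof -
  have "\<Delta> c \<in> tensor_space (span {1}) (span {1})" if "c \<in> span {1}" for c
  proof -
    obtain k where "c = scale k 1" using \<open>c \<in> span {1}\<close> by (auto simp: span_singleton)
    then have "\<Delta> c = fscale k (1 \<otimes>\<^sub>t 1)" by (simp add: comult_simps comult_one)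
    then show ?thesis by (auto intro!: fscale_tensor_space tensor_in_tensor_space span_base)
  qed
  then show ?thesis by (simp add: subcoalgebra_def)
qed

lemma one_not_zero: "(1::'h) \<noteq> 0"
  using counit_one counit_simps(3) by auto

text \<open>
  A functional that vanishes on the other simple subcoalgebras, but not at \<open>1\<close>, extracts from an
  expression of \<open>1\<close> an element of one of them.
\<close>

lemma one_notin_span_finitely_many:
  assumes "finite F" "\<And>A. A \<in> F \<Longrightarrow> simple_subcoalgebra A \<and> A \<noteq> span {1}"
  shows "1 \<notin> span (\<Union>F)"
  using assms
proof (induction F)
  case empty
  then show ?case using one_not_zero by simp
next
  case (insert A F)
  define B where "B = span (\<Union>F)"
  have "1 \<notin> B" using insert by (simp add: B_def)
  then obtain f where f: "linear_functional f" "f 1 = 1" "\<And>b. b \<in> B \<Longrightarrow> f b = 0"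
    using functional_separating_subspace[of B 1] by (auto simp: B_def)
  have A: "subspace A" "simple_subcoalgebra A" "subcoalgebra A" "A \<noteq> span {1}"
    using insert.prems[of A] by (auto simp: simple_subcoalgebra_def subcoalgebraD)
  interpret g: Vector_Spaces.linear scale scale "\<lambda>h. slice_right f (\<Delta> h)"
    by (rule linear_slice_comult[OF f(1)])
  interpret pr: vector_space_pair scale scale
    using vector_space_axioms vector_space_axioms by (rule vector_space_pair.intro)
  show ?case
  proof
    assume "1 \<in> span (\<Union>(insert A F))"
    then have "1 \<in> span (A \<union> \<Union>F)" by simp
    then obtain a b where ab: "1 = a + b" "a \<in> A" "b \<in> B"
      unfolding span_Un B_def span_eq_iff[THEN iffD2, OF A(1)] by auto
    have "slice_right f (\<Delta> 1) = 1"
      by (simp add: slice_right_def comult_one tlift_tensor[OF bilinear_slice(1)[OF f(1)]] f(2))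
    moreover have "slice_right f (\<Delta> 1) = slice_right f (\<Delta> a) + slice_right f (\<Delta> b)"
      unfolding ab(1) by (rule g.add)
    moreover have "slice_right f (\<Delta> b) = 0"
    proof (rule pr.linear_eq_0_on_span[OF g.linear_axioms])
      show "b \<in> span (\<Union>F)" using ab by (simp add: B_def)
      fix x assume "x \<in> \<Union>F"
      then obtain C where C: "C \<in> F" "x \<in> C" by blast
      then have sC: "subcoalgebra C" using insert.prems[of C] by (auto simp: simple_subcoalgebra_def)
      have "f c = 0" if "c \<in> C" for c
        using that C by (intro f(3)) (auto simp: B_def intro!: span_base)
      then show "slice_right f (\<Delta> x) = 0"
        using slice_vanish(1)[OF f(1) subcoalgebraD(1)[OF sC] subcoalgebraD(2)[OF sC C(2)]] by blast
    qed
    moreover have "slice_right f (\<Delta> a) \<in> A"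
      using slice_in(1)[OF f(1) A(1) A(1)] subcoalgebraD(2)[OF A(3) ab(2)] .
    ultimately have "1 \<in> A" by simp
    then have "span {1} \<subseteq> A" using A(1) by (simp add: span_minimal)
    then have "span {1} = A"
      using A(2) subcoalgebra_span_one span_base[of 1 "{1}"] one_not_zero unfolding simple_subcoalgebra_def by blast
    then show False using A(4) by simp
  qed
qed

text \<open>Distinct simple subcoalgebras are independent; this is the instance on which the Haar functional rests.\<close>

lemma one_notin_span_simple:
  "1 \<notin> span (\<Union>{C. simple_subcoalgebra C \<and> C \<noteq> span {1}})"
proof
  assume "1 \<in> span (\<Union>{C. simple_subcoalgebra C \<and> C \<noteq> span {1}})"
  then obtain T where T: "finite T" "T \<subseteq> \<Union>{C. simple_subcoalgebra C \<and> C \<noteq> span {1}}" "1 \<in> span T"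
    unfolding span_explicit by (auto intro!: span_sum span_scale span_base)
  obtain F where F: "finite F" "F \<subseteq> {C. simple_subcoalgebra C \<and> C \<noteq> span {1}}" "T \<subseteq> \<Union>F"
    using finite_subset_Union[OF T(1,2)] by blast
  have "1 \<in> span (\<Union>F)" using T(3) span_mono[OF F(3)] by blast
  then show False using one_notin_span_finitely_many[OF F(1)] F(2) by blast
qed

text \<open>
  The projection of \<open>H\<close> to the simple subcoalgebra \<open>span {1}\<close> along the sum of the others: the normalized two-sided integral.
\<close>

definition haar :: "'h \<Rightarrow> 'k" where
  "haar = (SOME f. linear_functional f \<and> f 1 = 1 \<and> (\<forall>C. simple_subcoalgebra C \<and> C \<noteq> span {1} \<longrightarrow> (\<forall>c\<in>C. f c = 0)))"

lemma haar: "linear_functional haar" "haar 1 = 1"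
  "simple_subcoalgebra C \<Longrightarrow> C \<noteq> span {1} \<Longrightarrow> c \<in> C \<Longrightarrow> haar c = 0"
proof -
  obtain f where f: "linear_functional f" "f 1 = 1"
    "\<And>b. b \<in> span (\<Union>{C. simple_subcoalgebra C \<and> C \<noteq> span {1}}) \<Longrightarrow> f b = 0"
    using functional_separating_subspace[OF _ one_notin_span_simple] subspace_span by blast
  then have "\<exists>f. linear_functional f \<and> f 1 = 1 \<and> (\<forall>C. simple_subcoalgebra C \<and> C \<noteq> span {1} \<longrightarrow> (\<forall>c\<in>C. f c = 0))"
    by (intro exI[of _ f] conjI allI impI ballI f span_base) auto
  from someI_ex[OF this]
  show "linear_functional haar" "haar 1 = 1"
    "simple_subcoalgebra C \<Longrightarrow> C \<noteq> span {1} \<Longrightarrow> c \<in> C \<Longrightarrow> haar c = 0"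
    unfolding haar_def[symmetric] by auto
qed

lemmas haar_simps = linear_functionalD[OF haar(1)]

text \<open>
  Both sides are linear in \<open>h\<close>, so \<open>h\<close> may be taken in a simple subcoalgebra, where \<open>haar\<close> either vanishes identically or is the
  coordinate with respect to \<open>1\<close>.
\<close>

lemma haar_invariant:
  "slice_right haar (\<Delta> h) = scale (haar h) 1" "slice_left haar (\<Delta> h) = scale (haar h) 1"
proof -
  interpret pr: vector_space_pair scale scale
    using vector_space_axioms vector_space_axioms by (rule vector_space_pair.intro)
  have lin: "Vector_Spaces.linear scale scale (\<lambda>h. scale (haar h) 1)"
    by (rule linearI'[OF vector_space_axioms vector_space_axioms]) (auto simp: haar_simps scale_left_distrib)
  have h: "h \<in> span (\<Union>{C. simple_subcoalgebra C})" using cosemisimple by (simp add: cosemisimple_def)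
  have *: "slice_right haar (\<Delta> x) = scale (haar x) 1 \<and> slice_left haar (\<Delta> x) = scale (haar x) 1"
    if "x \<in> \<Union>{C. simple_subcoalgebra C}" for x
  proof -
    obtain C where C: "simple_subcoalgebra C" "x \<in> C" using \<open>x \<in> _\<close> by blast
    show ?thesis
    proof (cases "C = span {1}")
      case True
      then obtain k where "x = scale k 1" using C by (auto simp: span_singleton)
      then have "\<Delta> x = scale k 1 \<otimes>\<^sub>t 1" "haar x = k"
        by (simp_all add: comult_simps comult_one fscale_tensor haar_simps haar)
      then show ?thesis
        by (simp add: slice_right_def slice_left_def tlift_tensor[OF bilinear_slice(1)[OF haar(1)]]
            tlift_tensor[OF bilinear_slice(2)[OF haar(1)]] haar_simps haar)
    next
      case False
      have sC: "subcoalgebra C" using C by (auto simp: simple_subcoalgebra_def)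
      show ?thesis
        using slice_vanish[OF haar(1) subcoalgebraD(1)[OF sC] subcoalgebraD(2)[OF sC C(2)] haar(3)[OF C(1) False]]
          haar(3)[OF C(1) False C(2)] by simp
    qed
  qed
  show "slice_right haar (\<Delta> h) = scale (haar h) 1"
    by (rule pr.linear_eq_on_span[OF linear_slice_comult(1)[OF haar(1)] lin _ h]) (use * in blast)
  show "slice_left haar (\<Delta> h) = scale (haar h) 1"
    by (rule pr.linear_eq_on_span[OF linear_slice_comult(2)[OF haar(1)] lin _ h]) (use * in blast)
qed

end

section \<open>The antipode and tensor multiplication\<close>

context cosemisimple_hopf_algebra
begin

lemmas antipode_simps = antipode_linear[unfolded Vector_Spaces.linear_iff, THEN conjunct2, THEN conjunct2, THEN conjunct1, rule_format]
  antipode_linear[unfolded Vector_Spaces.linear_iff, THEN conjunct2, THEN conjunct2, THEN conjunct2, rule_format]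

lemma bilinear_antipode:
  "bilinear_map scale (\<lambda>x y. S x * y)" "bilinear_map scale (\<lambda>x y. x * S y)"
  by (rule bilinear_mapI[OF vector_space_axioms];
      simp add: antipode_simps algebra_simps scale_mult_left scale_mult_right)+

text \<open>Left multiplication by \<open>a \<otimes> b\<close> on the tensor square of \<open>H\<close>.\<close>

definition tmul :: "'h \<Rightarrow> 'h \<Rightarrow> (('h \<Rightarrow> 'h \<Rightarrow> 'k) \<Rightarrow> 'k) \<Rightarrow> ('h \<Rightarrow> 'h \<Rightarrow> 'k) \<Rightarrow> 'k" where
  "tmul a b = tlift (\<lambda>c d. (a * c) \<otimes>\<^sub>t (b * d))"

lemma tmul_pure [simp]: "tmul a b (x \<otimes>\<^sub>t y) = (a * x) \<otimes>\<^sub>t (b * y)"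
  unfolding tmul_def by (rule tlift_tensor[OF bilinear_map_mult_tensor])

lemma tmul_sum: "(\<And>i. i \<in> I \<Longrightarrow> X i \<in> tensor_space UNIV UNIV) \<Longrightarrow> tmul a b (\<Sum>i\<in>I. X i) = (\<Sum>i\<in>I. tmul a b (X i))"
  unfolding tmul_def by (rule tlift_sum[OF bilinear_map_mult_tensor])

lemma tmul_zero: "tmul a b 0 = 0"
  unfolding tmul_def by (rule tlift_zero[OF bilinear_map_mult_tensor])

lemma tmul_list: "tmul a b (\<Sum>(x, y)\<leftarrow>ps. x \<otimes>\<^sub>t y) = (\<Sum>(x, y)\<leftarrow>ps. (a * x) \<otimes>\<^sub>t (b * y))"
  unfolding tmul_def by (rule tlift_sum_tensor[OF bilinear_map_mult_tensor])

lemma tensor_list: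
  assumes "X \<in> tensor_space UNIV UNIV"
  obtains ps where "X = (\<Sum>(x, y)\<leftarrow>ps. x \<otimes>\<^sub>t y)"
  using assms tensor_space_sum subspace_UNIV by metis

lemma fscale_zero: "fscale c (\<lambda>_. 0) = (\<lambda>_. 0)"
  by (simp add: fscale_def)

lemma bilinear_tmul:
  assumes "X \<in> tensor_space UNIV UNIV"
  shows "bilinear_map fscale (\<lambda>a b. tmul a b X)"
proof -
  interpret f: vector_space "fscale :: 'k \<Rightarrow> (('h \<Rightarrow> 'h \<Rightarrow> 'k) \<Rightarrow> 'k) \<Rightarrow> _"
    by (rule vector_space_fscale)
  obtain ps where ps: "X = (\<Sum>(x, y)\<leftarrow>ps. x \<otimes>\<^sub>t y)" using tensor_list[OF assms] .
  note b = bilinear_mapD[OF bilinear_map_tensor]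
  have "(\<Sum>(x, y)\<leftarrow>ps. ((a + a') * x) \<otimes>\<^sub>t (b * y)) =
      (\<Sum>(x, y)\<leftarrow>ps. (a * x) \<otimes>\<^sub>t (b * y)) + (\<Sum>(x, y)\<leftarrow>ps. (a' * x) \<otimes>\<^sub>t (b * y))"
    "(\<Sum>(x, y)\<leftarrow>ps. (a * x) \<otimes>\<^sub>t ((b + b') * y)) =
      (\<Sum>(x, y)\<leftarrow>ps. (a * x) \<otimes>\<^sub>t (b * y)) + (\<Sum>(x, y)\<leftarrow>ps. (a * x) \<otimes>\<^sub>t (b' * y))"
    "(\<Sum>(x, y)\<leftarrow>ps. (scale c a * x) \<otimes>\<^sub>t (b * y)) = fscale c (\<Sum>(x, y)\<leftarrow>ps. (a * x) \<otimes>\<^sub>t (b * y))"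
    "(\<Sum>(x, y)\<leftarrow>ps. (a * x) \<otimes>\<^sub>t (scale c b * y)) = fscale c (\<Sum>(x, y)\<leftarrow>ps. (a * x) \<otimes>\<^sub>t (b * y))"
    for a a' b b' c
    by (induction ps; auto simp: distrib_right b add_ac f.scale_right_distrib scale_mult_left scale_mult_right fscale_zero
        simp del: plus_fun_apply)+
  then show ?thesis
    unfolding ps tmul_list by (intro bilinear_mapI[OF vector_space_fscale])
qed

lemma tmul_tmul:
  assumes "X \<in> tensor_space UNIV UNIV"
  shows "tmul a b (tmul c d X) = tmul (a * c) (b * d) X"
proof -
  obtain ps where ps: "X = (\<Sum>(x, y)\<leftarrow>ps. x \<otimes>\<^sub>t y)" using tensor_list[OF assms] .
  have "(\<Sum>(x, y)\<leftarrow>ps. (c * x) \<otimes>\<^sub>t (d * y)) = (\<Sum>(x, y)\<leftarrow>map (\<lambda>(x,y). (c * x, d * y)) ps. x \<otimes>\<^sub>t y)"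
    by (simp add: o_def case_prod_unfold)
  then show ?thesis
    unfolding ps tmul_list by (simp only: tmul_list) (simp add: o_def case_prod_unfold mult.assoc)
qed

lemma tmul_one:
  assumes "X \<in> tensor_space UNIV UNIV"
  shows "tmul 1 1 X = X"
proof -
  obtain ps where ps: "X = (\<Sum>(x, y)\<leftarrow>ps. x \<otimes>\<^sub>t y)" using tensor_list[OF assms] .
  show ?thesis unfolding ps tmul_list by simp
qed

lemma tmul_in: "X \<in> tensor_space UNIV UNIV \<Longrightarrow> tmul a b X \<in> tensor_space UNIV UNIV"
proof -
  assume "X \<in> tensor_space UNIV UNIV"
  then obtain ps where ps: "X = (\<Sum>(x, y)\<leftarrow>ps. x \<otimes>\<^sub>t y)" using tensor_list by blast
  interpret f: vector_space "fscale :: 'k \<Rightarrow> (('h \<Rightarrow> 'h \<Rightarrow> 'k) \<Rightarrow> 'k) \<Rightarrow> _"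
    by (rule vector_space_fscale)
  have "(\<Sum>(x, y)\<leftarrow>qs. (a * x) \<otimes>\<^sub>t (b * y)) \<in> tensor_space UNIV UNIV" for qs
  proof (induction qs)
    case Nil
    show ?case unfolding tensor_space_def by (simp add: f.span_zero del: zero_fun_apply)
  next
    case (Cons q qs)
    have "u + v \<in> tensor_space UNIV UNIV" if "u \<in> tensor_space UNIV UNIV" "v \<in> tensor_space UNIV UNIV"
      for u v using that unfolding tensor_space_def by (rule f.span_add)
    from this[OF tensor_UNIV Cons] show ?case
      by (simp add: case_prod_unfold del: plus_fun_apply)
  qed
  then show ?thesis unfolding ps tmul_list .
qed

lemma comult_mult_sum:
  assumes "\<Delta> g = (\<Sum>i\<in>I. x i \<otimes>\<^sub>t y i)"
  shows "\<Delta> (g * h) = (\<Sum>i\<in>I. tmul (x i) (y i) (\<Delta> h))"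
  unfolding comult_mult assms tmul_def[symmetric]
  by (rule tlift_sum_pure[OF bilinear_tmul[OF comult_in_tensor]])

section \<open>Matrix comodules\<close>

text \<open>Scalar matrices regarded as matrices over \<open>H\<close>; their entries are central.\<close>

definition emb :: "'k mat \<Rightarrow> 'h mat" where
  "emb = map_mat (\<lambda>c. scale c 1)"

lemma scale_one_mult [simp]: "scale c 1 * x = scale c x" "x * scale c 1 = scale c x"
  by (simp_all add: scale_mult_left scale_mult_right)

lemma emb_carrier [simp]: "emb T \<in> carrier_mat m n \<longleftrightarrow> T \<in> carrier_mat m n"
  by (simp add: emb_def)

lemma dim_emb [simp]: "dim_row (emb T) = dim_row T" "dim_col (emb T) = dim_col T"
  by (simp_all add: emb_def)

lemma emb_index [simp]: "i < dim_row T \<Longrightarrow> j < dim_col T \<Longrightarrow> emb T $$ (i,j) = scale (T $$ (i,j)) 1"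
  by (simp add: emb_def)

lemma emb_mult: "dim_col A = dim_row B \<Longrightarrow> emb (A * B) = emb A * emb B"
  by (rule eq_matI) (auto simp: scalar_prod_def scale_sum_left atLeast0LessThan scale_scale intro!: sum.cong)

lemma emb_one [simp]: "emb (1\<^sub>m n) = 1\<^sub>m n"
  by (rule eq_matI) auto

lemma emb_zero [simp]: "emb (0\<^sub>m m n) = 0\<^sub>m m n"
  by (rule eq_matI) auto

lemma emb_add: "dim_row A = dim_row B \<Longrightarrow> dim_col A = dim_col B \<Longrightarrow> emb (A + B) = emb A + emb B"
  by (rule eq_matI) (auto simp: scale_left_distrib)

lemma emb_minus: "dim_row A = dim_row B \<Longrightarrow> dim_col A = dim_col B \<Longrightarrow> emb (A - B) = emb A - emb B"
  by (rule eq_matI) (auto simp: scale_left_diff_distrib)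

lemma emb_kron: "emb (A \<boxtimes> B) = emb A \<boxtimes> emb B"
  by (rule eq_matI) (auto simp: kron_def div_mod_lt scale_scale mult.commute)

text \<open>Linear functionals, applied to each entry, commute with multiplication by scalar matrices.\<close>

lemma map_mat_emb_mult:
  assumes "linear_functional f" "dim_col T = dim_row X"
  shows "map_mat f (emb T * X) = T * map_mat f X"
  by (rule eq_matI) (use assms in \<open>auto simp: scalar_prod_def linear_functionalD[OF assms(1)] intro!: sum.cong\<close>)

lemma map_mat_mult_emb:
  assumes "linear_functional f" "dim_col X = dim_row T"
  shows "map_mat f (X * emb T) = map_mat f X * T"
  by (rule eq_matI) (use assms in \<open>auto simp: scalar_prod_def linear_functionalD[OF assms(1)] mult.commute intro!: sum.cong\<close>)

text \<open>
  The relation \<open>\<Delta>(X) = A \<otimes> B\<close> between matrices, where the entries of a product are tensors. The three matrices may differ, so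
  that scalar matrices can be moved across the tensor sign.
\<close>

definition comult_mat :: "'h mat \<Rightarrow> 'h mat \<Rightarrow> 'h mat \<Rightarrow> bool" where
  "comult_mat X A B \<longleftrightarrow> dim_row A = dim_row X \<and> dim_col B = dim_col X \<and> dim_col A = dim_row B \<and>
     (\<forall>i<dim_row X. \<forall>j<dim_col X. \<Delta> (X $$ (i,j)) = (\<Sum>k<dim_row B. A $$ (i,k) \<otimes>\<^sub>t B $$ (k,j)))"

lemmas tensor_simps = bilinear_mapD[OF bilinear_map_tensor]
lemmas tensor_sum = bilinear_map_sum[OF bilinear_map_tensor]

lemma fscale_sum: "fscale c (\<Sum>i\<in>I. X i) = (\<Sum>i\<in>I. fscale c (X i))" for X :: "_ \<Rightarrow> _ \<Rightarrow> 'k"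
proof -
  interpret f: vector_space "fscale :: 'k \<Rightarrow> (_ \<Rightarrow> 'k) \<Rightarrow> _"
    by (rule vector_space_fscale)
  show ?thesis by (rule f.scale_sum_right)
qed

lemma emb_mult_index:
  "dim_col L = dim_row X \<Longrightarrow> i < dim_row L \<Longrightarrow> j < dim_col X \<Longrightarrow>
    (emb L * X) $$ (i,j) = (\<Sum>k<dim_row X. scale (L $$ (i,k)) (X $$ (k,j)))"
  by (auto simp: scalar_prod_def atLeast0LessThan intro!: sum.cong)

lemma mult_emb_index:
  "dim_col X = dim_row R \<Longrightarrow> i < dim_row X \<Longrightarrow> j < dim_col R \<Longrightarrow>
    (X * emb R) $$ (i,j) = (\<Sum>k<dim_row R. scale (R $$ (k,j)) (X $$ (i,k)))"
  by (auto simp: scalar_prod_def atLeast0LessThan intro!: sum.cong)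

lemma comult_mat_left:
  assumes "comult_mat X A B" "dim_col L = dim_row X"
  shows "comult_mat (emb L * X) (emb L * A) B"
proof -
  have "\<Delta> ((emb L * X) $$ (i,j)) = (\<Sum>k<dim_row B. (emb L * A) $$ (i,k) \<otimes>\<^sub>t B $$ (k,j))"
    if "i < dim_row L" "j < dim_col X" for i j
  proof -
    have "\<Delta> ((emb L * X) $$ (i,j)) = (\<Sum>a<dim_row X. fscale (L $$ (i,a)) (\<Delta> (X $$ (a,j))))"
      using that assms by (simp add: emb_mult_index comult_simps del: index_mult_mat(1))
    also have "\<dots> = (\<Sum>a<dim_row X. \<Sum>k<dim_row B. scale (L $$ (i,a)) (A $$ (a,k)) \<otimes>\<^sub>t B $$ (k,j))"
      using that assms by (intro sum.cong refl) (simp add: comult_mat_def fscale_sum fscale_tensor)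
    also have "\<dots> = (\<Sum>k<dim_row B. (emb L * A) $$ (i,k) \<otimes>\<^sub>t B $$ (k,j))"
      using that assms by (subst sum.swap, intro sum.cong refl) (simp add: comult_mat_def emb_mult_index tensor_sum del: index_mult_mat(1))
    finally show ?thesis .
  qed
  then show ?thesis using assms by (simp add: comult_mat_def)
qed

lemma comult_mat_right:
  assumes "comult_mat X A B" "dim_col X = dim_row R"
  shows "comult_mat (X * emb R) A (B * emb R)"
proof -
  have "\<Delta> ((X * emb R) $$ (i,j)) = (\<Sum>k<dim_row B. A $$ (i,k) \<otimes>\<^sub>t (B * emb R) $$ (k,j))"
    if "i < dim_row X" "j < dim_col R" for i j
  proof -
    have "\<Delta> ((X * emb R) $$ (i,j)) = (\<Sum>a<dim_row R. fscale (R $$ (a,j)) (\<Delta> (X $$ (i,a))))"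
      using that assms by (simp add: mult_emb_index comult_simps del: index_mult_mat(1))
    also have "\<dots> = (\<Sum>a<dim_row R. \<Sum>k<dim_row B. A $$ (i,k) \<otimes>\<^sub>t scale (R $$ (a,j)) (B $$ (k,a)))"
      using that assms by (intro sum.cong refl) (simp add: comult_mat_def fscale_sum tensor_simps)
    also have "\<dots> = (\<Sum>k<dim_row B. A $$ (i,k) \<otimes>\<^sub>t (B * emb R) $$ (k,j))"
      using that assms by (subst sum.swap, intro sum.cong refl) (simp add: comult_mat_def mult_emb_index tensor_sum del: index_mult_mat(1))
    finally show ?thesis .
  qed
  then show ?thesis using assms by (simp add: comult_mat_def)
qed

lemma comult_mat_middle:
  assumes "comult_mat X A (emb R * B)" "dim_col R = dim_row B"
  shows "comult_mat X (A * emb R) B"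
proof -
  have "\<Delta> (X $$ (i,j)) = (\<Sum>k<dim_row B. (A * emb R) $$ (i,k) \<otimes>\<^sub>t B $$ (k,j))"
    if "i < dim_row X" "j < dim_col X" for i j
  proof -
    have "\<Delta> (X $$ (i,j)) = (\<Sum>k<dim_row R. A $$ (i,k) \<otimes>\<^sub>t (\<Sum>l<dim_row B. scale (R $$ (k,l)) (B $$ (l,j))))"
      using that assms by (simp add: comult_mat_def emb_mult_index del: index_mult_mat(1))
    also have "\<dots> = (\<Sum>l<dim_row B. \<Sum>k<dim_row R. A $$ (i,k) \<otimes>\<^sub>t scale (R $$ (k,l)) (B $$ (l,j)))"
      by (subst sum.swap) (simp add: tensor_sum)
    also have "\<dots> = (\<Sum>l<dim_row B. (A * emb R) $$ (i,l) \<otimes>\<^sub>t B $$ (l,j))"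
      using that assms by (intro sum.cong refl) (simp add: comult_mat_def mult_emb_index tensor_sum tensor_simps del: index_mult_mat(1))
    finally show ?thesis .
  qed
  then show ?thesis using assms by (simp add: comult_mat_def)
qed

text \<open>A comodule of finite dimension with a chosen basis, given by its matrix of coefficients.\<close>

definition corep :: "'h mat \<Rightarrow> bool" where
  "corep t \<longleftrightarrow> dim_col t = dim_row t \<and> comult_mat t t t \<and> map_mat \<epsilon> t = 1\<^sub>m (dim_row t)"

lemma corepD:
  assumes "corep t"
  shows "dim_col t = dim_row t" "t \<in> carrier_mat (dim_row t) (dim_row t)"
    "i < dim_row t \<Longrightarrow> j < dim_row t \<Longrightarrow> \<Delta> (t $$ (i,j)) = (\<Sum>k<dim_row t. t $$ (i,k) \<otimes>\<^sub>t t $$ (k,j))"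
    "i < dim_row t \<Longrightarrow> j < dim_row t \<Longrightarrow> \<epsilon> (t $$ (i,j)) = (if i = j then 1 else 0)"
proof -
  show d: "dim_col t = dim_row t" using assms by (simp add: corep_def)
  then show "t \<in> carrier_mat (dim_row t) (dim_row t)" by auto
  show "i < dim_row t \<Longrightarrow> j < dim_row t \<Longrightarrow> \<Delta> (t $$ (i,j)) = (\<Sum>k<dim_row t. t $$ (i,k) \<otimes>\<^sub>t t $$ (k,j))"
    using assms d by (simp add: corep_def comult_mat_def)
  assume ij: "i < dim_row t" "j < dim_row t"
  have "map_mat \<epsilon> t $$ (i,j) = (1\<^sub>m (dim_row t) :: 'k mat) $$ (i,j)" using assms by (simp add: corep_def)
  then show "\<epsilon> (t $$ (i,j)) = (if i = j then 1 else 0)" using ij d by simp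
qed

lemma corepI:
  assumes "t \<in> carrier_mat n n"
    "\<And>i j. i < n \<Longrightarrow> j < n \<Longrightarrow> \<Delta> (t $$ (i,j)) = (\<Sum>k<n. t $$ (i,k) \<otimes>\<^sub>t t $$ (k,j))"
    "\<And>i j. i < n \<Longrightarrow> j < n \<Longrightarrow> \<epsilon> (t $$ (i,j)) = (if i = j then 1 else 0)"
  shows "corep t"
  using assms by (auto simp: corep_def comult_mat_def)

definition antip :: "'h mat \<Rightarrow> 'h mat" where "antip = map_mat S"

lemma antip_dim [simp]: "dim_row (antip t) = dim_row t" "dim_col (antip t) = dim_col t"
  by (simp_all add: antip_def)

lemma antip_index [simp]: "i < dim_row t \<Longrightarrow> j < dim_col t \<Longrightarrow> antip t $$ (i,j) = S (t $$ (i,j))"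
  by (simp add: antip_def)

lemma antip_inverse:
  assumes t: "corep t"
  shows "t * antip t = 1\<^sub>m (dim_row t)" "antip t * t = 1\<^sub>m (dim_row t)"
proof -
  have *: "(t * antip t) $$ (i,j) = (1\<^sub>m (dim_row t) :: 'h mat) $$ (i,j)" "(antip t * t) $$ (i,j) = (1\<^sub>m (dim_row t) :: 'h mat) $$ (i,j)"
    if ij: "i < dim_row t" "j < dim_row t" for i j
  proof -
    have "(\<Sum>k<dim_row t. t $$ (i,k) * S (t $$ (k,j))) = tlift (\<lambda>x y. x * S y) (\<Delta> (t $$ (i,j)))"
      unfolding corepD(3)[OF t ij] by (rule tlift_sum_pure[symmetric, OF bilinear_antipode(2)])
    also have "\<dots> = scale (\<epsilon> (t $$ (i,j))) 1" by (rule antipode_right)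
    finally show "(t * antip t) $$ (i,j) = (1\<^sub>m (dim_row t) :: 'h mat) $$ (i,j)"
      using corepD(1,4)[OF t] ij by (simp add: scalar_prod_def atLeast0LessThan)
    have "(\<Sum>k<dim_row t. S (t $$ (i,k)) * t $$ (k,j)) = tlift (\<lambda>x y. S x * y) (\<Delta> (t $$ (i,j)))"
      unfolding corepD(3)[OF t ij] by (rule tlift_sum_pure[symmetric, OF bilinear_antipode(1)])
    also have "\<dots> = scale (\<epsilon> (t $$ (i,j))) 1" by (rule antipode_left)
    finally show "(antip t * t) $$ (i,j) = (1\<^sub>m (dim_row t) :: 'h mat) $$ (i,j)"
      using corepD(1,4)[OF t] ij by (simp add: scalar_prod_def atLeast0LessThan)
  qed
  show "t * antip t = 1\<^sub>m (dim_row t)" "antip t * t = 1\<^sub>m (dim_row t)"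
    by (rule eq_matI; use * corepD(1)[OF t] in simp)+
qed

lemma antip_inverse_index:
  assumes t: "corep t" and ij: "i < dim_row t" "j < dim_row t"
  shows "(\<Sum>k<dim_row t. t $$ (i,k) * S (t $$ (k,j))) = (if i = j then 1 else 0)"
    "(\<Sum>k<dim_row t. S (t $$ (i,k)) * t $$ (k,j)) = (if i = j then 1 else 0)"
  using arg_cong[OF antip_inverse(1)[OF t], of "\<lambda>M. M $$ (i,j)"]
    arg_cong[OF antip_inverse(2)[OF t], of "\<lambda>M. M $$ (i,j)"] ij corepD(1)[OF t]
  by (simp_all add: scalar_prod_def atLeast0LessThan)

lemma sum_rotate:
  "(\<Sum>i\<in>I. \<Sum>j\<in>J. \<Sum>k\<in>K. G i j k) = (\<Sum>j\<in>J. \<Sum>k\<in>K. \<Sum>i\<in>I. G i j k)"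
  by (rule trans[OF sum.swap]) (intro sum.cong refl sum.swap)

text \<open>
  Both sides are the \<open>(b,l)\<close> entry of an inverse of the matrix \<open>\<Delta>(t)\<close> over the algebra
  \<open>H \<otimes> H\<close>: the left one because \<open>\<Delta>\<close> is multiplicative, the right one because \<open>t\<close> has the inverse
  \<open>S(t)\<close>. The computation below is the usual proof that a left and a right inverse agree.
\<close>

lemma comult_antipode:
  assumes t: "corep t" and bl: "b < dim_row t" "l < dim_row t"
  shows "\<Delta> (S (t $$ (b,l))) = (\<Sum>p<dim_row t. S (t $$ (p,l)) \<otimes>\<^sub>t S (t $$ (b,p)))"
proof -
  define n where "n = dim_row t"
  define s where "s = (\<lambda>i j. S (t $$ (i,j)))"
  define \<tau> where "\<tau> = (\<lambda>i j. t $$ (i,j))"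
  define Y where "Y = (\<lambda>i j. \<Delta> (s i j))"
  let ?T = "tensor_space UNIV UNIV"
  have Y: "Y i j \<in> ?T" for i j by (simp add: Y_def comult_in_tensor)
  note tT = Y tmul_in sum_in_tensor_space
  have st: "(\<Sum>k<n. s i k * \<tau> k j) = (if i = j then 1 else 0)" and ts: "(\<Sum>k<n. \<tau> i k * s k j) = (if i = j then 1 else 0)"
    if "i < n" "j < n" for i j
    using antip_inverse_index[OF t] that by (simp_all add: s_def \<tau>_def n_def)
  have tm0: "tmul a 0 X = 0" "tmul 0 a X = 0" if "X \<in> ?T" for a X
    using bilinear_map_zero[OF bilinear_tmul[OF that]] by auto
  have one: "(\<Sum>j<n. \<Sum>k<n. tmul (\<tau> i k) (\<tau> k j) (Y j l)) = (if i = l then 1 \<otimes>\<^sub>t 1 else 0)"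
    if i: "i < n" for i
  proof -
    have "(\<Sum>j<n. \<Sum>k<n. tmul (\<tau> i k) (\<tau> k j) (Y j l)) = (\<Sum>j<n. \<Delta> (\<tau> i j * s j l))"
      by (intro sum.cong refl, unfold Y_def, rule comult_mult_sum[symmetric])
         (use corepD(3)[OF t] i in \<open>simp add: n_def \<tau>_def\<close>)
    also have "\<dots> = \<Delta> (if i = l then 1 else 0)" using ts[OF i, of l] bl by (simp add: n_def comult_simps(4)[symmetric])
    finally show ?thesis by (simp add: comult_one comult_simps(3))
  qed
  have "(\<Sum>p<n. s p l \<otimes>\<^sub>t s b p) = (\<Sum>i<n. \<Sum>p<n. tmul (s p i) (s b p) (if i = l then 1 \<otimes>\<^sub>t 1 else 0))"
  proof -
    have "(\<Sum>i<n. \<Sum>p<n. tmul (s p i) (s b p) (if i = l then 1 \<otimes>\<^sub>t 1 else 0)) =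
        (\<Sum>i<n. if i = l then (\<Sum>p<n. s p i \<otimes>\<^sub>t s b p) else 0)"
      by (intro sum.cong refl) (simp add: tmul_zero del: zero_fun_apply)
    then show ?thesis using bl by (simp add: n_def)
  qed
  also have "\<dots> = (\<Sum>i<n. \<Sum>p<n. \<Sum>j<n. \<Sum>k<n. tmul (s p i * \<tau> i k) (s b p * \<tau> k j) (Y j l))"
    by (intro sum.cong refl) (simp add: one[symmetric] tmul_sum tT tmul_tmul)
  also have "\<dots> = (\<Sum>p<n. \<Sum>j<n. \<Sum>k<n. \<Sum>i<n. tmul (s p i * \<tau> i k) (s b p * \<tau> k j) (Y j l))"
    by (rule trans[OF sum.swap]) (intro sum.cong refl sum_rotate)
  also have "\<dots> = (\<Sum>p<n. \<Sum>j<n. \<Sum>k<n. if p = k then tmul 1 (s b p * \<tau> k j) (Y j l) else 0)"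
    by (intro sum.cong refl)
       (simp add: bilinear_map_sum(1)[OF bilinear_tmul[OF Y], symmetric] st tm0 Y del: zero_fun_apply)
  also have "\<dots> = (\<Sum>p<n. \<Sum>j<n. tmul 1 (s b p * \<tau> p j) (Y j l))"
    by (intro sum.cong refl) simp
  also have "\<dots> = (\<Sum>j<n. \<Sum>p<n. tmul 1 (s b p * \<tau> p j) (Y j l))"
    by (rule sum.swap)
  also have "\<dots> = (\<Sum>j<n. if b = j then tmul 1 1 (Y j l) else 0)"
    using bl by (intro sum.cong refl)
       (simp add: bilinear_map_sum(2)[OF bilinear_tmul[OF Y], symmetric] st tm0 Y n_def[symmetric] del: zero_fun_apply)
  also have "\<dots> = Y b l" using bl by (simp add: tmul_one Y n_def)
  finally show ?thesis by (simp add: Y_def s_def n_def)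
qed

text \<open>The dual comodule: the transposed matrix of antipodes.\<close>

definition star :: "'h mat \<Rightarrow> 'h mat" where
  "star t = transpose_mat (antip t)"

lemma star_dim [simp]: "dim_row (star t) = dim_col t" "dim_col (star t) = dim_row t"
  by (simp_all add: star_def)

lemma star_index [simp]: "i < dim_col t \<Longrightarrow> j < dim_row t \<Longrightarrow> star t $$ (i,j) = S (t $$ (j,i))"
  by (simp add: star_def)

lemma counit_antipode:
  assumes t: "corep t" and ij: "i < dim_row t" "j < dim_row t"
  shows "\<epsilon> (S (t $$ (i,j))) = (if i = j then 1 else 0)"
proof -
  have "\<epsilon> (\<Sum>k<dim_row t. t $$ (i,k) * S (t $$ (k,j))) = (\<Sum>k<dim_row t. if k = i then \<epsilon> (S (t $$ (k,j))) else 0)"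
    using ij corepD(4)[OF t] by (simp add: counit_simps counit_mult if_distrib[of "\<lambda>x. x * _"] cong: if_cong)
  then show ?thesis using antip_inverse_index(1)[OF t ij] ij by (simp add: counit_one counit_simps split: if_splits)
qed

lemma corep_star: "corep t \<Longrightarrow> corep (star t)"
  by (rule corepI[of _ "dim_row t"]) (auto simp: corepD(1) comult_antipode counit_antipode intro!: carrier_matI)

lemma comult_mult_pure_sums:
  assumes "\<Delta> g = (\<Sum>i\<in>I. x i \<otimes>\<^sub>t y i)" "\<Delta> h = (\<Sum>j\<in>J. z j \<otimes>\<^sub>t w j)"
  shows "\<Delta> (g * h) = (\<Sum>i\<in>I. \<Sum>j\<in>J. (x i * z j) \<otimes>\<^sub>t (y i * w j))"
  unfolding comult_mult_sum[OF assms(1)] assms(2) by (simp add: tmul_sum)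

lemma corep_kron:
  assumes t: "corep t" and s: "corep s"
  shows "corep (t \<boxtimes> s)"
proof -
  define n where "n = dim_row t"
  define m where "m = dim_row s"
  have tc: "t \<in> carrier_mat n n" using corepD(2)[OF t] by (simp only: n_def)
  have sc: "s \<in> carrier_mat m m" using corepD(2)[OF s] by (simp only: m_def)
  show ?thesis
  proof (rule corepI[of _ "n * m"])
  show "t \<boxtimes> s \<in> carrier_mat (n * m) (n * m)" by (rule kron_carrier[OF tc sc])
  fix i j assume i: "i < n * m" and j: "j < n * m"
  note i' = div_mod_lt[OF i] and j' = div_mod_lt[OF j]
  have "\<Delta> ((t \<boxtimes> s) $$ (i,j)) = \<Delta> (t $$ (i div m, j div m) * s $$ (i mod m, j mod m))"
    using kron_index[OF tc sc i j] by simp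
  also have "\<dots> = (\<Sum>a<n. \<Sum>b<m. (t $$ (i div m, a) * s $$ (i mod m, b)) \<otimes>\<^sub>t (t $$ (a, j div m) * s $$ (b, j mod m)))"
    using corepD(3)[OF t, of "i div m" "j div m"] corepD(3)[OF s, of "i mod m" "j mod m"] i' j'
    unfolding n_def[symmetric] m_def[symmetric] by (intro comult_mult_pure_sums)
  also have "\<dots> = (\<Sum>k<n*m. (t $$ (i div m, k div m) * s $$ (i mod m, k mod m)) \<otimes>\<^sub>t (t $$ (k div m, j div m) * s $$ (k mod m, j mod m)))"
    by (rule sum_div_mod[symmetric])
  also have "\<dots> = (\<Sum>k<n*m. (t \<boxtimes> s) $$ (i,k) \<otimes>\<^sub>t (t \<boxtimes> s) $$ (k,j))"
    by (intro sum.cong refl) (simp add: kron_index[OF tc sc i] kron_index[OF tc sc _ j])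
  finally show "\<Delta> ((t \<boxtimes> s) $$ (i,j)) = (\<Sum>k<n*m. (t \<boxtimes> s) $$ (i,k) \<otimes>\<^sub>t (t \<boxtimes> s) $$ (k,j))" .
  have "i = j \<longleftrightarrow> i div m = j div m \<and> i mod m = j mod m" by (metis div_mult_mod_eq)
  then show "\<epsilon> ((t \<boxtimes> s) $$ (i,j)) = (if i = j then 1 else 0)"
    using kron_index[OF tc sc i j] i' j' corepD(4)[OF t] corepD(4)[OF s]
    by (auto simp: n_def m_def counit_mult)
  qed
qed

lemma corep_one: "corep (1\<^sub>m 1)"
  by (rule corepI[of _ 1]) (auto simp: comult_one counit_one)

end

section \<open>Homomorphisms and Schur's lemma\<close>

lemma dims_add_of_split:
  fixes B :: "'a::field mat"
  assumes B: "B \<in> carrier_mat n d" and L: "L \<in> carrier_mat d n" and B': "B' \<in> carrier_mat n d'" and L': "L' \<in> carrier_mat d' n"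
    and "L * B = 1\<^sub>m d" "L' * B' = 1\<^sub>m d'" "L * B' = 0\<^sub>m d d'" "L' * B = 0\<^sub>m d' d" "B * L + B' * L' = 1\<^sub>m n"
  shows "n = d + d'"
proof -
  define P where "P = four_block_mat B B' (0\<^sub>m 0 d) (0\<^sub>m 0 d')"
  define Q where "Q = four_block_mat L (0\<^sub>m d 0) L' (0\<^sub>m d' 0)"
  have P: "P \<in> carrier_mat n (d + d')" and Q: "Q \<in> carrier_mat (d + d') n"
    using B B' L L' by (auto simp: P_def Q_def)
  have "P * Q = four_block_mat (B * L + B' * L') (B * 0\<^sub>m d 0 + B' * 0\<^sub>m d' 0)
      (0\<^sub>m 0 d * L + 0\<^sub>m 0 d' * L') (0\<^sub>m 0 d * 0\<^sub>m d 0 + 0\<^sub>m 0 d' * 0\<^sub>m d' 0)"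
    unfolding P_def Q_def by (rule mult_four_block_mat[OF B B' _ _ L _ L']) auto
  also have "\<dots> = 1\<^sub>m n" using assms(9) B L B' L' by (intro eq_matI) auto
  finally have PQ: "P * Q = 1\<^sub>m n" .
  have "Q * P = four_block_mat (L * B + 0\<^sub>m d 0 * 0\<^sub>m 0 d) (L * B' + 0\<^sub>m d 0 * 0\<^sub>m 0 d')
      (L' * B + 0\<^sub>m d' 0 * 0\<^sub>m 0 d) (L' * B' + 0\<^sub>m d' 0 * 0\<^sub>m 0 d')"
    unfolding P_def Q_def by (rule mult_four_block_mat[OF L _ L' _ B B']) auto
  also have "\<dots> = 1\<^sub>m (d + d')"
  proof -
    have *: "0\<^sub>m a 0 * 0\<^sub>m 0 b = (0\<^sub>m a b :: 'a mat)" for a b by (intro left_mult_zero_mat) auto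
    show ?thesis using assms by (intro eq_matI) (auto simp: *)
  qed
  finally have QP: "Q * P = 1\<^sub>m (d + d')" .
  show ?thesis by (rule two_sided_inverse_imp_square[OF P Q PQ QP])
qed

lemma mat_add_eq_iff_minus:
  fixes A :: "'a::ab_group_add mat"
  assumes "A \<in> carrier_mat m n" "B \<in> carrier_mat m n"
  shows "A - B = 0\<^sub>m m n \<longleftrightarrow> A = B"
proof
  assume *: "A - B = 0\<^sub>m m n"
  show "A = B"
  proof (rule eq_matI)
    fix i j assume "i < dim_row B" "j < dim_col B"
    then show "A $$ (i,j) = B $$ (i,j)" using arg_cong[OF *, of "\<lambda>M. M $$ (i,j)"] assms by simp
  qed (use assms in auto)
qed (use assms in simp)

context cosemisimple_hopf_algebra
begin

text \<open>Homomorphisms of comodules, as matrices with respect to the chosen bases.\<close>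

definition homs :: "'h mat \<Rightarrow> 'h mat \<Rightarrow> 'k mat set" where
  "homs t s = {T. dim_row T = dim_row s \<and> dim_col T = dim_row t \<and> emb T * t = s * emb T}"

lemma homsD:
  assumes "T \<in> homs t s"
  shows "dim_row T = dim_row s" "dim_col T = dim_row t" "emb T * t = s * emb T" "T \<in> carrier_mat (dim_row s) (dim_row t)"
  using assms by (auto simp: homs_def)

lemma homsI: "T \<in> carrier_mat (dim_row s) (dim_row t) \<Longrightarrow> emb T * t = s * emb T \<Longrightarrow> T \<in> homs t s"
  by (auto simp: homs_def)

lemma homs_comp:
  assumes t: "corep t" and r: "corep r" and s: "corep s" and T: "T \<in> homs r s" and U: "U \<in> homs t r"
  shows "T * U \<in> homs t s"
proof (rule homsI)
  note d = corepD(1)[OF t] corepD(1)[OF s] corepD(1)[OF r] homsD(1,2)[OF T] homsD(1,2)[OF U]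
  show "T * U \<in> carrier_mat (dim_row s) (dim_row t)" using d by auto
  have "emb (T * U) * t = emb T * (emb U * t)" using d by (simp add: emb_mult mat_assoc)
  also have "\<dots> = (emb T * r) * emb U" using d by (simp add: homsD(3)[OF U] mat_assoc)
  also have "\<dots> = s * emb (T * U)" using d by (simp add: homsD(3)[OF T] emb_mult mat_assoc)
  finally show "emb (T * U) * t = s * emb (T * U)" .
qed

lemma homs_one: "corep t \<Longrightarrow> 1\<^sub>m (dim_row t) \<in> homs t t"
  by (rule homsI) (auto simp: corepD(1))

lemma homs_zero: "corep t \<Longrightarrow> corep s \<Longrightarrow> 0\<^sub>m (dim_row s) (dim_row t) \<in> homs t s"
proof (rule homsI)
  assume "corep t" "corep s"
  then have "t \<in> carrier_mat (dim_row t) (dim_row t)" "s \<in> carrier_mat (dim_row s) (dim_row s)"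
    by (simp_all add: corepD)
  then show "emb (0\<^sub>m (dim_row s) (dim_row t)) * t = s * emb (0\<^sub>m (dim_row s) (dim_row t))"
    unfolding emb_zero by (metis left_mult_zero_mat right_mult_zero_mat)
qed auto

lemma homs_add:
  assumes t: "corep t" and s: "corep s" and T: "T \<in> homs t s" and U: "U \<in> homs t s"
  shows "T + U \<in> homs t s" "T - U \<in> homs t s"
proof -
  note d = corepD(1)[OF t] corepD(1)[OF s] homsD(1,2)[OF T] homsD(1,2)[OF U]
  have T': "emb T \<in> carrier_mat (dim_row s) (dim_row t)" and U': "emb U \<in> carrier_mat (dim_row s) (dim_row t)"
    using d by auto
  show "T + U \<in> homs t s"
    using homsD(3)[OF T] homsD(3)[OF U] d
    by (intro homsI) (auto simp: emb_add add_mult_distrib_mat[OF T' U' corepD(2)[OF t]]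
        mult_add_distrib_mat[OF corepD(2)[OF s] T' U'])
  show "T - U \<in> homs t s"
    using homsD(3)[OF T] homsD(3)[OF U] d
    by (intro homsI) (auto simp: emb_minus minus_mult_distrib_mat[OF T' U' corepD(2)[OF t]]
        mult_minus_distrib_mat[OF corepD(2)[OF s] T' U'])
qed

lemma homs_smult:
  assumes t: "corep t" and s: "corep s" and T: "T \<in> homs t s"
  shows "c \<cdot>\<^sub>m T \<in> homs t s"
proof (rule homsI)
  note d = corepD(1)[OF t] corepD(1)[OF s] homsD(1,2)[OF T]
  have "emb (c \<cdot>\<^sub>m T) * t = map_mat (scale c) (emb T * t)"
    by (rule eq_matI) (use d in \<open>simp_all add: emb_mult_index scale_sum_right scale_scale del: index_mult_mat(1)\<close>)
  moreover have "s * emb (c \<cdot>\<^sub>m T) = map_mat (scale c) (s * emb T)"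
    by (rule eq_matI) (use d in \<open>simp_all add: mult_emb_index scale_sum_right scale_scale del: index_mult_mat(1)\<close>)
  ultimately show "emb (c \<cdot>\<^sub>m T) * t = s * emb (c \<cdot>\<^sub>m T)" using homsD(3)[OF T] by simp
qed (use homsD(1,2)[OF T] in auto)

lemma homs_kron:
  assumes t: "corep t" "corep t'" and s: "corep s" "corep s'" and T: "T \<in> homs t s" and U: "U \<in> homs t' s'"
  shows "T \<boxtimes> U \<in> homs (t \<boxtimes> t') (s \<boxtimes> s')"
proof (rule homsI)
  note d = corepD(1)[OF t(1)] corepD(1)[OF s(1)] corepD(1)[OF t(2)] corepD(1)[OF s(2)] homsD(1,2)[OF T] homsD(1,2)[OF U]
  have T': "emb T \<in> carrier_mat (dim_row s) (dim_row t)" and U': "emb U \<in> carrier_mat (dim_row s') (dim_row t')"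
    using d by auto
  have "emb (T \<boxtimes> U) * (t \<boxtimes> t') = (emb T * t) \<boxtimes> (emb U * t')"
    unfolding emb_kron by (rule kron_mult[OF T' corepD(2)[OF t(1)] U' corepD(2)[OF t(2)]]) (use U' in auto)
  also have "\<dots> = (s * emb T) \<boxtimes> (s' * emb U)" by (simp add: homsD(3)[OF T] homsD(3)[OF U])
  also have "\<dots> = (s \<boxtimes> s') * emb (T \<boxtimes> U)"
    unfolding emb_kron by (rule kron_mult[symmetric, OF corepD(2)[OF s(1)] T' corepD(2)[OF s(2)] U']) (use T' in auto)
  finally show "emb (T \<boxtimes> U) * (t \<boxtimes> t') = (s \<boxtimes> s') * emb (T \<boxtimes> U)" .
qed (use homsD(1,2)[OF T] homsD(1,2)[OF U] in auto)

lemma homs_antip: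
  assumes t: "corep t" and s: "corep s" and T: "T \<in> homs t s"
  shows "antip s * emb T = emb T * antip t"
proof -
  note d = corepD(1)[OF t] corepD(1)[OF s] homsD(1,2)[OF T]
  have "antip s * emb T = antip s * (emb T * (t * antip t))"
    using d by (simp add: antip_inverse(1)[OF t])
  also have "\<dots> = antip s * (emb T * t) * antip t" using d by (simp add: mat_assoc)
  also have "\<dots> = (antip s * s) * (emb T * antip t)"
    unfolding homsD(3)[OF T] using d by (simp add: mat_assoc)
  also have "\<dots> = emb T * antip t" using d by (simp add: antip_inverse(2)[OF s])
  finally show ?thesis .
qed

lemma comult_mult_antipode:
  assumes t: "corep t" and s: "corep s" and "i < dim_row s" "a < dim_row s" "b < dim_row t" "j < dim_row t"
  shows "\<Delta> (s $$ (i,a) * S (t $$ (b,j))) =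
    (\<Sum>k<dim_row s. \<Sum>l<dim_row t. (s $$ (i,k) * S (t $$ (l,j))) \<otimes>\<^sub>t (s $$ (k,a) * S (t $$ (b,l))))"
  by (rule comult_mult_pure_sums) (use assms corepD(3)[OF s] comult_antipode[OF t] in auto)

text \<open>
  Invariance of the Haar functional, applied to a product of a coefficient of \<open>s\<close> and a coefficient of the dual of \<open>t\<close>.
\<close>

lemma haar_coefficients:
  assumes t: "corep t" and s: "corep s" and ia: "i < dim_row s" "a < dim_row s" "b < dim_row t" "j < dim_row t"
  shows "(\<Sum>k<dim_row s. \<Sum>l<dim_row t. scale (haar (s $$ (k,a) * S (t $$ (b,l)))) (s $$ (i,k) * S (t $$ (l,j))))
      = scale (haar (s $$ (i,a) * S (t $$ (b,j)))) 1"
    "(\<Sum>k<dim_row s. \<Sum>l<dim_row t. scale (haar (s $$ (i,k) * S (t $$ (l,j)))) (s $$ (k,a) * S (t $$ (b,l))))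
      = scale (haar (s $$ (i,a) * S (t $$ (b,j)))) 1"
proof -
  let ?h = "s $$ (i,a) * S (t $$ (b,j))"
  note lin = bilinear_slice(1)[OF haar(1)] bilinear_slice(2)[OF haar(1)]
  have "slice_right haar (\<Delta> ?h) = (\<Sum>k<dim_row s. \<Sum>l<dim_row t. scale (haar (s $$ (k,a) * S (t $$ (b,l)))) (s $$ (i,k) * S (t $$ (l,j))))"
    unfolding slice_right_def comult_mult_antipode[OF t s ia]
    by (simp add: tlift_sum[OF lin(1)] tlift_tensor[OF lin(1)] sum_in_tensor_space)
  then show "(\<Sum>k<dim_row s. \<Sum>l<dim_row t. scale (haar (s $$ (k,a) * S (t $$ (b,l)))) (s $$ (i,k) * S (t $$ (l,j))))
      = scale (haar ?h) 1" by (simp add: haar_invariant)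
  have "slice_left haar (\<Delta> ?h) = (\<Sum>k<dim_row s. \<Sum>l<dim_row t. scale (haar (s $$ (i,k) * S (t $$ (l,j)))) (s $$ (k,a) * S (t $$ (b,l))))"
    unfolding slice_left_def comult_mult_antipode[OF t s ia]
    by (simp add: tlift_sum[OF lin(2)] tlift_tensor[OF lin(2)] sum_in_tensor_space)
  then show "(\<Sum>k<dim_row s. \<Sum>l<dim_row t. scale (haar (s $$ (i,k) * S (t $$ (l,j)))) (s $$ (k,a) * S (t $$ (b,l))))
      = scale (haar ?h) 1" by (simp add: haar_invariant)
qed

text \<open>The analogue of averaging a linear map over a group.\<close>

definition average :: "'h mat \<Rightarrow> 'h mat \<Rightarrow> 'k mat \<Rightarrow> 'k mat" where
  "average t s X = map_mat haar (s * emb X * antip t)"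

lemma sandwich_index:
  assumes t: "corep t" and s: "corep s" and X: "X \<in> carrier_mat (dim_row s) (dim_row t)" and ij: "i < dim_row s" "j < dim_row t"
  shows "(s * emb X * antip t) $$ (i,j) = (\<Sum>b<dim_row t. \<Sum>a<dim_row s. scale (X $$ (a,b)) (s $$ (i,a) * S (t $$ (b,j))))"
proof -
  note d = corepD(1)[OF t] corepD(1)[OF s]
  have "(s * emb X * antip t) $$ (i,j) = (\<Sum>b<dim_row t. (s * emb X) $$ (i,b) * antip t $$ (b,j))"
    by (rule mult_index[of _ "dim_row s" _ _ "dim_row t"]) (use ij d X in auto)
  also have "\<dots> = (\<Sum>b<dim_row t. \<Sum>a<dim_row s. scale (X $$ (a,b)) (s $$ (i,a) * S (t $$ (b,j))))"
    using d X ij by (intro sum.cong refl) (simp add: mult_emb_index sum_distrib_right scale_mult_left del: index_mult_mat(1))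
  finally show ?thesis .
qed

lemma average_index:
  assumes t: "corep t" and s: "corep s" and X: "X \<in> carrier_mat (dim_row s) (dim_row t)" and ij: "i < dim_row s" "j < dim_row t"
  shows "average t s X $$ (i,j) = (\<Sum>b<dim_row t. \<Sum>a<dim_row s. X $$ (a,b) * haar (s $$ (i,a) * S (t $$ (b,j))))"
  using sandwich_index[OF assms] corepD(1)[OF t] corepD(1)[OF s] ij
  by (simp add: average_def haar_simps del: index_mult_mat(1))

lemma average_carrier: "dim_row (average t s X) = dim_row s" "dim_col (average t s X) = dim_col t"
  by (auto simp: average_def)

lemma average_hom:
  assumes t: "corep t" and s: "corep s" and X: "X \<in> carrier_mat (dim_row s) (dim_row t)"
  shows "average t s X \<in> homs t s"
proof (rule homsI)
  define A where "A = average t s X"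
  note d = corepD(1)[OF t] corepD(1)[OF s]
  show A: "average t s X \<in> carrier_mat (dim_row s) (dim_row t)" using average_carrier[of t s X] d by auto
  note A' = A[folded A_def]
  have "s * emb A * antip t = emb A"
  proof (rule eq_matI)
    fix i j assume "i < dim_row (emb A)" "j < dim_col (emb A)"
    then have ij: "i < dim_row s" "j < dim_row t" using A' by auto
    let ?h = "\<lambda>k a b l. haar (s $$ (k,a) * S (t $$ (b,l)))"
    have "(s * emb A * antip t) $$ (i,j) = (\<Sum>l<dim_row t. \<Sum>k<dim_row s. \<Sum>b<dim_row t. \<Sum>a<dim_row s.
        scale (X $$ (a,b)) (scale (?h k a b l) (s $$ (i,k) * S (t $$ (l,j)))))"
      unfolding sandwich_index[OF t s A' ij]
      by (intro sum.cong refl) (simp add: A_def average_index[OF t s X] scale_sum_left scale_scale)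
    also have "\<dots> = (\<Sum>b<dim_row t. \<Sum>a<dim_row s. \<Sum>l<dim_row t. \<Sum>k<dim_row s.
        scale (X $$ (a,b)) (scale (?h k a b l) (s $$ (i,k) * S (t $$ (l,j)))))"
    proof -
      have "(\<Sum>l\<in>I. \<Sum>k\<in>J. \<Sum>b\<in>I. \<Sum>a\<in>J. F l k b a) = (\<Sum>b\<in>I. \<Sum>a\<in>J. \<Sum>l\<in>I. \<Sum>k\<in>J. F l k b a)"
        for F :: "nat \<Rightarrow> nat \<Rightarrow> nat \<Rightarrow> nat \<Rightarrow> 'h" and I J
      proof -
        have "(\<Sum>l\<in>I. \<Sum>k\<in>J. \<Sum>b\<in>I. \<Sum>a\<in>J. F l k b a) = (\<Sum>l\<in>I. \<Sum>b\<in>I. \<Sum>a\<in>J. \<Sum>k\<in>J. F l k b a)"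
          by (intro sum.cong refl sum_rotate)
        also have "\<dots> = (\<Sum>b\<in>I. \<Sum>a\<in>J. \<Sum>l\<in>I. \<Sum>k\<in>J. F l k b a)"
          by (rule sum_rotate)
        finally show ?thesis .
      qed
      then show ?thesis .
    qed
    also have "\<dots> = (\<Sum>b<dim_row t. \<Sum>a<dim_row s. scale (X $$ (a,b)) (\<Sum>k<dim_row s. \<Sum>l<dim_row t.
        scale (?h k a b l) (s $$ (i,k) * S (t $$ (l,j)))))"
      by (intro sum.cong refl, subst sum.swap) (simp add: scale_sum_right)
    also have "\<dots> = (\<Sum>b<dim_row t. \<Sum>a<dim_row s. scale (X $$ (a,b)) (scale (?h i a b j) 1))"
      using ij by (intro sum.cong refl) (simp add: haar_coefficients(1)[OF t s])
    also have "\<dots> = emb A $$ (i,j)"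
      using A' ij by (simp add: A_def average_index[OF t s X ij] scale_sum_left scale_scale)
    finally show "(s * emb A * antip t) $$ (i,j) = emb A $$ (i,j)" .
  qed (use A' d in auto)
  then have "emb A * t = s * emb A * antip t * t" by simp
  also have "\<dots> = s * emb A * (antip t * t)" using A' d by (simp add: mat_assoc)
  finally have "emb A * t = s * emb A * (antip t * t)" .
  then show "emb (average t s X) * t = s * emb (average t s X)"
    using A' d by (simp add: antip_inverse(2)[OF t] A_def)
qed

lemma map_mat_haar_emb: "map_mat haar (emb M) = M"
  by (rule eq_matI) (auto simp: haar_simps haar(2))

text \<open>
  Averaging a generalized inverse: every morphism of comodules factors as a split epimorphism
  followed by a split monomorphism. This is the form in which complete reducibility is used.
\<close>

lemma homs_regular:
  assumes t: "corep t" and s: "corep s" and M: "M \<in> homs t s"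
  obtains N where "N \<in> homs s t" "M * N * M = M"
proof -
  note d = corepD(1)[OF t] corepD(1)[OF s] homsD(1,2)[OF M]
  obtain e B L X where B: "B \<in> carrier_mat (dim_row t) e" and L: "L \<in> carrier_mat e (dim_row t)"
    and X: "X \<in> carrier_mat (dim_row t) (dim_row s)"
    and MB: "M * B = 0\<^sub>m (dim_row s) e" and BL: "B * L + X * M = 1\<^sub>m (dim_row t)"
    using kernel_split[OF homsD(4)[OF M]] by blast
  have "M * (B * L + X * M) = M * (B * L) + M * (X * M)"
    by (rule mult_add_distrib_mat[OF homsD(4)[OF M]]) (use B L X homsD(4)[OF M] in auto)
  also have "M * (B * L) = 0\<^sub>m (dim_row s) (dim_row t)"
    using d B L by (simp add: mat_assoc[symmetric] MB)
  finally have MXM: "M * X * M = M"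
    using d X BL homsD(4)[OF M] by (simp add: mat_assoc)
  define N where "N = average s t X"
  have N: "N \<in> homs s t" unfolding N_def by (rule average_hom[OF s t X])
  have lf: "linear_functional haar" by (rule haar)
  have "M * N * M = map_mat haar (emb M * (t * emb X * antip s) * emb M)"
    using d X by (simp add: N_def average_def map_mat_emb_mult[OF lf] map_mat_mult_emb[OF lf])
  also have "emb M * (t * emb X * antip s) * emb M = (emb M * t) * emb X * (antip s * emb M)"
    using d X by (simp add: mat_assoc)
  also have "\<dots> = s * emb (M * X * M) * antip t"
    using d X by (simp add: homsD(3)[OF M] homs_antip[OF t s M] emb_mult mat_assoc)
  also have "\<dots> = emb M * (t * antip t)"
    unfolding MXM homsD(3)[OF M, symmetric] using d by (simp add: mat_assoc)
  also have "map_mat haar \<dots> = M"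
    using d by (simp add: antip_inverse(1)[OF t] map_mat_haar_emb)
  finally show ?thesis using that[OF N] by blast
qed

text \<open>
  The matrix \<open>L t B\<close> describes the action on the image of the idempotent endomorphism \<open>B L\<close> in the basis \<open>B\<close>.
\<close>

lemma subcorep:
  assumes t: "corep t" and B: "B \<in> carrier_mat (dim_row t) d" and L: "L \<in> carrier_mat d (dim_row t)"
    and LB: "L * B = 1\<^sub>m d" and BL: "B * L \<in> homs t t"
  obtains r where "corep r" "dim_row r = d" "B \<in> homs r t" "L \<in> homs t r"
proof
  define r where "r = emb L * t * emb B"
  note d = corepD(1)[OF t]
  have LBe: "emb L * emb B = 1\<^sub>m d" using B L LB by (metis carrier_matD emb_mult emb_one)
  have BLt: "emb B * emb L * t = t * (emb B * emb L)" using homsD(3)[OF BL] B L by (simp add: emb_mult)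
  show rd: "dim_row r = d" using L by (simp add: r_def)
  have c1: "emb B * r = t * emb B"
  proof -
    have "emb B * r = (emb B * emb L * t) * emb B" unfolding r_def using B L d by (simp add: mat_assoc)
    also have "\<dots> = t * (emb B * (emb L * emb B))" unfolding BLt using B L d by (simp add: mat_assoc)
    finally show ?thesis using B LBe by simp
  qed
  have c2: "emb L * t = r * emb L"
  proof -
    have "r * emb L = emb L * (t * (emb B * emb L))" unfolding r_def using B L d by (simp add: mat_assoc)
    also have "\<dots> = (emb L * emb B) * (emb L * t)" unfolding BLt[symmetric] using B L d by (simp add: mat_assoc)
    finally show ?thesis using L LBe d by simp
  qed
  show "B \<in> homs r t" by (rule homsI) (use B rd c1 in auto)
  show "L \<in> homs t r" by (rule homsI) (use L rd c2 in auto)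
  have "comult_mat t t t" using t by (simp add: corep_def)
  then have "comult_mat (emb L * t) (emb L * t) t" using L by (intro comult_mat_left) auto
  then have "comult_mat r (emb L * t) (t * emb B)" unfolding r_def using B d by (intro comult_mat_right) auto
  then have "comult_mat r r r"
    unfolding c1[symmetric] by (subst (2) r_def, intro comult_mat_middle) (use B rd in auto)
  moreover have "map_mat \<epsilon> r = 1\<^sub>m d"
  proof -
    have "map_mat \<epsilon> t = 1\<^sub>m (dim_row t)" using t by (simp add: corep_def)
    then show ?thesis unfolding r_def
      using B L d LB by (simp add: map_mat_mult_emb[OF counit_linear] map_mat_emb_mult[OF counit_linear])
  qed
  moreover have "dim_col r = d" using B by (simp add: r_def)
  ultimately show "corep r" using rd by (simp add: corep_def)
qed

text \<open>
  Irreducibility by scalar endomorphisms. Because of complete reducibility and algebraic closedness this excludes proper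
  subcomodules; see \<open>reducible_splits\<close>.
\<close>

definition irr :: "'h mat \<Rightarrow> bool" where
  "irr t \<longleftrightarrow> corep t \<and> 0 < dim_row t \<and> (\<forall>T\<in>homs t t. \<exists>c. T = c \<cdot>\<^sub>m 1\<^sub>m (dim_row t))"

definition isom :: "'h mat \<Rightarrow> 'h mat \<Rightarrow> bool" where
  "isom t s \<longleftrightarrow> (\<exists>T\<in>homs t s. \<exists>U\<in>homs s t. T * U = 1\<^sub>m (dim_row s) \<and> U * T = 1\<^sub>m (dim_row t))"

lemma irr_corep: "irr t \<Longrightarrow> corep t" and irr_pos: "irr t \<Longrightarrow> 0 < dim_row t"
  by (auto simp: irr_def)

lemma isom_refl: "corep t \<Longrightarrow> isom t t"
  unfolding isom_def by (intro bexI[of _ "1\<^sub>m (dim_row t)"] homs_one conjI) auto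

lemma isom_sym: "isom t s \<Longrightarrow> isom s t"
  unfolding isom_def by blast

lemma isom_dim: "isom t s \<Longrightarrow> dim_row t = dim_row s"
  unfolding isom_def by (metis homsD(4) two_sided_inverse_imp_square)

lemma isom_trans:
  assumes c: "corep t" "corep r" "corep s" and "isom t r" "isom r s"
  shows "isom t s"
proof -
  obtain T U where TU: "T \<in> homs t r" "U \<in> homs r t" "T * U = 1\<^sub>m (dim_row r)" "U * T = 1\<^sub>m (dim_row t)"
    using assms(4) by (auto simp: isom_def)
  obtain T' U' where TU': "T' \<in> homs r s" "U' \<in> homs s r" "T' * U' = 1\<^sub>m (dim_row s)" "U' * T' = 1\<^sub>m (dim_row r)"
    using assms(5) by (auto simp: isom_def)
  note d = homsD(1,2)[OF TU(1)] homsD(1,2)[OF TU(2)] homsD(1,2)[OF TU'(1)] homsD(1,2)[OF TU'(2)]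
  have "T' * T * (U * U') = T' * ((T * U) * U')" using d by (simp add: mat_assoc)
  then have 1: "T' * T * (U * U') = 1\<^sub>m (dim_row s)" using TU TU' d by simp
  have "U * U' * (T' * T) = U * ((U' * T') * T)" using d by (simp add: mat_assoc)
  then have 2: "U * U' * (T' * T) = 1\<^sub>m (dim_row t)" using TU TU' d by simp
  show ?thesis unfolding isom_def
    by (intro bexI[of _ "T' * T"] bexI[of _ "U * U'"] conjI 1 2 homs_comp[OF c(1) c(2) c(3)] homs_comp[OF c(3) c(2) c(1)] TU TU')
qed

lemma smult_one_mult: "X \<in> carrier_mat m n \<Longrightarrow> (c \<cdot>\<^sub>m 1\<^sub>m m) * X = c \<cdot>\<^sub>m X" for X :: "'k mat"
  by (metis left_mult_one_mat mult_smult_assoc_mat one_carrier_mat)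

lemma mult_smult_one: "X \<in> carrier_mat m n \<Longrightarrow> X * (c \<cdot>\<^sub>m 1\<^sub>m n) = c \<cdot>\<^sub>m X" for X :: "'k mat"
  by (metis mult_smult_distrib one_carrier_mat right_mult_one_mat)

lemma smult_eq_self:
  assumes "c \<cdot>\<^sub>m X = X" "X \<in> carrier_mat m n" "X \<noteq> 0\<^sub>m m n"
  shows "c = (1::'k)"
proof -
  obtain i j where ij: "i < m" "j < n" "X $$ (i,j) \<noteq> 0"
    using assms(2,3) by (metis carrier_matD eq_matI index_zero_mat)
  then have "c * X $$ (i,j) = X $$ (i,j)" using assms(1,2) by (metis carrier_matD index_smult_mat(1))
  then show ?thesis using ij by simp
qed

text \<open>
  For \<open>N\<close> with \<open>M N M = M\<close>, both \<open>M N\<close> and \<open>N M\<close> are scalar, and the scalars are \<open>1\<close> since \<open>M\<close> is nonzero.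
\<close>

lemma schur_isom:
  assumes t: "irr t" and s: "irr s" and M: "M \<in> homs t s" and M0: "M \<noteq> 0\<^sub>m (dim_row s) (dim_row t)"
  obtains N where "N \<in> homs s t" "M * N = 1\<^sub>m (dim_row s)" "N * M = 1\<^sub>m (dim_row t)"
proof -
  note c = irr_corep[OF t] irr_corep[OF s]
  obtain N where N: "N \<in> homs s t" "M * N * M = M" using homs_regular[OF c M] .
  note d = homsD(1,2)[OF M] homsD(1,2)[OF N(1)]
  obtain a where a: "M * N = a \<cdot>\<^sub>m 1\<^sub>m (dim_row s)"
    using s homs_comp[OF c(2,1,2) M N(1)] by (auto simp: irr_def)
  obtain b where b: "N * M = b \<cdot>\<^sub>m 1\<^sub>m (dim_row t)"
    using t homs_comp[OF c(1,2,1) N(1) M] by (auto simp: irr_def)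
  have "a \<cdot>\<^sub>m M = M" using N(2) a smult_one_mult[OF homsD(4)[OF M]] by simp
  then have "a = 1" using smult_eq_self homsD(4)[OF M] M0 by blast
  moreover have "M * (N * M) = M" using N(2) d by (simp add: mat_assoc)
  then have "b \<cdot>\<^sub>m M = M" using b mult_smult_one[OF homsD(4)[OF M]] by simp
  then have "b = 1" using smult_eq_self homsD(4)[OF M] M0 by blast
  moreover have "1 \<cdot>\<^sub>m 1\<^sub>m n = (1\<^sub>m n :: 'k mat)" for n by (rule eq_matI) auto
  ultimately show ?thesis using that N(1) a b by simp
qed

lemma schur_scalar:
  assumes t: "irr t" and s: "irr s" and M: "M \<in> homs t s" and M0: "M \<noteq> 0\<^sub>m (dim_row s) (dim_row t)" and U: "U \<in> homs t s"
  obtains c where "U = c \<cdot>\<^sub>m M"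
proof -
  note c = irr_corep[OF t] irr_corep[OF s]
  obtain N where N: "N \<in> homs s t" "M * N = 1\<^sub>m (dim_row s)" "N * M = 1\<^sub>m (dim_row t)"
    using schur_isom[OF t s M M0] .
  note d = homsD(1,2)[OF M] homsD(1,2)[OF N(1)] homsD(1,2)[OF U]
  obtain b where b: "N * U = b \<cdot>\<^sub>m 1\<^sub>m (dim_row t)"
    using t homs_comp[OF c(1,2,1) N(1) U] by (auto simp: irr_def)
  have "U = M * N * U" using N d by simp
  also have "\<dots> = M * (N * U)" using d by (simp add: mat_assoc)
  also have "\<dots> = b \<cdot>\<^sub>m M" unfolding b by (rule mult_smult_one[OF homsD(4)[OF M]])
  finally show ?thesis using that by blast
qed

text \<open>
  A direct sum decomposition with its inclusions \<open>B\<close>, \<open>B'\<close> and projections \<open>L\<close>, \<open>L'\<close>.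
\<close>

definition splits :: "'h mat \<Rightarrow> 'h mat \<Rightarrow> 'h mat \<Rightarrow> bool" where
  "splits t r s \<longleftrightarrow> corep t \<and> corep r \<and> corep s \<and>
     (\<exists>B L B' L'. B \<in> homs r t \<and> L \<in> homs t r \<and> B' \<in> homs s t \<and> L' \<in> homs t s \<and>
        L * B = 1\<^sub>m (dim_row r) \<and> L' * B' = 1\<^sub>m (dim_row s) \<and>
        L * B' = 0\<^sub>m (dim_row r) (dim_row s) \<and> L' * B = 0\<^sub>m (dim_row s) (dim_row r) \<and>
        B * L + B' * L' = 1\<^sub>m (dim_row t))"

lemma splits_dim: "splits t r s \<Longrightarrow> dim_row t = dim_row r + dim_row s"
  unfolding splits_def by (elim conjE exE, rule dims_add_of_split) (rule homsD(4) | assumption)+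

text \<open>
  A nonscalar endomorphism \<open>T\<close> has an eigenvalue \<open>c\<close>, and a generalized inverse of the singular endomorphism \<open>T - c\<close> yields an
  idempotent endomorphism that is neither \<open>0\<close> nor \<open>1\<close>.
\<close>

lemma reducible_splits:
  assumes t: "corep t" and n: "0 < dim_row t" and "\<not> irr t"
  obtains r s where "splits t r s" "0 < dim_row r" "0 < dim_row s"
proof -
  define n where "n = dim_row t"
  obtain T where T: "T \<in> homs t t" "\<And>c. T \<noteq> c \<cdot>\<^sub>m 1\<^sub>m n"
    using assms by (auto simp: irr_def n_def)
  have Tc: "T \<in> carrier_mat n n" using homsD(4)[OF T(1)] by (simp add: n_def)
  obtain c v where v: "v \<in> carrier_mat n 1" "v \<noteq> 0\<^sub>m n 1" "T * v = c \<cdot>\<^sub>m v"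
    using eigenvector_exists[OF Tc] n unfolding n_def by blast
  define M where "M = T - c \<cdot>\<^sub>m 1\<^sub>m n"
  have M: "M \<in> homs t t" unfolding M_def n_def using T(1) t
    by (intro homs_add homs_smult homs_one)
  have Mc: "M \<in> carrier_mat n n" using homsD(4)[OF M] by (simp add: n_def)
  have M0: "M \<noteq> 0\<^sub>m n n" unfolding M_def using mat_add_eq_iff_minus[OF Tc] T(2) by auto
  have "M * v = T * v - c \<cdot>\<^sub>m v"
    unfolding M_def using Tc v(1) smult_one_mult[OF v(1), of c] by (subst minus_mult_distrib_mat[of _ n n]) auto
  then have Mv: "M * v = 0\<^sub>m n 1" using v by simp
  obtain N where N: "N \<in> homs t t" "M * N * M = M" using homs_regular[OF t t M] .
  have Nc: "N \<in> carrier_mat n n" using homsD(4)[OF N(1)] by (simp add: n_def)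
  define e where "e = N * M"
  define f where "f = 1\<^sub>m n - e"
  have e: "e \<in> homs t t" unfolding e_def by (rule homs_comp[OF t t t N(1) M])
  have f: "f \<in> homs t t" unfolding f_def n_def by (intro homs_add t homs_one e)
  have ec: "e \<in> carrier_mat n n" and fc: "f \<in> carrier_mat n n"
    using homsD(4)[OF e] homsD(4)[OF f] by (simp_all add: n_def)
  have ee: "e * e = e"
  proof -
    have "e * e = N * (M * N * M)" unfolding e_def using Nc Mc by (simp add: mat_assoc)
    then show ?thesis using N by (simp add: e_def)
  qed
  have ef: "e * f = 0\<^sub>m n n" unfolding f_def using ec ee by (simp add: mult_minus_distrib_mat[OF ec one_carrier_mat ec])
  have fe: "f * e = 0\<^sub>m n n" unfolding f_def using ec ee by (simp add: minus_mult_distrib_mat[OF one_carrier_mat ec ec])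
  have ff: "f * f = f"
  proof -
    have "f * f = f - e * f" using minus_mult_distrib_mat[OF one_carrier_mat ec fc] fc by (simp add: f_def[symmetric])
    then show ?thesis using ef fc by (intro eq_matI) auto
  qed
  have sum1: "e + f = 1\<^sub>m n" unfolding f_def using ec by (intro eq_matI) auto
  obtain p B L where B: "B \<in> carrier_mat n p" and L: "L \<in> carrier_mat p n" and BL: "B * L = e" and LB: "L * B = 1\<^sub>m p"
    using idempotent_split[OF ec ee] .
  obtain q B' L' where B': "B' \<in> carrier_mat n q" and L': "L' \<in> carrier_mat q n" and BL': "B' * L' = f" and LB': "L' * B' = 1\<^sub>m q"
    using idempotent_split[OF fc ff] .
  obtain r where r: "corep r" "dim_row r = p" "B \<in> homs r t" "L \<in> homs t r"
    using subcorep[OF t, of B p L] B L LB BL e by (auto simp: n_def)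
  obtain s where s: "corep s" "dim_row s = q" "B' \<in> homs s t" "L' \<in> homs t s"
    using subcorep[OF t, of B' q L'] B' L' LB' BL' f by (auto simp: n_def)
  have cross: "L1 * B2 = 0\<^sub>m a b"
    if "L1 * B1 = 1\<^sub>m a" "L2 * B2 = 1\<^sub>m b" "B1 * L1 * (B2 * L2) = 0\<^sub>m n n"
      "B1 \<in> carrier_mat n a" "L1 \<in> carrier_mat a n" "B2 \<in> carrier_mat n b" "L2 \<in> carrier_mat b n"
    for B1 L1 B2 L2 :: "'k mat" and a b
  proof -
    have "L1 * B2 \<in> carrier_mat a b" using that by (intro mult_carrier_mat)
    then have "L1 * B2 = (L1 * B1) * (L1 * B2) * (L2 * B2)" unfolding that(1,2) by (metis left_mult_one_mat right_mult_one_mat)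
    also have "\<dots> = L1 * (B1 * L1 * (B2 * L2)) * B2" using that(4-) by (simp add: mat_assoc)
    also have "\<dots> = 0\<^sub>m a b" unfolding that(3) using that(4-) by simp
    finally show ?thesis .
  qed
  have LB0: "L * B' = 0\<^sub>m p q" by (rule cross[OF LB LB' _ B L B' L']) (use ef BL BL' in simp)
  have LB0': "L' * B = 0\<^sub>m q p" by (rule cross[OF LB' LB _ B' L' B L]) (use fe BL BL' in simp)
  have "splits t r s"
    unfolding splits_def
    by (intro conjI t r(1) s(1) exI[of _ B] exI[of _ L] exI[of _ B'] exI[of _ L'] r(3,4) s(3,4))
       (use LB LB' LB0 LB0' BL BL' sum1 r(2) s(2) in \<open>simp_all add: n_def\<close>)
  moreover have "0 < p"
  proof (rule ccontr)
    assume "\<not> 0 < p"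
    then have "e = 0\<^sub>m n n" using B L BL by (intro eq_matI) (auto simp: scalar_prod_def BL[symmetric])
    then have "M * e = 0\<^sub>m n n" using Mc by simp
    then show False using N(2) M0 Mc Nc by (simp add: e_def mat_assoc)
  qed
  moreover have "0 < q"
  proof (rule ccontr)
    assume "\<not> 0 < q"
    then have "f = 0\<^sub>m n n" using B' L' BL' by (intro eq_matI) (auto simp: scalar_prod_def BL'[symmetric])
    then have "e = 1\<^sub>m n" using sum1 ec by simp
    then have "v = N * (M * v)" using v Nc Mc by (simp add: e_def mat_assoc[symmetric])
    then show False using Mv Nc v by simp
  qed
  ultimately show ?thesis using that r s by simp
qed

end

section \<open>Dimensions of spaces of homomorphisms\<close>

lemma (in vector_space) dim_direct_sum:
  assumes V: "subspace V" and W: "subspace W" and int: "V \<inter> W = {0}"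
    and fin: "finite D" "V \<subseteq> span D" "W \<subseteq> span D"
  shows "dim {v + w | v w. v \<in> V \<and> w \<in> W} = dim V + dim W"
proof -
  obtain A where A: "A \<subseteq> V" "independent A" "V \<subseteq> span A" "card A = dim V" using basis_exists by blast
  obtain B where B: "B \<subseteq> W" "independent B" "W \<subseteq> span B" "card B = dim W" using basis_exists by blast
  have finAB: "finite A" "finite B"
    using independent_span_bound[OF fin(1) A(2)] independent_span_bound[OF fin(1) B(2)] A(1) B(1) fin by blast+
  have spA: "span A = V" and spB: "span B = W"
    using A B V W by (metis span_subspace)+
  have ind: "independent (A \<union> F)" if "F \<subseteq> B" for F
    using finite_subset[OF that finAB(2)] that
  proof (induction F rule: finite_induct)
    case empty
    then show ?case using A by simp
  next
    case (insert b F)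
    have "b \<notin> span (A \<union> F)"
    proof
      assume "b \<in> span (A \<union> F)"
      then obtain v w where vw: "b = v + w" "v \<in> V" "w \<in> span F" unfolding span_Un spA by auto
      have wW: "w \<in> W" using vw(3) span_mono[of F B] insert.prems spB by auto
      have "v = b - w" using vw by simp
      then have "v \<in> W" using wW insert.prems B(1) subspace_diff[OF W] by auto
      then have "v = 0" using vw int by auto
      then have "b \<in> span F" using vw by simp
      moreover have "independent (insert b F)" using independent_mono[OF B(2) insert.prems] .
      ultimately show False using insert.hyps(2) by (simp add: independent_insert)
    qed
    then show ?case using insert by (simp add: independent_insert)
  qed
  have disj: "A \<inter> B = {}"
  proof -
    have "A \<inter> B \<subseteq> {0}" using A(1) B(1) int by auto
    moreover have "0 \<notin> A" using A(2) dependent_zero by blast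
    ultimately show ?thesis by auto
  qed
  have "dim {v + w | v w. v \<in> V \<and> w \<in> W} = dim (span (A \<union> B))"
    unfolding span_Un spA spB ..
  also have "\<dots> = card (A \<union> B)" using dim_eq_card_independent[OF ind[OF order_refl]] by simp
  also have "\<dots> = dim V + dim W" using A B finAB disj by (simp add: card_Un_disjoint)
  finally show ?thesis .
qed

lemma sum_fun_apply: "(\<Sum>p\<in>I. f p) q = (\<Sum>p\<in>I. f p q)" for f :: "'p \<Rightarrow> 'q \<Rightarrow> 'a::comm_monoid_add"
  by (induction I rule: infinite_finite_induct) auto

text \<open>
  Matrices of different shapes do not form a vector space; as functions on pairs of indices, extended by \<open>0\<close>, they do.
\<close>

definition flat :: "'a::zero mat \<Rightarrow> nat \<times> nat \<Rightarrow> 'a" where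
  "flat T = (\<lambda>(i,j). if i < dim_row T \<and> j < dim_col T then T $$ (i,j) else 0)"

lemma mat_flat: "T \<in> carrier_mat m n \<Longrightarrow> mat m n (flat T) = T"
  by (rule eq_matI) (auto simp: flat_def)

lemma flat_inj: "T \<in> carrier_mat m n \<Longrightarrow> U \<in> carrier_mat m n \<Longrightarrow> flat T = flat U \<Longrightarrow> T = U"
  by (metis mat_flat)

lemma flat_add: "T \<in> carrier_mat m n \<Longrightarrow> U \<in> carrier_mat m n \<Longrightarrow> flat (T + U) = flat T + flat U" for T :: "'a::monoid_add mat"
  by (auto simp: flat_def fun_eq_iff)

lemma flat_smult: "flat (c \<cdot>\<^sub>m T) = fscale c (flat T)" for T :: "'a::field mat"
  by (auto simp: flat_def fun_eq_iff fscale_def)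

lemma flat_zero: "flat (0\<^sub>m m n) = (0 :: nat \<times> nat \<Rightarrow> 'a::zero)"
  by (auto simp: flat_def fun_eq_iff)

context cosemisimple_hopf_algebra
begin

interpretation fn: vector_space "fscale :: 'k \<Rightarrow> (nat \<times> nat \<Rightarrow> 'k) \<Rightarrow> _"
  by (rule vector_space_fscale)

definition hdim :: "'h mat \<Rightarrow> 'h mat \<Rightarrow> nat" where
  "hdim t s = fn.dim (flat ` homs t s)"

lemma homs_carrier: "homs t s \<subseteq> carrier_mat (dim_row s) (dim_row t)"
  using homsD(4) by blast

lemma flat_homs_subspace:
  assumes "corep t" "corep s"
  shows "fn.subspace (flat ` homs t s)"
proof (rule fn.subspaceI)
  show "0 \<in> flat ` homs t s" using homs_zero[OF assms] flat_zero by (metis image_eqI)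
  fix x y c assume "x \<in> flat ` homs t s" "y \<in> flat ` homs t s"
  then obtain T U where TU: "T \<in> homs t s" "U \<in> homs t s" "x = flat T" "y = flat U" by blast
  then show "x + y \<in> flat ` homs t s"
    using flat_add[OF homsD(4) homsD(4), OF TU(1,2)] homs_add(1)[OF assms TU(1,2)] by (metis image_eqI)
  show "fscale c x \<in> flat ` homs t s"
    using TU flat_smult[of c T] homs_smult[OF assms TU(1), of c] by (metis image_eqI)
qed

lemma flat_finite_span:
  obtains D :: "(nat \<times> nat \<Rightarrow> 'k) set" where "finite D" "flat ` carrier_mat m n \<subseteq> fn.span D"
proof
  define \<delta> where "\<delta> = (\<lambda>p q :: nat \<times> nat. if q = p then 1 else (0::'k))"
  let ?I = "{..<m} \<times> {..<n}"
  show "finite (\<delta> ` ?I)" by simp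
  show "flat ` carrier_mat m n \<subseteq> fn.span (\<delta> ` ?I)"
  proof
    fix x :: "nat \<times> nat \<Rightarrow> 'k" assume "x \<in> flat ` carrier_mat m n"
    then obtain T :: "'k mat" where T: "T \<in> carrier_mat m n" "x = flat T" by blast
    have "x = (\<Sum>p\<in>?I. fscale (T $$ p) (\<delta> p))"
    proof
      fix q
      have "(\<Sum>p\<in>?I. fscale (T $$ p) (\<delta> p)) q = (\<Sum>p\<in>?I. fscale (T $$ p) (\<delta> p) q)"
        by (rule sum_fun_apply)
      also have "\<dots> = (\<Sum>p\<in>?I. if q = p then T $$ p else 0)"
        by (intro sum.cong refl) (simp add: fscale_def \<delta>_def)
      also have "\<dots> = x q" using T by (auto simp: flat_def split: prod.splits)
      finally show "x q = (\<Sum>p\<in>?I. fscale (T $$ p) (\<delta> p)) q" by simp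
    qed
    then show "x \<in> fn.span (\<delta> ` ?I)"
      by (metis (no_types, lifting) fn.span_sum fn.span_scale fn.span_base imageI)
  qed
qed

definition matlin :: "nat \<Rightarrow> nat \<Rightarrow> nat \<Rightarrow> nat \<Rightarrow> ('k mat \<Rightarrow> 'k mat) \<Rightarrow> bool" where
  "matlin m n m' n' F \<longleftrightarrow> (\<forall>A\<in>carrier_mat m n. F A \<in> carrier_mat m' n') \<and>
     (\<forall>A\<in>carrier_mat m n. \<forall>B\<in>carrier_mat m n. F (A + B) = F A + F B) \<and>
     (\<forall>c. \<forall>A\<in>carrier_mat m n. F (c \<cdot>\<^sub>m A) = c \<cdot>\<^sub>m F A)"

lemma matlin_left: "P \<in> carrier_mat m' m \<Longrightarrow> matlin m n m' n (\<lambda>X. P * X)"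
  by (auto simp: matlin_def mult_add_distrib_mat mult_smult_distrib)

lemma matlin_right: "P \<in> carrier_mat n n' \<Longrightarrow> matlin m n m n' (\<lambda>X. X * P)"
  by (auto simp: matlin_def add_mult_distrib_mat mult_smult_assoc_mat)

lemma matlin_reindex:
  assumes "\<And>i j. i < m' \<Longrightarrow> j < n' \<Longrightarrow> a i j < m \<and> b i j < n"
  shows "matlin m n m' n' (\<lambda>X. mat m' n' (\<lambda>(i,j). X $$ (a i j, b i j)))"
  using assms by (auto simp: matlin_def intro!: eq_matI)

lemma flat_image_dim:
  assumes F: "matlin m n m' n' F" and V: "V \<subseteq> carrier_mat m n" and sub: "fn.subspace (flat ` V)"
    and inj: "inj_on F V"
  shows "fn.dim (flat ` F ` V) = fn.dim (flat ` V)" "fn.subspace (flat ` F ` V)"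
proof -
  interpret pr: vector_space_pair "fscale :: 'k \<Rightarrow> (nat \<times> nat \<Rightarrow> 'k) \<Rightarrow> _" "fscale :: 'k \<Rightarrow> (nat \<times> nat \<Rightarrow> 'k) \<Rightarrow> _"
    by unfold_locales
  define g where "g = (\<lambda>f. flat (F (mat m n f)))"
  have g: "g (flat T) = flat (F T)" if "T \<in> V" for T
    using that V by (auto simp: g_def mat_flat)
  then have img: "flat ` F ` V = g ` flat ` V" by force
  interpret g: Vector_Spaces.linear "fscale :: 'k \<Rightarrow> (nat \<times> nat \<Rightarrow> 'k) \<Rightarrow> _" fscale g
  proof (rule linearI'[OF vector_space_fscale vector_space_fscale])
    fix x y :: "nat \<times> nat \<Rightarrow> 'k" and c
    have *: "mat m n x \<in> carrier_mat m n" "mat m n y \<in> carrier_mat m n" by auto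
    have "mat m n (x + y) = mat m n x + mat m n y" by (rule eq_matI) auto
    then show "g (x + y) = g x + g y"
      using F * flat_add[of "F (mat m n x)" m' n' "F (mat m n y)"] by (simp add: g_def matlin_def)
    have "mat m n (fscale c x) = c \<cdot>\<^sub>m mat m n x" by (rule eq_matI) (auto simp: fscale_def)
    then show "g (fscale c x) = fscale c (g x)" using F * by (simp add: g_def matlin_def flat_smult)
  qed
  have inj': "inj_on g (flat ` V)"
  proof (rule inj_onI)
    fix x y assume "x \<in> flat ` V" "y \<in> flat ` V" "g x = g y"
    then obtain T U where TU: "T \<in> V" "U \<in> V" "x = flat T" "y = flat U" by blast
    then have "flat (F T) = flat (F U)" using g \<open>g x = g y\<close> by simp
    moreover have "F T \<in> carrier_mat m' n'" "F U \<in> carrier_mat m' n'" using F V TU by (auto simp: matlin_def)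
    ultimately have "F T = F U" by (rule flat_inj[rotated 2])
    then show "x = y" using inj TU by (auto dest: inj_onD)
  qed
  obtain B where B: "B \<subseteq> flat ` V" "fn.independent B" "flat ` V \<subseteq> fn.span B" "card B = fn.dim (flat ` V)"
    using fn.basis_exists by blast
  have spB: "fn.span B = flat ` V" using B sub by (metis fn.span_subspace)
  have "fn.independent (g ` B)"
    using pr.linear_independent_injective_image[OF g.linear_axioms B(2)] inj' spB by simp
  moreover have "fn.span (g ` B) = g ` flat ` V" using g.span_image[of B] spB by simp
  moreover have "card (g ` B) = card B"
    using inj' B(1) by (intro card_image) (auto intro: inj_on_subset)
  ultimately show "fn.dim (flat ` F ` V) = fn.dim (flat ` V)"
    unfolding img using B(4) by (metis fn.dim_span_eq_card_independent)
  show "fn.subspace (flat ` F ` V)" unfolding img by (rule g.subspace_image[OF sub])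
qed

lemma hdim_bij:
  assumes c: "corep t" "corep s" and F: "matlin (dim_row s) (dim_row t) (dim_row s') (dim_row t') F"
    and b: "bij_betw F (homs t s) (homs t' s')"
  shows "hdim t s = hdim t' s'"
  using flat_image_dim(1)[OF F homs_carrier flat_homs_subspace[OF c]] b
  by (simp add: hdim_def bij_betw_def)

lemma matlin_diff:
  assumes F: "matlin m n m' n' F" and "A \<in> carrier_mat m n" "B \<in> carrier_mat m n"
  shows "F (A - B) = F A - F B"
proof -
  have "F (A - B) = F (A + (-1) \<cdot>\<^sub>m B)" using assms by (intro arg_cong[of _ _ F] eq_matI) auto
  also have "\<dots> = F A + (-1) \<cdot>\<^sub>m F B" using assms by (simp add: matlin_def)
  also have "\<dots> = F A - F B" using assms unfolding matlin_def by (intro eq_matI) (auto dest!: bspec)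
  finally show ?thesis .
qed

lemma matlin_zero:
  assumes F: "matlin m n m' n' F"
  shows "F (0\<^sub>m m n) = 0\<^sub>m m' n'"
proof -
  have z: "0\<^sub>m m n \<in> carrier_mat m n" by simp
  have "F (0\<^sub>m m n) = F (0\<^sub>m m n) - F (0\<^sub>m m n)" 
  proof -
    have "0\<^sub>m m n - 0\<^sub>m m n = (0\<^sub>m m n :: 'k mat)" by (intro eq_matI) auto
    then show ?thesis using matlin_diff[OF F z z] by metis
  qed
  moreover have "F (0\<^sub>m m n) \<in> carrier_mat m' n'" using F z by (simp add: matlin_def)
  ultimately show ?thesis by (metis minus_r_inv_mat)
qed

text \<open>
  Both additivity statements, in the source and in the target, are instances, with \<open>F\<close> and \<open>G\<close> given by composition with
  inclusions or projections.
\<close>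

lemma hdim_direct_sum:
  assumes c: "corep t" "corep s" "corep t1" "corep s1" "corep t2" "corep s2"
    and F: "matlin (dim_row s1) (dim_row t1) (dim_row s) (dim_row t) F" "\<And>T. T \<in> homs t1 s1 \<Longrightarrow> F T \<in> homs t s"
    and G: "matlin (dim_row s2) (dim_row t2) (dim_row s) (dim_row t) G" "\<And>T. T \<in> homs t2 s2 \<Longrightarrow> G T \<in> homs t s"
    and spans: "\<And>X. X \<in> homs t s \<Longrightarrow> \<exists>T\<in>homs t1 s1. \<exists>U\<in>homs t2 s2. X = F T + G U"
    and indep: "\<And>T U. T \<in> homs t1 s1 \<Longrightarrow> U \<in> homs t2 s2 \<Longrightarrow> F T = G U \<Longrightarrow>
        T = 0\<^sub>m (dim_row s1) (dim_row t1) \<and> U = 0\<^sub>m (dim_row s2) (dim_row t2)"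
  shows "hdim t s = hdim t1 s1 + hdim t2 s2"
proof -
  let ?V = "flat ` F ` homs t1 s1" and ?W = "flat ` G ` homs t2 s2"
  have inF: "inj_on F (homs t1 s1)"
  proof (rule inj_onI)
    fix A B assume AB: "A \<in> homs t1 s1" "B \<in> homs t1 s1" "F A = F B"
    have "F (A - B) = F A - F B" by (rule matlin_diff[OF F(1) homsD(4) homsD(4)]) (use AB in auto)
    also have "\<dots> = 0\<^sub>m (dim_row s) (dim_row t)" using AB homsD(4)[OF F(2)[OF AB(2)]] by (simp add: minus_r_inv_mat)
    also have "\<dots> = G (0\<^sub>m (dim_row s2) (dim_row t2))" using matlin_zero[OF G(1)] by simp
    finally have "A - B = 0\<^sub>m (dim_row s1) (dim_row t1)"
      using indep[OF homs_add(2)[OF c(3,4) AB(1,2)] homs_zero[OF c(5,6)]] by blast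
    then show "A = B" using mat_add_eq_iff_minus[OF homsD(4)[OF AB(1)] homsD(4)[OF AB(2)]] by simp
  qed
  have inG: "inj_on G (homs t2 s2)"
  proof (rule inj_onI)
    fix A B assume AB: "A \<in> homs t2 s2" "B \<in> homs t2 s2" "G A = G B"
    have "G (A - B) = G A - G B" by (rule matlin_diff[OF G(1) homsD(4) homsD(4)]) (use AB in auto)
    also have "\<dots> = 0\<^sub>m (dim_row s) (dim_row t)" using AB homsD(4)[OF G(2)[OF AB(2)]] by (simp add: minus_r_inv_mat)
    also have "\<dots> = F (0\<^sub>m (dim_row s1) (dim_row t1))" using matlin_zero[OF F(1)] by simp
    finally have "A - B = 0\<^sub>m (dim_row s2) (dim_row t2)"
      using indep[OF homs_zero[OF c(3,4)] homs_add(2)[OF c(5,6) AB(1,2)]] by metis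
    then show "A = B" using mat_add_eq_iff_minus[OF homsD(4)[OF AB(1)] homsD(4)[OF AB(2)]] by simp
  qed
  note V = flat_image_dim[OF F(1) homs_carrier flat_homs_subspace[OF c(3,4)] inF]
  note W = flat_image_dim[OF G(1) homs_carrier flat_homs_subspace[OF c(5,6)] inG]
  obtain D where D: "finite D" "flat ` carrier_mat (dim_row s) (dim_row t) \<subseteq> fn.span D"
    using flat_finite_span by blast
  have sub: "?V \<subseteq> flat ` homs t s" "?W \<subseteq> flat ` homs t s" using F(2) G(2) by auto
  have subD: "?V \<subseteq> fn.span D" "?W \<subseteq> fn.span D"
    using sub D(2) homs_carrier[of t s] by blast+
  have "?V \<inter> ?W = {0}"
  proof
    show "{0} \<subseteq> ?V \<inter> ?W" using V(2) W(2) fn.subspace_0 by blast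
    show "?V \<inter> ?W \<subseteq> {0}"
    proof
      fix x assume "x \<in> ?V \<inter> ?W"
      then obtain T U where TU: "T \<in> homs t1 s1" "U \<in> homs t2 s2" "x = flat (F T)" "x = flat (G U)" by blast
      then have "F T = G U" using flat_inj[OF homsD(4)[OF F(2)] homsD(4)[OF G(2)]] by metis
      then have "U = 0\<^sub>m (dim_row s2) (dim_row t2)" using indep TU by blast
      then show "x \<in> {0}" using TU(4) matlin_zero[OF G(1)] flat_zero by simp
    qed
  qed
  moreover have "flat ` homs t s = {v + w | v w. v \<in> ?V \<and> w \<in> ?W}"
  proof
    show "flat ` homs t s \<subseteq> {v + w | v w. v \<in> ?V \<and> w \<in> ?W}"
    proof
      fix x assume "x \<in> flat ` homs t s"
      then obtain X where X: "X \<in> homs t s" "x = flat X" by blast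
      obtain T U where TU: "T \<in> homs t1 s1" "U \<in> homs t2 s2" "X = F T + G U" using spans[OF X(1)] by blast
      have "x = flat (F T) + flat (G U)"
        unfolding X(2) TU(3) by (rule flat_add[OF homsD(4) homsD(4)]) (use F(2) G(2) TU in auto)
      then show "x \<in> {v + w | v w. v \<in> ?V \<and> w \<in> ?W}" using TU by blast
    qed
    show "{v + w | v w. v \<in> ?V \<and> w \<in> ?W} \<subseteq> flat ` homs t s"
      using sub fn.subspace_add[OF flat_homs_subspace[OF c(1,2)]] by blast
  qed
  ultimately show ?thesis
    using fn.dim_direct_sum[OF V(2) W(2) _ D(1) subD] V(1) W(1) by (simp add: hdim_def)
qed

lemma split_components:
  assumes "splits t r s"
  obtains B L B' L' where "corep t" "corep r" "corep s"
    "B \<in> homs r t" "L \<in> homs t r" "B' \<in> homs s t" "L' \<in> homs t s"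
    "L * B = 1\<^sub>m (dim_row r)" "L' * B' = 1\<^sub>m (dim_row s)"
    "L * B' = 0\<^sub>m (dim_row r) (dim_row s)" "L' * B = 0\<^sub>m (dim_row s) (dim_row r)"
    "B * L + B' * L' = 1\<^sub>m (dim_row t)"
  using assms unfolding splits_def by blast

lemma hdim_splits_right:
  assumes sp: "splits t r s" and x: "corep x"
  shows "hdim x t = hdim x r + hdim x s"
proof -
  obtain B L B' L' where c: "corep t" "corep r" "corep s"
    and h: "B \<in> homs r t" "L \<in> homs t r" "B' \<in> homs s t" "L' \<in> homs t s"
    and e: "L * B = 1\<^sub>m (dim_row r)" "L' * B' = 1\<^sub>m (dim_row s)"
    "L * B' = 0\<^sub>m (dim_row r) (dim_row s)" "L' * B = 0\<^sub>m (dim_row s) (dim_row r)"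
    "B * L + B' * L' = 1\<^sub>m (dim_row t)"
    using split_components[OF sp] .
  note hc = h[THEN homsD(4)]
  show ?thesis
  proof (rule hdim_direct_sum[OF x c(1) x c(2) x c(3), of "\<lambda>T. B * T" "\<lambda>T. B' * T"])
    show "B * T \<in> homs x t" if "T \<in> homs x r" for T by (rule homs_comp[OF x c(2,1) h(1) that])
    show "B' * T \<in> homs x t" if "T \<in> homs x s" for T by (rule homs_comp[OF x c(3,1) h(3) that])
    show "\<exists>T\<in>homs x r. \<exists>U\<in>homs x s. X = B * T + B' * U" if X: "X \<in> homs x t" for X
    proof (intro bexI)
      note Xc = homsD(4)[OF X]
      have "X = (B * L + B' * L') * X" using e(5) Xc by simp
      also have "\<dots> = B * L * X + B' * L' * X" by (rule add_mult_distrib_mat) (use hc Xc in auto)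
      also have "\<dots> = B * (L * X) + B' * (L' * X)" using hc Xc by (simp add: mat_assoc)
      finally show "X = B * (L * X) + B' * (L' * X)" .
      show "L * X \<in> homs x r" "L' * X \<in> homs x s" by (rule homs_comp[OF x c(1)] c h X)+
    qed
    fix T U assume T: "T \<in> homs x r" and U: "U \<in> homs x s" and eq: "B * T = B' * U"
    note Tc = homsD(4)[OF T] and Uc = homsD(4)[OF U]
    have "T = L * B * T" using e(1) Tc by simp
    also have "\<dots> = L * B' * U" using hc Tc Uc eq by (simp add: mat_assoc)
    finally have 1: "T = 0\<^sub>m (dim_row r) (dim_row x)" using e(3) Uc by simp
    have "U = L' * B' * U" using e(2) Uc by simp
    also have "\<dots> = L' * B * T" using hc Tc Uc eq by (simp add: mat_assoc)
    finally have 2: "U = 0\<^sub>m (dim_row s) (dim_row x)" using e(4) Tc by simp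
    show "T = 0\<^sub>m (dim_row r) (dim_row x) \<and> U = 0\<^sub>m (dim_row s) (dim_row x)" using 1 2 by blast
  qed (use hc in \<open>auto intro: matlin_left\<close>)
qed

lemma hdim_splits_left:
  assumes sp: "splits t r s" and x: "corep x"
  shows "hdim t x = hdim r x + hdim s x"
proof -
  obtain B L B' L' where c: "corep t" "corep r" "corep s"
    and h: "B \<in> homs r t" "L \<in> homs t r" "B' \<in> homs s t" "L' \<in> homs t s"
    and e: "L * B = 1\<^sub>m (dim_row r)" "L' * B' = 1\<^sub>m (dim_row s)"
    "L * B' = 0\<^sub>m (dim_row r) (dim_row s)" "L' * B = 0\<^sub>m (dim_row s) (dim_row r)"
    "B * L + B' * L' = 1\<^sub>m (dim_row t)"
    using split_components[OF sp] .
  note hc = h[THEN homsD(4)]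
  show ?thesis
  proof (rule hdim_direct_sum[OF c(1) x c(2) x c(3) x, of "\<lambda>T. T * L" "\<lambda>T. T * L'"])
    show "T * L \<in> homs t x" if "T \<in> homs r x" for T by (rule homs_comp[OF c(1,2) x that h(2)])
    show "T * L' \<in> homs t x" if "T \<in> homs s x" for T by (rule homs_comp[OF c(1,3) x that h(4)])
    show "\<exists>T\<in>homs r x. \<exists>U\<in>homs s x. X = T * L + U * L'" if X: "X \<in> homs t x" for X
    proof (intro bexI)
      note Xc = homsD(4)[OF X]
      have "X = X * (B * L + B' * L')" using e(5) Xc by simp
      also have "\<dots> = X * (B * L) + X * (B' * L')" by (rule mult_add_distrib_mat) (use hc Xc in auto)
      also have "\<dots> = (X * B) * L + (X * B') * L'" using hc Xc by (simp add: mat_assoc)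
      finally show "X = (X * B) * L + (X * B') * L'" .
      show "X * B \<in> homs r x" by (rule homs_comp[OF c(2,1) x X h(1)])
      show "X * B' \<in> homs s x" by (rule homs_comp[OF c(3,1) x X h(3)])
    qed
    fix T U assume T: "T \<in> homs r x" and U: "U \<in> homs s x" and eq: "T * L = U * L'"
    note Tc = homsD(4)[OF T] and Uc = homsD(4)[OF U]
    have "T = T * (L * B)" using e(1) Tc by simp
    also have "\<dots> = (T * L) * B" using hc Tc by (simp add: mat_assoc)
    also have "\<dots> = U * (L' * B)" unfolding eq using hc Uc by (simp add: mat_assoc)
    finally have 1: "T = 0\<^sub>m (dim_row x) (dim_row r)" using e(4) Uc by simp
    have "U = U * (L' * B')" using e(2) Uc by simp
    also have "\<dots> = (U * L') * B'" using hc Uc by (simp add: mat_assoc)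
    also have "\<dots> = T * (L * B')" unfolding eq[symmetric] using hc Tc by (simp add: mat_assoc)
    finally have 2: "U = 0\<^sub>m (dim_row x) (dim_row s)" using e(3) Tc by simp
    show "T = 0\<^sub>m (dim_row x) (dim_row r) \<and> U = 0\<^sub>m (dim_row x) (dim_row s)" using 1 2 by blast
  qed (use hc in \<open>auto intro: matlin_right\<close>)
qed

lemma isom_components:
  assumes "isom t s"
  obtains T U where "T \<in> homs t s" "U \<in> homs s t" "T * U = 1\<^sub>m (dim_row s)" "U * T = 1\<^sub>m (dim_row t)"
  using assms by (auto simp: isom_def)

lemma hdim_isom_right:
  assumes c: "corep t" "corep s" and x: "corep x" and "isom t s"
  shows "hdim x t = hdim x s"
proof -
  obtain T U where TU: "T \<in> homs t s" "U \<in> homs s t" "T * U = 1\<^sub>m (dim_row s)" "U * T = 1\<^sub>m (dim_row t)"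
    using isom_components[OF assms(4)] .
  note Tc = homsD(4)[OF TU(1)] and Uc = homsD(4)[OF TU(2)]
  show ?thesis
  proof (rule hdim_bij[OF x c(1) matlin_left[OF Tc]], rule bij_betw_byWitness[of _ "\<lambda>X. U * X"])
    show "\<forall>X\<in>homs x t. U * (T * X) = X"
    proof
      fix X assume "X \<in> homs x t"
      note Xc = homsD(4)[OF this]
      show "U * (T * X) = X" using assoc_mult_mat[OF Uc Tc Xc] TU(4) Xc by simp
    qed
    show "\<forall>X\<in>homs x s. T * (U * X) = X"
    proof
      fix X assume "X \<in> homs x s"
      note Xc = homsD(4)[OF this]
      show "T * (U * X) = X" using assoc_mult_mat[OF Tc Uc Xc] TU(3) Xc by simp
    qed
    show "(\<lambda>X. T * X) ` homs x t \<subseteq> homs x s" "(\<lambda>X. U * X) ` homs x s \<subseteq> homs x t"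
      using homs_comp[OF x c(1,2) TU(1)] homs_comp[OF x c(2,1) TU(2)] by auto
  qed
qed

lemma hdim_isom_left:
  assumes c: "corep t" "corep s" and x: "corep x" and "isom t s"
  shows "hdim t x = hdim s x"
proof -
  obtain T U where TU: "T \<in> homs t s" "U \<in> homs s t" "T * U = 1\<^sub>m (dim_row s)" "U * T = 1\<^sub>m (dim_row t)"
    using isom_components[OF assms(4)] .
  note Tc = homsD(4)[OF TU(1)] and Uc = homsD(4)[OF TU(2)]
  show ?thesis
  proof (rule hdim_bij[OF c(1) x matlin_right[OF Uc]], rule bij_betw_byWitness[of _ "\<lambda>X. X * T"])
    show "\<forall>X\<in>homs t x. X * U * T = X"
    proof
      fix X assume "X \<in> homs t x"
      note Xc = homsD(4)[OF this]
      show "X * U * T = X" using assoc_mult_mat[OF Xc Uc Tc] TU(4) Xc by simp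
    qed
    show "\<forall>X\<in>homs s x. X * T * U = X"
    proof
      fix X assume "X \<in> homs s x"
      note Xc = homsD(4)[OF this]
      show "X * T * U = X" using assoc_mult_mat[OF Xc Tc Uc] TU(3) Xc by simp
    qed
    show "(\<lambda>X. X * U) ` homs t x \<subseteq> homs s x" "(\<lambda>X. X * T) ` homs s x \<subseteq> homs t x"
      using homs_comp[OF c(2,1) x _ TU(2)] homs_comp[OF c(1,2) x _ TU(1)] by auto
  qed
qed

lemma hdim_zero:
  assumes "homs t s \<subseteq> {0\<^sub>m (dim_row s) (dim_row t)}"
  shows "hdim t s = 0"
proof -
  have "flat ` homs t s \<subseteq> {0}" using assms flat_zero by auto
  then show ?thesis unfolding hdim_def by (intro fn.dim_unique[of "{}"]) (auto simp: fn.independent_empty)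
qed

lemma hdim_degenerate: "dim_row t = 0 \<Longrightarrow> hdim x t = 0" "dim_row t = 0 \<Longrightarrow> hdim t x = 0"
  by (rule hdim_zero; use homsD(4) in \<open>fastforce intro!: eq_matI\<close>)+

lemma hdim_irr_isom:
  assumes t: "irr t" and s: "irr s" and "isom t s"
  shows "hdim t s = 1"
proof -
  obtain M U where TU: "M \<in> homs t s" "M * U = 1\<^sub>m (dim_row s)" "U * M = 1\<^sub>m (dim_row t)" "U \<in> homs s t"
    using isom_components[OF assms(3)] by metis
  have M0: "M \<noteq> 0\<^sub>m (dim_row s) (dim_row t)"
  proof
    assume "M = 0\<^sub>m (dim_row s) (dim_row t)"
    then have "U * M = 0\<^sub>m (dim_row t) (dim_row t)" using homsD(4)[OF TU(4)] by simp
    then have "(1\<^sub>m (dim_row t) :: 'k mat) $$ (0,0) = 0" using TU(3) irr_pos[OF t] by simp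
    then show False using irr_pos[OF t] by simp
  qed
  have "flat ` homs t s = fn.span {flat M}"
  proof
    show "flat ` homs t s \<subseteq> fn.span {flat M}"
    proof
      fix x assume "x \<in> flat ` homs t s"
      then obtain X where "X \<in> homs t s" "x = flat X" by blast
      moreover from schur_scalar[OF t s TU(1) M0 this(1)] obtain c where "X = c \<cdot>\<^sub>m M" .
      ultimately show "x \<in> fn.span {flat M}" by (auto simp: flat_smult fn.span_singleton)
    qed
    show "fn.span {flat M} \<subseteq> flat ` homs t s"
      using TU(1) flat_homs_subspace[OF irr_corep[OF t] irr_corep[OF s]] by (intro fn.span_minimal) auto
  qed
  moreover have "flat M \<noteq> 0" using M0 flat_inj[OF homsD(4)[OF TU(1)] zero_carrier_mat] flat_zero by metis
  ultimately show ?thesis unfolding hdim_def using fn.dim_span_eq_card_independent[of "{flat M}"] by simp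
qed

lemma hdim_irr_not_isom:
  assumes t: "irr t" and s: "irr s" and "\<not> isom t s"
  shows "hdim t s = 0"
proof (rule hdim_zero, rule ccontr)
  assume "\<not> homs t s \<subseteq> {0\<^sub>m (dim_row s) (dim_row t)}"
  then obtain M where "M \<in> homs t s" "M \<noteq> 0\<^sub>m (dim_row s) (dim_row t)" by blast
  from schur_isom[OF t s this] this(1) have "isom t s" unfolding isom_def by blast
  then show False using assms(3) by simp
qed

end

section \<open>Duality and decomposition into irreducibles\<close>

lemma all_pair_index:
  "(\<forall>k<p * q. P k) \<longleftrightarrow> (\<forall>a<p. \<forall>b<q. P (a * q + b))" for p q :: nat
proof
  assume r: "\<forall>a<p. \<forall>b<q. P (a * q + b)"
  show "\<forall>k<p * q. P k"
  proof (intro allI impI)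
    fix k assume "k < p * q"
    then show "P k" using r[rule_format, OF div_mod_lt, of k q q] div_mod_lt[of k p q] r by (metis div_mult_mod_eq)
  qed
qed (auto intro: pair_index_lt)

lemma sum_pair_index: "(\<Sum>k<p*q. h k) = (\<Sum>a<p. \<Sum>b<q. h (a * q + b))" for p q :: nat
  using sum_div_mod[of "\<lambda>a b. h (a * q + b)" q p] by simp

lemma mat_eq_iff_index:
  assumes "A \<in> carrier_mat m n" "B \<in> carrier_mat m n"
  shows "A = B \<longleftrightarrow> (\<forall>i<m. \<forall>j<n. A $$ (i,j) = B $$ (i,j))"
  using assms by (auto intro!: eq_matI)

context cosemisimple_hopf_algebra
begin

lemma homs_iff_index:
  assumes t: "corep t" and s: "corep s" and T: "T \<in> carrier_mat (dim_row s) (dim_row t)"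
  shows "T \<in> homs t s \<longleftrightarrow> (\<forall>i<dim_row s. \<forall>j<dim_row t.
    (\<Sum>k<dim_row t. scale (T $$ (i,k)) (t $$ (k,j))) = (\<Sum>k<dim_row s. scale (T $$ (k,j)) (s $$ (i,k))))"
proof -
  note d = corepD(1)[OF t] corepD(1)[OF s]
  have "T \<in> homs t s \<longleftrightarrow> emb T * t = s * emb T" using T by (auto simp: homs_def)
  also have "\<dots> \<longleftrightarrow> (\<forall>i<dim_row s. \<forall>j<dim_row t. (emb T * t) $$ (i,j) = (s * emb T) $$ (i,j))"
    using T d by (intro mat_eq_iff_index) auto
  also have "\<dots> \<longleftrightarrow> (\<forall>i<dim_row s. \<forall>j<dim_row t.
    (\<Sum>k<dim_row t. scale (T $$ (i,k)) (t $$ (k,j))) = (\<Sum>k<dim_row s. scale (T $$ (k,j)) (s $$ (i,k))))"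
    using T d by (simp add: emb_mult_index mult_emb_index del: index_mult_mat(1))
  finally show ?thesis .
qed

lemma kron_pair_index:
  assumes "corep x" "corep b" "i < dim_row x" "j < dim_row b" "k < dim_row x" "l < dim_row b"
  shows "(x \<boxtimes> b) $$ (i * dim_row b + j, k * dim_row b + l) = x $$ (i,k) * b $$ (j,l)"
  using assms kron_index[OF corepD(2)[OF assms(1)] corepD(2)[OF assms(2)] pair_index_lt pair_index_lt] by simp

lemma homs_kron_source:
  assumes x: "corep x" and b: "corep b" and y: "corep y" and f: "f \<in> carrier_mat (dim_row y) (dim_row x * dim_row b)"
  shows "f \<in> homs (x \<boxtimes> b) y \<longleftrightarrow> (\<forall>i<dim_row y. \<forall>a<dim_row x. \<forall>\<beta><dim_row b.
    (\<Sum>a'<dim_row x. \<Sum>\<beta>'<dim_row b. scale (f $$ (i, a' * dim_row b + \<beta>')) (x $$ (a',a) * b $$ (\<beta>',\<beta>)))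
    = (\<Sum>i'<dim_row y. scale (f $$ (i', a * dim_row b + \<beta>)) (y $$ (i,i'))))"
proof -
  have f': "f \<in> carrier_mat (dim_row y) (dim_row (x \<boxtimes> b))" using f by simp
  show ?thesis
    unfolding homs_iff_index[OF corep_kron[OF x b] y f'] dim_kron sum_pair_index all_pair_index
    by (intro all_cong1 imp_cong refl arg_cong2[of _ _ _ _ "(=)"] sum.cong) (simp_all add: kron_pair_index[OF x b])
qed

lemma homs_kron_target:
  assumes x: "corep x" and b: "corep b" and y: "corep y" and g: "g \<in> carrier_mat (dim_row y * dim_row b) (dim_row x)"
  shows "g \<in> homs x (y \<boxtimes> b) \<longleftrightarrow> (\<forall>i<dim_row y. \<forall>\<beta><dim_row b. \<forall>a<dim_row x.
    (\<Sum>a'<dim_row x. scale (g $$ (i * dim_row b + \<beta>, a')) (x $$ (a',a)))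
    = (\<Sum>i'<dim_row y. \<Sum>\<beta>'<dim_row b. scale (g $$ (i' * dim_row b + \<beta>', a)) (y $$ (i,i') * b $$ (\<beta>,\<beta>'))))"
proof -
  have g': "g \<in> carrier_mat (dim_row (y \<boxtimes> b)) (dim_row x)" using g by simp
  show ?thesis
    unfolding homs_iff_index[OF x corep_kron[OF y b] g'] dim_kron sum_pair_index all_pair_index
    by (intro all_cong1 imp_cong refl arg_cong2[of _ _ _ _ "(=)"] sum.cong) (simp_all add: kron_pair_index[OF y b])
qed

lemma sum_collapse:
  "i < n \<Longrightarrow> (\<Sum>k<n. scale (F k) (if k = i then G k else 0)) = scale (F i) (G i)"
  "i < n \<Longrightarrow> (\<Sum>k<n. scale (F k) (if i = k then G k else 0)) = scale (F i) (G i)"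
  for n :: nat
  by (simp_all add: if_distrib[of "scale _"] cong: if_cong)

text \<open>The adjunction \<open>Hom(x \<otimes> b, y) = Hom(x, y \<otimes> b*)\<close>: a tensor with three indices, read in two ways.\<close>

lemma bend_right_iff:
  assumes x: "corep x" and b: "corep b" and y: "corep y" and f: "f \<in> carrier_mat (dim_row y) (dim_row x * dim_row b)"
    and g: "g \<in> carrier_mat (dim_row y * dim_row b) (dim_row x)"
    and fg: "\<And>i a \<beta>. i < dim_row y \<Longrightarrow> a < dim_row x \<Longrightarrow> \<beta> < dim_row b \<Longrightarrow>
      f $$ (i, a * dim_row b + \<beta>) = \<phi> i a \<beta> \<and> g $$ (i * dim_row b + \<beta>, a) = \<phi> i a \<beta>"
  shows "f \<in> homs (x \<boxtimes> b) y \<longleftrightarrow> g \<in> homs x (y \<boxtimes> star b)"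
proof -
  let ?p = "dim_row x" and ?q = "dim_row b" and ?r = "dim_row y"
  have dsb: "dim_row (star b) = ?q" using corepD(1)[OF b] by simp
  have src: "f \<in> homs (x \<boxtimes> b) y \<longleftrightarrow> (\<forall>i<?r. \<forall>a<?p. \<forall>\<beta><?q.
    (\<Sum>a'<?p. \<Sum>\<beta>'<?q. scale (\<phi> i a' \<beta>') (x $$ (a',a) * b $$ (\<beta>',\<beta>))) = (\<Sum>i'<?r. scale (\<phi> i' a \<beta>) (y $$ (i,i'))))"
    unfolding homs_kron_source[OF x b y f]
    by (intro all_cong1 imp_cong refl arg_cong2[of _ _ _ _ "(=)"] sum.cong) (simp_all add: fg)
  have tgt: "g \<in> homs x (y \<boxtimes> star b) \<longleftrightarrow> (\<forall>i<?r. \<forall>\<beta><?q. \<forall>a<?p.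
    (\<Sum>a'<?p. scale (\<phi> i a' \<beta>) (x $$ (a',a))) = (\<Sum>i'<?r. \<Sum>\<beta>'<?q. scale (\<phi> i' a \<beta>') (y $$ (i,i') * S (b $$ (\<beta>',\<beta>)))))"
    unfolding homs_kron_target[OF x corep_star[OF b] y g[folded dsb]] dsb
    using corepD(1)[OF b]
    by (intro all_cong1 imp_cong refl arg_cong2[of _ _ _ _ "(=)"] sum.cong) (simp_all add: fg)
  show ?thesis unfolding src tgt
  proof (intro iffI allI impI)
    fix i \<beta> a assume A: "\<forall>i<?r. \<forall>a<?p. \<forall>\<beta><?q.
      (\<Sum>a'<?p. \<Sum>\<beta>'<?q. scale (\<phi> i a' \<beta>') (x $$ (a',a) * b $$ (\<beta>',\<beta>))) = (\<Sum>i'<?r. scale (\<phi> i' a \<beta>) (y $$ (i,i')))"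
      and lt: "i < ?r" "\<beta> < ?q" "a < ?p"
    have "(\<Sum>i'<?r. \<Sum>\<beta>'<?q. scale (\<phi> i' a \<beta>') (y $$ (i,i') * S (b $$ (\<beta>',\<beta>)))) =
        (\<Sum>\<gamma><?q. (\<Sum>i'<?r. scale (\<phi> i' a \<gamma>) (y $$ (i,i'))) * S (b $$ (\<gamma>,\<beta>)))"
      by (subst sum.swap) (simp add: sum_distrib_right scale_mult_left)
    also have "\<dots> = (\<Sum>\<gamma><?q. (\<Sum>a'<?p. \<Sum>\<beta>'<?q. scale (\<phi> i a' \<beta>') (x $$ (a',a) * b $$ (\<beta>',\<gamma>))) * S (b $$ (\<gamma>,\<beta>)))"
      using A lt by (intro sum.cong refl) simp
    also have "\<dots> = (\<Sum>\<gamma><?q. \<Sum>a'<?p. \<Sum>\<beta>'<?q. scale (\<phi> i a' \<beta>') (x $$ (a',a) * (b $$ (\<beta>',\<gamma>) * S (b $$ (\<gamma>,\<beta>)))))"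
      by (simp add: sum_distrib_right scale_mult_left mult.assoc)
    also have "\<dots> = (\<Sum>a'<?p. \<Sum>\<beta>'<?q. scale (\<phi> i a' \<beta>') (x $$ (a',a) * (\<Sum>\<gamma><?q. b $$ (\<beta>',\<gamma>) * S (b $$ (\<gamma>,\<beta>)))))"
      by (subst sum_rotate) (simp add: sum_distrib_left scale_sum_right)
    also have "\<dots> = (\<Sum>a'<?p. scale (\<phi> i a' \<beta>) (x $$ (a',a)))"
      using lt by (intro sum.cong refl) (simp add: antip_inverse_index(1)[OF b] if_distrib[of "(*) _"] sum_collapse cong: if_cong)
    finally show "(\<Sum>a'<?p. scale (\<phi> i a' \<beta>) (x $$ (a',a))) =
        (\<Sum>i'<?r. \<Sum>\<beta>'<?q. scale (\<phi> i' a \<beta>') (y $$ (i,i') * S (b $$ (\<beta>',\<beta>))))" by simp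
  next
    fix i a \<beta> assume B: "\<forall>i<?r. \<forall>\<beta><?q. \<forall>a<?p.
      (\<Sum>a'<?p. scale (\<phi> i a' \<beta>) (x $$ (a',a))) = (\<Sum>i'<?r. \<Sum>\<beta>'<?q. scale (\<phi> i' a \<beta>') (y $$ (i,i') * S (b $$ (\<beta>',\<beta>))))"
      and lt: "i < ?r" "a < ?p" "\<beta> < ?q"
    have "(\<Sum>a'<?p. \<Sum>\<beta>'<?q. scale (\<phi> i a' \<beta>') (x $$ (a',a) * b $$ (\<beta>',\<beta>))) =
        (\<Sum>\<gamma><?q. (\<Sum>a'<?p. scale (\<phi> i a' \<gamma>) (x $$ (a',a))) * b $$ (\<gamma>,\<beta>))"
      by (subst sum.swap) (simp add: sum_distrib_right scale_mult_left)
    also have "\<dots> = (\<Sum>\<gamma><?q. (\<Sum>i'<?r. \<Sum>\<beta>'<?q. scale (\<phi> i' a \<beta>') (y $$ (i,i') * S (b $$ (\<beta>',\<gamma>)))) * b $$ (\<gamma>,\<beta>))"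
      using B lt by (intro sum.cong refl) simp
    also have "\<dots> = (\<Sum>\<gamma><?q. \<Sum>i'<?r. \<Sum>\<beta>'<?q. scale (\<phi> i' a \<beta>') (y $$ (i,i') * (S (b $$ (\<beta>',\<gamma>)) * b $$ (\<gamma>,\<beta>))))"
      by (simp add: sum_distrib_right scale_mult_left mult.assoc)
    also have "\<dots> = (\<Sum>i'<?r. \<Sum>\<beta>'<?q. scale (\<phi> i' a \<beta>') (y $$ (i,i') * (\<Sum>\<gamma><?q. S (b $$ (\<beta>',\<gamma>)) * b $$ (\<gamma>,\<beta>))))"
      by (subst sum_rotate) (simp add: sum_distrib_left scale_sum_right)
    also have "\<dots> = (\<Sum>i'<?r. scale (\<phi> i' a \<beta>) (y $$ (i,i')))"
      using lt by (intro sum.cong refl) (simp add: antip_inverse_index(2)[OF b] if_distrib[of "(*) _"] sum_collapse cong: if_cong)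
    finally show "(\<Sum>a'<?p. \<Sum>\<beta>'<?q. scale (\<phi> i a' \<beta>') (x $$ (a',a) * b $$ (\<beta>',\<beta>))) =
        (\<Sum>i'<?r. scale (\<phi> i' a \<beta>) (y $$ (i,i')))" .
  qed
qed

lemma bend_left_iff:
  assumes x: "corep x" and b: "corep b" and y: "corep y" and f: "f \<in> carrier_mat (dim_row y) (dim_row b * dim_row x)"
    and g: "g \<in> carrier_mat (dim_row b * dim_row y) (dim_row x)"
    and fg: "\<And>i a \<beta>. i < dim_row y \<Longrightarrow> a < dim_row x \<Longrightarrow> \<beta> < dim_row b \<Longrightarrow>
      f $$ (i, \<beta> * dim_row x + a) = \<phi> i a \<beta> \<and> g $$ (\<beta> * dim_row y + i, a) = \<phi> i a \<beta>"
  shows "f \<in> homs (star b \<boxtimes> x) y \<longleftrightarrow> g \<in> homs x (b \<boxtimes> y)"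
proof -
  let ?p = "dim_row x" and ?q = "dim_row b" and ?r = "dim_row y"
  have dsb: "dim_row (star b) = ?q" using corepD(1)[OF b] by simp
  have src: "f \<in> homs (star b \<boxtimes> x) y \<longleftrightarrow> (\<forall>i<?r. \<forall>\<beta><?q. \<forall>a<?p.
    (\<Sum>\<beta>'<?q. \<Sum>a'<?p. scale (\<phi> i a' \<beta>') (S (b $$ (\<beta>,\<beta>')) * x $$ (a',a))) = (\<Sum>i'<?r. scale (\<phi> i' a \<beta>) (y $$ (i,i'))))"
    unfolding homs_kron_source[OF corep_star[OF b] x y f[folded dsb]] dsb
    using corepD(1)[OF b]
    by (intro all_cong1 imp_cong refl arg_cong2[of _ _ _ _ "(=)"] sum.cong) (simp_all add: fg)
  have tgt: "g \<in> homs x (b \<boxtimes> y) \<longleftrightarrow> (\<forall>\<beta><?q. \<forall>i<?r. \<forall>a<?p.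
    (\<Sum>a'<?p. scale (\<phi> i a' \<beta>) (x $$ (a',a))) = (\<Sum>\<beta>'<?q. \<Sum>i'<?r. scale (\<phi> i' a \<beta>') (b $$ (\<beta>,\<beta>') * y $$ (i,i'))))"
    unfolding homs_kron_target[OF x y b g]
    by (intro all_cong1 imp_cong refl arg_cong2[of _ _ _ _ "(=)"] sum.cong) (simp_all add: fg)
  show ?thesis unfolding src tgt
  proof (intro iffI allI impI)
    fix i \<beta> a assume A: "\<forall>i<?r. \<forall>\<beta><?q. \<forall>a<?p.
      (\<Sum>\<beta>'<?q. \<Sum>a'<?p. scale (\<phi> i a' \<beta>') (S (b $$ (\<beta>,\<beta>')) * x $$ (a',a))) = (\<Sum>i'<?r. scale (\<phi> i' a \<beta>) (y $$ (i,i')))"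
      and lt: "\<beta> < ?q" "i < ?r" "a < ?p"
    have "(\<Sum>\<beta>'<?q. \<Sum>i'<?r. scale (\<phi> i' a \<beta>') (b $$ (\<beta>,\<beta>') * y $$ (i,i'))) =
        (\<Sum>\<gamma><?q. b $$ (\<beta>,\<gamma>) * (\<Sum>i'<?r. scale (\<phi> i' a \<gamma>) (y $$ (i,i'))))"
      by (simp add: sum_distrib_left scale_mult_right)
    also have "\<dots> = (\<Sum>\<gamma><?q. b $$ (\<beta>,\<gamma>) * (\<Sum>\<beta>'<?q. \<Sum>a'<?p. scale (\<phi> i a' \<beta>') (S (b $$ (\<gamma>,\<beta>')) * x $$ (a',a))))"
      using A lt by (intro sum.cong refl) simp
    also have "\<dots> = (\<Sum>\<gamma><?q. \<Sum>\<beta>'<?q. \<Sum>a'<?p. scale (\<phi> i a' \<beta>') ((b $$ (\<beta>,\<gamma>) * S (b $$ (\<gamma>,\<beta>'))) * x $$ (a',a)))"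
      by (simp add: sum_distrib_left scale_mult_right mult.assoc)
    also have "\<dots> = (\<Sum>\<beta>'<?q. \<Sum>a'<?p. scale (\<phi> i a' \<beta>') ((\<Sum>\<gamma><?q. b $$ (\<beta>,\<gamma>) * S (b $$ (\<gamma>,\<beta>'))) * x $$ (a',a)))"
      by (subst sum_rotate) (simp add: sum_distrib_right scale_sum_right)
    also have "\<dots> = (\<Sum>a'<?p. \<Sum>\<beta>'<?q. scale (\<phi> i a' \<beta>') (if \<beta> = \<beta>' then x $$ (a',a) else 0))"
      using lt by (subst sum.swap, intro sum.cong refl) (simp add: antip_inverse_index(1)[OF b])
    also have "\<dots> = (\<Sum>a'<?p. scale (\<phi> i a' \<beta>) (x $$ (a',a)))"
      using lt by (simp add: sum_collapse)
    finally show "(\<Sum>a'<?p. scale (\<phi> i a' \<beta>) (x $$ (a',a))) =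
        (\<Sum>\<beta>'<?q. \<Sum>i'<?r. scale (\<phi> i' a \<beta>') (b $$ (\<beta>,\<beta>') * y $$ (i,i')))" by simp
  next
    fix i a \<beta> assume B: "\<forall>\<beta><?q. \<forall>i<?r. \<forall>a<?p.
      (\<Sum>a'<?p. scale (\<phi> i a' \<beta>) (x $$ (a',a))) = (\<Sum>\<beta>'<?q. \<Sum>i'<?r. scale (\<phi> i' a \<beta>') (b $$ (\<beta>,\<beta>') * y $$ (i,i')))"
      and lt: "i < ?r" "\<beta> < ?q" "a < ?p"
    have "(\<Sum>\<beta>'<?q. \<Sum>a'<?p. scale (\<phi> i a' \<beta>') (S (b $$ (\<beta>,\<beta>')) * x $$ (a',a))) =
        (\<Sum>\<gamma><?q. S (b $$ (\<beta>,\<gamma>)) * (\<Sum>a'<?p. scale (\<phi> i a' \<gamma>) (x $$ (a',a))))"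
      by (simp add: sum_distrib_left scale_mult_right)
    also have "\<dots> = (\<Sum>\<gamma><?q. S (b $$ (\<beta>,\<gamma>)) * (\<Sum>\<beta>'<?q. \<Sum>i'<?r. scale (\<phi> i' a \<beta>') (b $$ (\<gamma>,\<beta>') * y $$ (i,i'))))"
      using B lt by (intro sum.cong refl) simp
    also have "\<dots> = (\<Sum>\<gamma><?q. \<Sum>\<beta>'<?q. \<Sum>i'<?r. scale (\<phi> i' a \<beta>') ((S (b $$ (\<beta>,\<gamma>)) * b $$ (\<gamma>,\<beta>')) * y $$ (i,i')))"
      by (simp add: sum_distrib_left scale_mult_right mult.assoc)
    also have "\<dots> = (\<Sum>\<beta>'<?q. \<Sum>i'<?r. scale (\<phi> i' a \<beta>') ((\<Sum>\<gamma><?q. S (b $$ (\<beta>,\<gamma>)) * b $$ (\<gamma>,\<beta>')) * y $$ (i,i')))"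
      by (subst sum_rotate) (simp add: sum_distrib_right scale_sum_right)
    also have "\<dots> = (\<Sum>i'<?r. \<Sum>\<beta>'<?q. scale (\<phi> i' a \<beta>') (if \<beta> = \<beta>' then y $$ (i,i') else 0))"
      using lt by (subst sum.swap, intro sum.cong refl) (simp add: antip_inverse_index(2)[OF b])
    also have "\<dots> = (\<Sum>i'<?r. scale (\<phi> i' a \<beta>) (y $$ (i,i')))"
      using lt by (simp add: sum_collapse)
    finally show "(\<Sum>\<beta>'<?q. \<Sum>a'<?p. scale (\<phi> i a' \<beta>') (S (b $$ (\<beta>,\<beta>')) * x $$ (a',a))) =
        (\<Sum>i'<?r. scale (\<phi> i' a \<beta>) (y $$ (i,i')))" .
  qed
qed

lemma hdim_bend_right:
  assumes x: "corep x" and b: "corep b" and y: "corep y"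
  shows "hdim (x \<boxtimes> b) y = hdim x (y \<boxtimes> star b)"
proof -
  let ?p = "dim_row x" and ?q = "dim_row b" and ?r = "dim_row y"
  have dsb: "dim_row (star b) = ?q" using corepD(1)[OF b] by simp
  define F where "F = (\<lambda>f :: 'k mat. mat (?r * ?q) ?p (\<lambda>(i,j). f $$ (i div ?q, j * ?q + i mod ?q)))"
  define G where "G = (\<lambda>g :: 'k mat. mat ?r (?p * ?q) (\<lambda>(i,j). g $$ (i * ?q + j mod ?q, j div ?q)))"
  have GF: "G (F f) = f" if "f \<in> carrier_mat ?r (?p * ?q)" for f
    using that by (cases "?q = 0"; intro eq_matI) (auto simp: F_def G_def div_mod_lt pair_index_lt)
  have FG: "F (G g) = g" if "g \<in> carrier_mat (?r * ?q) ?p" for g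
    using that by (cases "?q = 0"; intro eq_matI) (auto simp: F_def G_def div_mod_lt pair_index_lt)
  have Fc: "F f \<in> carrier_mat (?r * ?q) ?p" and Gc: "G f \<in> carrier_mat ?r (?p * ?q)" for f by (auto simp: F_def G_def)
  have iff: "f \<in> homs (x \<boxtimes> b) y \<longleftrightarrow> F f \<in> homs x (y \<boxtimes> star b)" if "f \<in> carrier_mat ?r (?p * ?q)" for f
    by (rule bend_right_iff[OF x b y that Fc, of "\<lambda>i a \<beta>. f $$ (i, a * ?q + \<beta>)"]) (auto simp: F_def pair_index_lt)
  note c1 = homs_carrier[of "x \<boxtimes> b" y, unfolded dim_kron] and c2 = homs_carrier[of x "y \<boxtimes> star b", unfolded dim_kron dsb]
  have mlin: "matlin (dim_row y) (dim_row (x \<boxtimes> b)) (dim_row (y \<boxtimes> star b)) (dim_row x) F"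
    unfolding F_def dim_kron dsb by (rule matlin_reindex) (auto simp: div_mod_lt pair_index_lt)
  show ?thesis
  proof (rule hdim_bij[OF corep_kron[OF x b] y mlin], rule bij_betw_byWitness[of _ G])
    show "\<forall>a\<in>homs (x \<boxtimes> b) y. G (F a) = a" using c1 GF by blast
    show "\<forall>a\<in>homs x (y \<boxtimes> star b). F (G a) = a" using c2 FG by blast
    show "F ` homs (x \<boxtimes> b) y \<subseteq> homs x (y \<boxtimes> star b)" using c1 iff by blast
    show "G ` homs x (y \<boxtimes> star b) \<subseteq> homs (x \<boxtimes> b) y" using c2 iff[OF Gc] FG by (auto simp: subset_iff)
  qed
qed

lemma hdim_bend_left:
  assumes x: "corep x" and b: "corep b" and y: "corep y"
  shows "hdim (star b \<boxtimes> x) y = hdim x (b \<boxtimes> y)"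
proof -
  let ?p = "dim_row x" and ?q = "dim_row b" and ?r = "dim_row y"
  have dsb: "dim_row (star b) = ?q" using corepD(1)[OF b] by simp
  define F where "F = (\<lambda>f :: 'k mat. mat (?q * ?r) ?p (\<lambda>(i,j). f $$ (i mod ?r, (i div ?r) * ?p + j)))"
  define G where "G = (\<lambda>g :: 'k mat. mat ?r (?q * ?p) (\<lambda>(i,j). g $$ ((j div ?p) * ?r + i, j mod ?p)))"
  have GF: "G (F f) = f" if "f \<in> carrier_mat ?r (?q * ?p)" for f
    using that by (cases "?p = 0"; intro eq_matI) (auto simp: F_def G_def div_mod_lt pair_index_lt)
  have FG: "F (G g) = g" if "g \<in> carrier_mat (?q * ?r) ?p" for g
    using that by (cases "?r = 0"; intro eq_matI) (auto simp: F_def G_def div_mod_lt pair_index_lt)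
  have Fc: "F f \<in> carrier_mat (?q * ?r) ?p" and Gc: "G f \<in> carrier_mat ?r (?q * ?p)" for f by (auto simp: F_def G_def)
  have iff: "f \<in> homs (star b \<boxtimes> x) y \<longleftrightarrow> F f \<in> homs x (b \<boxtimes> y)" if "f \<in> carrier_mat ?r (?q * ?p)" for f
    by (rule bend_left_iff[OF x b y that Fc, of "\<lambda>i a \<beta>. f $$ (i, \<beta> * ?p + a)"]) (auto simp: F_def pair_index_lt)
  note c1 = homs_carrier[of "star b \<boxtimes> x" y, unfolded dim_kron dsb] and c2 = homs_carrier[of x "b \<boxtimes> y", unfolded dim_kron]
  have mlin: "matlin (dim_row y) (dim_row (star b \<boxtimes> x)) (dim_row (b \<boxtimes> y)) (dim_row x) F"
    unfolding F_def dim_kron dsb by (rule matlin_reindex) (auto simp: div_mod_lt pair_index_lt)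
  show ?thesis
  proof (rule hdim_bij[OF corep_kron[OF corep_star[OF b] x] y mlin], rule bij_betw_byWitness[of _ G])
    show "\<forall>a\<in>homs (star b \<boxtimes> x) y. G (F a) = a" using c1 GF by blast
    show "\<forall>a\<in>homs x (b \<boxtimes> y). F (G a) = a" using c2 FG by blast
    show "F ` homs (star b \<boxtimes> x) y \<subseteq> homs x (b \<boxtimes> y)" using c1 iff by blast
    show "G ` homs x (b \<boxtimes> y) \<subseteq> homs (star b \<boxtimes> x) y" using c2 iff[OF Gc] FG by (auto simp: subset_iff)
  qed
qed

lemma transpose_emb_mult:
  "dim_col T = dim_row X \<Longrightarrow> transpose_mat (emb T * X) = transpose_mat X * emb (transpose_mat T)"
  by (rule eq_matI) (auto simp: emb_mult_index mult_emb_index simp del: index_mult_mat(1))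

lemma transpose_mult_emb:
  "dim_col X = dim_row T \<Longrightarrow> transpose_mat (X * emb T) = emb (transpose_mat T) * transpose_mat X"
  by (rule eq_matI) (auto simp: emb_mult_index mult_emb_index simp del: index_mult_mat(1))

lemma homs_star:
  assumes t: "corep t" and s: "corep s" and T: "T \<in> homs t s"
  shows "transpose_mat T \<in> homs (star s) (star t)"
proof (rule homsI)
  note d = corepD(1)[OF t] corepD(1)[OF s] homsD(1,2)[OF T]
  show "transpose_mat T \<in> carrier_mat (dim_row (star t)) (dim_row (star s))" using d by auto
  have "transpose_mat (antip s * emb T) = transpose_mat (emb T * antip t)"
    using homs_antip[OF t s T] by simp
  then show "emb (transpose_mat T) * star s = star t * emb (transpose_mat T)"
    using d by (simp add: transpose_emb_mult transpose_mult_emb star_def)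
qed

lemma homs_star_rev:
  assumes t: "corep t" and s: "corep s" and T: "T \<in> homs (star s) (star t)"
  shows "transpose_mat T \<in> homs t s"
proof (rule homsI)
  note d = corepD(1)[OF t] corepD(1)[OF s] homsD(1,2)[OF T]
  define U where "U = transpose_mat T"
  have dU: "dim_row U = dim_row s" "dim_col U = dim_row t" using d by (auto simp: U_def)
  show "transpose_mat T \<in> carrier_mat (dim_row s) (dim_row t)" using d by auto
  have "transpose_mat (emb T * star s) = transpose_mat (star t * emb T)"
    using homsD(3)[OF T] by simp
  then have e: "antip s * emb U = emb U * antip t"
    using d by (simp add: transpose_emb_mult transpose_mult_emb star_def U_def)
  have "emb U * t = s * (antip s * emb U) * t"
    using d dU by (simp add: mat_assoc[symmetric] antip_inverse(1)[OF s])
  also have "\<dots> = s * emb U * (antip t * t)" unfolding e using d dU by (simp add: mat_assoc)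
  also have "\<dots> = s * emb U" using d dU by (simp add: antip_inverse(2)[OF t])
  finally show "emb (transpose_mat T) * t = s * emb (transpose_mat T)" by (simp add: U_def)
qed

lemma irr_star:
  assumes t: "irr t"
  shows "irr (star t)"
proof -
  note c = irr_corep[OF t]
  have "\<exists>c. T = c \<cdot>\<^sub>m 1\<^sub>m (dim_row (star t))" if T: "T \<in> homs (star t) (star t)" for T
  proof -
    obtain k where "transpose_mat T = k \<cdot>\<^sub>m 1\<^sub>m (dim_row t)"
      using t homs_star_rev[OF c c T] by (auto simp: irr_def)
    then have "transpose_mat (transpose_mat T) = k \<cdot>\<^sub>m 1\<^sub>m (dim_row t)"
      by (auto intro!: eq_matI)
    then show ?thesis using corepD(1)[OF c] by auto
  qed
  then show ?thesis using c corep_star[OF c] irr_pos[OF t] corepD(1)[OF c] by (simp add: irr_def)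
qed

lemma isom_star:
  assumes c: "corep t" "corep s" and "isom t s"
  shows "isom (star t) (star s)"
proof -
  obtain T U where TU: "T \<in> homs t s" "U \<in> homs s t" "T * U = 1\<^sub>m (dim_row s)" "U * T = 1\<^sub>m (dim_row t)"
    using isom_components[OF assms(3)] .
  have "transpose_mat U * transpose_mat T = transpose_mat (T * U)" "transpose_mat T * transpose_mat U = transpose_mat (U * T)"
    using transpose_mult[OF homsD(4)[OF TU(1)] homsD(4)[OF TU(2)]]
      transpose_mult[OF homsD(4)[OF TU(2)] homsD(4)[OF TU(1)]] by auto
  then have "transpose_mat U * transpose_mat T = 1\<^sub>m (dim_row (star s))" "transpose_mat T * transpose_mat U = 1\<^sub>m (dim_row (star t))"
    using TU corepD(1)[OF c(1)] corepD(1)[OF c(2)] by auto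
  then show ?thesis
    unfolding isom_def using homs_star[OF c(2,1) TU(2)] homs_star[OF c TU(1)] by blast
qed

text \<open>
  The values of the Haar functional on products of entries of \<open>t\<close> and of its dual; the choice of the row \<open>0\<close> is immaterial by
  \<open>haar_orthogonality\<close>.
\<close>

definition haar_form :: "'h mat \<Rightarrow> 'k mat" where
  "haar_form t = mat (dim_row t) (dim_row t) (\<lambda>(b,a). haar (t $$ (0,a) * S (t $$ (b,0))))"

text \<open>The average of an elementary matrix is an endomorphism of \<open>t\<close>, hence scalar.\<close>

lemma haar_orthogonality:
  assumes t: "irr t" and "i < dim_row t" "j < dim_row t" "a < dim_row t" "b < dim_row t"
  shows "haar (t $$ (i,a) * S (t $$ (b,j))) = (if i = j then haar_form t $$ (b,a) else 0)"
proof -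
  let ?n = "dim_row t"
  note c = irr_corep[OF t]
  define X where "X = mat ?n ?n (\<lambda>(k,l). if k = a \<and> l = b then 1 else (0::'k))"
  have X: "X \<in> carrier_mat ?n ?n" by (simp add: X_def)
  have av: "average t t X $$ (k,l) = haar (t $$ (k,a) * S (t $$ (b,l)))" if "k < ?n" "l < ?n" for k l
  proof -
    have "average t t X $$ (k,l) = (\<Sum>b'<?n. \<Sum>a'<?n. if a' = a then (if b' = b then haar (t $$ (k,a') * S (t $$ (b',l))) else 0) else 0)"
      unfolding average_index[OF c c X that] by (intro sum.cong refl) (simp add: X_def)
    then show ?thesis using assms by simp
  qed
  obtain k where k: "average t t X = k \<cdot>\<^sub>m 1\<^sub>m ?n"
    using t average_hom[OF c c X] by (auto simp: irr_def)
  have "average t t X $$ (i,j) = (if i = j then k else 0)" "average t t X $$ (0,0) = k"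
    unfolding k using assms irr_pos[OF t] by auto
  then show ?thesis using av[of i j] av[of 0 0] assms irr_pos[OF t] by (simp add: haar_form_def)
qed

lemma haar_form_hom:
  assumes t: "irr t"
  shows "haar_form t \<in> homs t (star (star t))"
proof -
  let ?n = "dim_row t"
  note c = irr_corep[OF t]
  have d: "dim_row (star (star t)) = ?n" "dim_col t = ?n" using corepD(1)[OF c] by auto
  define f where "f = (\<lambda>a b. haar_form t $$ (b,a))"
  have key: "(\<Sum>k<?n. \<Sum>l<?n. scale (f k l) (t $$ (k,a) * S (t $$ (b,l)))) = scale (f a b) 1"
    if "a < ?n" "b < ?n" for a b
    using haar_coefficients(2)[OF c c irr_pos[OF t] that irr_pos[OF t]] that irr_pos[OF t]
    by (simp add: haar_orthogonality[OF t] f_def)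
  have sb: "(\<Sum>b<?n. S (t $$ (b,l)) * S (S (t $$ (c,b)))) = (if l = c then 1 else 0)" if "l < ?n" "c < ?n" for l c
    using antip_inverse_index(1)[OF corep_star[OF irr_corep[OF t]], of l c] that d by simp
  have "(\<Sum>k<?n. scale (haar_form t $$ (c,k)) (t $$ (k,a))) = (\<Sum>k<?n. scale (haar_form t $$ (k,a)) (star (star t) $$ (c,k)))"
    if lt: "c < ?n" "a < ?n" for c a
  proof -
    have "(\<Sum>b<?n. scale (f a b) (S (S (t $$ (c,b))))) =
        (\<Sum>b<?n. (\<Sum>k<?n. \<Sum>l<?n. scale (f k l) (t $$ (k,a) * S (t $$ (b,l)))) * S (S (t $$ (c,b))))"
      using lt by (intro sum.cong refl) (simp add: key)
    also have "\<dots> = (\<Sum>b<?n. \<Sum>k<?n. \<Sum>l<?n. scale (f k l) (t $$ (k,a) * (S (t $$ (b,l)) * S (S (t $$ (c,b))))))"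
      by (simp add: sum_distrib_right scale_mult_left mult.assoc)
    also have "\<dots> = (\<Sum>k<?n. \<Sum>l<?n. scale (f k l) (t $$ (k,a) * (\<Sum>b<?n. S (t $$ (b,l)) * S (S (t $$ (c,b))))))"
      by (subst sum_rotate) (simp add: sum_distrib_left scale_sum_right)
    also have "\<dots> = (\<Sum>k<?n. scale (f k c) (t $$ (k,a)))"
      using lt by (intro sum.cong refl) (simp add: sb if_distrib[of "(*) _"] sum_collapse cong: if_cong)
    finally show ?thesis using lt d by (simp add: f_def)
  qed
  moreover have H: "haar_form t \<in> carrier_mat (dim_row (star (star t))) (dim_row t)"
    unfolding d(1) haar_form_def by simp
  ultimately show ?thesis
    unfolding homs_iff_index[OF c corep_star[OF corep_star[OF c]] H] d(1) by blast
qed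

text \<open>The trace collects a row of \<open>t S(t) = 1\<close>; so the form is nonzero, whatever the characteristic.\<close>

lemma haar_form_trace:
  assumes t: "irr t"
  shows "(\<Sum>a<dim_row t. haar_form t $$ (a,a)) = 1"
proof -
  have "(\<Sum>a<dim_row t. haar_form t $$ (a,a)) = haar (\<Sum>a<dim_row t. t $$ (0,a) * S (t $$ (a,0)))"
    by (simp add: haar_form_def haar_simps)
  then show ?thesis using antip_inverse_index(1)[OF irr_corep[OF t], of 0 0] irr_pos[OF t] haar(2) by simp
qed

lemma haar_form_invertible:
  assumes t: "irr t"
  obtains N where "N \<in> homs (star (star t)) t" "haar_form t * N = 1\<^sub>m (dim_row t)" "N * haar_form t = 1\<^sub>m (dim_row t)"
proof -
  have d: "dim_row (star (star t)) = dim_row t" using corepD(1)[OF irr_corep[OF t]] by simp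
  have "haar_form t \<noteq> 0\<^sub>m (dim_row (star (star t))) (dim_row t)"
  proof
    assume "haar_form t = 0\<^sub>m (dim_row (star (star t))) (dim_row t)"
    then have "(\<Sum>a<dim_row t. haar_form t $$ (a,a)) = 0" using d by simp
    then show False using haar_form_trace[OF t] by simp
  qed
  from schur_isom[OF t irr_star[OF irr_star[OF t]] haar_form_hom[OF t] this] show ?thesis
    using that d by metis
qed

lemma isom_star_star: "irr t \<Longrightarrow> isom t (star (star t))"
  unfolding isom_def using haar_form_hom haar_form_invertible corepD(1)[OF irr_corep] by (metis star_dim)

text \<open>A chosen representative of the isomorphism class, which depends only on the class.\<close>

definition can :: "'h mat \<Rightarrow> 'h mat" where
  "can t = (SOME s. irr s \<and> isom s t)"

lemma can: assumes "irr t" shows "irr (can t)" "isom (can t) t"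
proof -
  have "\<exists>s. irr s \<and> isom s t" using assms isom_refl[OF irr_corep[OF assms]] by blast
  from someI_ex[OF this] show "irr (can t)" "isom (can t) t" by (auto simp: can_def)
qed

lemma can_eqI: "irr t \<Longrightarrow> irr s \<Longrightarrow> isom t s \<Longrightarrow> can t = can s"
  unfolding can_def by (metis irr_corep isom_sym isom_trans)

lemma can_can: "irr t \<Longrightarrow> can (can t) = can t"
  by (rule can_eqI) (auto intro: can)

definition Irr :: "'h mat set" where "Irr = {t. irr t \<and> can t = t}"

lemma Irr_D: "t \<in> Irr \<Longrightarrow> irr t" "t \<in> Irr \<Longrightarrow> can t = t" "t \<in> Irr \<Longrightarrow> corep t"
  by (auto simp: Irr_def irr_corep)

lemma can_Irr: "irr t \<Longrightarrow> can t \<in> Irr" by (simp add: Irr_def can can_can)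

lemma hdim_Irr: "a \<in> Irr \<Longrightarrow> b \<in> Irr \<Longrightarrow> hdim a b = (if a = b then 1 else 0)"
  using hdim_irr_isom[of a b] hdim_irr_not_isom[of a b] can_eqI[of a b] isom_refl[of a] Irr_D by (metis (full_types))

inductive decomp :: "'h mat \<Rightarrow> 'h mat multiset \<Rightarrow> bool" where
  decomp_zero: "corep t \<Longrightarrow> dim_row t = 0 \<Longrightarrow> decomp t {#}"
| decomp_irr: "irr t \<Longrightarrow> decomp t {#can t#}"
| decomp_split: "splits t r s \<Longrightarrow> decomp r M \<Longrightarrow> decomp s N \<Longrightarrow> decomp t (M + N)"

lemma decomp_exists: "corep t \<Longrightarrow> \<exists>M. decomp t M"
proof (induction "dim_row t" arbitrary: t rule: less_induct)
  case less
  show ?case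
  proof (cases "dim_row t = 0 \<or> irr t")
    case True
    then show ?thesis using less.prems decomp_zero decomp_irr by blast
  next
    case False
    then obtain r s where rs: "splits t r s" "0 < dim_row r" "0 < dim_row s"
      using reducible_splits[OF less.prems] by auto
    then have "corep r" "corep s" "dim_row r < dim_row t" "dim_row s < dim_row t"
      using splits_dim[OF rs(1)] by (auto simp: splits_def)
    then show ?thesis using less.hyps decomp_split[OF rs(1)] by blast
  qed
qed

lemma decomp_corep: "decomp t M \<Longrightarrow> corep t"
  by (induction rule: decomp.induct) (auto simp: irr_corep splits_def)

lemma decomp_Irr: "decomp t M \<Longrightarrow> e \<in># M \<Longrightarrow> e \<in> Irr"
  by (induction rule: decomp.induct) (auto simp: can_Irr)

text \<open>An isomorphism invariant that is additive on direct sums is determined by its values on irreducibles.\<close>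

lemma decomp_sum:
  fixes F :: "'h mat \<Rightarrow> 'z::comm_monoid_add"
  assumes "decomp t M"
    and "\<And>t. corep t \<Longrightarrow> dim_row t = 0 \<Longrightarrow> F t = 0"
    and "\<And>t. irr t \<Longrightarrow> F t = F (can t)"
    and "\<And>t r s. splits t r s \<Longrightarrow> F t = F r + F s"
  shows "F t = (\<Sum>e\<in>#M. F e)"
  using assms(1) by (induction rule: decomp.induct) (auto simp: assms(2,4) intro: assms(3))

lemma hdim_decomp:
  assumes "decomp t M" "corep x"
  shows "hdim x t = (\<Sum>e\<in>#M. hdim x e)" "hdim t x = (\<Sum>e\<in>#M. hdim e x)"
  by (rule decomp_sum[OF assms(1)];
      use assms(2) hdim_degenerate hdim_splits_right hdim_splits_left hdim_isom_right hdim_isom_left can irr_corep isom_sym in metis)+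

text \<open>Multiplicities are dimensions of spaces of homomorphisms, so a decomposition is unique.\<close>

lemma hdim_count:
  assumes "decomp t M" "x \<in> Irr"
  shows "hdim x t = count M x" "hdim t x = count M x"
proof -
  have "(\<Sum>e\<in>#N. hdim x e) = count N x \<and> (\<Sum>e\<in>#N. hdim e x) = count N x" if "\<And>e. e \<in># N \<Longrightarrow> e \<in> Irr" for N
    using that by (induction N) (auto simp: hdim_Irr assms(2))
  then show "hdim x t = count M x" "hdim t x = count M x"
    using hdim_decomp[OF assms(1) Irr_D(3)[OF assms(2)]] decomp_Irr[OF assms(1)] by auto
qed

lemma decomp_unique: "decomp t M \<Longrightarrow> decomp t N \<Longrightarrow> M = N"
proof (rule multiset_eqI)
  fix x assume "decomp t M" "decomp t N"
  then show "count M x = count N x"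
    by (cases "x \<in> Irr") (metis hdim_count(1), metis decomp_Irr not_in_iff)
qed

definition dec :: "'h mat \<Rightarrow> 'h mat multiset" where "dec t = (THE M. decomp t M)"

lemma decomp_dec: "corep t \<Longrightarrow> decomp t (dec t)"
  unfolding dec_def using decomp_exists decomp_unique by (metis theI)

lemma dec_eq: "decomp t M \<Longrightarrow> dec t = M"
  using decomp_dec decomp_corep decomp_unique by blast

lemma dec_count: "corep t \<Longrightarrow> x \<in> Irr \<Longrightarrow> count (dec t) x = hdim x t" "corep t \<Longrightarrow> x \<in> Irr \<Longrightarrow> count (dec t) x = hdim t x"
  using hdim_count[OF decomp_dec] by simp_all

lemma dec_Irr: "corep t \<Longrightarrow> e \<in># dec t \<Longrightarrow> e \<in> Irr"
  using decomp_Irr[OF decomp_dec] .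

lemma dec_isom:
  assumes "corep t" "corep s" "isom t s"
  shows "dec t = dec s"
proof (rule multiset_eqI)
  fix x show "count (dec t) x = count (dec s) x"
  proof (cases "x \<in> Irr")
    case True
    then show ?thesis using assms hdim_isom_right[OF assms(1,2) Irr_D(3) assms(3)] by (simp add: dec_count(1))
  next
    case False
    then have "x \<notin># dec t" "x \<notin># dec s" using dec_Irr assms(1,2) by blast+
    then show ?thesis by (simp add: not_in_iff)
  qed
qed

lemma splits_corep: "splits t r s \<Longrightarrow> corep t \<and> corep r \<and> corep s"
  by (simp add: splits_def)

lemma dec_splits: "splits t r s \<Longrightarrow> dec t = dec r + dec s"
  using dec_eq[OF decomp_split[OF _ decomp_dec decomp_dec]] splits_corep by blast

lemma dec_degree: "corep t \<Longrightarrow> (\<Sum>e\<in>#dec t. dim_row e) = dim_row t"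
  by (rule decomp_sum[OF decomp_dec, symmetric]) (auto simp: splits_dim dest: can(2)[THEN isom_dim])

lemma splits_kron:
  assumes sp: "splits t r s" and x: "corep x"
  shows "splits (t \<boxtimes> x) (r \<boxtimes> x) (s \<boxtimes> x)" "splits (x \<boxtimes> t) (x \<boxtimes> r) (x \<boxtimes> s)"
proof -
  obtain B L B' L' where c: "corep t" "corep r" "corep s"
    and h: "B \<in> homs r t" "L \<in> homs t r" "B' \<in> homs s t" "L' \<in> homs t s"
    and e: "L * B = 1\<^sub>m (dim_row r)" "L' * B' = 1\<^sub>m (dim_row s)"
    "L * B' = 0\<^sub>m (dim_row r) (dim_row s)" "L' * B = 0\<^sub>m (dim_row s) (dim_row r)"
    "B * L + B' * L' = 1\<^sub>m (dim_row t)"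
    using split_components[OF sp] .
  note hc = h[THEN homsD(4)]
  let ?I = "1\<^sub>m (dim_row x) :: 'k mat"
  have I: "?I \<in> homs x x" and Ic: "?I \<in> carrier_mat (dim_row x) (dim_row x)" using homs_one[OF x] by auto
  note m1 = kron_mult[OF _ _ Ic Ic]
  have k1: "(P \<boxtimes> ?I) * (Q \<boxtimes> ?I) = (P * Q) \<boxtimes> ?I" if "P \<in> carrier_mat a b" "Q \<in> carrier_mat b d" for P Q :: "'k mat" and a b d
    by (subst kron_mult[OF that Ic Ic]) (auto simp: mult.commute)
  have k2: "(?I \<boxtimes> P) * (?I \<boxtimes> Q) = ?I \<boxtimes> (P * Q)" if "P \<in> carrier_mat a b" "Q \<in> carrier_mat b d" for P Q :: "'k mat" and a b d
    by (subst kron_mult[OF Ic Ic that]) (auto simp: mult.commute)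
  show "splits (t \<boxtimes> x) (r \<boxtimes> x) (s \<boxtimes> x)"
    unfolding splits_def
  proof (intro conjI corep_kron c x exI)
    show "B \<boxtimes> ?I \<in> homs (r \<boxtimes> x) (t \<boxtimes> x)" "L \<boxtimes> ?I \<in> homs (t \<boxtimes> x) (r \<boxtimes> x)"
      "B' \<boxtimes> ?I \<in> homs (s \<boxtimes> x) (t \<boxtimes> x)" "L' \<boxtimes> ?I \<in> homs (t \<boxtimes> x) (s \<boxtimes> x)"
      by (rule homs_kron c x h I)+
    show "(L \<boxtimes> ?I) * (B \<boxtimes> ?I) = 1\<^sub>m (dim_row (r \<boxtimes> x))" "(L' \<boxtimes> ?I) * (B' \<boxtimes> ?I) = 1\<^sub>m (dim_row (s \<boxtimes> x))"
      "(L \<boxtimes> ?I) * (B' \<boxtimes> ?I) = 0\<^sub>m (dim_row (r \<boxtimes> x)) (dim_row (s \<boxtimes> x))"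
      "(L' \<boxtimes> ?I) * (B \<boxtimes> ?I) = 0\<^sub>m (dim_row (s \<boxtimes> x)) (dim_row (r \<boxtimes> x))"
      by (simp_all add: k1[OF hc(2,1)] k1[OF hc(4,3)] k1[OF hc(2,3)] k1[OF hc(4,1)] e kron_one_one kron_zero_left)
    have "(B \<boxtimes> ?I) * (L \<boxtimes> ?I) + (B' \<boxtimes> ?I) * (L' \<boxtimes> ?I) = (B * L + B' * L') \<boxtimes> ?I"
      unfolding k1[OF hc(1,2)] k1[OF hc(3,4)]
      by (rule kron_add_left[symmetric]) (use hc in auto)
    then show "(B \<boxtimes> ?I) * (L \<boxtimes> ?I) + (B' \<boxtimes> ?I) * (L' \<boxtimes> ?I) = 1\<^sub>m (dim_row (t \<boxtimes> x))"
      by (simp add: e kron_one_one)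
  qed
  show "splits (x \<boxtimes> t) (x \<boxtimes> r) (x \<boxtimes> s)"
    unfolding splits_def
  proof (intro conjI corep_kron c x exI)
    show "?I \<boxtimes> B \<in> homs (x \<boxtimes> r) (x \<boxtimes> t)" "?I \<boxtimes> L \<in> homs (x \<boxtimes> t) (x \<boxtimes> r)"
      "?I \<boxtimes> B' \<in> homs (x \<boxtimes> s) (x \<boxtimes> t)" "?I \<boxtimes> L' \<in> homs (x \<boxtimes> t) (x \<boxtimes> s)"
      by (rule homs_kron c x h I)+
    show "(?I \<boxtimes> L) * (?I \<boxtimes> B) = 1\<^sub>m (dim_row (x \<boxtimes> r))" "(?I \<boxtimes> L') * (?I \<boxtimes> B') = 1\<^sub>m (dim_row (x \<boxtimes> s))"
      "(?I \<boxtimes> L) * (?I \<boxtimes> B') = 0\<^sub>m (dim_row (x \<boxtimes> r)) (dim_row (x \<boxtimes> s))"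
      "(?I \<boxtimes> L') * (?I \<boxtimes> B) = 0\<^sub>m (dim_row (x \<boxtimes> s)) (dim_row (x \<boxtimes> r))"
      by (simp_all add: k2[OF hc(2,1)] k2[OF hc(4,3)] k2[OF hc(2,3)] k2[OF hc(4,1)] e kron_one_one kron_zero_right)
    have "(?I \<boxtimes> B) * (?I \<boxtimes> L) + (?I \<boxtimes> B') * (?I \<boxtimes> L') = ?I \<boxtimes> (B * L + B' * L')"
      unfolding k2[OF hc(1,2)] k2[OF hc(3,4)]
      by (rule kron_add_right[symmetric]) (use hc in auto)
    then show "(?I \<boxtimes> B) * (?I \<boxtimes> L) + (?I \<boxtimes> B') * (?I \<boxtimes> L') = 1\<^sub>m (dim_row (x \<boxtimes> t))"
      by (simp add: e kron_one_one)
  qed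
qed

lemma isom_kron:
  assumes c: "corep t" "corep s" and x: "corep x" and i: "isom t s"
  shows "isom (t \<boxtimes> x) (s \<boxtimes> x)" "isom (x \<boxtimes> t) (x \<boxtimes> s)"
proof -
  obtain T U where TU: "T \<in> homs t s" "U \<in> homs s t" "T * U = 1\<^sub>m (dim_row s)" "U * T = 1\<^sub>m (dim_row t)"
    using isom_components[OF i] .
  let ?I = "1\<^sub>m (dim_row x) :: 'k mat"
  have I: "?I \<in> homs x x" and Ic: "?I \<in> carrier_mat (dim_row x) (dim_row x)" using homs_one[OF x] by auto
  note Tc = homsD(4)[OF TU(1)] and Uc = homsD(4)[OF TU(2)]
  have "(T \<boxtimes> ?I) * (U \<boxtimes> ?I) = (T * U) \<boxtimes> ?I" "(U \<boxtimes> ?I) * (T \<boxtimes> ?I) = (U * T) \<boxtimes> ?I"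
    "(?I \<boxtimes> T) * (?I \<boxtimes> U) = ?I \<boxtimes> (T * U)" "(?I \<boxtimes> U) * (?I \<boxtimes> T) = ?I \<boxtimes> (U * T)"
    using kron_mult[OF Tc Uc Ic Ic] kron_mult[OF Uc Tc Ic Ic] kron_mult[OF Ic Ic Tc Uc] kron_mult[OF Ic Ic Uc Tc]
    by (simp_all add: mult.commute)
  note m = this[unfolded TU(3,4) kron_one_one]
  show "isom (t \<boxtimes> x) (s \<boxtimes> x)"
    unfolding isom_def by (intro bexI[of _ "T \<boxtimes> ?I"] bexI[of _ "U \<boxtimes> ?I"] homs_kron c x TU I) (simp add: m)
  show "isom (x \<boxtimes> t) (x \<boxtimes> s)"
    unfolding isom_def by (intro bexI[of _ "?I \<boxtimes> T"] bexI[of _ "?I \<boxtimes> U"] homs_kron c x TU I) (simp add: m)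
qed

lemma dec_zero: "corep t \<Longrightarrow> dim_row t = 0 \<Longrightarrow> dec t = {#}"
  by (rule dec_eq, rule decomp_zero)

lemma dec_kron_left:
  assumes t: "corep t" and x: "corep x"
  shows "dec (t \<boxtimes> x) = (\<Sum>e\<in>#dec t. dec (e \<boxtimes> x))"
proof (rule decomp_sum[OF decomp_dec[OF t]])
  show "dec (r \<boxtimes> x) = 0" if "corep r" "dim_row r = 0" for r
    using dec_zero[OF corep_kron[OF that(1) x]] that by simp
  show "dec (r \<boxtimes> x) = dec (can r \<boxtimes> x)" if "irr r" for r
    using can[OF that] irr_corep[OF that] irr_corep[OF can(1)[OF that]] x
    by (intro dec_isom corep_kron isom_kron(1) isom_sym[OF can(2)] that)
qed (use dec_splits splits_kron(1)[OF _ x] in blast)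

lemma dec_kron_right:
  assumes t: "corep t" and x: "corep x"
  shows "dec (x \<boxtimes> t) = (\<Sum>e\<in>#dec t. dec (x \<boxtimes> e))"
proof (rule decomp_sum[OF decomp_dec[OF t]])
  show "dec (x \<boxtimes> r) = 0" if "corep r" "dim_row r = 0" for r
    using dec_zero[OF corep_kron[OF x that(1)]] that by simp
  show "dec (x \<boxtimes> r) = dec (x \<boxtimes> can r)" if "irr r" for r
    using can[OF that] irr_corep[OF that] irr_corep[OF can(1)[OF that]] x
    by (intro dec_isom corep_kron isom_kron(2) isom_sym[OF can(2)] that)
qed (use dec_splits splits_kron(2)[OF _ x] in blast)

end

lemma (in vector_space) independent_family:
  assumes P: "finite P" and z: "\<And>c. (\<Sum>p\<in>P. scale (c p) (v p)) = 0 \<Longrightarrow> \<forall>p\<in>P. c p = 0"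
  shows "inj_on v P" "independent (v ` P)"
proof -
  show inj: "inj_on v P"
  proof (rule inj_onI, rule ccontr)
    fix p q assume pq: "p \<in> P" "q \<in> P" "v p = v q" "p \<noteq> q"
    let ?c = "\<lambda>r. if r = p then 1 else if r = q then - 1 else (0::'a)"
    have "(\<Sum>r\<in>P. scale (?c r) (v r)) = (\<Sum>r\<in>{p,q}. scale (?c r) (v r))"
      by (rule sum.mono_neutral_right) (use P pq in auto)
    also have "\<dots> = 0" using pq by simp
    finally have "?c p = 0" using z[of ?c] pq by blast
    then show False by simp
  qed
  show "independent (v ` P)"
  proof (rule independent_if_scalars_zero)
    show "finite (v ` P)" using P by simp
    fix f x assume f: "(\<Sum>x\<in>v ` P. scale (f x) x) = 0" and x: "x \<in> v ` P"
    have "(\<Sum>p\<in>P. scale (f (v p)) (v p)) = 0" using f inj by (simp add: sum.reindex)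
    then show "f x = 0" using z[of "\<lambda>p. f (v p)"] x by auto
  qed
qed

lemma (in kspace) dual_functional:
  assumes "independent (v ` P)" "inj_on v P" "p \<in> P"
  obtains f where "linear_functional f" "\<And>q. q \<in> P \<Longrightarrow> f (v q) = (if q = p then 1 else 0)"
proof -
  interpret pr: vector_space_pair scale "(*)"
    using vector_space_axioms vector_space_field by (rule vector_space_pair.intro)
  let ?f = "pr.construct (v ` P) (\<lambda>x. if x = v p then 1 else 0)"
  show ?thesis
  proof (rule that[of ?f])
    show "linear_functional ?f" by (rule pr.linear_construct[OF assms(1)])
    fix q assume "q \<in> P"
    then show "?f (v q) = (if q = p then 1 else 0)"
      using pr.construct_basis[OF assms(1), of "v q"] assms(2,3) by (auto dest: inj_onD)
  qed
qed

lemma (in kspace) tensor_space_apply_not_bilinear: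
  assumes "t \<in> tensor_space UNIV UNIV" "\<not> bilinear_map (*) \<beta>"
  shows "t \<beta> = 0"
proof -
  obtain ps where "t = (\<Sum>(x, y)\<leftarrow>ps. x \<otimes>\<^sub>t y)" using assms(1) tensor_space_sum subspace_UNIV by metis
  moreover have "(\<Sum>(x, y)\<leftarrow>qs. x \<otimes>\<^sub>t y) \<beta> = 0" for qs
    using assms(2) by (induction qs) (auto simp: tensor_def)
  ultimately show ?thesis by simp
qed

context cosemisimple_hopf_algebra
begin

section \<open>Coefficient coalgebras\<close>

definition coeff :: "'h mat \<Rightarrow> 'h set" where
  "coeff t = span ((\<lambda>p. t $$ p) ` ({..<dim_row t} \<times> {..<dim_row t}))"

lemma coeff_subspace: "subspace (coeff t)" by (simp add: coeff_def)

lemma coeff_entry: "i < dim_row t \<Longrightarrow> j < dim_row t \<Longrightarrow> t $$ (i,j) \<in> coeff t"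
  unfolding coeff_def by (rule span_base) auto

lemma coeff_minimal:
  assumes "subspace V" "\<And>i j. i < dim_row t \<Longrightarrow> j < dim_row t \<Longrightarrow> t $$ (i,j) \<in> V"
  shows "coeff t \<subseteq> V"
  unfolding coeff_def by (rule span_minimal[OF _ assms(1)]) (use assms(2) in auto)

text \<open>
  Multiplying a linear relation by a coefficient of the dual and applying the Haar functional shows, by orthogonality, that the
  matrix of the relation is annihilated by the invertible matrix \<open>haar_form t\<close>.
\<close>

lemma irr_coefficients_independent:
  assumes t: "irr t" and x: "(\<Sum>p\<in>{..<dim_row t} \<times> {..<dim_row t}. scale (x p) (t $$ p)) = 0"
  shows "\<forall>p\<in>{..<dim_row t} \<times> {..<dim_row t}. x p = 0"
proof -
  let ?n = "dim_row t"
  define F where "F = haar_form t"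
  have F: "F \<in> carrier_mat ?n ?n" by (simp add: F_def haar_form_def)
  have dss: "dim_row (star (star t)) = ?n" using corepD(1)[OF irr_corep[OF t]] by simp
  obtain N where N: "N \<in> homs (star (star t)) t" "N * F = 1\<^sub>m ?n"
    using haar_form_invertible[OF t] unfolding F_def by metis
  have Nc: "N \<in> carrier_mat ?n ?n" using homsD(4)[OF N(1)] dss by simp
  define X where "X = mat ?n ?n x"
  have X: "X \<in> carrier_mat ?n ?n" by (simp add: X_def)
  have zero: "(\<Sum>j<?n. x (l,j) * F $$ (b,j)) = 0" if lb: "l < ?n" "b < ?n" for l b
  proof -
    have "0 = haar ((\<Sum>i<?n. \<Sum>j<?n. scale (x (i,j)) (t $$ (i,j))) * S (t $$ (b,l)))"
      using x by (simp add: sum.cartesian_product haar_simps)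
    also have "\<dots> = (\<Sum>i<?n. \<Sum>j<?n. x (i,j) * haar (t $$ (i,j) * S (t $$ (b,l))))"
      by (simp add: sum_distrib_right scale_mult_left haar_simps)
    also have "\<dots> = (\<Sum>i<?n. if i = l then (\<Sum>j<?n. x (i,j) * F $$ (b,j)) else 0)"
      using lb by (intro sum.cong refl) (simp add: haar_orthogonality[OF t] F_def)
    also have "\<dots> = (\<Sum>j<?n. x (l,j) * F $$ (b,j))" using lb by simp
    finally show ?thesis by simp
  qed
  have "X * transpose_mat F = 0\<^sub>m ?n ?n"
  proof (rule eq_matI)
    fix i j assume "i < dim_row (0\<^sub>m ?n ?n :: 'k mat)" "j < dim_col (0\<^sub>m ?n ?n :: 'k mat)"
    then have ij: "i < ?n" "j < ?n" by auto
    have "(X * transpose_mat F) $$ (i,j) = (\<Sum>k<?n. X $$ (i,k) * transpose_mat F $$ (k,j))"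
      by (rule mult_index[OF X _ ij]) (use F in simp)
    also have "\<dots> = (\<Sum>k<?n. x (i,k) * F $$ (j,k))" using F ij by (intro sum.cong refl) (simp add: X_def)
    also have "\<dots> = 0" by (rule zero[OF ij])
    finally show "(X * transpose_mat F) $$ (i,j) = (0\<^sub>m ?n ?n :: 'k mat) $$ (i,j)" using ij by simp
  qed (use X F in auto)
  moreover have "transpose_mat F * transpose_mat N = 1\<^sub>m ?n"
    using transpose_mult[OF Nc F] N(2) by simp
  moreover have "X * transpose_mat F * transpose_mat N = X * (transpose_mat F * transpose_mat N)"
    using X F Nc by (intro assoc_mult_mat) auto
  ultimately have "X = 0\<^sub>m ?n ?n" using X Nc by simp
  then show ?thesis by (auto simp: X_def dest: arg_cong[where f = "\<lambda>M. M $$ _"]) (metis index_mat(1) index_zero_mat(1))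
qed

lemma irr_coefficients:
  assumes t: "irr t"
  shows "inj_on (\<lambda>p. t $$ p) ({..<dim_row t} \<times> {..<dim_row t})"
    "independent ((\<lambda>p. t $$ p) ` ({..<dim_row t} \<times> {..<dim_row t}))"
  by (rule independent_family; use irr_coefficients_independent[OF t] in simp)+

lemma dim_coeff: "irr t \<Longrightarrow> dim (coeff t) = (dim_row t)\<^sup>2"
  unfolding coeff_def using dim_span_eq_card_independent[OF irr_coefficients(2)] card_image[OF irr_coefficients(1)]
  by (simp add: power2_eq_square)

lemma fin_dim_coeff: "fin_dim (coeff t)"
  unfolding fin_dim_def coeff_def
  by (rule exI[of _ "(\<lambda>p. t $$ p) ` ({..<dim_row t} \<times> {..<dim_row t})"]) simp

lemma slice_coeff:
  assumes t: "corep t" and f: "linear_functional f" and ij: "i < dim_row t" "j < dim_row t"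
  shows "slice_left f (\<Delta> (t $$ (i,j))) = (\<Sum>k<dim_row t. scale (f (t $$ (i,k))) (t $$ (k,j)))"
    "slice_right f (\<Delta> (t $$ (i,j))) = (\<Sum>k<dim_row t. scale (f (t $$ (k,j))) (t $$ (i,k)))"
  unfolding slice_left_def slice_right_def corepD(3)[OF t ij]
  by (rule tlift_sum_pure[OF bilinear_slice(2)[OF f]], rule tlift_sum_pure[OF bilinear_slice(1)[OF f]])

lemma subspace_comult_in: "subspace {h. \<Delta> h \<in> tensor_space A B}"
proof -
  interpret f: vector_space "fscale :: 'k \<Rightarrow> (('h \<Rightarrow> 'h \<Rightarrow> 'k) \<Rightarrow> 'k) \<Rightarrow> _"
    by (rule vector_space_fscale)
  show ?thesis
    by (rule subspaceI)
       (auto simp: comult_simps tensor_space_def f.span_zero f.span_add f.span_scale simp del: plus_fun_apply zero_fun_apply)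
qed

lemma coeff_subcoalgebra:
  assumes "corep t"
  shows "subcoalgebra (coeff t)"
proof -
  have "coeff t \<subseteq> {h. \<Delta> h \<in> tensor_space (coeff t) (coeff t)}"
    by (rule coeff_minimal[OF subspace_comult_in])
       (auto simp: corepD(3)[OF assms] intro!: sum_in_tensor_space tensor_in_tensor_space coeff_entry)
  then show ?thesis by (auto simp: subcoalgebra_def coeff_subspace)
qed

text \<open>
  Slicing \<open>\<Delta>\<close> of an element on both sides with dual basis functionals moves any of its coordinates to any
  place, so a nonzero element generates the whole coefficient coalgebra.
\<close>

lemma coeff_simple:
  assumes t: "irr t"
  shows "simple_subcoalgebra (coeff t)"
  unfolding simple_subcoalgebra_def
proof (intro conjI allI impI)
  let ?n = "dim_row t"
  let ?P = "{..<?n} \<times> {..<?n}"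
  note c = irr_corep[OF t]
  show "subcoalgebra (coeff t)" by (rule coeff_subcoalgebra[OF c])
  show "coeff t \<noteq> {0}"
  proof
    assume "coeff t = {0}"
    then have "t $$ (0,0) = 0" using coeff_entry[of 0 t 0] irr_pos[OF t] by simp
    then show False using corepD(4)[OF c irr_pos[OF t] irr_pos[OF t]] counit_simps(3) by simp
  qed
  fix D assume "subcoalgebra D \<and> D \<subseteq> coeff t"
  then have D: "subspace D" "\<And>d. d \<in> D \<Longrightarrow> \<Delta> d \<in> tensor_space D D" "D \<subseteq> coeff t"
    by (auto simp: subcoalgebraD)
  show "D = {0} \<or> D = coeff t"
  proof (cases "D = {0}")
    case False
    then obtain h where h: "h \<in> D" "h \<noteq> 0" using subspace_0[OF D(1)] by blast
    then have "h \<in> span ((\<lambda>p. t $$ p) ` ?P)" using D(3) by (auto simp: coeff_def)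
    then obtain u where "h = (\<Sum>v\<in>(\<lambda>p. t $$ p) ` ?P. scale (u v) v)"
      using span_finite[of "(\<lambda>p. t $$ p) ` ?P"] by auto
    then have hx: "h = (\<Sum>p\<in>?P. scale (u (t $$ p)) (t $$ p))"
      using irr_coefficients(1)[OF t] by (simp add: sum.reindex)
    define x where "x = (\<lambda>i j. u (t $$ (i,j)))"
    have hx': "h = (\<Sum>i<?n. \<Sum>j<?n. scale (x i j) (t $$ (i,j)))"
      by (simp add: hx sum.cartesian_product x_def split_beta')
    have "\<not> (\<forall>a<?n. \<forall>b<?n. x a b = 0)"
    proof
      assume "\<forall>a<?n. \<forall>b<?n. x a b = 0"
      then have "h = 0" unfolding hx' by simp
      then show False using h(2) by simp
    qed
    then obtain a b where ab: "a < ?n" "b < ?n" "x a b \<noteq> 0" by blast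
    have "t $$ (r,l) \<in> D" if rl: "r < ?n" "l < ?n" for r l
    proof -
      obtain f where f: "linear_functional f" "\<And>q. q \<in> ?P \<Longrightarrow> f (t $$ q) = (if q = (a,r) then 1 else 0)"
        using dual_functional[OF irr_coefficients(2,1)[OF t], of "(a,r)"] ab rl by auto
      obtain g where g: "linear_functional g" "\<And>q. q \<in> ?P \<Longrightarrow> g (t $$ q) = (if q = (l,b) then 1 else 0)"
        using dual_functional[OF irr_coefficients(2,1)[OF t], of "(l,b)"] ab rl by auto
      interpret lf: Vector_Spaces.linear scale scale "\<lambda>h. slice_left f (\<Delta> h)" by (rule linear_slice_comult(2)[OF f(1)])
      interpret lg: Vector_Spaces.linear scale scale "\<lambda>h. slice_right g (\<Delta> h)" by (rule linear_slice_comult(1)[OF g(1)])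
      have "slice_left f (\<Delta> h) = (\<Sum>i<?n. \<Sum>j<?n. scale (x i j) (\<Sum>k<?n. scale (f (t $$ (i,k))) (t $$ (k,j))))"
        unfolding hx' by (simp add: lf.sum lf.scale slice_coeff[OF c f(1)])
      also have "\<dots> = (\<Sum>i<?n. \<Sum>j<?n. if i = a then scale (x i j) (t $$ (r,j)) else 0)"
      proof (intro sum.cong refl)
        fix i j assume ij: "i \<in> {..<?n}" "j \<in> {..<?n}"
        have "(\<Sum>k<?n. scale (f (t $$ (i,k))) (t $$ (k,j))) = (\<Sum>k<?n. if k = r then (if i = a then t $$ (k,j) else 0) else 0)"
          using ij by (intro sum.cong refl) (simp add: f(2))
        then show "scale (x i j) (\<Sum>k<?n. scale (f (t $$ (i,k))) (t $$ (k,j))) = (if i = a then scale (x i j) (t $$ (r,j)) else 0)"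
          using rl by simp
      qed
      also have "\<dots> = (\<Sum>j<?n. scale (x a j) (t $$ (r,j)))"
        using ab by (subst sum.swap) simp
      finally have h1: "(\<Sum>j<?n. scale (x a j) (t $$ (r,j))) \<in> D"
        using slice_in(2)[OF f(1) D(1,1) D(2)[OF h(1)]] by simp
      have "slice_right g (\<Delta> (\<Sum>j<?n. scale (x a j) (t $$ (r,j)))) = (\<Sum>j<?n. scale (x a j) (\<Sum>k<?n. scale (g (t $$ (k,j))) (t $$ (r,k))))"
        using rl by (simp add: lg.sum lg.scale slice_coeff[OF c g(1)])
      also have "\<dots> = (\<Sum>j<?n. if j = b then scale (x a j) (t $$ (r,l)) else 0)"
      proof (intro sum.cong refl)
        fix j assume j: "j \<in> {..<?n}"
        have "(\<Sum>k<?n. scale (g (t $$ (k,j))) (t $$ (r,k))) = (\<Sum>k<?n. if k = l then (if j = b then t $$ (r,k) else 0) else 0)"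
          using j by (intro sum.cong refl) (simp add: g(2))
        then show "scale (x a j) (\<Sum>k<?n. scale (g (t $$ (k,j))) (t $$ (r,k))) = (if j = b then scale (x a j) (t $$ (r,l)) else 0)"
          using rl by simp
      qed
      also have "\<dots> = scale (x a b) (t $$ (r,l))" using ab by simp
      finally have "scale (x a b) (t $$ (r,l)) \<in> D"
        using slice_in(1)[OF g(1) D(1,1) D(2)[OF h1]] by simp
      from subspace_scale[OF D(1) this, of "1 / x a b"] show ?thesis using ab by simp
    qed
    then have "coeff t \<subseteq> D" by (rule coeff_minimal[OF D(1)])
    then show ?thesis using D(3) by blast
  qed simp
qed

lemma sandwich_entry_coeff:
  assumes s: "dim_col s = dim_row s" and P: "dim_col P = dim_row s" and Q: "dim_row Q = dim_row s"
    and ij: "i < dim_row P" "j < dim_col Q"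
  shows "(emb P * s * emb Q) $$ (i,j) \<in> coeff s"
proof -
  have "(emb P * s * emb Q) $$ (i,j) = (\<Sum>l<dim_row Q. scale (Q $$ (l,j)) ((emb P * s) $$ (i,l)))"
    by (rule mult_emb_index) (use assms in auto)
  also have "\<dots> = (\<Sum>l<dim_row Q. scale (Q $$ (l,j)) (\<Sum>k<dim_row s. scale (P $$ (i,k)) (s $$ (k,l))))"
    using assms by (intro sum.cong refl arg_cong2[of _ _ _ _ scale] emb_mult_index) auto
  also have "\<dots> \<in> coeff s"
    using Q by (intro subspace_sum[OF coeff_subspace] subspace_scale[OF coeff_subspace] coeff_entry) auto
  finally show ?thesis .
qed

lemma coeff_sub:
  assumes c: "corep t" "corep s" and B: "B \<in> homs s t" and L: "L \<in> homs t s" and LB: "L * B = 1\<^sub>m (dim_row s)"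
  shows "coeff s \<subseteq> coeff t"
proof (rule coeff_minimal[OF coeff_subspace])
  fix i j assume ij: "i < dim_row s" "j < dim_row s"
  note d = corepD(1)[OF c(1)] corepD(1)[OF c(2)] homsD(1,2)[OF B] homsD(1,2)[OF L]
  have "emb L * t * emb B = (emb L * emb B) * s" using d homsD(3)[OF B] by (simp add: mat_assoc)
  also have "emb L * emb B = 1\<^sub>m (dim_row s)" using d LB by (metis emb_mult emb_one)
  finally have "emb L * t * emb B = s" using d by simp
  then show "s $$ (i,j) \<in> coeff t" using sandwich_entry_coeff[of t L B i j] d ij by simp
qed

lemma coeff_isom:
  assumes c: "corep t" "corep s" and i: "isom t s"
  shows "coeff t = coeff s"
proof -
  obtain T U where TU: "T \<in> homs t s" "U \<in> homs s t" "T * U = 1\<^sub>m (dim_row s)" "U * T = 1\<^sub>m (dim_row t)"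
    using isom_components[OF i] .
  show ?thesis using coeff_sub[OF c TU(2,1,3)] coeff_sub[OF c(2,1) TU(1,2,4)] by blast
qed

lemma coeff_splits:
  assumes sp: "splits t r s"
  shows "coeff t = coeff r + coeff s"
proof -
  obtain B L B' L' where c: "corep t" "corep r" "corep s"
    and h: "B \<in> homs r t" "L \<in> homs t r" "B' \<in> homs s t" "L' \<in> homs t s"
    and e: "L * B = 1\<^sub>m (dim_row r)" "L' * B' = 1\<^sub>m (dim_row s)"
    "L * B' = 0\<^sub>m (dim_row r) (dim_row s)" "L' * B = 0\<^sub>m (dim_row s) (dim_row r)"
    "B * L + B' * L' = 1\<^sub>m (dim_row t)"
    using split_components[OF sp] .
  note d = corepD(1)[OF c(1)] corepD(1)[OF c(2)] corepD(1)[OF c(3)] h[THEN homsD(1)] h[THEN homsD(2)]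
  have sub: "coeff r \<subseteq> coeff t" "coeff s \<subseteq> coeff t" by (rule coeff_sub c h e)+
  have sumsub: "subspace (coeff r + coeff s)"
  proof -
    have "coeff r + coeff s = {x + y | x y. x \<in> coeff r \<and> y \<in> coeff s}" by (auto simp: set_plus_def)
    then show ?thesis using subspace_sums[OF coeff_subspace coeff_subspace, of r s] by simp
  qed
  show ?thesis
  proof
    show "coeff r + coeff s \<subseteq> coeff t"
      using sub by (auto simp: set_plus_def intro!: subspace_add[OF coeff_subspace])
    show "coeff t \<subseteq> coeff r + coeff s"
    proof (rule coeff_minimal[OF sumsub])
      fix i j assume ij: "i < dim_row t" "j < dim_row t"
      have "t = emb (B * L + B' * L') * t" using d by (simp add: e(5))
      also have "\<dots> = (emb B * emb L + emb B' * emb L') * t"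
        using d by (simp add: emb_add emb_mult)
      also have "\<dots> = emb B * emb L * t + emb B' * emb L' * t"
        by (rule add_mult_distrib_mat[of _ "dim_row t" "dim_row t" _ _ "dim_row t"]) (use d in auto)
      also have "emb B * emb L * t = emb B * r * emb L" using d homsD(3)[OF h(2)] by (simp add: mat_assoc)
      also have "emb B' * emb L' * t = emb B' * s * emb L'" using d homsD(3)[OF h(4)] by (simp add: mat_assoc)
      finally have "t $$ (i,j) = (emb B * r * emb L + emb B' * s * emb L') $$ (i,j)" by simp
      then have "t $$ (i,j) = (emb B * r * emb L) $$ (i,j) + (emb B' * s * emb L') $$ (i,j)"
        using d ij by (simp del: index_mult_mat(1))
      moreover have "(emb B * r * emb L) $$ (i,j) \<in> coeff r" "(emb B' * s * emb L') $$ (i,j) \<in> coeff s"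
        using d ij by (intro sandwich_entry_coeff; simp)+
      ultimately show "t $$ (i,j) \<in> coeff r + coeff s" by (auto simp: set_plus_def)
    qed
  qed
qed

lemma coeff_dec:
  assumes t: "corep t"
  shows "coeff t = (\<Sum>e\<in>#dec t. coeff e)"
proof (rule decomp_sum[OF decomp_dec[OF t]])
  show "coeff r = 0" if "dim_row r = 0" for r using that by (simp add: coeff_def set_zero)
  show "coeff r = coeff (can r)" if "irr r" for r
    using coeff_isom[OF irr_corep[OF can(1)] irr_corep can(2)] that by simp
qed (rule coeff_splits)

lemma coeff_kron:
  assumes t: "corep t" and s: "corep s"
  shows "coeff (t \<boxtimes> s) = coeff t \<cdot> coeff s"
proof
  have *: "(t \<boxtimes> s) $$ (i,j) = t $$ (i div dim_row s, j div dim_row s) * s $$ (i mod dim_row s, j mod dim_row s)"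
    if "i < dim_row t * dim_row s" "j < dim_row t * dim_row s" for i j
    using kron_index[OF corepD(2)[OF t] corepD(2)[OF s] that] .
  show "coeff (t \<boxtimes> s) \<subseteq> coeff t \<cdot> coeff s"
  proof (rule coeff_minimal)
    show "subspace (coeff t \<cdot> coeff s)" by (simp add: subspace_prod_def)
    fix i j assume "i < dim_row (t \<boxtimes> s)" "j < dim_row (t \<boxtimes> s)"
    then have ij: "i < dim_row t * dim_row s" "j < dim_row t * dim_row s" by auto
    show "(t \<boxtimes> s) $$ (i,j) \<in> coeff t \<cdot> coeff s"
      unfolding *[OF ij] subspace_prod_def
      by (rule span_base) (use div_mod_lt[OF ij(1)] div_mod_lt[OF ij(2)] coeff_entry in blast)
  qed
  have entry: "t $$ (i,j) * s $$ (k,l) \<in> coeff (t \<boxtimes> s)"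
    if "i < dim_row t" "j < dim_row t" "k < dim_row s" "l < dim_row s" for i j k l
    using coeff_entry[of "i * dim_row s + k" "t \<boxtimes> s" "j * dim_row s + l"] kron_pair_index[OF t s] that
    by (simp add: pair_index_lt)
  have 1: "coeff s \<subseteq> {b. t $$ (i,j) * b \<in> coeff (t \<boxtimes> s)}" if "i < dim_row t" "j < dim_row t" for i j
    by (rule coeff_minimal[OF subspaceI])
       (use that entry coeff_subspace subspace_0 subspace_add subspace_scale in \<open>auto simp: distrib_left scale_mult_right\<close>)
  have "coeff t \<subseteq> {a. a * b \<in> coeff (t \<boxtimes> s)}" if "b \<in> coeff s" for b
    by (rule coeff_minimal[OF subspaceI])
       (use that 1 coeff_subspace subspace_0 subspace_add subspace_scale in \<open>auto simp: distrib_right scale_mult_left\<close>)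
  then show "coeff t \<cdot> coeff s \<subseteq> coeff (t \<boxtimes> s)"
    unfolding subspace_prod_def by (intro span_minimal coeff_subspace) auto
qed

lemma bilinear_tensor3_comult:
  "bilinear_map fscale (\<lambda>a b. tensor3 a b y)" "bilinear_map fscale (\<lambda>a b. tensor3 x a b)"
  "bilinear_map fscale (\<lambda>x y. tlift (\<lambda>a b. tensor3 a b y) (\<Delta> x))"
  "bilinear_map fscale (\<lambda>x y. tlift (\<lambda>a b. tensor3 x a b) (\<Delta> y))"
proof -
  note tr = trilinear_mapD[OF trilinear_map_tensor3]
  interpret f: vector_space "fscale :: 'k \<Rightarrow> (('h \<Rightarrow> 'h \<Rightarrow> 'h \<Rightarrow> 'k) \<Rightarrow> 'k) \<Rightarrow> _"
    by (rule vector_space_fscale)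
  show b1: "bilinear_map fscale (\<lambda>a b. tensor3 a b y)" for y
    by (rule bilinear_mapI[OF vector_space_fscale]) (rule tr)+
  show b2: "bilinear_map fscale (\<lambda>a b. tensor3 x a b)" for x
    by (rule bilinear_mapI[OF vector_space_fscale]) (rule tr)+
  have l1: "(\<Sum>(a,b)\<leftarrow>ps. tensor3 a b (y + y')) = (\<Sum>(a,b)\<leftarrow>ps. tensor3 a b y) + (\<Sum>(a,b)\<leftarrow>ps. tensor3 a b y')"
    "(\<Sum>(a,b)\<leftarrow>ps. tensor3 a b (scale c y)) = fscale c (\<Sum>(a,b)\<leftarrow>ps. tensor3 a b y)"
    "(\<Sum>(a,b)\<leftarrow>ps. tensor3 (y + y') a b) = (\<Sum>(a,b)\<leftarrow>ps. tensor3 y a b) + (\<Sum>(a,b)\<leftarrow>ps. tensor3 y' a b)"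
    "(\<Sum>(a,b)\<leftarrow>ps. tensor3 (scale c y) a b) = fscale c (\<Sum>(a,b)\<leftarrow>ps. tensor3 y a b)"
    for ps :: "('h \<times> 'h) list" and y y' c
    by (induction ps; auto simp: tr add_ac f.scale_right_distrib fscale_zero simp del: plus_fun_apply)+
  have ex: "\<exists>ps. \<Delta> x = (\<Sum>(a, b)\<leftarrow>ps. a \<otimes>\<^sub>t b)" for x using comult_sum by metis
  show "bilinear_map fscale (\<lambda>x y. tlift (\<lambda>a b. tensor3 a b y) (\<Delta> x))"
  proof (rule bilinear_mapI[OF vector_space_fscale])
    fix x x' y y' c
    note lin = linear_tlift_comult[OF b1, unfolded Vector_Spaces.linear_iff]
    show "tlift (\<lambda>a b. tensor3 a b y) (\<Delta> (x + x')) = tlift (\<lambda>a b. tensor3 a b y) (\<Delta> x) + tlift (\<lambda>a b. tensor3 a b y) (\<Delta> x')"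
      "tlift (\<lambda>a b. tensor3 a b y) (\<Delta> (scale c x)) = fscale c (tlift (\<lambda>a b. tensor3 a b y) (\<Delta> x))"
      using lin by blast+
    obtain ps where ps: "\<Delta> x = (\<Sum>(a, b)\<leftarrow>ps. a \<otimes>\<^sub>t b)" using ex by blast
    show "tlift (\<lambda>a b. tensor3 a b (y + y')) (\<Delta> x) = tlift (\<lambda>a b. tensor3 a b y) (\<Delta> x) + tlift (\<lambda>a b. tensor3 a b y') (\<Delta> x)"
      "tlift (\<lambda>a b. tensor3 a b (scale c y)) (\<Delta> x) = fscale c (tlift (\<lambda>a b. tensor3 a b y) (\<Delta> x))"
      unfolding ps tlift_sum_tensor[OF b1] by (rule l1)+
  qed
  show "bilinear_map fscale (\<lambda>x y. tlift (\<lambda>a b. tensor3 x a b) (\<Delta> y))"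
  proof (rule bilinear_mapI[OF vector_space_fscale])
    fix x x' y y' c
    note lin = linear_tlift_comult[OF b2, unfolded Vector_Spaces.linear_iff]
    show "tlift (\<lambda>a b. tensor3 x a b) (\<Delta> (y + y')) = tlift (\<lambda>a b. tensor3 x a b) (\<Delta> y) + tlift (\<lambda>a b. tensor3 x a b) (\<Delta> y')"
      "tlift (\<lambda>a b. tensor3 x a b) (\<Delta> (scale c y)) = fscale c (tlift (\<lambda>a b. tensor3 x a b) (\<Delta> y))"
      using lin by blast+
    obtain ps where ps: "\<Delta> y = (\<Sum>(a, b)\<leftarrow>ps. a \<otimes>\<^sub>t b)" using ex by blast
    show "tlift (\<lambda>a b. tensor3 (x + x') a b) (\<Delta> y) = tlift (\<lambda>a b. tensor3 x a b) (\<Delta> y) + tlift (\<lambda>a b. tensor3 x' a b) (\<Delta> y)"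
      "tlift (\<lambda>a b. tensor3 (scale c x) a b) (\<Delta> y) = fscale c (tlift (\<lambda>a b. tensor3 x a b) (\<Delta> y))"
      unfolding ps tlift_sum_tensor[OF b2] by (rule l1)+
  qed
qed

text \<open>
  In a basis \<open>e\<close> of a finite-dimensional subcoalgebra write \<open>\<Delta> (e j)\<close> as the sum of the \<open>e i \<otimes> t i j\<close>. Evaluating both
  sides of coassociativity at the trilinear forms \<open>\<phi> m \<cdot> \<beta>\<close>, where \<open>\<phi>\<close> is the dual basis, shows that \<open>t\<close> is a
  matrix comodule.
\<close>

lemma simple_subcoalgebra_irr:
  assumes C: "simple_subcoalgebra C" and d0: "dim C \<noteq> 0"
  obtains t where "t \<in> Irr" "coeff t = C"
proof -
  have sC: "subspace C" "\<And>h. h \<in> C \<Longrightarrow> \<Delta> h \<in> tensor_space C C" using C by (auto simp: simple_subcoalgebra_def subcoalgebra_def)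
  obtain B where B: "B \<subseteq> C" "independent B" "C \<subseteq> span B" "card B = dim C" using basis_exists by blast
  have "finite B" using B(4) d0 card.infinite by fastforce
  define N where "N = dim C"
  obtain e where e: "bij_betw e {..<N} B"
    using ex_bij_betw_nat_finite[OF \<open>finite B\<close>] B(4) by (auto simp: N_def atLeast0LessThan)
  have eB: "e ` {..<N} = B" "inj_on e {..<N}" using e by (auto simp: bij_betw_def)
  have eC: "e i \<in> C" if "i < N" for i using that eB B(1) by blast
  have "\<forall>i. \<exists>f. i < N \<longrightarrow> linear_functional f \<and> (\<forall>j<N. f (e j) = (if j = i then 1 else 0))"
  proof
    fix i
    show "\<exists>f. i < N \<longrightarrow> linear_functional f \<and> (\<forall>j<N. f (e j) = (if j = i then 1 else 0))"
      using dual_functional[of e "{..<N}" i] B(2) eB by (metis lessThan_iff)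
  qed
  then obtain \<phi> where \<phi>: "\<And>i. i < N \<Longrightarrow> linear_functional (\<phi> i)"
    "\<And>i j. i < N \<Longrightarrow> j < N \<Longrightarrow> \<phi> i (e j) = (if j = i then 1 else 0)" by metis
  have expand: "(\<Sum>i<N. scale (\<phi> i x) (e i)) = x" if "x \<in> C" for x
  proof -
    have "x \<in> span (e ` {..<N})" using that B(3) eB by auto
    then obtain u where "x = (\<Sum>v\<in>e ` {..<N}. scale (u v) v)" using span_finite[of "e ` {..<N}"] by auto
    then have x: "x = (\<Sum>i<N. scale (u (e i)) (e i))" using eB(2) by (simp add: sum.reindex)
    have "\<phi> i x = u (e i)" if i: "i < N" for i
    proof -
      have "\<phi> i x = (\<Sum>j<N. if j = i then u (e j) else 0)"
        unfolding x using i by (simp add: linear_functionalD[OF \<phi>(1)] \<phi>(2) if_distrib[of "(*) _"] cong: if_cong)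
      then show ?thesis using i by simp
    qed
    then show ?thesis using x by simp
  qed
  define t where "t = mat N N (\<lambda>(i,j). slice_left (\<phi> i) (\<Delta> (e j)))"
  have tc: "t \<in> carrier_mat N N" by (simp add: t_def)
  have tC: "t $$ (i,j) \<in> C" if "i < N" "j < N" for i j
    using slice_in(2)[OF \<phi>(1) sC(1,1) sC(2)[OF eC]] that by (simp add: t_def)
  have De: "\<Delta> (e j) = (\<Sum>i<N. e i \<otimes>\<^sub>t t $$ (i,j))" if j: "j < N" for j
  proof -
    obtain ps where ps: "\<Delta> (e j) = (\<Sum>(x, y)\<leftarrow>ps. x \<otimes>\<^sub>t y)" "set ps \<subseteq> C \<times> C"
      using tensor_space_sum[OF sC(2)[OF eC[OF j]] sC(1)] .
    have *: "(\<Sum>(x, y)\<leftarrow>qs. x \<otimes>\<^sub>t y) = (\<Sum>i<N. e i \<otimes>\<^sub>t (\<Sum>(x, y)\<leftarrow>qs. scale (\<phi> i x) y))" if "set qs \<subseteq> C \<times> C" for qs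
      using that
    proof (induction qs)
      case Nil
      have "e i \<otimes>\<^sub>t 0 = 0" for i using bilinear_map_zero(2)[OF bilinear_map_tensor] .
      then show ?case by (simp del: zero_fun_apply)
    next
      case (Cons q qs)
      obtain x y where q: "q = (x,y)" by (cases q)
      then have x: "x \<in> C" using Cons.prems by auto
      have "x \<otimes>\<^sub>t y = (\<Sum>i<N. scale (\<phi> i x) (e i)) \<otimes>\<^sub>t y" using expand[OF x] by simp
      also have "\<dots> = (\<Sum>i<N. e i \<otimes>\<^sub>t scale (\<phi> i x) y)" by (simp add: tensor_sum tensor_simps)
      finally show ?case using Cons by (simp add: q tensor_simps sum.distrib del: plus_fun_apply)
    qed
    have "slice_left (\<phi> i) (\<Delta> (e j)) = (\<Sum>(x, y)\<leftarrow>ps. scale (\<phi> i x) y)" if "i < N" for i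
      unfolding slice_left_def ps(1) by (rule tlift_sum_tensor[OF bilinear_slice(2)[OF \<phi>(1)[OF that]]])
    then show ?thesis using *[OF ps(2)] ps(1) j by (simp add: t_def)
  qed
  have t: "corep t"
  proof (rule corepI[OF tc])
    fix m j assume m: "m < N" and j: "j < N"
    show "\<Delta> (t $$ (m,j)) = (\<Sum>k<N. t $$ (m,k) \<otimes>\<^sub>t t $$ (k,j))"
    proof
      fix \<beta> :: "'h \<Rightarrow> 'h \<Rightarrow> 'k"
      show "\<Delta> (t $$ (m,j)) \<beta> = (\<Sum>k<N. t $$ (m,k) \<otimes>\<^sub>t t $$ (k,j)) \<beta>"
      proof (cases "bilinear_map (*) \<beta>")
        case False
        then show ?thesis
          using tensor_space_apply_not_bilinear[OF comult_in_tensor False]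
          by (simp add: sum_fun_apply tensor_def)
      next
        case True
        define \<tau> where "\<tau> = (\<lambda>a b c. \<phi> m a * \<beta> b c)"
        have if_mult: "(if P then 1 else 0) * x = (if P then x else (0::'k))" for P x by simp
        have tri: "trilinear_map (*) \<tau>"
          unfolding trilinear_map_def \<tau>_def
          by (auto simp: Vector_Spaces.linear_iff vector_space_axioms vector_space_field
              linear_functionalD[OF \<phi>(1)[OF m]] bilinear_mapD[OF True] algebra_simps)
        have t3: "tensor3 a b c \<tau> = \<phi> m a * \<beta> b c" for a b c using tri by (simp add: tensor3_def \<tau>_def)
        have "tlift (\<lambda>x y. tlift (\<lambda>a b. tensor3 a b y) (\<Delta> x)) (\<Delta> (e j)) = (\<Sum>i<N. \<Sum>l<N. tensor3 (e l) (t $$ (l,i)) (t $$ (i,j)))"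
          using j by (simp add: De tlift_sum_pure[OF bilinear_tensor3_comult(3)] tlift_sum_pure[OF bilinear_tensor3_comult(1)])
        then have "tlift (\<lambda>x y. tlift (\<lambda>a b. tensor3 a b y) (\<Delta> x)) (\<Delta> (e j)) \<tau> =
            (\<Sum>i<N. \<Sum>l<N. if l = m then \<beta> (t $$ (l,i)) (t $$ (i,j)) else 0)"
          using m by (auto simp: sum_fun_apply t3 \<phi>(2) if_mult intro!: sum.cong)
        then have lhs: "tlift (\<lambda>x y. tlift (\<lambda>a b. tensor3 a b y) (\<Delta> x)) (\<Delta> (e j)) \<tau> = (\<Sum>i<N. \<beta> (t $$ (m,i)) (t $$ (i,j)))"
          using m by simp
        have inner: "tlift (\<lambda>a b. tensor3 x a b) (\<Delta> h) \<tau> = \<phi> m x * \<Delta> h \<beta>" for x h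
        proof -
          obtain ps where ps: "\<Delta> h = (\<Sum>(a, b)\<leftarrow>ps. a \<otimes>\<^sub>t b)" using comult_sum by metis
          have "(\<Sum>(a, b)\<leftarrow>qs. tensor3 x a b) \<tau> = \<phi> m x * (\<Sum>(a, b)\<leftarrow>qs. a \<otimes>\<^sub>t b) \<beta>" for qs
            using True by (induction qs) (auto simp: t3 tensor_def distrib_left)
          then show ?thesis unfolding ps tlift_sum_tensor[OF bilinear_tensor3_comult(2)] .
        qed
        have "tlift (\<lambda>x y. tlift (\<lambda>a b. tensor3 x a b) (\<Delta> y)) (\<Delta> (e j)) = (\<Sum>l<N. tlift (\<lambda>a b. tensor3 (e l) a b) (\<Delta> (t $$ (l,j))))"
          using j by (simp add: De tlift_sum_pure[OF bilinear_tensor3_comult(4)])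
        then have "tlift (\<lambda>x y. tlift (\<lambda>a b. tensor3 x a b) (\<Delta> y)) (\<Delta> (e j)) \<tau> = (\<Sum>l<N. if l = m then \<Delta> (t $$ (l,j)) \<beta> else 0)"
          using m by (auto simp: sum_fun_apply inner \<phi>(2) if_mult intro!: sum.cong)
        then have "\<Delta> (t $$ (m,j)) \<beta> = (\<Sum>i<N. \<beta> (t $$ (m,i)) (t $$ (i,j)))"
          using m lhs coassoc[of "e j"] by simp
        then show ?thesis using True by (simp add: sum_fun_apply tensor_def)
      qed
    qed
    have "e j = tlift (\<lambda>x y. scale (\<epsilon> y) x) (\<Delta> (e j))" by (rule counit_right[symmetric])
    also have "\<dots> = (\<Sum>i<N. scale (\<epsilon> (t $$ (i,j))) (e i))"
      unfolding De[OF j] by (rule tlift_sum_pure[OF bilinear_slice(1)[OF counit_linear]])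
    finally have "\<phi> m (e j) = \<phi> m (\<Sum>i<N. scale (\<epsilon> (t $$ (i,j))) (e i))" by simp
    also have "\<dots> = (\<Sum>i<N. if i = m then \<epsilon> (t $$ (i,j)) else 0)"
      using m by (simp add: linear_functionalD[OF \<phi>(1)] \<phi>(2) if_distrib[of "(*) _"] cong: if_cong)
    finally show "\<epsilon> (t $$ (m,j)) = (if m = j then 1 else 0)" using m j \<phi>(2) by auto
  qed
  have dt: "dim_row t = N" by (simp add: t_def)
  have "coeff t \<subseteq> C" by (rule coeff_minimal[OF sC(1)]) (use tC dt in auto)
  moreover have "N \<noteq> 0" using d0 by (simp add: N_def)
  then have "dec t \<noteq> {#}" using dec_degree[OF t] dt by auto
  then obtain x M where x: "dec t = add_mset x M" by (meson multiset_cases)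
  have xI: "x \<in> Irr" using dec_Irr[OF t, of x] x by simp
  have sum0: "0 \<in> (\<Sum>y\<in>#K. coeff y)" for K
    by (induction K) (use set_plus_intro[OF subspace_0[OF coeff_subspace]] in \<open>fastforce simp: set_zero\<close>)+
  have "coeff x \<subseteq> coeff t"
  proof
    fix h assume h: "h \<in> coeff x"
    have "h + 0 \<in> coeff x + (\<Sum>y\<in>#M. coeff y)" by (rule set_plus_intro[OF h sum0])
    then show "h \<in> coeff t" using coeff_dec[OF t] x by simp
  qed
  ultimately have "coeff x \<subseteq> C" by blast
  then have "coeff x = C"
    using C coeff_simple[OF Irr_D(1)[OF xI]] unfolding simple_subcoalgebra_def by blast
  then show ?thesis using that xI by blast
qed

end

section \<open>Fusion rules with odd degrees\<close>

text \<open>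
  The combinatorial structure of the irreducible comodules of \<open>H\<close> with tensor product and duality. The last axiom says that finite
  groups of elements of degree \<open>1\<close> have order prime to \<open>6\<close>.
\<close>

locale odd_fusion_rules =
  fixes Irr :: "'i set" and one :: 'i and dual :: "'i \<Rightarrow> 'i" and deg :: "'i \<Rightarrow> nat"
    and mul :: "'i \<Rightarrow> 'i \<Rightarrow> 'i multiset" (infixl \<open>\<star>\<close> 72)
  assumes one_in: "one \<in> Irr"
    and dual_in: "a \<in> Irr \<Longrightarrow> dual a \<in> Irr"
    and dual_dual: "a \<in> Irr \<Longrightarrow> dual (dual a) = a"
    and deg_dual: "a \<in> Irr \<Longrightarrow> deg (dual a) = deg a"
    and mul_in: "a \<in> Irr \<Longrightarrow> b \<in> Irr \<Longrightarrow> c \<in># a \<star> b \<Longrightarrow> c \<in> Irr"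
    and deg_mul: "a \<in> Irr \<Longrightarrow> b \<in> Irr \<Longrightarrow> (\<Sum>c\<in>#a \<star> b. deg c) = deg a * deg b"
    and mul_assoc: "a \<in> Irr \<Longrightarrow> b \<in> Irr \<Longrightarrow> c \<in> Irr \<Longrightarrow> (\<Sum>e\<in>#a \<star> b. e \<star> c) = (\<Sum>e\<in>#b \<star> c. a \<star> e)"
    and one_mul: "a \<in> Irr \<Longrightarrow> one \<star> a = {#a#}"
    and mul_one: "a \<in> Irr \<Longrightarrow> a \<star> one = {#a#}"
    and frobenius_right: "a \<in> Irr \<Longrightarrow> b \<in> Irr \<Longrightarrow> c \<in> Irr \<Longrightarrow> count (a \<star> b) c = count (c \<star> dual b) a"
    and frobenius_left: "a \<in> Irr \<Longrightarrow> b \<in> Irr \<Longrightarrow> c \<in> Irr \<Longrightarrow> count (dual a \<star> b) c = count (a \<star> c) b"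
    and deg_one: "deg one = 1"
    and odd_deg: "a \<in> Irr \<Longrightarrow> odd (deg a)"
    and card_group: "X \<subseteq> {g \<in> Irr. deg g = 1} \<Longrightarrow> finite X \<Longrightarrow> one \<in> X \<Longrightarrow>
      (\<And>g. g \<in> X \<Longrightarrow> dual g \<in> X) \<Longrightarrow> (\<And>g h k. g \<in> X \<Longrightarrow> h \<in> X \<Longrightarrow> k \<in># g \<star> h \<Longrightarrow> k \<in> X) \<Longrightarrow> odd (card X) \<and> \<not> 3 dvd card X"
begin

lemma deg_pos: "a \<in> Irr \<Longrightarrow> 0 < deg a"
  using odd_deg[of a] by (cases "deg a") auto

lemma size_mult_le: "(\<And>x. x \<in># M \<Longrightarrow> k \<le> deg x) \<Longrightarrow> size M * k \<le> (\<Sum>x\<in>#M. deg x)"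
  by (induction M) (auto intro: add_mono)

lemma parity_size: "(\<And>x. x \<in># M \<Longrightarrow> x \<in> Irr) \<Longrightarrow> even (\<Sum>x\<in>#M. deg x) \<longleftrightarrow> even (size M)"
  by (induction M) (auto simp: odd_deg)

lemma deg_sum_zero: "(\<And>x. x \<in># M \<Longrightarrow> x \<in> Irr) \<Longrightarrow> (\<Sum>x\<in>#M. deg x) = 0 \<Longrightarrow> M = {#}"
  using deg_pos by (cases M) fastforce+

lemma least_degree_member:
  assumes "M \<noteq> {#}"
  obtains v where "v \<in># M" "\<And>z. z \<in># M \<Longrightarrow> deg v \<le> deg z"
proof -
  obtain x where "x \<in># M" using assms by blast
  from ex_has_least_nat[of "\<lambda>x. x \<in># M" x deg, OF this] show ?thesis using that by blast
qed

lemma even_ge_2: "even n \<Longrightarrow> n \<noteq> 0 \<Longrightarrow> 2 \<le> n" for n :: nat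
  by presburger

lemma even_ge_4: "even n \<Longrightarrow> 3 \<le> n \<Longrightarrow> 4 \<le> n" for n :: nat
  by presburger

lemma size_two: "size M = 2 \<Longrightarrow> \<exists>x y. M = {#x, y#}"
proof -
  assume *: "size M = 2"
  then obtain x N where M: "M = add_mset x N" using size_eq_Suc_imp_eq_union[of M 1] by auto
  then obtain y where "N = {#y#}" using * size_1_singleton_mset[of N] by auto
  then show ?thesis using M by blast
qed

lemma size_sum_mset: "size (\<Sum>e\<in>#M. f e) = (\<Sum>e\<in>#M. size (f e))" for f :: "'a \<Rightarrow> 'b multiset"
  by (induction M) auto

lemma dual_mul:
  assumes "a \<in> Irr" "b \<in> Irr" "c \<in> Irr"
  shows "count (a \<star> b) c = count (dual b \<star> dual a) (dual c)"
proof -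
  have "count (a \<star> b) c = count (c \<star> dual b) a" using assms by (intro frobenius_right)
  also have "\<dots> = count (dual c \<star> a) (dual b)" using assms by (intro frobenius_left[symmetric] dual_in)
  also have "\<dots> = count (dual b \<star> dual a) (dual c)" using assms by (intro frobenius_right dual_in)
  finally show ?thesis .
qed

lemma mul_assoc_single:
  assumes "a \<in> Irr" "b \<in> Irr" "c \<in> Irr" "a \<star> b = {#y#}"
  shows "y \<star> c = (\<Sum>e\<in>#b \<star> c. a \<star> e)"
  using mul_assoc[OF assms(1-3)] assms(4) by simp

definition Inv :: "'i set" where "Inv = {g \<in> Irr. deg g = 1}"

lemma Inv_D: "g \<in> Inv \<Longrightarrow> g \<in> Irr" "g \<in> Inv \<Longrightarrow> deg g = 1"
  by (auto simp: Inv_def)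

lemma one_Inv: "one \<in> Inv" by (simp add: Inv_def one_in deg_one)

lemma dual_Inv: "g \<in> Inv \<Longrightarrow> dual g \<in> Inv" by (simp add: Inv_def dual_in deg_dual)

lemma dual_inverse:
  assumes "g \<in> Inv"
  shows "dual g \<star> g = {#one#}"
proof -
  note g = Inv_D[OF assms]
  have "count (dual g \<star> g) one = 1"
    using frobenius_left[OF g(1) g(1) one_in] mul_one[OF g(1)] by simp
  then have "one \<in># dual g \<star> g" by (simp flip: count_greater_zero_iff)
  then obtain M where M: "dual g \<star> g = add_mset one M" by (meson mset_add)
  have "(\<Sum>x\<in>#M. deg x) = 0"
    using deg_mul[OF dual_in[OF g(1)] g(1)] M g deg_dual[OF g(1)] deg_one by simp
  then have "M = {#}"
    using mul_in[OF dual_in[OF g(1)] g(1)] M by (intro deg_sum_zero) auto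
  then show ?thesis using M by simp
qed

lemma Inv_mul_single:
  assumes "g \<in> Inv" "x \<in> Irr"
  shows "\<exists>y\<in>Irr. g \<star> x = {#y#} \<and> deg y = deg x"
proof -
  note g = Inv_D[OF assms(1)]
  note dg = Inv_D[OF dual_Inv[OF assms(1)]]
  have "(\<Sum>e\<in>#g \<star> x. dual g \<star> e) = {#x#}"
    using mul_assoc[OF dg(1) g(1) assms(2)] dual_inverse[OF assms(1)] one_mul[OF assms(2)] by simp
  then have eq: "(\<Sum>e\<in>#g \<star> x. size (dual g \<star> e)) = 1"
    by (metis size_single size_sum_mset)
  have nonempty: "0 < size (dual g \<star> e)" if "e \<in># g \<star> x" for e
  proof -
    have e: "e \<in> Irr" using mul_in[OF g(1) assms(2) that] .
    then have "(\<Sum>c\<in>#dual g \<star> e. deg c) > 0" using deg_mul[OF dg(1) e] deg_pos[OF e] dg by simp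
    then show ?thesis by (cases "dual g \<star> e = {#}") (auto simp: nonempty_has_size)
  qed
  have "size (g \<star> x) \<le> (\<Sum>e\<in>#g \<star> x. size (dual g \<star> e))"
    using sum_mset_mono[of "g \<star> x" "\<lambda>_. 1" "\<lambda>e. size (dual g \<star> e)"] nonempty
    by (simp add: Suc_le_eq)
  moreover have "0 < size (g \<star> x)" using eq by (cases "g \<star> x") auto
  ultimately have "size (g \<star> x) = 1" using eq by linarith
  then obtain y where y: "g \<star> x = {#y#}" using size_1_singleton_mset by blast
  then have "y \<in> Irr" "deg y = deg x"
    using mul_in[OF g(1) assms(2), of y] deg_mul[OF g(1) assms(2)] g by auto
  then show ?thesis using y by blast
qed

text \<open>Elements of degree \<open>1\<close> are invertible, so multiplication by them permutes \<open>Irr\<close>.\<close>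

definition act :: "'i \<Rightarrow> 'i \<Rightarrow> 'i" where
  "act g x = (THE y. g \<star> x = {#y#})"

lemma act:
  assumes "g \<in> Inv" "x \<in> Irr"
  shows "g \<star> x = {#act g x#}" "act g x \<in> Irr" "deg (act g x) = deg x"
proof -
  obtain y where y: "y \<in> Irr" "g \<star> x = {#y#}" "deg y = deg x" using Inv_mul_single[OF assms] by blast
  then have "act g x = y" unfolding act_def by auto
  then show "g \<star> x = {#act g x#}" "act g x \<in> Irr" "deg (act g x) = deg x" using y by auto
qed

lemma act_Inv: "g \<in> Inv \<Longrightarrow> h \<in> Inv \<Longrightarrow> act g h \<in> Inv"
  using act[of g h] by (auto simp: Inv_def)

lemma act_act: "g \<in> Inv \<Longrightarrow> h \<in> Inv \<Longrightarrow> x \<in> Irr \<Longrightarrow> act (act g h) x = act g (act h x)"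
  using mul_assoc_single[of g h x "act g h"] act(1)[of g h] act(1)[of h x] act(1)[of g "act h x"]
    act(1)[OF act_Inv, of g h x] act(2)[of h x] Inv_D by simp

lemma act_one: "x \<in> Irr \<Longrightarrow> act one x = x"
  using act(1)[OF one_Inv, of x] one_mul[of x] by simp

lemma act_on_one: "g \<in> Inv \<Longrightarrow> act g one = g"
  using act(1)[of g one] mul_one[of g] Inv_D one_in by simp

lemma act_dual: "g \<in> Inv \<Longrightarrow> x \<in> Irr \<Longrightarrow> act (dual g) (act g x) = x"
  using act_act[of "dual g" g x] dual_inverse[of g] act(1)[of "dual g" g] dual_Inv[of g] Inv_D[of g] act_one by simp

lemma act_inj: "g \<in> Inv \<Longrightarrow> x \<in> Irr \<Longrightarrow> y \<in> Irr \<Longrightarrow> act g x = act g y \<longleftrightarrow> x = y"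
  by (metis act_dual)

lemma act_mul:
  assumes "g \<in> Inv" "x \<in> Irr" "y \<in> Irr"
  shows "act g x \<star> y = image_mset (act g) (x \<star> y)"
proof -
  have "act g x \<star> y = (\<Sum>e\<in>#x \<star> y. g \<star> e)"
    using mul_assoc_single[OF Inv_D(1)[OF assms(1)] assms(2,3) act(1)[OF assms(1,2)]] .
  also have "\<dots> = (\<Sum>e\<in>#x \<star> y. {#act g e#})"
    using act(1)[OF assms(1)] mul_in[OF assms(2,3)] by (intro arg_cong[of _ _ sum_mset] image_mset_cong) auto
  finally show ?thesis by simp
qed

definition Stab :: "'i \<Rightarrow> 'i set" where
  "Stab x = {g \<in> Inv. act g x = x}"

text \<open>
  By reciprocity the multiplicity of \<open>g\<close> in \<open>x \<star> dual x\<close> is that of \<open>x\<close> in \<open>g \<star> x\<close>, which is irreducible.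
\<close>

lemma count_stab:
  assumes "x \<in> Irr" "g \<in> Inv"
  shows "count (x \<star> dual x) g = (if g \<in> Stab x then 1 else 0)"
  using frobenius_right[OF Inv_D(1)[OF assms(2)] assms(1,1)] act(1)[OF assms(2,1)] assms(2)
  by (auto simp: Stab_def)

lemma finite_Stab: "x \<in> Irr \<Longrightarrow> finite (Stab x)"
  by (rule finite_subset[of _ "set_mset (x \<star> dual x)"])
     (auto simp: count_stab Stab_def simp flip: count_greater_zero_iff)

lemma one_Stab: "x \<in> Irr \<Longrightarrow> one \<in> Stab x"
  by (simp add: Stab_def one_Inv act_one)

lemma card_Stab:
  assumes "x \<in> Irr"
  shows "odd (card (Stab x))" "\<not> 3 dvd card (Stab x)"
proof -
  have "odd (card (Stab x)) \<and> \<not> 3 dvd card (Stab x)"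
  proof (rule card_group)
    show "dual g \<in> Stab x" if "g \<in> Stab x" for g
      using that act_dual[OF _ assms, of g] dual_Inv[of g] by (simp add: Stab_def)
    fix g h k assume "g \<in> Stab x" "h \<in> Stab x" "k \<in># g \<star> h"
    then have g: "g \<in> Inv" "act g x = x" and h: "h \<in> Inv" "act h x = x" and k: "k = act g h"
      using act(1)[of g h] Inv_D(1)[of h] by (auto simp: Stab_def)
    then show "k \<in> Stab x" using act_act[OF g(1) h(1) assms] act_Inv[OF g(1) h(1)] by (simp add: Stab_def)
  qed (use finite_Stab[OF assms] one_Stab[OF assms] in \<open>auto simp: Stab_def Inv_def\<close>)
  then show "odd (card (Stab x))" "\<not> 3 dvd card (Stab x)" by auto
qed

text \<open>
  The constituents of degree \<open>1\<close> form the stabilizer \<open>G\<close> of \<open>x\<close>, and the others have odd degree at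
  least \<open>3\<close>. Since the order of \<open>G\<close> is prime to \<open>6\<close>, the only way to fill up \<open>9\<close> is
  \<open>1 + 3 + 5\<close>.
\<close>

lemma degree_three_square:
  assumes x: "x \<in> Irr" "deg x = 3"
  obtains p q where "p \<in> Irr" "q \<in> Irr" "x \<star> dual x = {#one, p, q#}" "deg p = 3" "deg q = 5"
proof -
  define M where "M = x \<star> dual x"
  define I where "I = filter_mset (\<lambda>y. deg y = 1) M"
  define R where "R = filter_mset (\<lambda>y. deg y \<noteq> 1) M"
  have M_in: "y \<in> Irr" if "y \<in># M" for y using mul_in[OF x(1) dual_in[OF x(1)]] that by (simp add: M_def)
  have M: "M = I + R" unfolding I_def R_def by (rule multiset_partition)
  have IS: "I = mset_set (Stab x)"
  proof (rule multiset_eqI)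
    fix g show "count I g = count (mset_set (Stab x)) g"
    proof (cases "g \<in> Inv")
      case True
      then show ?thesis using count_stab[OF x(1) True] finite_Stab[OF x(1)] Inv_D[OF True]
        by (auto simp: I_def M_def count_mset_set')
    next
      case False
      then have "g \<notin># I" using M_in by (auto simp: I_def Inv_def)
      moreover have "g \<notin> Stab x" using False by (simp add: Stab_def)
      ultimately show ?thesis by (simp add: not_in_iff)
    qed
  qed
  then have sI: "size I = card (Stab x)" by simp
  have dI: "(\<Sum>y\<in>#I. deg y) = size I"
  proof -
    have "(\<Sum>y\<in>#I. deg y) = (\<Sum>y\<in>#I. 1)"
      by (intro arg_cong[of _ _ sum_mset] image_mset_cong) (simp add: I_def)
    then show ?thesis by simp
  qed
  have tot: "size I + (\<Sum>y\<in>#R. deg y) = 9"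
    using deg_mul[OF x(1) dual_in[OF x(1)]] deg_dual[OF x(1)] x(2) dI M by (simp add: M_def[symmetric])
  have R3: "3 \<le> deg y" "odd (deg y)" "y \<in> Irr" if "y \<in># R" for y
  proof -
    have "y \<in># M" "deg y \<noteq> 1" using that by (auto simp: R_def)
    then show "y \<in> Irr" "odd (deg y)" using M_in odd_deg by auto
    then show "3 \<le> deg y" using \<open>deg y \<noteq> 1\<close> by (cases "deg y = 0 \<or> deg y = 2") auto
  qed
  have sR: "size R * 3 \<le> (\<Sum>y\<in>#R. deg y)" by (rule size_mult_le) (rule R3)
  have pR: "even (\<Sum>y\<in>#R. deg y) \<longleftrightarrow> even (size R)" by (rule parity_size) (rule R3)
  have one_I: "one \<in># I" using one_Stab[OF x(1)] finite_Stab[OF x(1)] IS by simp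
  then have "0 < size I" by (cases I) auto
  note cS = card_Stab[OF x(1), folded sI]
  have "odd (size I + (\<Sum>y\<in>#R. deg y))" unfolding tot by simp
  then have "even (size R)" using pR cS(1) by simp
  moreover have "size R \<noteq> 0" using tot cS(2) by (auto simp: dvd_def)
  moreover have "size R < 3" using tot sR \<open>0 < size I\<close> by linarith
  ultimately have "size R = 2" using even_ge_2[of "size R"] by linarith
  then obtain p q where R: "R = {#p, q#}" using size_two by blast
  have pq: "deg p + deg q = 9 - size I" "3 \<le> deg p" "3 \<le> deg q" "odd (deg p)" "odd (deg q)" "p \<in> Irr" "q \<in> Irr"
    using tot R R3 by auto
  have "size I \<noteq> 3" "size I \<noteq> 2" using cS by auto
  then have s1: "size I = 1" using pq \<open>0 < size I\<close> by presburger
  then have I: "I = {#one#}" using one_I size_1_singleton_mset by fastforce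
  have "deg p = 3 \<and> deg q = 5 \<or> deg p = 5 \<and> deg q = 3"
    using pq s1 by presburger
  then show ?thesis
  proof
    assume "deg p = 3 \<and> deg q = 5"
    then show ?thesis using that[of p q] pq M I R by (simp add: M_def)
  next
    assume "deg p = 5 \<and> deg q = 3"
    then show ?thesis using that[of q p] pq M I R by (simp add: M_def add_mset_commute)
  qed
qed

lemma square_constituents_self_dual:
  assumes x: "x \<in> Irr" and eq: "x \<star> dual x = {#one, p, q#}" "p \<in> Irr" "q \<in> Irr" "deg p = 3" "deg q = 5"
  shows "dual p = p" "dual q = q"
proof -
  have "count (x \<star> dual x) (dual y) = count (x \<star> dual x) y" if "y \<in> Irr" for y
    using dual_mul[OF x dual_in[OF x] that] dual_dual[OF x] by simp
  then have *: "dual y \<in># {#one, p, q#}" if "y \<in># {#one, p, q#}" "y \<in> Irr" for y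
    using that unfolding eq(1) by (metis count_greater_zero_iff)
  show "dual p = p" using *[of p] eq deg_dual[of p] deg_one by auto
  show "dual q = q" using *[of q] eq deg_dual[of q] deg_one by auto
qed

text \<open>
  An initial segment of the two families, with \<open>u = c 1\<close>. Membership and degree are recorded up to \<open>c (n + 1)\<close>, but the
  decomposition of \<open>c j \<star> u\<close> only up to \<open>j = n\<close>.
\<close>

definition chain :: "'i \<Rightarrow> (nat \<Rightarrow> 'i) \<Rightarrow> (nat \<Rightarrow> 'i) \<Rightarrow> nat \<Rightarrow> bool" where
  "chain u c d n \<longleftrightarrow> u \<in> Irr \<and> deg u = 3 \<and> dual u = u \<and> c 0 = one \<and> c 1 = u \<and>
     (\<forall>j\<le>Suc n. c j \<in> Irr \<and> deg (c j) = 2 * j + 1) \<and>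
     (\<forall>j. 1 \<le> j \<and> j \<le> n \<longrightarrow> d j \<in> Irr \<and> deg (d j) = 2 * j + 1 \<and> c j \<star> u = {#c (j - 1), d j, c (Suc j)#})"

lemma chainD:
  assumes "chain u c d n"
  shows "u \<in> Irr" "deg u = 3" "dual u = u" "c 0 = one" "c 1 = u" "c (Suc 0) = u"
    "j \<le> Suc n \<Longrightarrow> c j \<in> Irr" "j \<le> Suc n \<Longrightarrow> deg (c j) = 2 * j + 1"
    "1 \<le> j \<Longrightarrow> j \<le> n \<Longrightarrow> d j \<in> Irr" "1 \<le> j \<Longrightarrow> j \<le> n \<Longrightarrow> deg (d j) = 2 * j + 1"
    "1 \<le> j \<Longrightarrow> j \<le> n \<Longrightarrow> c j \<star> u = {#c (j - 1), d j, c (Suc j)#}"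
  using assms by (auto simp: chain_def)

lemma adjacent_sym:
  assumes "u \<in> Irr" "dual u = u" "v \<in> Irr" "w \<in> Irr"
  shows "count (v \<star> u) w = count (w \<star> u) v"
  using frobenius_right[OF assms(3,1,4)] assms(2) by simp

lemma adjacent_sym': "u \<in> Irr \<Longrightarrow> dual u = u \<Longrightarrow> v \<in> Irr \<Longrightarrow> w \<in> Irr \<Longrightarrow> w \<in># v \<star> u \<Longrightarrow> v \<in># w \<star> u"
  using adjacent_sym by (metis count_greater_zero_iff)

text \<open>
  Continue the edge from \<open>v0\<close> down to \<open>v1\<close> by always moving to a neighbour of least degree. The
  degrees decrease, because the other neighbours of \<open>v1\<close> are at least two in number and have total degree
  \<open>3 deg v1 - deg v0 < 2 deg v1\<close>; so the walk ends in a vertex \<open>v\<close> whose only neighbour is the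
  preceding one. Going back up, minimality leaves no room for a decomposition of \<open>v \<star> c j\<close>.
\<close>

lemma descent:
  assumes ch: "chain u c d n"
    and "v0 \<in> Irr" "v1 \<in># v0 \<star> u" "deg v1 < deg v0" "deg v0 \<le> 2 * n + 3"
  shows "\<exists>v\<in>Irr. \<exists>k\<ge>1. k \<le> n + 1 \<and> v \<star> c k = {#v0#} \<and> v \<star> c (k - 1) = {#v1#}"
  using assms(2-)
proof (induction "deg v1" arbitrary: v0 v1 rule: less_induct)
  case less
  note u = chainD(1-6)[OF ch]
  have v1: "v1 \<in> Irr" using mul_in[OF less.prems(1) u(1) less.prems(2)] .
  have "v0 \<in># v1 \<star> u" using adjacent_sym'[OF u(1,3) less.prems(1) v1 less.prems(2)] .
  then obtain Q where Q: "v1 \<star> u = add_mset v0 Q" by (meson mset_add)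
  have Q_in: "z \<in> Irr" if "z \<in># Q" for z using mul_in[OF v1 u(1), of z] Q that by simp
  have DQ: "deg v0 + (\<Sum>z\<in>#Q. deg z) = 3 * deg v1" using deg_mul[OF v1 u(1)] Q u(2) by simp
  have eQ: "even (size Q)"
  proof -
    have "odd (deg v0 + (\<Sum>z\<in>#Q. deg z))" unfolding DQ using odd_deg[OF v1] by simp
    then have "even (\<Sum>z\<in>#Q. deg z)" using odd_deg[OF less.prems(1)] by simp
    then show ?thesis using parity_size[of Q] Q_in by blast
  qed
  show ?case
  proof (cases "Q = {#}")
    case True
    then show ?thesis using Q v1 u mul_one[OF v1] by (intro bexI[of _ v1] exI[of _ 1]) auto
  next
    case False
    then obtain v2 where v2: "v2 \<in># Q" and least: "\<And>z. z \<in># Q \<Longrightarrow> deg v2 \<le> deg z"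
      using least_degree_member by blast
    have "size Q \<noteq> 0" using False by simp
    then have "2 \<le> size Q" by (rule even_ge_2[OF eQ])
    then have "2 * deg v2 \<le> (\<Sum>z\<in>#Q. deg z)"
      using size_mult_le[of Q "deg v2"] least by (meson le_trans mult_le_mono1)
    then have lt: "deg v2 < deg v1" using DQ less.prems by linarith
    have "v2 \<in># v1 \<star> u" using Q v2 by simp
    then obtain v k where v: "v \<in> Irr" and k: "1 \<le> k" "k \<le> n + 1" and vk: "v \<star> c k = {#v1#}" "v \<star> c (k - 1) = {#v2#}"
      using less.hyps[OF lt v1 _ lt] less.prems by auto
    define a where "a = deg v"
    have a: "1 \<le> a" using deg_pos[OF v] by (simp add: a_def)
    have d1: "deg v1 = a * (2 * k + 1)"
      using deg_mul[OF v, of "c k"] chainD(7,8)[OF ch, of k] vk k by (simp add: a_def)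
    have d2: "deg v2 = a * (2 * k - 1)"
      using deg_mul[OF v, of "c (k - 1)"] chainD(7,8)[OF ch, of "k - 1"] vk k by (simp add: a_def) (cases k; simp)
    have "2 * k + 1 \<le> deg v1" unfolding d1 using mult_le_mono1[OF a, of "2 * k + 1"] by simp
    then have kn: "k \<le> n" using less.prems by linarith
    note ck = chainD(7)[OF ch] chainD(9)[OF ch]
    have nb: "v1 \<star> u = {#v2#} + v \<star> d k + v \<star> c (Suc k)"
      using mul_assoc_single[OF v _ u(1) vk(1)] chainD(11)[OF ch k(1) kn] vk(2) ck(1)[of k] k by simp
    have dd: "(\<Sum>z\<in>#v \<star> d k. deg z) = a * (2 * k + 1)"
      using deg_mul[OF v chainD(9)[OF ch k(1) kn]] chainD(10)[OF ch k(1) kn] by (simp add: a_def)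
    have dc: "(\<Sum>z\<in>#v \<star> c (Suc k). deg z) = a * (2 * k + 3)"
      using deg_mul[OF v chainD(7)[OF ch, of "Suc k"]] chainD(8)[OF ch, of "Suc k"] kn by (simp add: a_def algebra_simps)
    have "v0 \<notin># v \<star> d k"
    proof
      assume "v0 \<in># v \<star> d k"
      then obtain M where "v \<star> d k = add_mset v0 M" by (meson mset_add)
      then show False using dd d1 less.prems by simp
    qed
    moreover have "v0 \<noteq> v2" using lt less.prems by auto
    moreover have "v0 \<in># v1 \<star> u" by fact
    ultimately have "v0 \<in># v \<star> c (Suc k)" unfolding nb by simp
    then obtain Z where Z: "v \<star> c (Suc k) = add_mset v0 Z" by (meson mset_add)
    have QZ: "Q = {#v2#} + v \<star> d k + Z" using Q nb Z by simp
    have Z_in: "z \<in> Irr" "deg v2 \<le> deg z" if "z \<in># Z" for z using that Q_in least QZ by auto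
    have DZ: "deg v0 + (\<Sum>z\<in>#Z. deg z) = a * (2 * k + 3)" using dc Z by simp
    have "Z = {#}"
    proof (rule ccontr)
      assume "Z \<noteq> {#}"
      then have "size Z \<noteq> 0" by simp
      moreover have "even (size Z)"
      proof -
        have "odd a" using odd_deg[OF v] by (simp add: a_def)
        then have "odd (deg v0 + (\<Sum>z\<in>#Z. deg z))" unfolding DZ by simp
        then have "even (\<Sum>z\<in>#Z. deg z)" using odd_deg[OF less.prems(1)] by simp
        then show ?thesis using parity_size[of Z] Z_in by blast
      qed
      ultimately have "2 \<le> size Z" by (intro even_ge_2)
      then have "2 * deg v2 \<le> (\<Sum>z\<in>#Z. deg z)"
        using size_mult_le[of Z "deg v2"] Z_in by (meson le_trans mult_le_mono1)
      then have "2 * (a * (2 * k - 1)) + a * (2 * k + 1) < a * (2 * k + 3)"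
        using DZ d1 d2 less.prems(3) by linarith
      moreover have "a * (2 * k + 3) = a * (2 * k + 1) + 2 * a" by (simp add: algebra_simps)
      moreover have "a \<le> a * (2 * k - 1)"
      proof -
        have "1 \<le> 2 * k - 1" using k by linarith
        from mult_le_mono2[OF this, of a] show ?thesis by simp
      qed
      ultimately show False by linarith
    qed
    then show ?thesis using Z vk v kn by (intro bexI[of _ v] exI[of _ "Suc k"]) auto
  qed
qed

text \<open>
  An element that fixes \<open>c j\<close> permutes the neighbours of \<open>c j\<close>, among which \<open>c (j - 1)\<close> is singled out by its degree. So it fixes
  \<open>c (j - 1)\<close> as well, and finally \<open>c 0 = one\<close>.
\<close>

lemma stabilizer_trivial:
  assumes ch: "chain u c d n" and "j \<le> n" "h \<in> Inv" "act h (c j) = c j"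
  shows "h = one"
  using assms(2,4)
proof (induction j)
  case 0
  then show ?case using chainD(4)[OF ch] act_on_one[OF assms(3)] by simp
next
  case (Suc j)
  note c = chainD(7,8)[OF ch]
  have nb: "c (Suc j) \<star> u = {#c j, d (Suc j), c (Suc (Suc j))#}"
    using chainD(11)[OF ch, of "Suc j"] Suc.prems by simp
  have "c (Suc j) \<star> u = image_mset (act h) (c (Suc j) \<star> u)"
    using act_mul[OF assms(3) _ chainD(1)[OF ch], of "c (Suc j)"] c(1)[of "Suc j"] Suc.prems by simp
  then have "act h (c j) \<in># c (Suc j) \<star> u" unfolding nb by simp
  moreover have "deg (act h (c j)) = 2 * j + 1"
    using act(3)[OF assms(3)] c[of j] Suc.prems by simp
  ultimately have "act h (c j) = c j"
    unfolding nb using c[of j] c[of "Suc (Suc j)"] chainD(10)[OF ch, of "Suc j"] Suc.prems by auto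
  then show ?case using Suc by simp
qed

text \<open>
  Here \<open>g \<star> c (Suc n) = c (Suc n)\<close> for some \<open>g \<noteq> one\<close>. Then the stabilizer of \<open>c (Suc n)\<close>, whose order is
  at least \<open>5\<close>, acts freely on the neighbours of degree \<open>2 n + 1\<close>, and there is room for this
  only if \<open>n = 1\<close> and the order is \<open>5\<close>.
\<close>

lemma stabilized_end:
  assumes ch: "chain u c d n" and n: "1 \<le> n" and g: "g \<in> Stab (c (Suc n))" "g \<noteq> one"
  shows "n = 1 \<and> c 2 \<star> u = image_mset (\<lambda>h. act h u) (mset_set (Stab (c 2)))"
proof -
  note u = chainD(1-6)[OF ch]
  define y where "y = c (Suc n)"
  define X where "X = Stab y"
  have y: "y \<in> Irr" "deg y = 2 * n + 3" using chainD(7,8)[OF ch, of "Suc n"] by (auto simp: y_def)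
  have cn: "c n \<in> Irr" "deg (c n) = 2 * n + 1" using chainD(7,8)[OF ch, of n] by auto
  have finX: "finite X" unfolding X_def by (rule finite_Stab[OF y(1)])
  have "card {one, g} \<le> card X"
    using g one_Stab[OF y(1)] finX by (intro card_mono) (auto simp: X_def y_def)
  then have "2 \<le> card X" using g by simp
  moreover have "odd (card X)" "card X \<noteq> 3" using card_Stab[OF y(1)] by (auto simp: X_def)
  ultimately have X5: "5 \<le> card X" by presburger
  have X_Inv: "h \<in> Inv" "act h y = y" if "h \<in> X" for h using that by (auto simp: X_def Stab_def)
  have "c n \<star> u = {#c (n - 1), d n, y#}" using chainD(11)[OF ch n] by (simp add: y_def)
  then have "c n \<in># y \<star> u" using adjacent_sym'[OF u(1,3) cn(1) y(1)] by simp
  then have mem: "act h (c n) \<in># y \<star> u" if "h \<in> X" for h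
    using act_mul[OF X_Inv(1)[OF that] y(1) u(1)] X_Inv(2)[OF that] by (metis image_eqI set_image_mset)
  have inj: "inj_on (\<lambda>h. act h (c n)) X"
  proof (rule inj_onI)
    fix h k assume hk: "h \<in> X" "k \<in> X" "act h (c n) = act k (c n)"
    note I = X_Inv(1)[OF hk(1)] X_Inv(1)[OF hk(2)]
    have "act (act (dual k) h) (c n) = c n"
      using act_act[OF dual_Inv[OF I(2)] I(1) cn(1)] hk(3) act_dual[OF I(2) cn(1)] by simp
    then have "act (dual k) h = one"
      using stabilizer_trivial[OF ch order_refl act_Inv[OF dual_Inv[OF I(2)] I(1)]] by simp
    then have "act (dual k) h = act (dual k) k"
      using dual_inverse[OF I(2)] act(1)[OF dual_Inv[OF I(2)] Inv_D(1)[OF I(2)]] by simp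
    then show "h = k" using act_inj[OF dual_Inv[OF I(2)] Inv_D(1)[OF I(1)] Inv_D(1)[OF I(2)]] by simp
  qed
  define W where "W = image_mset (\<lambda>h. act h (c n)) (mset_set X)"
  have W: "W = mset_set ((\<lambda>h. act h (c n)) ` X)" unfolding W_def by (rule image_mset_mset_set[OF inj])
  have sub: "W \<subseteq># y \<star> u"
  proof -
    have "(\<lambda>h. act h (c n)) ` X \<subseteq> set_mset (y \<star> u)" using mem by auto
    then have "W \<subseteq># mset_set (set_mset (y \<star> u))" unfolding W by (intro subset_imp_msubset_mset_set) auto
    then show ?thesis using mset_set_set_mset_msubset subset_mset.order_trans by blast
  qed
  then obtain V where V: "y \<star> u = W + V" by (metis subset_mset.add_diff_inverse)
  have DW: "(\<Sum>z\<in>#W. deg z) = card X * (2 * n + 1)"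
  proof -
    have "(\<Sum>z\<in>#W. deg z) = (\<Sum>h\<in>#mset_set X. 2 * n + 1)"
      unfolding W_def image_mset.compositionality comp_def
      using act(3)[OF X_Inv(1) cn(1)] cn(2) finX by (intro arg_cong[of _ _ sum_mset] image_mset_cong) auto
    then show ?thesis by simp
  qed
  have tot: "card X * (2 * n + 1) + (\<Sum>z\<in>#V. deg z) = (2 * n + 3) * 3"
    using deg_mul[OF y(1) u(1)] u(2) y(2) V DW by simp
  have "5 * (2 * n + 1) \<le> card X * (2 * n + 1)" using X5 by (intro mult_le_mono1)
  then have "5 * (2 * n + 1) \<le> (2 * n + 3) * 3" using tot by (metis le_add1 le_trans)
  then have n1: "n = 1" using n by simp
  then have "card X * 3 + (\<Sum>z\<in>#V. deg z) = 15" using tot by simp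
  then have "(\<Sum>z\<in>#V. deg z) = 0" using X5 by linarith
  then have "V = {#}" using V mul_in[OF y(1) u(1)] by (intro deg_sum_zero) auto
  then show ?thesis using n1 V u(5) by (simp add: W_def y_def X_def numeral_2_eq_2)
qed

text \<open>
  The other outcome of the descent: \<open>v \<star> c k = c (Suc n)\<close> with \<open>a = deg v \<ge> 3\<close>. Counting degrees among the
  neighbours \<open>v \<star> c (k - 1)\<close>, \<open>v \<star> d k\<close>, \<open>v \<star> c (k + 1)\<close> of \<open>c (Suc n)\<close> forces \<open>k = 1\<close> and yields a neighbour \<open>t\<close> of
  degree \<open>a + 2\<close>. Its other two neighbours have degree \<open>3\<close>, and no degree of \<open>t\<close> is compatible
  with that.
\<close>

lemma multiple_end_impossible:
  assumes ch: "chain u c d n" and n: "1 \<le> n" and R: "c (Suc n) \<star> u = add_mset (c n) R"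
    and cnR: "c n \<notin># R" and w: "w \<in># R" and least: "\<And>z. z \<in># R \<Longrightarrow> deg w \<le> deg z"
    and v: "v \<in> Irr" "deg v \<noteq> 1" and k: "1 \<le> k" "k \<le> n + 1"
    and vk: "v \<star> c k = {#c (Suc n)#}" "v \<star> c (k - 1) = {#w#}"
  shows False
proof -
  note u = chainD(1-6)[OF ch]
  define y where "y = c (Suc n)"
  have y: "y \<in> Irr" "deg y = 2 * n + 3" using chainD(7,8)[OF ch, of "Suc n"] by (auto simp: y_def)
  have cn: "c n \<in> Irr" "deg (c n) = 2 * n + 1" using chainD(7,8)[OF ch, of n] by auto
  note R = R[folded y_def] and vk = vk[folded y_def]
  define a where "a = deg v"
  have oa: "odd a" using odd_deg[OF v(1)] by (simp add: a_def)
  have a3: "3 \<le> a" using oa v(2) by (cases "a = 0 \<or> a = 2") (auto simp: a_def)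
  have dy: "2 * n + 3 = a * (2 * k + 1)"
    using deg_mul[OF v(1), of "c k"] chainD(7,8)[OF ch, of k] vk k y by (simp add: a_def)
  have dw: "deg w = a * (2 * k - 1)"
    using deg_mul[OF v(1), of "c (k - 1)"] chainD(7,8)[OF ch, of "k - 1"] vk k by (simp add: a_def) (cases k; simp)
  have kn: "k \<le> n"
  proof -
    have "3 * (2 * k + 1) \<le> 2 * n + 3" unfolding dy using a3 by (intro mult_le_mono1)
    then show ?thesis by simp
  qed
  have nb: "y \<star> u = {#w#} + v \<star> d k + v \<star> c (Suc k)"
    using mul_assoc_single[OF v(1) _ u(1) vk(1)] chainD(11)[OF ch k(1) kn] vk(2) chainD(7)[OF ch, of k] k by simp
  have dd: "(\<Sum>z\<in>#v \<star> d k. deg z) = a * (2 * k + 1)"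
    using deg_mul[OF v(1) chainD(9)[OF ch k(1) kn]] chainD(10)[OF ch k(1) kn] by (simp add: a_def)
  have dc: "(\<Sum>z\<in>#v \<star> c (Suc k). deg z) = a * (2 * k + 3)"
    using deg_mul[OF v(1) chainD(7)[OF ch, of "Suc k"]] chainD(8)[OF ch, of "Suc k"] kn by (simp add: a_def algebra_simps)
  have in_nb: "z \<in> Irr" if "z \<in># x \<star> u" "x \<in> Irr" for x z using mul_in[OF that(2) u(1) that(1)] .
  have sym: "x \<in># z \<star> u" if "z \<in># x \<star> u" "x \<in> Irr" for x z
    using adjacent_sym'[OF u(1,3) that(2) in_nb[OF that] that(1)] .
  have Inv_nb: "x \<star> u = {#act x u#}" "deg (act x u) = 3" if "x \<in> Inv" for x
    using act[OF that u(1)] u(2) by auto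
  \<comment> \<open>a neighbour of a vertex of degree \<open>1\<close> has degree \<open>3\<close>\<close>
  have no_Inv: "deg z \<noteq> 1" if "z \<in># x \<star> u" "x \<in> Irr" "deg x \<noteq> 3" for x z
  proof
    assume "deg z = 1"
    then have "z \<in> Inv" using in_nb[OF that(1,2)] by (simp add: Inv_def)
    then show False using sym[OF that(1,2)] Inv_nb[of z] that(3) by auto
  qed
  have "c n \<in># y \<star> u" using R by simp
  moreover have "c n \<noteq> w" using w cnR by auto
  moreover have "c n \<notin># v \<star> d k"
  proof
    assume "c n \<in># v \<star> d k"
    then obtain M where M: "v \<star> d k = add_mset (c n) M" by (meson mset_add)
    then have DM: "(\<Sum>z\<in>#M. deg z) = 2" using dd dy cn by simp
    have "z \<in># y \<star> u" if "z \<in># M" for z using nb M that by simp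
    then have "3 \<le> deg z" if "z \<in># M" for z
      using no_Inv[OF _ y(1), of z] odd_deg[of z] in_nb[OF _ y(1), of z] that y(2) n
      by (cases "deg z = 0 \<or> deg z = 2") auto
    then have "size M * 3 \<le> 2" using size_mult_le[of M 3] DM by metis
    then have "size M = 0" by linarith
    then show False using DM by simp
  qed
  ultimately have "c n \<in># v \<star> c (Suc k)" unfolding nb by simp
  then obtain Z where Z: "v \<star> c (Suc k) = add_mset (c n) Z" by (meson mset_add)
  have RZ: "R = {#w#} + v \<star> d k + Z" using R nb Z by simp
  have DZ: "(\<Sum>z\<in>#Z. deg z) = 2 * a + 2"
  proof -
    have "2 * n + 1 + (\<Sum>z\<in>#Z. deg z) = a * (2 * k + 3)" using dc Z cn by simp
    moreover have "a * (2 * k + 3) = a * (2 * k + 1) + 2 * a" by (simp add: algebra_simps)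
    ultimately show ?thesis using dy by linarith
  qed
  have Z_in: "z \<in> Irr" "a * (2 * k - 1) \<le> deg z" "z \<in># y \<star> u" if "z \<in># Z" for z
  proof -
    show *: "z \<in># y \<star> u" using nb Z that by simp
    show "z \<in> Irr" by (rule in_nb[OF * y(1)])
    show "a * (2 * k - 1) \<le> deg z" using least[of z] RZ that dw by simp
  qed
  have "even (size Z)" using parity_size[of Z] Z_in(1) DZ by simp
  moreover have "size Z \<noteq> 0" using DZ by auto
  ultimately have Z2: "2 \<le> size Z" by (intro even_ge_2)
  have Zle: "size Z * (a * (2 * k - 1)) \<le> 2 * a + 2" using size_mult_le[of Z "a * (2 * k - 1)"] Z_in(2) DZ by simp
  have k1: "k = 1"
  proof (rule ccontr)
    assume "k \<noteq> 1"
    then have "3 \<le> 2 * k - 1" using k by simp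
    then have "a * 3 \<le> a * (2 * k - 1)" by (rule mult_le_mono2)
    moreover have "2 * (a * (2 * k - 1)) \<le> size Z * (a * (2 * k - 1))" using Z2 by (rule mult_le_mono1)
    ultimately show False using Zle a3 by linarith
  qed
  have "size Z < 3"
  proof (rule ccontr)
    assume "\<not> size Z < 3"
    then have "4 \<le> size Z" using even_ge_4[OF \<open>even (size Z)\<close>] by simp
    then have "4 * a \<le> size Z * a" by (rule mult_le_mono1)
    moreover have "size Z * a \<le> 2 * a + 2" using Zle k1 by simp
    ultimately have "4 * a \<le> 2 * a + 2" by (rule le_trans)
    then show False using a3 by simp
  qed
  then have "size Z = 2" using Z2 by simp
  then obtain z1 z2 where Z12: "Z = {#z1, z2#}" using size_two by blast
  have "\<exists>t. t \<in># y \<star> u \<and> deg t = a + 2"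
  proof -
    have z: "deg z1 + deg z2 = 2 * a + 2" "a \<le> deg z1" "a \<le> deg z2" "odd (deg z1)" "odd (deg z2)"
      "z1 \<in># y \<star> u" "z2 \<in># y \<star> u"
      using DZ Z_in k1 Z12 odd_deg by auto
    then have "deg z1 = a + 2 \<or> deg z2 = a + 2" using oa by presburger
    then show ?thesis using z by blast
  qed
  then obtain t where t: "t \<in># y \<star> u" "deg t = a + 2" by blast
  have tI: "t \<in> Irr" by (rule in_nb[OF t(1) y(1)])
  have yt: "y \<in># t \<star> u" by (rule sym[OF t(1) y(1)])
  then obtain F where F: "t \<star> u = add_mset y F" by (meson mset_add)
  have y3a: "deg y = 3 * a" using y(2) dy k1 by simp
  have DF: "(\<Sum>z\<in>#F. deg z) = 6" using deg_mul[OF tI u(1)] F u(2) t(2) y3a by simp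
  have F_in: "z \<in> Irr" "z \<in># t \<star> u" if "z \<in># F" for z using in_nb[OF _ tI] F that by auto
  have F3: "3 \<le> deg z" if "z \<in># F" for z
    using no_Inv[OF F_in(2)[OF that] tI] odd_deg[OF F_in(1)[OF that]] t(2) a3
    by (cases "deg z = 0 \<or> deg z = 2") auto
  have "size F * 3 \<le> 6" using size_mult_le[of F 3] F3 DF by metis
  moreover have "even (size F)" using parity_size[of F] F_in(1) DF by simp
  moreover have "size F \<noteq> 0" using DF by auto
  ultimately have "size F = 2" using even_ge_2[of "size F"] by linarith
  then obtain f f' where FF: "F = {#f, f'#}" using size_two by blast
  then have f: "f \<in># t \<star> u" "f \<in> Irr" "deg f = 3" using DF F3[of f] F3[of f'] F_in[of f] by auto
  have tf: "t \<in># f \<star> u" by (rule sym[OF f(1) tI])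
  then obtain E where E: "f \<star> u = add_mset t E" by (meson mset_add)
  have DE: "a + 2 + (\<Sum>z\<in>#E. deg z) = 9" using deg_mul[OF f(2) u(1)] E u(2) t(2) f(3) by simp
  have E_in: "z \<in> Irr" "z \<in># f \<star> u" if "z \<in># E" for z using in_nb[OF _ f(2)] E that by auto
  have c1: "c 1 \<star> u = {#one, d 1, c 2#}" using chainD(11)[OF ch, of 1] n u(4) by (simp add: numeral_2_eq_2)
  have d1: "d 1 \<in> Irr" "deg (d 1) = 3" using chainD(9,10)[OF ch, of 1] n by auto
  have c2: "c 2 \<in> Irr" "deg (c 2) = 5" using chainD(7,8)[OF ch, of 2] n by auto
  show False
  proof (cases "E = {#}")
    case True
    \<comment> \<open>\<open>f \<star> u = t\<close>, so the neighbours of \<open>t\<close> are constituents of \<open>f\<close>, \<open>f \<star> d 1\<close>, \<open>f \<star> c 2\<close>, of degree at most \<open>15\<close>\<close>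
    then have a7: "a = 7" and fu: "f \<star> u = {#t#}" using DE E by auto
    have "t \<star> u = {#f#} + f \<star> d 1 + f \<star> c 2"
      using mul_assoc_single[OF f(2) u(1,1) fu] c1 u(5) mul_one[OF f(2)] by simp
    then have "y \<in># {#f#} + f \<star> d 1 + f \<star> c 2" using yt by simp
    then consider "y = f" | "y \<in># f \<star> d 1" | "y \<in># f \<star> c 2" by auto
    then show False
    proof cases
      case 1
      then show ?thesis using f y3a a7 by simp
    next
      case 2
      then obtain M where "f \<star> d 1 = add_mset y M" by (meson mset_add)
      then show ?thesis using deg_mul[OF f(2) d1(1)] d1(2) f(3) y3a a7 by simp
    next
      case 3
      then obtain M where "f \<star> c 2 = add_mset y M" by (meson mset_add)
      then show ?thesis using deg_mul[OF f(2) c2(1)] c2(2) f(3) y3a a7 by simp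
    qed
  next
    case False
    have "\<exists>g\<in>#E. deg g = 1"
    proof (rule ccontr)
      assume no: "\<not> (\<exists>g\<in>#E. deg g = 1)"
      have E3: "3 \<le> deg z" if "z \<in># E" for z
        using no that odd_deg[OF E_in(1)[OF that]] by (cases "deg z = 0 \<or> deg z = 2") auto
      have "size E * 3 \<le> (\<Sum>z\<in>#E. deg z)" by (rule size_mult_le) (rule E3)
      then have "size E * 3 \<le> 4" using DE a3 by linarith
      moreover have "even (size E)"
      proof -
        have "odd (a + 2 + (\<Sum>z\<in>#E. deg z))" unfolding DE by simp
        then have "even (\<Sum>z\<in>#E. deg z)" using oa by simp
        then show ?thesis using parity_size[of E] E_in(1) by blast
      qed
      ultimately show False using False even_ge_2[of "size E"] by auto
    qed
    then obtain g where g: "g \<in># E" "deg g = 1" by blast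
    have gI: "g \<in> Inv" using g E_in by (simp add: Inv_def)
    have "f \<in># g \<star> u" using sym[OF E_in(2)[OF g(1)] f(2)] .
    then have fg: "f = act g u" using Inv_nb[OF gI] by simp
    have "f \<star> u = {#act g one, act g (d 1), act g (c 2)#}"
      unfolding fg act_mul[OF gI u(1,1)] using c1 u(5) by simp
    then have "t \<in> {act g one, act g (d 1), act g (c 2)}" using tf by auto
    then have tc: "t = act g (c 2)" and "a = 3"
      using act(3)[OF gI] one_in d1 c2 deg_one t(2) a3 by auto
    then have n3: "n = 3" using dy k1 by simp
    have "t \<star> u = image_mset (act g) {#c 1, d 2, c 3#}"
      unfolding tc act_mul[OF gI c2(1) u(1)] using chainD(11)[OF ch, of 2] n3 by (simp add: numeral_3_eq_3)
    then have "y \<in> {act g (c 1), act g (d 2), act g (c 3)}" using yt by auto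
    then have "deg y \<in> {3, 5, 7}"
      using act(3)[OF gI] chainD(7,8)[OF ch, of 1] chainD(7,8)[OF ch, of 3] chainD(9,10)[OF ch, of 2] n3 by auto
    then show False using y(2) n3 by simp
  qed
qed

text \<open>
  Apart from \<open>c n\<close>, the neighbours of \<open>c (Suc n)\<close> have total degree \<open>4 n + 8\<close>, and their number is even and positive. So one of them has
  degree at most \<open>2 n + 3\<close>, by parity. If none has smaller degree, there is room for exactly one more, of degree \<open>2 n + 5\<close>; otherwise
  the descent applies.
\<close>

lemma chain_step:
  assumes ch: "chain u c d n" and n: "1 \<le> n"
  obtains d' c' where "c (Suc n) \<star> u = {#c n, d', c'#}" "deg d' = 2 * n + 3" "deg c' = 2 * n + 5"
  | "n = 1" "c 2 \<star> u = image_mset (\<lambda>h. act h u) (mset_set (Stab (c 2)))"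
proof -
  note u = chainD(1-6)[OF ch]
  define y where "y = c (Suc n)"
  have y: "y \<in> Irr" "deg y = 2 * n + 3" using chainD(7,8)[OF ch, of "Suc n"] by (auto simp: y_def)
  have cn: "c n \<in> Irr" "deg (c n) = 2 * n + 1" using chainD(7,8)[OF ch, of n] by auto
  have nb: "c n \<star> u = {#c (n - 1), d n, y#}" using chainD(11)[OF ch n] by (simp add: y_def)
  have "deg (c (n - 1)) < deg y" "deg (d n) < deg y"
    using chainD(8)[OF ch, of "n - 1"] chainD(10)[OF ch n] y by auto
  then have "count (c n \<star> u) y = 1" unfolding nb by auto
  then have cnt: "count (y \<star> u) (c n) = 1" using adjacent_sym[OF u(1,3) cn(1) y(1)] by simp
  then have "c n \<in># y \<star> u" by (simp flip: count_greater_zero_iff)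
  then obtain R where R: "y \<star> u = add_mset (c n) R" by (meson mset_add)
  have cnR: "c n \<notin># R" using cnt R by (simp add: not_in_iff)
  have R_in: "z \<in> Irr" if "z \<in># R" for z using mul_in[OF y(1) u(1), of z] R that by simp
  have DR: "(\<Sum>z\<in>#R. deg z) = 4 * n + 8" using deg_mul[OF y(1) u(1)] R u(2) y(2) cn(2) by simp
  have eR: "even (size R)" using parity_size[of R] R_in DR by simp
  have "size R \<noteq> 0" using DR by auto
  then have R2: "2 \<le> size R" by (rule even_ge_2[OF eR])
  have "R \<noteq> {#}" using \<open>size R \<noteq> 0\<close> by simp
  then obtain w where w: "w \<in># R" and least: "\<And>z. z \<in># R \<Longrightarrow> deg w \<le> deg z"
    using least_degree_member by blast
  have wle: "size R * deg w \<le> 4 * n + 8" using size_mult_le[of R "deg w"] least DR by simp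
  have "2 * deg w \<le> size R * deg w" using R2 by (rule mult_le_mono1)
  then have "deg w \<le> 2 * n + 4" using wle by linarith
  moreover have ow: "odd (deg w)" using odd_deg R_in w by blast
  ultimately have "deg w = 2 * n + 3 \<or> deg w < 2 * n + 3" by presburger
  then consider "deg w = 2 * n + 3" | "deg w < deg y" unfolding y(2) by blast
  then show ?thesis
  proof cases
    case 1
    have "size R < 3"
    proof (rule ccontr)
      assume "\<not> size R < 3"
      then have "3 * deg w \<le> size R * deg w" by (intro mult_le_mono1) simp
      then show False using wle 1 by simp
    qed
    then have "size R = 2" using R2 by simp
    then obtain z1 z2 where z: "R = {#z1, z2#}" using size_two by blast
    then consider "z1 = w" | "z2 = w" using w by auto
    then obtain z where z: "R = {#w, z#}" using z by cases (auto simp: add_mset_commute)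
    then have "deg z = 2 * n + 5" using DR 1 by simp
    then show ?thesis using that(1)[of w z] R z 1 by (simp add: y_def)
  next
    case 2
    have "w \<in># y \<star> u" using R w by simp
    from descent[OF ch y(1) this 2] y(2) obtain v k where v: "v \<in> Irr" and k: "1 \<le> k" "k \<le> n + 1"
      and vk: "v \<star> c k = {#y#}" "v \<star> c (k - 1) = {#w#}" by auto
    have "deg v = 1"
      using multiple_end_impossible[OF ch n R[unfolded y_def] cnR w least v _ k vk[unfolded y_def]] by blast
    then have vI: "v \<in> Inv" using v by (simp add: Inv_def)
    have "2 * n + 3 = 2 * k + 1"
      using deg_mul[OF v, of "c k"] chainD(7,8)[OF ch, of k] vk k y \<open>deg v = 1\<close> by simp
    then have kn: "k = Suc n" by simp
    have "v \<in> Stab y" using act(1)[OF vI y(1)] vk(1) kn vI by (simp add: Stab_def y_def)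
    moreover have "v \<noteq> one"
    proof
      assume "v = one"
      then have "w = c n" using vk(2) kn one_mul[OF cn(1)] by simp
      then show False using w cnR by simp
    qed
    ultimately show ?thesis using stabilized_end[OF ch n, of v] that(2) by (simp add: y_def)
  qed
qed

text \<open>
  Write \<open>p = d 1\<close>, \<open>q = c 2\<close>. Multiplying the hypothesis by \<open>u\<close> exhibits \<open>q + q \<star> p + q \<star> q\<close> as the sum of \<open>h + h \<star> p + q\<close> over the
  stabilizer of \<open>q\<close>. Only \<open>h = one\<close> contributes \<open>p\<close>, hence \<open>p\<close> occurs at most once. If it occurred in \<open>q \<star> q\<close>, then \<open>q\<close> would occur once in
  \<open>q \<star> p\<close> and \<open>p\<close> not at all. Translation by the stabilizer then leaves no constituent but \<open>q\<close> for \<open>q \<star> p\<close>, whose degree is \<open>15\<close>.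
\<close>

lemma special_constituents:
  assumes ch: "chain u c d 1" and c2u: "c 2 \<star> u = image_mset (\<lambda>h. act h u) (mset_set (Stab (c 2)))"
    and dc: "dual (c 2) = c 2" and dd: "dual (d 1) = d 1"
  shows "d 1 \<notin># c 2 \<star> c 2" "c 2 \<notin># c 2 \<star> d 1" "c 2 \<notin># d 1 \<star> c 2"
proof -
  note u = chainD(1-6)[OF ch]
  define p where "p = d 1"
  define q where "q = c 2"
  define X where "X = Stab q"
  have p: "p \<in> Irr" "deg p = 3" using chainD(9,10)[OF ch, of 1] by (auto simp: p_def)
  have q: "q \<in> Irr" "deg q = 5" using chainD(7,8)[OF ch, of 2] by (auto simp: q_def)
  have uu: "u \<star> u = {#one, p, q#}" using chainD(11)[OF ch, of 1] u by (simp add: p_def q_def numeral_2_eq_2)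
  have finX: "finite X" unfolding X_def by (rule finite_Stab[OF q(1)])
  have X: "h \<in> Inv" "act h q = q" if "h \<in> X" for h using that by (auto simp: X_def Stab_def)
  have sum: "(\<Sum>e\<in>#q \<star> u. e \<star> u) = {#q#} + q \<star> p + q \<star> q"
    using mul_assoc[OF q(1) u(1,1)] uu mul_one[OF q(1)] by simp
  have "(\<Sum>e\<in>#q \<star> u. e \<star> u) = (\<Sum>h\<in>#mset_set X. act h u \<star> u)"
    using c2u by (simp add: q_def X_def image_mset.compositionality comp_def)
  also have "\<dots> = (\<Sum>h\<in>#mset_set X. {#h, act h p, q#})"
    using finX X act_on_one by (intro arg_cong[of _ _ sum_mset] image_mset_cong) (simp add: act_mul[OF _ u(1,1)] uu)
  finally have eq: "{#q#} + q \<star> p + q \<star> q = (\<Sum>h\<in>#mset_set X. {#h, act h p, q#})" using sum by simp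
  have fixp: "h = one" if "h \<in> Inv" "act h p = p" for h
  proof -
    have "count (p \<star> dual p) h = 1" using count_stab[OF p(1) that(1)] that by (simp add: Stab_def)
    then have "h \<in># p \<star> dual p" by (subst count_greater_zero_iff[symmetric]) simp
    moreover obtain p' q' where pq: "p' \<in> Irr" "q' \<in> Irr" "p \<star> dual p = {#one, p', q'#}" "deg p' = 3" "deg q' = 5"
      using degree_three_square[OF p] .
    ultimately have "h \<in># {#one, p', q'#}" by (simp only:)
    then show ?thesis using Inv_D[OF that(1)] pq by auto
  qed
  have "count (\<Sum>h\<in>#mset_set X. {#h, act h p, q#}) p = (\<Sum>h\<in>X. count {#h, act h p, q#} p)"
    using finX by (induction X rule: finite_induct) auto
  also have "\<dots> \<le> (\<Sum>h\<in>X. if h = one then 1 else 0)"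
  proof (rule sum_mono)
    fix h assume h: "h \<in> X"
    have "h \<noteq> p" using Inv_D(2)[OF X(1)[OF h]] p by auto
    moreover have "q \<noteq> p" using p q by auto
    ultimately show "count {#h, act h p, q#} p \<le> (if h = one then 1 else 0)"
      using fixp[OF X(1)[OF h]] by auto
  qed
  also have "\<dots> \<le> 1" using finX by simp
  finally have cnt: "count (q \<star> p) p + count (q \<star> q) p \<le> 1" using p q by (simp flip: eq split: if_splits)
  have swap: "count (q \<star> p) q = count (q \<star> q) p"
    using frobenius_left[OF q(1) p(1) q(1)] dc by (simp add: q_def)
  have "count (q \<star> p) q = 0"
  proof (rule ccontr)
    assume "count (q \<star> p) q \<noteq> 0"
    then have "1 \<le> count (q \<star> q) p" unfolding swap by linarith
    then have one_q: "count (q \<star> p) q = 1" "count (q \<star> p) p = 0" using cnt unfolding swap by linarith+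
    define M where "M = q \<star> p"
    \<comment> \<open>all constituents of \<open>q \<star> p\<close> are \<open>q\<close>, whose degree does not allow multiplicity one\<close>
    have all_q: "x = q" if x: "x \<in># M" for x
    proof -
      have xI: "x \<in> Irr" using mul_in[OF q(1) p(1)] x by (simp add: M_def)
      have "x \<in># (\<Sum>h\<in>#mset_set X. {#h, act h p, q#})" using x unfolding eq[symmetric] by (simp add: M_def)
      then obtain h where h: "h \<in> X" "x \<in> {h, act h p, q}" using finX by auto
      have "x \<noteq> h"
      proof
        assume "x = h"
        then have "count (q \<star> p) h \<noteq> 0" using x by (simp add: M_def)
        then have "count (h \<star> dual p) q \<noteq> 0"
          using frobenius_right[OF q(1) p(1) Inv_D(1)[OF X(1)[OF h(1)]]] by simp
        then have "q = act h (dual p)" using act(1)[OF X(1)[OF h(1)] dual_in[OF p(1)]] by (auto split: if_splits)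
        then show False using act(3)[OF X(1)[OF h(1)] dual_in[OF p(1)]] deg_dual[OF p(1)] p q by simp
      qed
      moreover have "x \<noteq> act h p"
      proof
        assume xh: "x = act h p"
        have hI: "h \<in> Inv" "act h q = q" using X h by auto
        have "act (dual h) q = q" using act_dual[OF hI(1) q(1)] hI(2) by simp
        then have "M = image_mset (act (dual h)) M"
          using act_mul[OF dual_Inv[OF hI(1)] q(1) p(1)] by (simp add: M_def)
        then have "act (dual h) x \<in># M" using x by (metis image_eqI set_image_mset)
        then have "p \<in># M" using xh act_dual[OF hI(1) p(1)] by simp
        then show False using one_q(2) by (simp add: M_def not_in_iff[symmetric])
      qed
      ultimately show ?thesis using h by simp
    qed
    moreover have "N = replicate_mset (size N) q" if "\<And>x. x \<in># N \<Longrightarrow> x = q" for N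
      using that by (induction N) auto
    ultimately have "M = replicate_mset (size M) q" by blast
    then have "M = replicate_mset (count M q) q" by (metis count_replicate_mset)
    then have "M = {#q#}" using one_q by (simp add: M_def)
    then show False using deg_mul[OF q(1) p(1)] p q by (simp add: M_def)
  qed
  then show "d 1 \<notin># c 2 \<star> c 2" "c 2 \<notin># c 2 \<star> d 1" "c 2 \<notin># d 1 \<star> c 2"
    using swap dual_mul[OF q(1) p(1) q(1)] dc dd by (simp_all add: p_def q_def not_in_iff)
qed

text \<open>
  The element \<open>u\<close> of degree \<open>3\<close> in \<open>x \<star> dual x\<close> is self-dual and starts the chain; the families are defined by recursion, choosing
  neighbours by their degrees. The second alternative is the case in which the chain stops at once.
\<close>

theorem degree_three_dichotomy:
  assumes x: "x \<in> Irr" "deg x = 3"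
  obtains c d where "c 0 = one" "\<And>j. c j \<in> Irr" "\<And>j. deg (c j) = 2 * j + 1"
      "\<And>j. 1 \<le> j \<Longrightarrow> d j \<in> Irr \<and> deg (d j) = 2 * j + 1 \<and> c j \<star> c 1 = {#c (j - 1), d j, c (Suc j)#}"
  | u p q where "u \<in> Irr" "p \<in> Irr" "q \<in> Irr" "deg u = 3" "deg p = 3" "deg q = 5" "u \<star> dual u = {#one, p, q#}"
      "p \<notin># q \<star> q" "q \<notin># q \<star> p" "q \<notin># p \<star> q"
proof -
  obtain u q0 where u0: "u \<in> Irr" "q0 \<in> Irr" "x \<star> dual x = {#one, u, q0#}" "deg u = 3" "deg q0 = 5"
    using degree_three_square[OF x] .
  have u: "dual u = u" using square_constituents_self_dual[OF x(1) u0(3,1,2,4,5)] by simp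
  obtain p q where pq: "p \<in> Irr" "q \<in> Irr" "u \<star> dual u = {#one, p, q#}" "deg p = 3" "deg q = 5"
    using degree_three_square[OF u0(1,4)] .
  have sd: "dual p = p" "dual q = q" using square_constituents_self_dual[OF u0(1) pq(3,1,2,4,5)] by auto
  have uu: "u \<star> u = {#one, p, q#}" using pq(3) u by simp
  define c where "c = rec_nat one (\<lambda>j v. SOME w. w \<in># v \<star> u \<and> deg w = 2 * j + 3)"
  define d where "d = (\<lambda>j. SOME w. w \<in># c j \<star> u \<and> deg w = 2 * j + 1)"
  have c0: "c 0 = one" and cS: "c (Suc j) = (SOME w. w \<in># c j \<star> u \<and> deg w = 2 * j + 3)" for j
    by (simp_all add: c_def)
  have unique: "d j = d'" "c (Suc j) = c'"
    if "c j \<star> u = {#e, d', c'#}" "deg d' = 2 * j + 1" "deg c' = 2 * j + 3" "deg e < 2 * j + 1" for j e d' c'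
  proof -
    show "d j = d'" unfolding d_def that(1) by (rule some_equality) (use that in auto)
    show "c (Suc j) = c'" unfolding cS that(1) by (rule some_equality) (use that in auto)
  qed
  have c1: "c 1 = u"
    unfolding One_nat_def cS c0 one_mul[OF u0(1)] by (rule some_equality) (use u0 in auto)
  have dp: "d 1 = p" and c2: "c (Suc 1) = q"
    using unique[of 1 one p q] uu c1 pq deg_one by auto
  have base: "chain u c d 1"
    unfolding chain_def using u0 u c0 c1 dp c2 pq uu one_in deg_one
    by (auto simp: le_Suc_eq)
  show ?thesis
  proof (cases "c 2 \<star> u = image_mset (\<lambda>h. act h u) (mset_set (Stab (c 2)))")
    case True
    have "c 2 = q" using c2 by (simp add: numeral_2_eq_2)
    then show ?thesis
      using special_constituents[OF base True] sd dp that(2)[of u p q] u0 pq by simp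
  next
    case False
    have ch: "chain u c d (Suc n)" for n
    proof (induction n)
      case 0
      then show ?case using base by simp
    next
      case (Suc n)
      obtain d' c' where dc': "c (Suc (Suc n)) \<star> u = {#c (Suc n), d', c'#}" "deg d' = 2 * Suc n + 3" "deg c' = 2 * Suc n + 5"
        using chain_step[OF Suc] False by auto
      have cI: "c (Suc (Suc n)) \<in> Irr" using chainD(7)[OF Suc, of "Suc (Suc n)"] by simp
      have eq: "d (Suc (Suc n)) = d'" "c (Suc (Suc (Suc n))) = c'"
        using unique[OF dc'(1)] dc' chainD(8)[OF Suc, of "Suc n"] by auto
      have "d' \<in> Irr" "c' \<in> Irr" using mul_in[OF cI u0(1)] dc'(1) by auto
      then show ?case
        using Suc dc' eq unfolding chain_def by (auto simp: le_Suc_eq)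
    qed
    show ?thesis
    proof (rule that(1)[of c d])
      show "c j \<in> Irr" "deg (c j) = 2 * j + 1" for j
        using chainD(7,8)[OF ch[of j], of j] by auto
      show "d j \<in> Irr \<and> deg (d j) = 2 * j + 1 \<and> c j \<star> c 1 = {#c (j - 1), d j, c (Suc j)#}" if "1 \<le> j" for j
        using chainD(9,10,11)[OF ch[of j] that] c1 by simp
    qed (rule c0)
  qed
qed

end

section \<open>Subalgebras of the three by three matrices\<close>

text \<open>The scalar product of a row and a column.\<close>

definition pr :: "'a::comm_ring_1 mat \<Rightarrow> 'a mat \<Rightarrow> 'a" where
  "pr \<theta> v = (\<theta> * v) $$ (0,0)"

lemma one_smult_mat [simp]: "1 \<cdot>\<^sub>m X = X" for X :: "'a::comm_ring_1 mat"
  by (rule eq_matI) auto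

lemma mat_diff_eqD:
  fixes u :: "'a::comm_ring_1 mat"
  assumes "u - a = b" "u \<in> carrier_mat m n" "a \<in> carrier_mat m n"
  shows "u = a + b"
  unfolding assms(1)[symmetric] using assms(2,3) by (intro eq_matI) auto

lemma pr_mat:
  assumes "\<theta> \<in> carrier_mat 1 n" "v \<in> carrier_mat n 1"
  shows "\<theta> * v = pr \<theta> v \<cdot>\<^sub>m 1\<^sub>m 1"
  using assms by (intro eq_matI) (auto simp: pr_def)

lemma pr_index: "\<theta> \<in> carrier_mat 1 n \<Longrightarrow> v \<in> carrier_mat n 1 \<Longrightarrow> pr \<theta> v = (\<Sum>k<n. \<theta> $$ (0,k) * v $$ (k,0))"
  unfolding pr_def by (rule mult_index) auto

lemma pr_lin:
  assumes "\<theta> \<in> carrier_mat 1 n" "\<theta>' \<in> carrier_mat 1 n" "v \<in> carrier_mat n 1" "v' \<in> carrier_mat n 1"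
  shows "pr (\<theta> + \<theta>') v = pr \<theta> v + pr \<theta>' v" "pr (\<theta> - \<theta>') v = pr \<theta> v - pr \<theta>' v"
    "pr \<theta> (v + v') = pr \<theta> v + pr \<theta> v'" "pr \<theta> (v - v') = pr \<theta> v - pr \<theta> v'"
    "pr (c \<cdot>\<^sub>m \<theta>) v = c * pr \<theta> v" "pr \<theta> (c \<cdot>\<^sub>m v) = c * pr \<theta> v"
  using assms by (simp_all add: pr_index[of _ n] minus_carrier_mat sum.distrib sum_subtractf sum_distrib_left algebra_simps)

lemma pr_assoc: "\<theta> \<in> carrier_mat 1 n \<Longrightarrow> m \<in> carrier_mat n n \<Longrightarrow> v \<in> carrier_mat n 1 \<Longrightarrow> pr (\<theta> * m) v = pr \<theta> (m * v)"
  by (simp add: pr_def mat_assoc)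

lemma outer:
  assumes "u \<in> carrier_mat n 1" "\<theta> \<in> carrier_mat 1 n" "v \<in> carrier_mat n 1" "\<theta>' \<in> carrier_mat 1 n"
  shows "u * \<theta> * v = pr \<theta> v \<cdot>\<^sub>m u" "\<theta> * (v * \<theta>') = pr \<theta> v \<cdot>\<^sub>m \<theta>'" "u * \<theta> * (v * \<theta>') = pr \<theta> v \<cdot>\<^sub>m (u * \<theta>')"
proof -
  have 1: "X * (c \<cdot>\<^sub>m 1\<^sub>m 1) = c \<cdot>\<^sub>m X" if "X \<in> carrier_mat n 1" for X :: "'a mat" and c
    using that by (metis mult_smult_distrib one_carrier_mat right_mult_one_mat)
  have 2: "(c \<cdot>\<^sub>m 1\<^sub>m 1) * X = c \<cdot>\<^sub>m X" if "X \<in> carrier_mat 1 n" for X :: "'a mat" and c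
    using that by (metis mult_smult_assoc_mat one_carrier_mat left_mult_one_mat)
  show "u * \<theta> * v = pr \<theta> v \<cdot>\<^sub>m u"
    using assoc_mult_mat[OF assms(1,2,3)] pr_mat[OF assms(2,3)] 1[OF assms(1)] by simp
  show e2: "\<theta> * (v * \<theta>') = pr \<theta> v \<cdot>\<^sub>m \<theta>'"
    using assoc_mult_mat[OF assms(2,3,4)] pr_mat[OF assms(2,3)] 2[OF assms(4)] by simp
  have "u * \<theta> * (v * \<theta>') = u * (\<theta> * (v * \<theta>'))"
    using assms by (simp add: mat_assoc)
  then show "u * \<theta> * (v * \<theta>') = pr \<theta> v \<cdot>\<^sub>m (u * \<theta>')"
    unfolding e2 by (simp add: mult_smult_distrib[OF assms(1,4)])
qed

lemma pr_nondegenerate: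
  fixes v :: "'a::field mat"
  assumes "v \<in> carrier_mat n 1" "\<And>\<beta>. \<beta> \<in> carrier_mat 1 n \<Longrightarrow> pr \<beta> v = 0"
  shows "v = 0\<^sub>m n 1"
proof (rule eq_matI)
  fix i j assume "i < dim_row (0\<^sub>m n 1 :: 'a mat)" "j < dim_col (0\<^sub>m n 1 :: 'a mat)"
  then have ij: "i < n" "j = 0" by auto
  define \<beta> where "\<beta> = mat 1 n (\<lambda>(_,k). if k = i then 1 else (0::'a))"
  have b: "\<beta> \<in> carrier_mat 1 n" by (simp add: \<beta>_def)
  have "pr \<beta> v = (\<Sum>k<n. if k = i then v $$ (k,0) else 0)"
    unfolding pr_index[OF b assms(1)] by (intro sum.cong refl) (simp add: \<beta>_def)
  then show "v $$ (i,j) = (0\<^sub>m n 1 :: 'a mat) $$ (i,j)" using assms(2)[OF b] ij by simp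
qed (use assms in auto)

lemma pr_nondegenerate':
  fixes \<theta> :: "'a::field mat"
  assumes "\<theta> \<in> carrier_mat 1 n" "\<And>v. v \<in> carrier_mat n 1 \<Longrightarrow> pr \<theta> v = 0"
  shows "\<theta> = 0\<^sub>m 1 n"
proof (rule eq_matI)
  fix i j assume "i < dim_row (0\<^sub>m 1 n :: 'a mat)" "j < dim_col (0\<^sub>m 1 n :: 'a mat)"
  then have ij: "i = 0" "j < n" by auto
  define v where "v = mat n 1 (\<lambda>(k,_). if k = j then 1 else (0::'a))"
  have b: "v \<in> carrier_mat n 1" by (simp add: v_def)
  have "pr \<theta> v = (\<Sum>k<n. if k = j then \<theta> $$ (0,k) else 0)"
    unfolding pr_index[OF assms(1) b] by (intro sum.cong refl) (simp add: v_def)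
  then show "\<theta> $$ (i,j) = (0\<^sub>m 1 n :: 'a mat) $$ (i,j)" using assms(2)[OF b] ij by simp
qed (use assms in auto)

lemma smult_zero_imp:
  fixes X :: "'a::field mat"
  assumes "c \<cdot>\<^sub>m X = 0\<^sub>m m n" "X \<in> carrier_mat m n" "X \<noteq> 0\<^sub>m m n"
  shows "c = 0"
proof (rule ccontr)
  assume "c \<noteq> 0"
  have "X = 0\<^sub>m m n"
  proof (rule eq_matI)
    fix i j assume "i < dim_row (0\<^sub>m m n :: 'a mat)" "j < dim_col (0\<^sub>m m n :: 'a mat)"
    then show "X $$ (i,j) = (0\<^sub>m m n :: 'a mat) $$ (i,j)"
      using arg_cong[OF assms(1), of "\<lambda>M. M $$ (i,j)"] assms(2) \<open>c \<noteq> 0\<close> by simp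
  qed (use assms in auto)
  then show False using assms by simp
qed

text \<open>
  In the application \<open>A\<close> and \<open>W\<close> are the components of type \<open>1 + q\<close> and \<open>p\<close> of the matrix algebra \<open>u \<otimes> u*\<close>. The coefficients \<open>c\<close> of the three
  equations for \<open>A\<close> are the entries of the projection to \<open>W\<close>; they express that \<open>A\<close> has codimension at most \<open>3\<close>.
\<close>

locale split_subalgebra =
  fixes A W :: "'a::alg_closed_field mat set" and c :: "nat \<Rightarrow> nat \<Rightarrow> nat \<Rightarrow> 'a"
  assumes A_iff: "\<And>X. X \<in> A \<longleftrightarrow> X \<in> carrier_mat 3 3 \<and> (\<forall>i<3. (\<Sum>p<3. \<Sum>q<3. c i p q * X $$ (p,q)) = 0)"
    and W_carrier: "W \<subseteq> carrier_mat 3 3"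
    and W_add: "\<And>X Y. X \<in> W \<Longrightarrow> Y \<in> W \<Longrightarrow> X + Y \<in> W"
    and AW: "\<And>X Y. X \<in> A \<Longrightarrow> Y \<in> W \<Longrightarrow> X * Y \<in> W"
    and WA: "\<And>X Y. X \<in> W \<Longrightarrow> Y \<in> A \<Longrightarrow> X * Y \<in> W"
    and AA: "\<And>X Y. X \<in> A \<Longrightarrow> Y \<in> A \<Longrightarrow> X * Y \<in> A"
    and sum: "\<And>X. X \<in> carrier_mat 3 3 \<Longrightarrow> \<exists>a\<in>A. \<exists>w\<in>W. X = a + w"
    and disjoint: "\<And>X. X \<in> A \<Longrightarrow> X \<in> W \<Longrightarrow> X = 0\<^sub>m 3 3"
    and W_nonzero: "\<exists>w\<in>W. w \<noteq> 0\<^sub>m 3 3"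
begin

lemma A_carrier: "X \<in> A \<Longrightarrow> X \<in> carrier_mat 3 3" by (simp add: A_iff)

lemma W_carrier': "X \<in> W \<Longrightarrow> X \<in> carrier_mat 3 3" using W_carrier by blast

lemma A_lin:
  assumes "X \<in> A" "Y \<in> A"
  shows "X + Y \<in> A" "X - Y \<in> A" "k \<cdot>\<^sub>m X \<in> A"
proof -
  have X: "X \<in> carrier_mat 3 3" "\<And>i. i < 3 \<Longrightarrow> (\<Sum>p<3. \<Sum>q<3. c i p q * X $$ (p,q)) = 0"
    and Y: "Y \<in> carrier_mat 3 3" "\<And>i. i < 3 \<Longrightarrow> (\<Sum>p<3. \<Sum>q<3. c i p q * Y $$ (p,q)) = 0"
    using assms by (auto simp: A_iff)
  have "(\<Sum>p<3. \<Sum>q<3. c i p q * (X + Y) $$ (p,q)) = (\<Sum>p<3. \<Sum>q<3. c i p q * X $$ (p,q)) + (\<Sum>p<3. \<Sum>q<3. c i p q * Y $$ (p,q))" for i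
    using X(1) Y(1) by (simp add: sum.distrib[symmetric] distrib_left)
  then show "X + Y \<in> A" using X Y by (simp add: A_iff)
  have "(\<Sum>p<3. \<Sum>q<3. c i p q * (X - Y) $$ (p,q)) = (\<Sum>p<3. \<Sum>q<3. c i p q * X $$ (p,q)) - (\<Sum>p<3. \<Sum>q<3. c i p q * Y $$ (p,q))" for i
    using X(1) Y(1) by (simp add: sum_subtractf[symmetric] right_diff_distrib)
  then show "X - Y \<in> A" using X Y by (simp add: A_iff minus_carrier_mat)
  have "(\<Sum>p<3. \<Sum>q<3. c i p q * (k \<cdot>\<^sub>m X) $$ (p,q)) = k * (\<Sum>p<3. \<Sum>q<3. c i p q * X $$ (p,q))" for i
    using X(1) by (simp add: sum_distrib_left mult_ac)
  then show "k \<cdot>\<^sub>m X \<in> A" using X by (simp add: A_iff)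
qed

text \<open>
  For \<open>\<eta>\<close> supported on the first two coordinates, with entries \<open>a\<close> and \<open>b\<close>, the three equations for \<open>x \<eta>\<close> to lie in \<open>A\<close> read
  \<open>(a M\<^sub>0 + b M\<^sub>1) x = 0\<close> with square matrices \<open>M\<^sub>0\<close>, \<open>M\<^sub>1\<close>. Some member of this pencil is singular: \<open>M\<^sub>0\<close> itself, or one that
  comes from an eigenvector of \<open>M\<^sub>0\<^sup>-\<^sup>1 M\<^sub>1\<close>.
\<close>

lemma rank_one_exists:
  obtains x \<eta> where "x \<in> carrier_mat 3 1" "\<eta> \<in> carrier_mat 1 3" "x \<noteq> 0\<^sub>m 3 1" "\<eta> \<noteq> 0\<^sub>m 1 3" "x * \<eta> \<in> A"
proof -
  define M where "M = (\<lambda>q. mat 3 3 (\<lambda>(i,p). c i p q))"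
  note witness = that
  have M: "M q \<in> carrier_mat 3 3" for q by (simp add: M_def)
  have key: "thesis" if x: "x \<in> carrier_mat 3 1" "x \<noteq> 0\<^sub>m 3 1" and ab: "a \<noteq> 0 \<or> b \<noteq> 0"
    and eq: "a \<cdot>\<^sub>m (M 0 * x) + b \<cdot>\<^sub>m (M 1 * x) = 0\<^sub>m 3 1" for x a b
  proof -
    define \<eta> where "\<eta> = mat 1 3 (\<lambda>(_,q). if q = 0 then a else if q = 1 then b else 0)"
    have \<eta>: "\<eta> \<in> carrier_mat 1 3" by (simp add: \<eta>_def)
    have "\<eta> $$ (0,0) = a" "\<eta> $$ (0,1) = b" by (simp_all add: \<eta>_def)
    then have "\<eta> \<noteq> 0\<^sub>m 1 3" using ab by auto
    moreover have "x * \<eta> \<in> A"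
      unfolding A_iff
    proof (intro conjI allI impI)
      show "x * \<eta> \<in> carrier_mat 3 3" using x \<eta> by simp
      fix i :: nat assume i: "i < 3"
      have "(x * \<eta>) $$ (p,q) = x $$ (p,0) * \<eta> $$ (0,q)" if "p < 3" "q < 3" for p q
        using mult_index[OF x(1) \<eta> that] by simp
      then have "(\<Sum>p<3. \<Sum>q<3. c i p q * (x * \<eta>) $$ (p,q)) = (\<Sum>p<3. \<Sum>q<3. c i p q * (x $$ (p,0) * \<eta> $$ (0,q)))"
        by (intro sum.cong refl) simp
      also have "\<dots> = (\<Sum>q<3. \<eta> $$ (0,q) * (\<Sum>p<3. c i p q * x $$ (p,0)))"
        by (subst sum.swap) (simp add: sum_distrib_left mult_ac)
      also have "\<dots> = (\<Sum>q<3. \<eta> $$ (0,q) * (M q * x) $$ (i,0))"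
        using mult_index[OF M x(1) i, of 0] i by (intro sum.cong refl) (simp add: M_def)
      also have "\<dots> = a * (M 0 * x) $$ (i,0) + b * (M 1 * x) $$ (i,0)"
        by (simp add: numeral_3_eq_3 \<eta>_def)
      also have "\<dots> = (a \<cdot>\<^sub>m (M 0 * x) + b \<cdot>\<^sub>m (M 1 * x)) $$ (i,0)"
        using M[of 0] M[of 1] x i by simp
      also have "\<dots> = 0" unfolding eq using i by simp
      finally show "(\<Sum>p<3. \<Sum>q<3. c i p q * (x * \<eta>) $$ (p,q)) = 0" .
    qed
    ultimately show thesis using witness[OF x(1) \<eta> x(2)] by blast
  qed
  obtain d B L N where B: "B \<in> carrier_mat 3 d" and L: "L \<in> carrier_mat d 3" and N: "N \<in> carrier_mat 3 3"
    and MB: "M 0 * B = 0\<^sub>m 3 d" and LB: "L * B = 1\<^sub>m d" and BL: "B * L + N * M 0 = 1\<^sub>m 3"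
    using kernel_split[OF M[of 0]] by blast
  show thesis
  proof (cases "d = 0")
    case False
    define z where "z = mat d 1 (\<lambda>(i,_). if i = 0 then 1 else (0::'a))"
    have z: "z \<in> carrier_mat d 1" by (simp add: z_def)
    have "L * (B * z) = z" using assoc_mult_mat[OF L B z] LB z by simp
    moreover have "z $$ (0,0) = 1" using False by (simp add: z_def)
    ultimately have "B * z \<noteq> 0\<^sub>m 3 1" using L False by auto
    moreover have "M 0 * (B * z) = 0\<^sub>m 3 1" using assoc_mult_mat[OF M[of 0] B z] MB z by simp
    moreover have "M 1 * (B * z) \<in> carrier_mat 3 1" using M[of 1] B z by simp
    then have "(0::'a) \<cdot>\<^sub>m (M 1 * (B * z)) = 0\<^sub>m 3 1" using M[of 1] B z by (intro eq_matI) auto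
    ultimately show thesis using key[of "B * z" 1 0] B z by simp
  next
    case True
    have "B * L = 0\<^sub>m 3 3" using True B L by (intro eq_matI) (auto simp: scalar_prod_def)
    then have NM: "N * M 0 = 1\<^sub>m 3" using BL N M[of 0] by simp
    then have MN: "M 0 * N = 1\<^sub>m 3" using mat_mult_left_right_inverse[OF N M[of 0]] by simp
    have T: "N * M 1 \<in> carrier_mat 3 3" using N M[of 1] by simp
    obtain k v where v: "v \<in> carrier_mat 3 1" "v \<noteq> 0\<^sub>m 3 1" "N * M 1 * v = k \<cdot>\<^sub>m v"
      by (rule eigenvector_exists[OF T]) (simp, blast)
    have "M 1 * v = M 0 * N * (M 1 * v)" using MN M[of 1] v by simp
    also have "\<dots> = M 0 * (N * M 1 * v)" using M[of 0] M[of 1] N v by (simp add: mat_assoc)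
    also have "\<dots> = k \<cdot>\<^sub>m (M 0 * v)" unfolding v(3) using mult_smult_distrib[OF M[of 0] v(1)] by simp
    finally have "(- k) \<cdot>\<^sub>m (M 0 * v) + 1 \<cdot>\<^sub>m (M 1 * v) = 0\<^sub>m 3 1"
      using M[of 0] v(1) by (intro eq_matI) auto
    then show thesis by (rule key[OF v(1,2), rotated]) simp
  qed
qed

text \<open>
  The matrices \<open>z \<beta> + v \<zeta>\<close> with \<open>\<beta> z = 0\<close> and \<open>\<zeta> v = 0\<close> form a space of dimension \<open>4\<close>, and \<open>A\<close> is cut out by three equations, so
  the two meet nontrivially. A space that is contained in \<open>W\<close> meets \<open>A\<close> only in \<open>0\<close>.
\<close>

lemma cross_not_in_W:
  assumes z: "z \<in> carrier_mat 3 1" and \<zeta>: "\<zeta> \<in> carrier_mat 1 3" and pz: "pr \<zeta> z = 1"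
    and 1: "\<And>\<beta>. \<beta> \<in> carrier_mat 1 3 \<Longrightarrow> pr \<beta> z = 0 \<Longrightarrow> z * \<beta> \<in> W"
    and 2: "\<And>v. v \<in> carrier_mat 3 1 \<Longrightarrow> pr \<zeta> v = 0 \<Longrightarrow> v * \<zeta> \<in> W"
  shows False
proof -
  define M where "M = mat 5 6 (\<lambda>(i,j). if i = 0 then (if j < 3 then z $$ (j,0) else 0)
      else if i = 1 then (if j < 3 then 0 else \<zeta> $$ (0,j-3))
      else if j < 3 then (\<Sum>p<3. c (i-2) p j * z $$ (p,0)) else (\<Sum>q<3. c (i-2) (j-3) q * \<zeta> $$ (0,q)))"
  have M: "M \<in> carrier_mat 5 6" by (simp add: M_def)
  obtain u where u: "u \<in> carrier_mat 6 1" "u \<noteq> 0\<^sub>m 6 1" "M * u = 0\<^sub>m 5 1"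
    using wide_matrix_kernel[OF M] by auto
  define \<beta> where "\<beta> = mat 1 3 (\<lambda>(_,q). u $$ (q,0))"
  define v where "v = mat 3 1 (\<lambda>(p,_). u $$ (3 + p,0))"
  have \<beta>: "\<beta> \<in> carrier_mat 1 3" and v: "v \<in> carrier_mat 3 1" by (simp_all add: \<beta>_def v_def)
  have six: "(\<Sum>j<6. f j) = (\<Sum>j<3. f j) + (\<Sum>j<3. f (3 + j))" for f :: "nat \<Rightarrow> 'a"
    by (simp add: eval_nat_numeral)
  have row: "(\<Sum>j<3. M $$ (i,j) * u $$ (j,0)) + (\<Sum>j<3. M $$ (i,3+j) * u $$ (3+j,0)) = 0" if "i < 5" for i
  proof -
    have "(M * u) $$ (i,0) = (\<Sum>j<6. M $$ (i,j) * u $$ (j,0))" by (rule mult_index[OF M u(1) that]) simp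
    then show ?thesis using u(3) that unfolding six by simp
  qed
  have bz: "pr \<beta> z = 0"
    using row[of 0] unfolding pr_index[OF \<beta> z] by (simp add: M_def \<beta>_def mult.commute)
  have zv: "pr \<zeta> v = 0"
    using row[of 1] unfolding pr_index[OF \<zeta> v] by (simp add: M_def v_def)
  have W: "z * \<beta> + v * \<zeta> \<in> W" by (intro W_add 1 2 \<beta> v bz zv)
  have "z * \<beta> + v * \<zeta> \<in> A"
    unfolding A_iff
  proof (intro conjI allI impI)
    show "z * \<beta> + v * \<zeta> \<in> carrier_mat 3 3" using z \<beta> v \<zeta> by simp
    fix i :: nat assume i: "i < 3"
    have e: "(z * \<beta> + v * \<zeta>) $$ (p,q) = z $$ (p,0) * u $$ (q,0) + u $$ (3+p,0) * \<zeta> $$ (0,q)" if "p < 3" "q < 3" for p q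
      using mult_index[OF z \<beta> that] mult_index[OF v \<zeta> that] that z \<beta> v \<zeta> by (simp add: \<beta>_def v_def)
    have "(\<Sum>p<3. \<Sum>q<3. c i p q * (z * \<beta> + v * \<zeta>) $$ (p,q)) =
        (\<Sum>p<3. \<Sum>q<3. c i p q * (z $$ (p,0) * u $$ (q,0))) + (\<Sum>p<3. \<Sum>q<3. c i p q * (u $$ (3+p,0) * \<zeta> $$ (0,q)))"
      unfolding sum.distrib[symmetric] by (intro sum.cong refl) (simp add: e distrib_left)
    also have "(\<Sum>p<3. \<Sum>q<3. c i p q * (z $$ (p,0) * u $$ (q,0))) = (\<Sum>j<3. M $$ (2+i,j) * u $$ (j,0))"
      using i by (subst sum.swap) (simp add: M_def sum_distrib_right sum_distrib_left mult_ac)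
    also have "(\<Sum>p<3. \<Sum>q<3. c i p q * (u $$ (3+p,0) * \<zeta> $$ (0,q))) = (\<Sum>j<3. M $$ (2+i,3+j) * u $$ (3+j,0))"
      using i by (simp add: M_def sum_distrib_right sum_distrib_left mult_ac)
    finally show "(\<Sum>p<3. \<Sum>q<3. c i p q * (z * \<beta> + v * \<zeta>) $$ (p,q)) = 0" using row[of "2 + i"] i by simp
  qed
  then have zero: "z * \<beta> + v * \<zeta> = 0\<^sub>m 3 3" using disjoint W by blast
  have "(z * \<beta> + v * \<zeta>) * z = pr \<beta> z \<cdot>\<^sub>m z + pr \<zeta> z \<cdot>\<^sub>m v"
    using z \<beta> v \<zeta> outer(1)[OF z \<beta> z \<beta>] outer(1)[OF v \<zeta> z \<zeta>] by (subst add_mult_distrib_mat[of _ 3 3]) auto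
  moreover have "0 \<cdot>\<^sub>m z + 1 \<cdot>\<^sub>m v = v" using z v by (intro eq_matI) auto
  ultimately have v0: "v = 0\<^sub>m 3 1" unfolding zero bz pz using z by simp
  have "\<zeta> * (z * \<beta> + v * \<zeta>) = pr \<zeta> z \<cdot>\<^sub>m \<beta> + pr \<zeta> v \<cdot>\<^sub>m \<zeta>"
    using z \<beta> v \<zeta> outer(2)[OF z \<zeta> z \<beta>] outer(2)[OF z \<zeta> v \<zeta>] by (subst mult_add_distrib_mat[of _ 1 3]) auto
  moreover have "1 \<cdot>\<^sub>m \<beta> + 0 \<cdot>\<^sub>m \<zeta> = \<beta>" using \<zeta> \<beta> by (intro eq_matI) auto
  ultimately have \<beta>0: "\<beta> = 0\<^sub>m 1 3" unfolding zero zv pz using \<zeta> by simp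
  have "u = 0\<^sub>m 6 1"
  proof (rule eq_matI)
    fix i j assume "i < dim_row (0\<^sub>m 6 1 :: 'a mat)" "j < dim_col (0\<^sub>m 6 1 :: 'a mat)"
    then have ij: "i < 6" "j = 0" by auto
    show "u $$ (i,j) = (0\<^sub>m 6 1 :: 'a mat) $$ (i,j)"
    proof (cases "i < 3")
      case True
      then have "u $$ (i,0) = \<beta> $$ (0,i)" by (simp add: \<beta>_def)
      then show ?thesis using \<beta>0 True ij by simp
    next
      case False
      then have "u $$ (i,0) = v $$ (i - 3,0)" using ij by (simp add: v_def)
      then show ?thesis using v0 False ij by simp
    qed
  qed (use u in auto)
  then show False using u by simp
qed

text \<open>
  For \<open>m\<close> in an off-diagonal Peirce component write \<open>m = a + y\<close> with \<open>a\<close> in \<open>A\<close> and \<open>y\<close> in \<open>W\<close>. Since \<open>E m E\<close> and \<open>E y E\<close> vanish, so does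
  \<open>E a E\<close>, which equals \<open>E a\<close> and \<open>a E\<close>; therefore \<open>m\<close> is \<open>E y\<close> or \<open>y E\<close>.
\<close>

lemma off_diagonal_in_W:
  assumes E: "E \<in> A" and l: "\<And>a. a \<in> A \<Longrightarrow> E * a = E * a * E" and r: "\<And>a. a \<in> A \<Longrightarrow> a * E = E * a * E"
    and w: "\<And>w. w \<in> W \<Longrightarrow> E * w * E = 0\<^sub>m 3 3" and m: "m \<in> carrier_mat 3 3"
  shows "E * m = m \<Longrightarrow> m * E = 0\<^sub>m 3 3 \<Longrightarrow> m \<in> W" "E * m = 0\<^sub>m 3 3 \<Longrightarrow> m * E = m \<Longrightarrow> m \<in> W"
proof -
  obtain a y where ay: "a \<in> A" "y \<in> W" "m = a + y" using sum[OF m] by blast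
  note Ec = A_carrier[OF E] and ac = A_carrier[OF ay(1)] and yc = W_carrier'[OF ay(2)]
  have Em: "E * m = E * a + E * y" unfolding ay(3) by (rule mult_add_distrib_mat[OF Ec ac yc])
  have mE: "m * E = a * E + y * E" unfolding ay(3) by (rule add_mult_distrib_mat[OF ac yc Ec])
  have "E * m * E = E * a * E + E * y * E"
    unfolding Em by (rule add_mult_distrib_mat) (use Ec ac yc in auto)
  then have EmE: "E * m * E = E * a * E" using w[OF ay(2)] Ec ac by simp
  {
    assume h: "E * m = m" "m * E = 0\<^sub>m 3 3"
    then have "E * a = 0\<^sub>m 3 3" using EmE l[OF ay(1)] by simp
    then have "m = E * y" using h Em Ec yc by simp
    then show "m \<in> W" using AW[OF E ay(2)] by simp
  next
    assume h: "E * m = 0\<^sub>m 3 3" "m * E = m"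
    have "E * m * E = 0\<^sub>m 3 3" unfolding h(1) using Ec by simp
    then have "a * E = 0\<^sub>m 3 3" using EmE r[OF ay(1)] by simp
    then have "m = y * E" using h mE Ec yc by simp
    then show "m \<in> W" using WA[OF ay(2) E] by simp
  }
qed

text \<open>
  Let \<open>e = x \<eta>\<close> be an idempotent of rank one in \<open>A\<close>. The columns \<open>C\<close> and rows \<open>R\<close> complementary to \<open>e\<close> in
  \<open>A\<close> are in perfect duality: every matrix is the sum of elements of \<open>A\<close> and \<open>W\<close>, and a product \<open>(x \<psi>) w (y \<eta>)\<close> with \<open>w\<close> in \<open>W\<close> lies in both
  and vanishes. If their dimension is \<open>2\<close>, then \<open>A\<close> contains a resolution of the identity into such rank one elements, and
  \<open>W\<close> is \<open>0\<close>. Otherwise \<open>A\<close> is block diagonal with blocks of sizes \<open>1\<close> and \<open>2\<close>, and the off-diagonal matrices lie in \<open>W\<close>; but they are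
  too many, by \<open>cross_not_in_W\<close>.
\<close>

theorem no_complementary_bimodule: False
proof -
  obtain x0 \<eta>0 where x: "x0 \<in> carrier_mat 3 1" and \<eta>0: "\<eta>0 \<in> carrier_mat 1 3" and x0: "x0 \<noteq> 0\<^sub>m 3 1"
    and ne: "\<eta>0 \<noteq> 0\<^sub>m 1 3" and xe: "x0 * \<eta>0 \<in> A" using rank_one_exists .
  define x where "x = x0"
  note x = x[folded x_def] and x0 = x0[folded x_def] and xe = xe[folded x_def]
  have oz: "u * \<theta> \<noteq> 0\<^sub>m 3 3" if "u \<in> carrier_mat 3 1" "\<theta> \<in> carrier_mat 1 3" "u \<noteq> 0\<^sub>m 3 1" "\<theta> \<noteq> 0\<^sub>m 1 3" for u \<theta> :: "'a mat"
  proof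
    assume z: "u * \<theta> = 0\<^sub>m 3 3"
    have "pr \<theta> v = 0" if v: "v \<in> carrier_mat 3 1" for v
    proof (rule smult_zero_imp[OF _ \<open>u \<in> _\<close> \<open>u \<noteq> _\<close>])
      show "pr \<theta> v \<cdot>\<^sub>m u = 0\<^sub>m 3 1" using outer(1)[OF \<open>u \<in> _\<close> \<open>\<theta> \<in> _\<close> v \<open>\<theta> \<in> _\<close>] z v by simp
    qed
    then show False using pr_nondegenerate'[OF \<open>\<theta> \<in> _\<close>] \<open>\<theta> \<noteq> _\<close> by blast
  qed
  \<comment> \<open>otherwise \<open>\<eta>0\<close> annihilates \<open>w x\<close> for \<open>w\<close> in \<open>W\<close> too, as \<open>(x \<eta>0) w (x \<eta>0)\<close> lies in \<open>A\<close> and \<open>W\<close>\<close>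
  have "\<exists>a\<in>A. pr \<eta>0 (a * x) \<noteq> 0"
  proof (rule ccontr)
    assume no: "\<not> (\<exists>a\<in>A. pr \<eta>0 (a * x) \<noteq> 0)"
    have W0: "pr \<eta>0 (w * x) = 0" if w: "w \<in> W" for w
    proof -
      note wc = W_carrier'[OF w]
      have "x * \<eta>0 * w * (x * \<eta>0) = x * \<eta>0 * ((w * x) * \<eta>0)" using x \<eta>0 wc by (simp add: mat_assoc)
      also have "\<dots> = pr \<eta>0 (w * x) \<cdot>\<^sub>m (x * \<eta>0)" by (rule outer(3)) (use x \<eta>0 wc in auto)
      finally have e: "x * \<eta>0 * w * (x * \<eta>0) = pr \<eta>0 (w * x) \<cdot>\<^sub>m (x * \<eta>0)" .
      have "pr \<eta>0 (w * x) \<cdot>\<^sub>m (x * \<eta>0) = 0\<^sub>m 3 3"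
        by (rule disjoint) (use A_lin(3)[OF xe xe] WA[OF AW[OF xe w] xe] e in auto)
      then show ?thesis using smult_zero_imp oz[OF x \<eta>0 x0 ne] A_carrier[OF xe] by blast
    qed
    have all0: "pr \<eta>0 (m * x) = 0" if m: "m \<in> carrier_mat 3 3" for m
    proof -
      obtain a w where aw: "a \<in> A" "w \<in> W" "m = a + w" using sum[OF m] by blast
      have "m * x = a * x + w * x" unfolding aw(3) by (rule add_mult_distrib_mat[OF A_carrier[OF aw(1)] W_carrier'[OF aw(2)] x])
      then show ?thesis using no W0[OF aw(2)] aw(1) pr_lin(3)[OF \<eta>0 \<eta>0, of "a * x" "w * x"] A_carrier[OF aw(1)] W_carrier'[OF aw(2)] x by simp
    qed
    have "pr \<beta> x = 0" if b: "\<beta> \<in> carrier_mat 1 3" for \<beta>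
    proof (rule ccontr)
      assume nz: "pr \<beta> x \<noteq> 0"
      have "pr \<eta>0 v = 0" if v: "v \<in> carrier_mat 3 1" for v
      proof -
        have "pr \<eta>0 (v * \<beta> * x) = 0" using all0[of "v * \<beta>"] v b by simp
        then show ?thesis unfolding outer(1)[OF v b x b] pr_lin(6)[OF \<eta>0 \<eta>0 v v] using nz by simp
      qed
      then show False using pr_nondegenerate'[OF \<eta>0] ne by blast
    qed
    then show False using pr_nondegenerate[OF x] x0 by blast
  qed
  then obtain a0 where a0: "a0 \<in> A" "pr \<eta>0 (a0 * x) \<noteq> 0" by blast
  define \<eta> where "\<eta> = (1 / pr \<eta>0 (a0 * x)) \<cdot>\<^sub>m (\<eta>0 * a0)"
  have \<eta>: "\<eta> \<in> carrier_mat 1 3" using \<eta>0 A_carrier[OF a0(1)] by (simp add: \<eta>_def)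
  have \<eta>x: "pr \<eta> x = 1"
    unfolding \<eta>_def using a0 pr_lin(5)[of "\<eta>0 * a0" 3 "\<eta>0 * a0" x x] pr_assoc[OF \<eta>0 A_carrier[OF a0(1)] x] \<eta>0 x A_carrier[OF a0(1)] by simp
  have e: "x * \<eta> \<in> A"
  proof -
    have "x * \<eta> = (1 / pr \<eta>0 (a0 * x)) \<cdot>\<^sub>m (x * \<eta>0 * a0)"
      unfolding \<eta>_def using x \<eta>0 A_carrier[OF a0(1)] by (simp add: mult_smult_distrib[of _ 3 1 _ 3] mat_assoc)
    then show ?thesis using A_lin(3)[OF AA[OF xe a0(1)] AA[OF xe a0(1)]] by simp
  qed
  have \<eta>ne: "\<eta> \<noteq> 0\<^sub>m 1 3"
  proof
    assume "\<eta> = 0\<^sub>m 1 3"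
    then have "pr \<eta> x = 0" using x by (simp add: pr_def)
    then show False using \<eta>x by simp
  qed
  have e_nz: "x * \<eta> \<noteq> 0\<^sub>m 3 3" by (rule oz[OF x \<eta> x0 \<eta>ne])
  \<comment> \<open>all columns and rows that occur with \<open>\<eta>\<close> and \<open>x\<close> in \<open>A\<close>, modulo \<open>x\<close> and \<open>\<eta>\<close>\<close>
  define C where "C = {y \<in> carrier_mat 3 1. y * \<eta> \<in> A \<and> pr \<eta> y = 0}"
  define R where "R = {\<psi> \<in> carrier_mat 1 3. x * \<psi> \<in> A \<and> pr \<psi> x = 0}"
  have ortho: "pr \<psi> (w * y) = 0"
    if y: "y \<in> carrier_mat 3 1" "y * \<eta> \<in> A" and \<psi>: "\<psi> \<in> carrier_mat 1 3" "x * \<psi> \<in> A" and w: "w \<in> W" for y \<psi> w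
  proof -
    note wc = W_carrier'[OF w]
    have "x * \<psi> * w * (y * \<eta>) = x * \<psi> * ((w * y) * \<eta>)" using x \<eta> \<psi> y wc by (simp add: mat_assoc)
    also have "\<dots> = pr \<psi> (w * y) \<cdot>\<^sub>m (x * \<eta>)" by (rule outer(3)) (use x \<eta> \<psi> y wc in auto)
    finally have eq: "x * \<psi> * w * (y * \<eta>) = pr \<psi> (w * y) \<cdot>\<^sub>m (x * \<eta>)" .
    have "pr \<psi> (w * y) \<cdot>\<^sub>m (x * \<eta>) = 0\<^sub>m 3 3"
      by (rule disjoint) (use A_lin(3)[OF e e] WA[OF AW[OF \<psi>(2) w] y(2)] eq in auto)
    then show ?thesis using smult_zero_imp e_nz A_carrier[OF e] by blast
  qed
  have colC: "y - pr \<eta> y \<cdot>\<^sub>m x \<in> C" if y: "y \<in> carrier_mat 3 1" "y * \<eta> \<in> A" for y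
  proof -
    have "(y - pr \<eta> y \<cdot>\<^sub>m x) * \<eta> = y * \<eta> - pr \<eta> y \<cdot>\<^sub>m (x * \<eta>)"
      using y x \<eta> by (subst minus_mult_distrib_mat[of _ 3 1]) (auto simp: mult_smult_assoc_mat[of _ 3 1 _ 3])
    then show ?thesis
      using A_lin(2)[OF y(2) A_lin(3)[OF e e]] pr_lin(4,6)[OF \<eta> \<eta>] y x \<eta>x by (simp add: C_def minus_carrier_mat)
  qed
  have rowR: "\<psi> - pr \<psi> x \<cdot>\<^sub>m \<eta> \<in> R" if \<psi>: "\<psi> \<in> carrier_mat 1 3" "x * \<psi> \<in> A" for \<psi>
  proof -
    have "x * (\<psi> - pr \<psi> x \<cdot>\<^sub>m \<eta>) = x * \<psi> - pr \<psi> x \<cdot>\<^sub>m (x * \<eta>)"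
      using \<psi> x \<eta> by (subst mult_minus_distrib_mat[of _ 3 1]) (auto simp: mult_smult_distrib[of _ 3 1 _ 3])
    then show ?thesis
      using A_lin(2)[OF \<psi>(2) A_lin(3)[OF e e]] pr_lin(2,5)[OF _ _ x x] \<psi> \<eta> \<eta>x by (simp add: R_def minus_carrier_mat)
  qed
  have aC: "a * y \<in> carrier_mat 3 1" "a * y * \<eta> \<in> A" if "a \<in> A" "y \<in> carrier_mat 3 1" "y * \<eta> \<in> A" for a y
    using that A_carrier[OF that(1)] AA[OF that(1,3)] \<eta> by (auto simp: mat_assoc)
  have aR: "\<psi> * a \<in> carrier_mat 1 3" "x * (\<psi> * a) \<in> A" if "a \<in> A" "\<psi> \<in> carrier_mat 1 3" "x * \<psi> \<in> A" for a \<psi>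
    using that A_carrier[OF that(1)] AA[OF that(3,1)] x by (auto simp: mat_assoc)
  have C_lin: "y - k \<cdot>\<^sub>m y' \<in> C" if "y \<in> C" "y' \<in> C" for y y' k
  proof -
    have "(y - k \<cdot>\<^sub>m y') * \<eta> = y * \<eta> - k \<cdot>\<^sub>m (y' * \<eta>)"
      using that \<eta> by (subst minus_mult_distrib_mat[of _ 3 1]) (auto simp: C_def mult_smult_assoc_mat[of _ 3 1 _ 3])
    then show ?thesis using that A_lin(2)[OF _ A_lin(3), of "y * \<eta>" "y' * \<eta>" "y' * \<eta>"]
        pr_lin(4)[OF \<eta> \<eta>, of y "k \<cdot>\<^sub>m y'"] pr_lin(6)[OF \<eta> \<eta>, of y' y']
      by (simp add: C_def minus_carrier_mat)
  qed
  have R_lin: "\<psi> - k \<cdot>\<^sub>m \<psi>' \<in> R" if "\<psi> \<in> R" "\<psi>' \<in> R" for \<psi> \<psi>' k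
  proof -
    have "x * (\<psi> - k \<cdot>\<^sub>m \<psi>') = x * \<psi> - k \<cdot>\<^sub>m (x * \<psi>')"
      using that x by (subst mult_minus_distrib_mat[of _ 3 1]) (auto simp: R_def mult_smult_distrib[of _ 3 1 _ 3])
    then show ?thesis using that A_lin(2)[OF _ A_lin(3), of "x * \<psi>" "x * \<psi>'" "x * \<psi>'"]
        pr_lin(2)[OF _ _ x x, of \<psi> "k \<cdot>\<^sub>m \<psi>'"] pr_lin(5)[OF _ _ x x, of \<psi>' \<psi>']
      by (simp add: R_def minus_carrier_mat)
  qed
  have R_smult: "k \<cdot>\<^sub>m \<psi> \<in> R" if "\<psi> \<in> R" for \<psi> k
    using that A_lin(3)[of "x * \<psi>" "x * \<psi>" k] pr_lin(5)[OF _ _ x x, of \<psi> \<psi>] x by (simp add: R_def mult_smult_distrib[of _ 3 1 _ 3])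
  have C_D: "y \<in> carrier_mat 3 1" "y * \<eta> \<in> A" "pr \<eta> y = 0" if "y \<in> C" for y using that by (auto simp: C_def)
  have R_D: "\<psi> \<in> carrier_mat 1 3" "x * \<psi> \<in> A" "pr \<psi> x = 0" if "\<psi> \<in> R" for \<psi> using that by (auto simp: R_def)
  have dualC: "\<exists>\<psi>\<in>R. pr \<psi> y \<noteq> 0" if y: "y \<in> C" "y \<noteq> 0\<^sub>m 3 1" for y
  proof (rule ccontr)
    assume no: "\<not> (\<exists>\<psi>\<in>R. pr \<psi> y \<noteq> 0)"
    note yD = C_D[OF y(1)]
    have all0: "pr \<eta> (m * y) = 0" if m: "m \<in> carrier_mat 3 3" for m
    proof -
      obtain a w where aw: "a \<in> A" "w \<in> W" "m = a + w" using sum[OF m] by blast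
      note ac = A_carrier[OF aw(1)] and wc = W_carrier'[OF aw(2)]
      have "\<eta> * a - pr (\<eta> * a) x \<cdot>\<^sub>m \<eta> \<in> R" using rowR[OF aR[OF aw(1) \<eta> e]] .
      then have "pr (\<eta> * a - pr (\<eta> * a) x \<cdot>\<^sub>m \<eta>) y = 0" using no by blast
      then have "pr (\<eta> * a) y = 0" using pr_lin(2,5)[OF _ _ yD(1,1)] aR(1)[OF aw(1) \<eta> e] \<eta> yD(3) by simp
      moreover have "m * y = a * y + w * y" unfolding aw(3) by (rule add_mult_distrib_mat[OF ac wc yD(1)])
      ultimately show ?thesis using ortho[OF yD(1,2) \<eta> e aw(2)] pr_assoc[OF \<eta> ac yD(1)] pr_lin(3)[OF \<eta> \<eta>, of "a * y" "w * y"] ac wc yD(1) by simp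
    qed
    have "pr \<beta> y = 0" if b: "\<beta> \<in> carrier_mat 1 3" for \<beta>
      using all0[of "x * \<beta>"] outer(1)[OF x b yD(1) b] pr_lin(6)[OF \<eta> \<eta> x x] \<eta>x x b by simp
    then show False using pr_nondegenerate[OF yD(1)] y(2) by blast
  qed
  have dualR: "\<exists>y\<in>C. pr \<psi> y \<noteq> 0" if \<psi>: "\<psi> \<in> R" "\<psi> \<noteq> 0\<^sub>m 1 3" for \<psi>
  proof (rule ccontr)
    assume no: "\<not> (\<exists>y\<in>C. pr \<psi> y \<noteq> 0)"
    note pD = R_D[OF \<psi>(1)]
    have all0: "pr \<psi> (m * x) = 0" if m: "m \<in> carrier_mat 3 3" for m
    proof -
      obtain a w where aw: "a \<in> A" "w \<in> W" "m = a + w" using sum[OF m] by blast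
      note ac = A_carrier[OF aw(1)] and wc = W_carrier'[OF aw(2)]
      have "a * x - pr \<eta> (a * x) \<cdot>\<^sub>m x \<in> C" using colC[OF aC[OF aw(1) x e]] .
      then have "pr \<psi> (a * x - pr \<eta> (a * x) \<cdot>\<^sub>m x) = 0" using no by blast
      then have "pr \<psi> (a * x) = 0" using pr_lin(4,6)[OF pD(1,1)] aC(1)[OF aw(1) x e] x pD(3) by simp
      moreover have "m * x = a * x + w * x" unfolding aw(3) by (rule add_mult_distrib_mat[OF ac wc x])
      ultimately show ?thesis using ortho[OF x e pD(1,2) aw(2)] pr_lin(3)[OF pD(1,1), of "a * x" "w * x"] ac wc x by simp
    qed
    have "pr \<psi> v = 0" if v: "v \<in> carrier_mat 3 1" for v
      using all0[of "v * \<eta>"] outer(1)[OF v \<eta> x \<eta>] \<eta>x v \<eta> by simp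
    then show False using pr_nondegenerate'[OF pD(1)] \<psi>(2) by blast
  qed
  have eqI: "u = k \<cdot>\<^sub>m v" if "u - k \<cdot>\<^sub>m v = 0\<^sub>m m n" "u \<in> carrier_mat m n" "v \<in> carrier_mat m n" for u v :: "'a mat" and k m n
    using mat_add_eq_iff_minus[of u m n "k \<cdot>\<^sub>m v"] that by simp
  show False
  proof (cases "C \<subseteq> {0\<^sub>m 3 1}")
    case True
    have R0: "\<psi> = 0\<^sub>m 1 3" if "\<psi> \<in> R" for \<psi>
    proof (rule ccontr)
      assume "\<psi> \<noteq> 0\<^sub>m 1 3"
      then obtain y where "y \<in> C" "pr \<psi> y \<noteq> 0" using dualR[OF \<open>\<psi> \<in> R\<close>] by blast
      then show False using True R_D(1)[OF \<open>\<psi> \<in> R\<close>] by (auto simp: pr_def)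
    qed
    \<comment> \<open>the block of size \<open>1\<close> is \<open>x \<eta>\<close>\<close>
    define E where "E = x * \<eta>"
    have Ec: "E \<in> carrier_mat 3 3" using x \<eta> by (simp add: E_def)
    have \<eta>a: "\<eta> * a = pr (\<eta> * a) x \<cdot>\<^sub>m \<eta>" if "a \<in> A" for a
      using eqI[OF R0[OF rowR[OF aR[OF that \<eta> e]]] aR(1)[OF that \<eta> e] \<eta>] .
    have ax: "a * x = pr \<eta> (a * x) \<cdot>\<^sub>m x" if "a \<in> A" for a
    proof (rule eqI[OF _ aC(1)[OF that x e] x])
      show "a * x - pr \<eta> (a * x) \<cdot>\<^sub>m x = 0\<^sub>m 3 1" using True colC[OF aC[OF that x e]] by blast
    qed
    have EE: "E * E = E" unfolding E_def outer(3)[OF x \<eta> x \<eta>] \<eta>x using x \<eta> by (intro eq_matI) auto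
    have l: "E * a = E * a * E" if a: "a \<in> A" for a
    proof -
      have "E * a = x * (\<eta> * a)" unfolding E_def using x \<eta> A_carrier[OF a] by (simp add: mat_assoc)
      also have "\<dots> = pr (\<eta> * a) x \<cdot>\<^sub>m E" by (subst \<eta>a[OF a]) (use x \<eta> in \<open>simp add: E_def mult_smult_distrib[of _ 3 1 _ 3]\<close>)
      finally have "E * a = pr (\<eta> * a) x \<cdot>\<^sub>m E" .
      then show ?thesis using Ec EE by (simp add: mult_smult_assoc_mat[of _ 3 3 _ 3])
    qed
    have r: "a * E = E * a * E" if a: "a \<in> A" for a
    proof -
      have "a * E = (a * x) * \<eta>" unfolding E_def using x \<eta> A_carrier[OF a] by (simp add: mat_assoc)
      also have "\<dots> = pr \<eta> (a * x) \<cdot>\<^sub>m E" by (subst ax[OF a]) (use x \<eta> in \<open>simp add: E_def mult_smult_assoc_mat[of _ 3 1 _ 3]\<close>)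
      finally have aE: "a * E = pr \<eta> (a * x) \<cdot>\<^sub>m E" .
      have "E * a * E = E * (a * E)" using Ec A_carrier[OF a] by (simp add: mat_assoc)
      then show ?thesis unfolding aE using Ec EE by (simp add: mult_smult_distrib[of _ 3 3 _ 3])
    qed
    have w: "E * w * E = 0\<^sub>m 3 3" if w: "w \<in> W" for w
    proof -
      have "E * w * E = x * \<eta> * ((w * x) * \<eta>)" unfolding E_def using x \<eta> W_carrier'[OF w] by (simp add: mat_assoc)
      also have "\<dots> = pr \<eta> (w * x) \<cdot>\<^sub>m (x * \<eta>)" by (rule outer(3)) (use x \<eta> W_carrier'[OF w] in auto)
      finally show ?thesis using ortho[OF x e \<eta> e w] x \<eta> by (auto intro!: eq_matI)
    qed
    note od = off_diagonal_in_W[OF e[folded E_def] l r w]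
    show False
    proof (rule cross_not_in_W[OF x \<eta> \<eta>x])
      fix \<beta> :: "'a mat" assume b: "\<beta> \<in> carrier_mat 1 3" "pr \<beta> x = 0"
      show "x * \<beta> \<in> W"
        by (rule od(1)) (use x b \<eta> outer(3)[OF x \<eta> x b(1)] outer(3)[OF x b(1) x \<eta>] \<eta>x in \<open>auto simp: E_def intro!: eq_matI\<close>)
    next
      fix v :: "'a mat" assume v: "v \<in> carrier_mat 3 1" "pr \<eta> v = 0"
      show "v * \<eta> \<in> W"
        by (rule od(2)) (use x v \<eta> outer(3)[OF x \<eta> v(1) \<eta>] outer(3)[OF v(1) \<eta> x \<eta>] \<eta>x in \<open>auto simp: E_def intro!: eq_matI\<close>)
    qed
  next
    case False
    then obtain y where y: "y \<in> C" "y \<noteq> 0\<^sub>m 3 1" by blast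
    note yD = C_D[OF y(1)]
    obtain \<psi>0 where p0: "\<psi>0 \<in> R" "pr \<psi>0 y \<noteq> 0" using dualC[OF y] by blast
    define \<psi> where "\<psi> = (1 / pr \<psi>0 y) \<cdot>\<^sub>m \<psi>0"
    have \<psi>R: "\<psi> \<in> R" unfolding \<psi>_def by (rule R_smult[OF p0(1)])
    note pD = R_D[OF \<psi>R]
    have \<psi>y: "pr \<psi> y = 1" unfolding \<psi>_def using p0 pr_lin(5)[OF R_D(1)[OF p0(1)] R_D(1)[OF p0(1)] yD(1) yD(1)] by simp
    have mixed: "u * \<theta> \<in> A" if "u \<in> carrier_mat 3 1" "u * \<eta> \<in> A" "\<theta> \<in> carrier_mat 1 3" "x * \<theta> \<in> A" for u \<theta>
    proof -
      have "u * \<eta> * (x * \<theta>) = u * \<theta>" using outer(3)[OF that(1) \<eta> x that(3)] \<eta>x that by (auto intro!: eq_matI)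
      then show ?thesis using AA[OF that(2,4)] by simp
    qed
    have sandwich0: "u * \<theta> * w * (u' * \<theta>') = 0\<^sub>m 3 3"
      if "u \<in> carrier_mat 3 1" "\<theta> \<in> carrier_mat 1 3" "x * \<theta> \<in> A" "u' \<in> carrier_mat 3 1" "u' * \<eta> \<in> A" "\<theta>' \<in> carrier_mat 1 3" "w \<in> W"
      for u u' \<theta> \<theta>' w
    proof -
      note wc = W_carrier'[OF that(7)]
      have "u * \<theta> * w * (u' * \<theta>') = u * \<theta> * ((w * u') * \<theta>')" using that wc by (simp add: mat_assoc)
      also have "\<dots> = pr \<theta> (w * u') \<cdot>\<^sub>m (u * \<theta>')" by (rule outer(3)) (use that wc in auto)
      finally show ?thesis using ortho[OF that(4,5,2,3,7)] that by (auto intro!: eq_matI)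
    qed
    show False
    proof (cases "\<forall>u\<in>C. \<exists>k. u = k \<cdot>\<^sub>m y")
      case False
      then obtain u where u: "u \<in> C" "\<And>k. u \<noteq> k \<cdot>\<^sub>m y" by blast
      \<comment> \<open>complete \<open>x\<close>, \<open>y\<close> and \<open>\<eta>\<close>, \<open>\<psi>\<close> to dual bases by Gram-Schmidt steps\<close>
      define z where "z = u - pr \<psi> u \<cdot>\<^sub>m y"
      have zC: "z \<in> C" unfolding z_def by (rule C_lin[OF u(1) y(1)])
      note zD = C_D[OF zC]
      have "z \<noteq> 0\<^sub>m 3 1" using eqI[of u "pr \<psi> u" y 3 1] u C_D(1)[OF u(1)] yD(1) by (auto simp: z_def)
      then obtain \<zeta>0 where z0: "\<zeta>0 \<in> R" "pr \<zeta>0 z \<noteq> 0" using dualC[OF zC] by blast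
      have \<psi>z: "pr \<psi> z = 0" unfolding z_def using pr_lin(4,6)[OF pD(1,1)] C_D(1)[OF u(1)] yD(1) \<psi>y by simp
      define \<zeta>1 where "\<zeta>1 = \<zeta>0 - pr \<zeta>0 y \<cdot>\<^sub>m \<psi>"
      define \<zeta> where "\<zeta> = (1 / pr \<zeta>0 z) \<cdot>\<^sub>m \<zeta>1"
      have z1: "\<zeta>1 \<in> R" unfolding \<zeta>1_def by (rule R_lin[OF z0(1) \<psi>R])
      have zR: "\<zeta> \<in> R" unfolding \<zeta>_def by (rule R_smult[OF z1])
      note zeD = R_D[OF zR]
      have "pr \<zeta>1 z = pr \<zeta>0 z" "pr \<zeta>1 y = 0"
        unfolding \<zeta>1_def using pr_lin(2,5)[OF _ _ zD(1) zD(1)] pr_lin(2,5)[OF _ _ yD(1) yD(1)] R_D(1)[OF z0(1)] pD(1) \<psi>z \<psi>y by simp_all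
      then have \<zeta>zy: "pr \<zeta> z = 1" "pr \<zeta> y = 0"
        unfolding \<zeta>_def using z0 pr_lin(5)[OF R_D(1)[OF z1] R_D(1)[OF z1] zD(1) zD(1)] pr_lin(5)[OF R_D(1)[OF z1] R_D(1)[OF z1] yD(1) yD(1)] by simp_all
      define P where "P = mat 3 3 (\<lambda>(i,j). if j = 0 then x $$ (i,0) else if j = 1 then y $$ (i,0) else z $$ (i,0))"
      define Q where "Q = mat 3 3 (\<lambda>(i,j). if i = 0 then \<eta> $$ (0,j) else if i = 1 then \<psi> $$ (0,j) else \<zeta> $$ (0,j))"
      have P: "P \<in> carrier_mat 3 3" and Q: "Q \<in> carrier_mat 3 3" by (simp_all add: P_def Q_def)
      have "Q * P = 1\<^sub>m 3"
      proof (rule eq_matI)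
        fix i j assume "i < dim_row (1\<^sub>m 3 :: 'a mat)" "j < dim_col (1\<^sub>m 3 :: 'a mat)"
        then have ij: "i < 3" "j < 3" by auto
        have "(Q * P) $$ (i,j) = pr (if i = 0 then \<eta> else if i = 1 then \<psi> else \<zeta>) (if j = 0 then x else if j = 1 then y else z)"
          unfolding mult_index[OF Q P ij] using ij x yD(1) zD(1) \<eta> pD(1) zeD(1) by (subst pr_index[of _ 3]) (auto simp: P_def Q_def intro!: sum.cong)
        then show "(Q * P) $$ (i,j) = (1\<^sub>m 3 :: 'a mat) $$ (i,j)"
          using ij \<eta>x yD(3) zD(3) pD(3) \<psi>y \<psi>z zeD(3) \<zeta>zy by (auto simp: less_Suc_eq numeral_3_eq_3)
      qed (use P Q in auto)
      then have "P * Q = 1\<^sub>m 3" using mat_mult_left_right_inverse[OF Q P] by simp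
      moreover have "P * Q = x * \<eta> + y * \<psi> + z * \<zeta>"
      proof (rule eq_matI)
        fix i j assume "i < dim_row (x * \<eta> + y * \<psi> + z * \<zeta>)" "j < dim_col (x * \<eta> + y * \<psi> + z * \<zeta>)"
        then have ij: "i < 3" "j < 3" using zD(1) zeD(1) by auto
        have "(x * \<eta> + y * \<psi> + z * \<zeta>) $$ (i,j) = (x * \<eta>) $$ (i,j) + (y * \<psi>) $$ (i,j) + (z * \<zeta>) $$ (i,j)"
          using ij x yD(1) zD(1) \<eta> pD(1) zeD(1) by simp
        then show "(P * Q) $$ (i,j) = (x * \<eta> + y * \<psi> + z * \<zeta>) $$ (i,j)"
          using mult_index[OF P Q ij] mult_index[OF x \<eta> ij] mult_index[OF yD(1) pD(1) ij] mult_index[OF zD(1) zeD(1) ij] ij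
          by (simp add: P_def Q_def numeral_3_eq_3)
      qed (use P Q zD(1) zeD(1) in auto)
      ultimately have one: "x * \<eta> + y * \<psi> + z * \<zeta> = 1\<^sub>m 3" by simp
      obtain w where w: "w \<in> W" "w \<noteq> 0\<^sub>m 3 3" using W_nonzero by blast
      note wc = W_carrier'[OF w(1)]
      have xc: "x * \<eta> \<in> carrier_mat 3 3" "y * \<psi> \<in> carrier_mat 3 3" "z * \<zeta> \<in> carrier_mat 3 3"
        using x \<eta> yD(1) pD(1) zD(1) zeD(1) by auto
      have dist: "(p + q + r) * m = p * m + q * m + r * m" if "p \<in> carrier_mat 3 3" "q \<in> carrier_mat 3 3" "r \<in> carrier_mat 3 3" "m \<in> carrier_mat 3 3" for p q r m :: "'a mat"
        using that add_mult_distrib_mat[of "p + q" 3 3 r m 3] add_mult_distrib_mat[of p 3 3 q m 3] by simp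
      have dist': "m * (p + q + r) = m * p + m * q + m * r" if "p \<in> carrier_mat 3 3" "q \<in> carrier_mat 3 3" "r \<in> carrier_mat 3 3" "m \<in> carrier_mat 3 3" for p q r m :: "'a mat"
        using that mult_add_distrib_mat[of m 3 3 "p + q" 3 r] mult_add_distrib_mat[of m 3 3 p 3 q] by simp
      have "w = (x * \<eta> + y * \<psi> + z * \<zeta>) * w * (x * \<eta> + y * \<psi> + z * \<zeta>)" unfolding one using wc by simp
      also have "\<dots> = 0\<^sub>m 3 3"
      proof -
        note s = sandwich0[OF _ _ _ _ _ _ w(1)]
        note rows = s[OF x \<eta> e] s[OF yD(1) pD(1,2)] s[OF zD(1) zeD(1,2)]
        note cells = rows[OF x e \<eta>] rows[OF yD(1,2) pD(1)] rows[OF zD(1,2) zeD(1)]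
        have c: "x * \<eta> * w \<in> carrier_mat 3 3" "y * \<psi> * w \<in> carrier_mat 3 3" "z * \<zeta> * w \<in> carrier_mat 3 3"
          using xc wc by auto
        then have c': "x * \<eta> * w + y * \<psi> * w + z * \<zeta> * w \<in> carrier_mat 3 3" by (intro add_carrier_mat) 
        show ?thesis
          unfolding dist[OF xc wc] dist'[OF xc c'] dist[OF c xc(1)] dist[OF c xc(2)] dist[OF c xc(3)] cells by simp
      qed
      finally show False using w by simp
    next
      case True
      have Ry: "\<exists>k. \<theta> = k \<cdot>\<^sub>m \<psi>" if t: "\<theta> \<in> R" for \<theta>
      proof -
        define \<theta>' where "\<theta>' = \<theta> - pr \<theta> y \<cdot>\<^sub>m \<psi>"
        have t': "\<theta>' \<in> R" unfolding \<theta>'_def by (rule R_lin[OF t \<psi>R])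
        have ty: "pr \<theta>' y = 0" unfolding \<theta>'_def using pr_lin(2,5)[OF _ _ yD(1) yD(1)] R_D(1)[OF t] pD(1) \<psi>y by simp
        have "pr \<theta>' u = 0" if u: "u \<in> C" for u
        proof -
          obtain k where k: "u = k \<cdot>\<^sub>m y" using bspec[OF True u] by blast
          show ?thesis unfolding k pr_lin(6)[OF R_D(1)[OF t'] R_D(1)[OF t'] yD(1) yD(1)] ty by simp
        qed
        then have "\<theta>' = 0\<^sub>m 1 3" using dualR[OF t'] by blast
        then show ?thesis using eqI[of \<theta> "pr \<theta> y" \<psi> 1 3] R_D(1)[OF t] pD(1) by (auto simp: \<theta>'_def)
      qed
      \<comment> \<open>the block of size \<open>2\<close> is cut out by \<open>E\<close>, and its complement \<open>F\<close> has rank one\<close>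
      define E where "E = x * \<eta> + y * \<psi>"
      have xc: "x * \<eta> \<in> carrier_mat 3 3" "y * \<psi> \<in> carrier_mat 3 3" using x \<eta> yD(1) pD(1) by auto
      have Ec: "E \<in> carrier_mat 3 3" using xc by (simp add: E_def)
      have EA: "E \<in> A" unfolding E_def by (rule A_lin(1)[OF e mixed[OF yD(1,2) pD(1,2)]])
      have \<theta>E: "\<theta> * E = pr \<theta> x \<cdot>\<^sub>m \<eta> + pr \<theta> y \<cdot>\<^sub>m \<psi>" if t: "\<theta> \<in> carrier_mat 1 3" for \<theta>
        unfolding E_def using mult_add_distrib_mat[OF t xc] outer(2)[OF x t x \<eta>] outer(2)[OF x t yD(1) pD(1)] by simp
      have Ev: "E * v = pr \<eta> v \<cdot>\<^sub>m x + pr \<psi> v \<cdot>\<^sub>m y" if v: "v \<in> carrier_mat 3 1" for v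
        unfolding E_def using add_mult_distrib_mat[OF xc v] outer(1)[OF x \<eta> v \<eta>] outer(1)[OF yD(1) pD(1) v \<eta>] by simp
      have rowE: "\<theta> * E = \<theta>" if t: "\<theta> \<in> carrier_mat 1 3" "x * \<theta> \<in> A" for \<theta>
      proof -
        obtain k where k: "\<theta> - pr \<theta> x \<cdot>\<^sub>m \<eta> = k \<cdot>\<^sub>m \<psi>" using Ry[OF rowR[OF t]] by blast
        have "pr (\<theta> - pr \<theta> x \<cdot>\<^sub>m \<eta>) y = k" unfolding k using pr_lin(5)[OF pD(1,1) yD(1,1)] \<psi>y by simp
        then have "pr \<theta> y = k" using pr_lin(2,5)[OF _ _ yD(1,1)] t \<eta> yD(3) by simp
        then show ?thesis unfolding \<theta>E[OF t(1)]
          by (metis mat_diff_eqD[OF k t(1)] smult_carrier_mat \<eta>)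
      qed
      have colE: "E * v = v" if v: "v \<in> carrier_mat 3 1" "v * \<eta> \<in> A" for v
      proof -
        obtain k where k: "v - pr \<eta> v \<cdot>\<^sub>m x = k \<cdot>\<^sub>m y" using True colC[OF v] by blast
        have "pr \<psi> (v - pr \<eta> v \<cdot>\<^sub>m x) = k" unfolding k using pr_lin(6)[OF pD(1,1) yD(1,1)] \<psi>y by simp
        then have "pr \<psi> v = k" using pr_lin(4,6)[OF pD(1,1)] v x pD(3) by simp
        then show ?thesis unfolding Ev[OF v(1)]
          by (metis mat_diff_eqD[OF k v(1)] smult_carrier_mat x)
      qed
      have l: "E * a = E * a * E" if a: "a \<in> A" for a
      proof -
        note ac = A_carrier[OF a]
        have "E * a = x * (\<eta> * a) + y * (\<psi> * a)"
          unfolding E_def using add_mult_distrib_mat[OF xc ac] x \<eta> yD(1) pD(1) ac by (simp add: mat_assoc)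
        also have "\<dots> = x * (\<eta> * a * E) + y * (\<psi> * a * E)"
          using rowE[OF aR[OF a \<eta> e]] rowE[OF aR[OF a pD(1,2)]] by simp
        also have "\<dots> = (x * \<eta> * a + y * \<psi> * a) * E"
          using add_mult_distrib_mat[of "x * \<eta> * a" 3 3 "y * \<psi> * a" E 3] x \<eta> yD(1) pD(1) ac Ec by (simp add: mat_assoc)
        also have "\<dots> = E * a * E" unfolding E_def using add_mult_distrib_mat[OF xc ac] by simp
        finally show ?thesis .
      qed
      have r: "a * E = E * a * E" if a: "a \<in> A" for a
      proof -
        note ac = A_carrier[OF a]
        have aE: "a * E = (a * x) * \<eta> + (a * y) * \<psi>"
          unfolding E_def using mult_add_distrib_mat[OF ac xc] x \<eta> yD(1) pD(1) ac by (simp add: mat_assoc)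
        have "E * (a * E) = E * (a * x) * \<eta> + E * (a * y) * \<psi>"
          unfolding aE using mult_add_distrib_mat[of E 3 3 "a * x * \<eta>" 3 "a * y * \<psi>"] x \<eta> yD(1) pD(1) ac Ec by (simp add: mat_assoc)
        also have "\<dots> = a * E" unfolding aE using colE[OF aC[OF a x e]] colE[OF aC[OF a yD(1,2)]] by simp
        finally show ?thesis using Ec ac by (simp add: mat_assoc)
      qed
      have w: "E * w * E = 0\<^sub>m 3 3" if w: "w \<in> W" for w
      proof -
        note wc = W_carrier'[OF w]
        have "E * w * E = (x * \<eta> * w + y * \<psi> * w) * (x * \<eta> + y * \<psi>)"
          unfolding E_def using add_mult_distrib_mat[OF xc wc] by simp
        also have "\<dots> = x * \<eta> * w * (x * \<eta>) + y * \<psi> * w * (x * \<eta>) + (x * \<eta> * w * (y * \<psi>) + y * \<psi> * w * (y * \<psi>))"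
        proof -
          have c1: "x * \<eta> * w \<in> carrier_mat 3 3" "y * \<psi> * w \<in> carrier_mat 3 3" using xc wc by auto
          then have c2: "x * \<eta> * w + y * \<psi> * w \<in> carrier_mat 3 3" by simp
          show ?thesis
            unfolding mult_add_distrib_mat[OF c2 xc] add_mult_distrib_mat[OF c1 xc(1)] add_mult_distrib_mat[OF c1 xc(2)]
            by (rule refl)
        qed
        also have "\<dots> = 0\<^sub>m 3 3"
        proof -
          note s = sandwich0[OF _ _ _ _ _ _ w]
          note rows = s[OF x \<eta> e] s[OF yD(1) pD(1,2)]
          note cells = rows[OF x e \<eta>] rows[OF yD(1,2) pD(1)]
          show ?thesis unfolding cells by simp
        qed
        finally show ?thesis .
      qed
      note od = off_diagonal_in_W[OF EA l r w]
      define F where "F = 1\<^sub>m 3 - E"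
      have Fc: "F \<in> carrier_mat 3 3" unfolding F_def using Ec by (intro minus_carrier_mat)
      have Ex: "E * x = x" by (rule colE[OF x e])
      have Ey: "E * y = y" by (rule colE[OF yD(1,2)])
      have EE: "E * E = E"
      proof -
        have "E * E = (E * x) * \<eta> + (E * y) * \<psi>"
          by (subst (2) E_def) (use mult_add_distrib_mat[OF Ec xc] x \<eta> yD(1) pD(1) Ec in \<open>simp add: mat_assoc\<close>)
        then show ?thesis unfolding Ex Ey by (simp add: E_def)
      qed
      have EF: "E * F = 0\<^sub>m 3 3" unfolding F_def using mult_minus_distrib_mat[OF Ec one_carrier_mat Ec] EE Ec by simp
      have FE: "F * E = 0\<^sub>m 3 3" unfolding F_def using minus_mult_distrib_mat[OF one_carrier_mat Ec Ec] EE Ec by simp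
      have FF: "F * F = F" using minus_mult_distrib_mat[OF one_carrier_mat Ec Fc] EF Fc by (simp add: F_def[symmetric]) (intro eq_matI, auto)
      obtain d z \<zeta> where z: "z \<in> carrier_mat 3 d" and \<zeta>: "\<zeta> \<in> carrier_mat d 3" and zF: "z * \<zeta> = F" and \<zeta>z: "\<zeta> * z = 1\<^sub>m d"
        using idempotent_split[OF Fc FF] .
      define P where "P = mat 3 2 (\<lambda>(i,j). if j = 0 then x $$ (i,0) else y $$ (i,0))"
      define Q where "Q = mat 2 3 (\<lambda>(i,j). if i = 0 then \<eta> $$ (0,j) else \<psi> $$ (0,j))"
      have P: "P \<in> carrier_mat 3 2" and Q: "Q \<in> carrier_mat 2 3" by (simp_all add: P_def Q_def)
      have QP: "Q * P = 1\<^sub>m 2"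
      proof (rule eq_matI)
        fix i j assume "i < dim_row (1\<^sub>m 2 :: 'a mat)" "j < dim_col (1\<^sub>m 2 :: 'a mat)"
        then have ij: "i < 2" "j < 2" by auto
        have "(Q * P) $$ (i,j) = pr (if i = 0 then \<eta> else \<psi>) (if j = 0 then x else y)"
          unfolding mult_index[OF Q P ij] using ij x yD(1) \<eta> pD(1) by (subst pr_index[of _ 3]) (auto simp: P_def Q_def intro!: sum.cong)
        then show "(Q * P) $$ (i,j) = (1\<^sub>m 2 :: 'a mat) $$ (i,j)"
          using ij \<eta>x yD(3) pD(3) \<psi>y by (auto simp: less_Suc_eq numeral_2_eq_2)
      qed (use P Q in auto)
      have PQ: "P * Q = E"
      proof (rule eq_matI)
        fix i j assume "i < dim_row E" "j < dim_col E"
        then have ij: "i < 3" "j < 3" using Ec by auto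
        have "E $$ (i,j) = (x * \<eta>) $$ (i,j) + (y * \<psi>) $$ (i,j)" unfolding E_def using ij x yD(1) \<eta> pD(1) by simp
        then show "(P * Q) $$ (i,j) = E $$ (i,j)"
          using mult_index[OF P Q ij] mult_index[OF x \<eta> ij] mult_index[OF yD(1) pD(1) ij] ij by (simp add: P_def Q_def numeral_2_eq_2)
      qed (use P Q Ec in auto)
      have Ez: "E * z = 0\<^sub>m 3 d"
      proof -
        have "E * z = E * (z * \<zeta>) * z" using Ec z \<zeta> \<zeta>z by (simp add: mat_assoc)
        then show ?thesis unfolding zF EF using z by simp
      qed
      have \<zeta>E: "\<zeta> * E = 0\<^sub>m d 3"
      proof -
        have "\<zeta> * E = (\<zeta> * z) * (\<zeta> * E)" using Ec z \<zeta> \<zeta>z by simp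
        also have "\<dots> = \<zeta> * (z * \<zeta> * E)" using Ec z \<zeta> by (simp add: mat_assoc)
        finally show ?thesis unfolding zF FE using \<zeta> by simp
      qed
      have Qz: "Q * z = 0\<^sub>m 2 d"
      proof -
        have "Q * z = (Q * P) * (Q * z)" using QP Q z by simp
        also have "\<dots> = Q * (E * z)" unfolding PQ[symmetric] using P Q z by (simp add: mat_assoc)
        finally show ?thesis unfolding Ez using Q by simp
      qed
      have \<zeta>P: "\<zeta> * P = 0\<^sub>m d 2"
      proof -
        have "\<zeta> * P = (\<zeta> * P) * (Q * P)" using QP \<zeta> P by simp
        also have "\<dots> = \<zeta> * E * P" unfolding PQ[symmetric] using P Q \<zeta> by (simp add: mat_assoc)
        finally show ?thesis unfolding \<zeta>E using P by simp
      qed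
      have "P * Q + z * \<zeta> = 1\<^sub>m 3" unfolding PQ zF F_def using Ec by (intro eq_matI) auto
      then have "3 = 2 + d" by (intro dims_add_of_split[OF P Q z \<zeta> QP \<zeta>z Qz \<zeta>P])
      then have d1: "d = 1" by simp
      note z = z[unfolded d1] and \<zeta> = \<zeta>[unfolded d1]
      have pz: "pr \<zeta> z = 1" unfolding pr_def \<zeta>z d1 by simp
      show False
      proof (rule cross_not_in_W[OF z \<zeta> pz])
        fix \<beta> :: "'a mat" assume b: "\<beta> \<in> carrier_mat 1 3" "pr \<beta> z = 0"
        have "F * (z * \<beta>) = z * \<beta>" unfolding zF[symmetric] outer(3)[OF z \<zeta> z b(1)] pz using z b by (auto intro!: eq_matI)
        have E1: "E * (z * \<beta>) = 0\<^sub>m 3 3" using Ez d1 Ec z b by (simp add: mat_assoc[symmetric])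
        have "z * \<beta> * F = 0\<^sub>m 3 3" unfolding zF[symmetric] outer(3)[OF z b(1) z \<zeta>] b(2) using z \<zeta> by (auto intro!: eq_matI)
        moreover have "z * \<beta> * F = z * \<beta> - z * \<beta> * E"
          unfolding F_def using mult_minus_distrib_mat[of "z * \<beta>" 3 3 "1\<^sub>m 3" 3 E] z b Ec by simp
        ultimately have d0: "z * \<beta> - z * \<beta> * E = 0\<^sub>m 3 3" by simp
        have E2: "z * \<beta> * E = z * \<beta>"
          by (rule iffD1[OF mat_add_eq_iff_minus d0, symmetric]) (use z b Ec in auto)
        show "z * \<beta> \<in> W" by (rule od(2)) (use z b E1 E2 in auto)
      next
        fix v :: "'a mat" assume v: "v \<in> carrier_mat 3 1" "pr \<zeta> v = 0"
        have E1: "v * \<zeta> * E = 0\<^sub>m 3 3" using \<zeta>E d1 Ec \<zeta> v by (simp add: mat_assoc)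
        have "F * (v * \<zeta>) = 0\<^sub>m 3 3" unfolding zF[symmetric] outer(3)[OF z \<zeta> v(1) \<zeta>] v(2) using z \<zeta> by (auto intro!: eq_matI)
        moreover have "F * (v * \<zeta>) = v * \<zeta> - E * (v * \<zeta>)"
          unfolding F_def using minus_mult_distrib_mat[of "1\<^sub>m 3" 3 3 E "v * \<zeta>" 3] v \<zeta> Ec by simp
        ultimately have d0: "v * \<zeta> - E * (v * \<zeta>) = 0\<^sub>m 3 3" by simp
        have E2: "E * (v * \<zeta>) = v * \<zeta>"
          by (rule iffD1[OF mat_add_eq_iff_minus d0, symmetric]) (use v \<zeta> Ec in auto)
        show "v * \<zeta> \<in> W" by (rule od(1)) (use v \<zeta> E1 E2 in auto)
      qed
    qed
  qed
qed

end

section \<open>The fusion ring of a cosemisimple Hopf algebra\<close>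

text \<open>Cauchy's theorem for a finite subgroup of a possibly infinite group.\<close>

lemma (in group) prime_order_element:
  assumes Y: "subgroup Y G" "finite Y" and p: "prime p" "p dvd card Y"
  shows "\<exists>g\<in>carrier G. ord g = p"
proof -
  have gY: "group (G\<lparr>carrier := Y\<rparr>)" by (rule subgroup_imp_group[OF Y(1)])
  obtain m where m: "card Y = p * m" using p(2) by (elim dvdE)
  have "order (G\<lparr>carrier := Y\<rparr>) = p ^ 1 * m" by (simp add: order_def m)
  from sylow_thm[OF p(1) gY this] Y(2) obtain H where H: "subgroup H (G\<lparr>carrier := Y\<rparr>)" "card H = p"
    by auto
  have HG: "subgroup H G" using incl_subgroup[OF Y(1) H(1)] .
  interpret H: group "G\<lparr>carrier := H\<rparr>" by (rule subgroup_imp_group[OF HG])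
  have p2: "2 \<le> p" using prime_ge_2_nat[OF p(1)] .
  then have "\<not> H \<subseteq> {\<one>}" using card_mono[of "{\<one>}" H] H(2) by auto
  then obtain x where x: "x \<in> H" "x \<noteq> \<one>" by blast
  have xG: "x \<in> carrier G" using subgroup.mem_carrier[OF HG x(1)] .
  have "x [^]\<^bsub>G\<lparr>carrier := H\<rparr>\<^esub> order (G\<lparr>carrier := H\<rparr>) = \<one>" using H.pow_order_eq_1[of x] x(1) by simp
  then have "x [^] p = \<one>" by (simp add: order_def H(2) nat_pow_consistent[symmetric])
  then have "ord x dvd p" using pow_eq_id[OF xG] by simp
  moreover have "ord x \<noteq> 1" using ord_eq_1[OF xG] x(2) by simp
  ultimately have "ord x = p" using p(1) by (auto simp: prime_nat_iff)
  then show ?thesis using xG by blast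
qed

context cosemisimple_hopf_algebra
begin

interpretation fn: vector_space "fscale :: 'k \<Rightarrow> (nat \<times> nat \<Rightarrow> 'k) \<Rightarrow> _" by (rule vector_space_fscale)

lemma homs_trivial:
  assumes c: "corep t" "corep s" and h: "hdim t s = 0" and T: "T \<in> homs t s"
  shows "T = 0\<^sub>m (dim_row s) (dim_row t)"
proof -
  obtain D :: "(nat \<times> nat \<Rightarrow> 'k) set" where D: "finite D" "flat ` carrier_mat (dim_row s) (dim_row t) \<subseteq> fn.span D"
    by (rule flat_finite_span)
  obtain B where B: "B \<subseteq> flat ` homs t s" "fn.independent B" "flat ` homs t s \<subseteq> fn.span B" "card B = fn.dim (flat ` homs t s)"
    by (rule fn.basis_exists)
  have "B \<subseteq> fn.span D" using B(1) D(2) homs_carrier[of t s] by blast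
  then have "finite B" using fn.independent_span_bound[OF D(1) B(2)] by blast
  then have "B = {}" using B(4) h by (simp add: hdim_def)
  then have "flat T = 0" using B(3) T by (auto simp: fn.span_empty)
  then have "flat T = flat (0\<^sub>m (dim_row s) (dim_row t))" by (simp only: flat_zero)
  then show ?thesis using flat_inj homsD(4)[OF T] zero_carrier_mat by blast
qed

lemma irr_dim_one: "corep t \<Longrightarrow> dim_row t = 1 \<Longrightarrow> irr t"
  unfolding irr_def
proof (intro conjI ballI)
  fix T assume t: "corep t" "dim_row t = 1" and T: "T \<in> homs t t"
  have "T = T $$ (0,0) \<cdot>\<^sub>m 1\<^sub>m (dim_row t)"
    using homsD(4)[OF T] t(2) by (intro eq_matI) auto
  then show "\<exists>c. T = c \<cdot>\<^sub>m 1\<^sub>m (dim_row t)" by blast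
qed auto

text \<open>Conjugation by an invertible scalar changes nothing.\<close>

lemma isom_dim_one:
  assumes t: "corep t" "dim_row t = 1" and s: "corep s" and i: "isom t s"
  shows "t = s"
proof -
  have s1: "dim_row s = 1" using isom_dim[OF i] t by simp
  obtain T U where T: "T \<in> homs t s" and U: "U \<in> homs s t" and TU: "T * U = 1\<^sub>m (dim_row s)"
    using isom_components[OF i] by metis
  have Tc: "T \<in> carrier_mat 1 1" "U \<in> carrier_mat 1 1" using homsD(4)[OF T] homsD(4)[OF U] t s1 by simp_all
  have "T $$ (0,0) * U $$ (0,0) = 1" using mult_index[OF Tc, of 0 0] TU s1 by simp
  then have c: "T $$ (0,0) \<noteq> 0" by auto
  have "(emb T * t) $$ (0,0) = (s * emb T) $$ (0,0)" using homsD(3)[OF T] by simp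
  then have "scale (T $$ (0,0)) (t $$ (0,0)) = scale (T $$ (0,0)) (s $$ (0,0))"
    using Tc t s1 corepD(1)[OF t(1)] corepD(1)[OF s]
    by (simp add: emb_mult_index mult_emb_index del: index_mult_mat(1))
  then have "t $$ (0,0) = s $$ (0,0)" using c by simp
  then show ?thesis using t s1 corepD(1)[OF t(1)] corepD(1)[OF s] by (intro eq_matI) auto
qed

lemma can_dim_one: "corep t \<Longrightarrow> dim_row t = 1 \<Longrightarrow> can t = t"
  using can[OF irr_dim_one[of t]] isom_dim_one[of t "can t"] irr_corep isom_sym by metis

lemma Irr_dim_one: "corep t \<Longrightarrow> dim_row t = 1 \<Longrightarrow> t \<in> Irr"
  by (simp add: Irr_def irr_dim_one can_dim_one)

lemma one_Irr: "1\<^sub>m 1 \<in> Irr"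
  by (rule Irr_dim_one[OF corep_one]) simp

lemma dec_irr: "irr t \<Longrightarrow> dec t = {#can t#}"
  by (rule dec_eq[OF decomp_irr])

lemma dec_Irr_self: "t \<in> Irr \<Longrightarrow> dec t = {#t#}"
  using dec_irr[of t] Irr_D[of t] by simp

lemma grouplike_entry:
  assumes "corep t" "dim_row t = 1"
  shows "grouplike (t $$ (0,0))" "S (t $$ (0,0)) * t $$ (0,0) = 1"
  using corepD(3,4)[OF assms(1), of 0 0] antip_inverse_index(2)[OF assms(1), of 0 0] assms(2)
  by (simp_all add: grouplike_def)

lemma can_star_isom:
  assumes "a \<in> Irr"
  shows "corep (star a)" "can (star a) \<in> Irr" "isom (star a) (can (star a))" "dim_row (can (star a)) = dim_row a"
proof -
  note a = Irr_D[OF assms]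
  show "corep (star a)" by (rule corep_star[OF a(3)])
  show "can (star a) \<in> Irr" by (rule can_Irr[OF irr_star[OF a(1)]])
  show i: "isom (star a) (can (star a))" by (rule isom_sym[OF can(2)[OF irr_star[OF a(1)]]])
  show "dim_row (can (star a)) = dim_row a" using isom_dim[OF i] corepD(1)[OF a(3)] by simp
qed

lemma dual_dual_Irr:
  assumes "a \<in> Irr"
  shows "can (star (can (star a))) = a"
proof -
  note a = Irr_D[OF assms] and s = can_star_isom[OF assms]
  have "isom a (star (star a))" by (rule isom_star_star[OF a(1)])
  moreover have "isom (star (star a)) (star (can (star a)))" by (rule isom_star[OF s(1) Irr_D(3)[OF s(2)] s(3)])
  ultimately have "isom a (star (can (star a)))"
    using isom_trans[OF a(3) corep_star[OF s(1)] corep_star[OF Irr_D(3)[OF s(2)]]] by blast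
  then have "can a = can (star (can (star a)))"
    by (rule can_eqI[OF a(1) irr_star[OF Irr_D(1)[OF s(2)]]])
  then show ?thesis using a(2) by simp
qed

text \<open>
  Labels of degree \<open>1\<close> are the same as grouplike elements, so that \<open>X\<close> is a finite subgroup.
\<close>

lemma card_grouplike_labels:
  assumes no: "\<And>g. grouplike g \<Longrightarrow> group.ord grouplike_group g \<notin> {2, 3}"
    and X: "X \<subseteq> {g \<in> Irr. dim_row g = 1}" "finite X" "1\<^sub>m 1 \<in> X" "\<And>g. g \<in> X \<Longrightarrow> can (star g) \<in> X"
      "\<And>g h k. g \<in> X \<Longrightarrow> h \<in> X \<Longrightarrow> k \<in># dec (g \<boxtimes> h) \<Longrightarrow> k \<in> X"
  shows "odd (card X) \<and> \<not> 3 dvd card X"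
proof -
  interpret G: group grouplike_group by (rule group_grouplike_group)
  have XD: "g \<in> Irr" "corep g" "dim_row g = 1" "dim_col g = 1" if "g \<in> X" for g
    using X(1) that Irr_D(3)[of g] corepD(1)[of g] by auto
  define Y where "Y = (\<lambda>g. g $$ (0,0)) ` X"
  have inj: "inj_on (\<lambda>g. g $$ (0,0)) X"
    by (rule inj_onI, rule eq_matI) (auto simp: XD)
  have star: "S (g $$ (0,0)) \<in> Y" if g: "g \<in> X" for g
  proof -
    have "can (star g) = star g" using XD[OF g] by (intro can_dim_one corep_star) auto
    then have "star g \<in> X" using X(4)[OF g] by simp
    moreover have "star g $$ (0,0) = S (g $$ (0,0))" using XD[OF g] by simp
    ultimately show ?thesis unfolding Y_def by force
  qed
  have prod: "g $$ (0,0) * h $$ (0,0) \<in> Y" if g: "g \<in> X" and h: "h \<in> X" for g h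
  proof -
    have "corep (g \<boxtimes> h)" "dim_row (g \<boxtimes> h) = 1" using XD[OF g] XD[OF h] by (simp_all add: corep_kron)
    then have "dec (g \<boxtimes> h) = {#g \<boxtimes> h#}" by (intro dec_Irr_self Irr_dim_one)
    then have "g \<boxtimes> h \<in> X" using X(5)[OF g h] by simp
    moreover have "(g \<boxtimes> h) $$ (0,0) = g $$ (0,0) * h $$ (0,0)" using XD[OF g] XD[OF h] by (simp add: kron_def)
    ultimately show ?thesis unfolding Y_def by force
  qed
  have "subgroup Y grouplike_group"
  proof (rule G.subgroupI)
    show "Y \<subseteq> carrier grouplike_group"
      using grouplike_entry(1) XD by (auto simp: Y_def grouplike_group_def)
    show "Y \<noteq> {}" using X(3) by (auto simp: Y_def)
    fix y assume "y \<in> Y"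
    then obtain g where g: "g \<in> X" "y = g $$ (0,0)" by (auto simp: Y_def)
    have "S y \<in> Y" using star[OF g(1)] g(2) by simp
    then have "S y \<in> carrier grouplike_group" using \<open>Y \<subseteq> _\<close> by blast
    moreover have "y \<in> carrier grouplike_group" using \<open>Y \<subseteq> _\<close> \<open>y \<in> Y\<close> by blast
    moreover have "S y \<otimes>\<^bsub>grouplike_group\<^esub> y = \<one>\<^bsub>grouplike_group\<^esub>"
      using grouplike_entry(2)[of g] XD[OF g(1)] g(2) by (simp add: grouplike_group_def)
    ultimately have "inv\<^bsub>grouplike_group\<^esub> y = S y" by (intro G.inv_equality)
    then show "inv\<^bsub>grouplike_group\<^esub> y \<in> Y" using \<open>S y \<in> Y\<close> by simp
  next
    fix y z assume "y \<in> Y" "z \<in> Y"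
    then show "y \<otimes>\<^bsub>grouplike_group\<^esub> z \<in> Y" using prod by (auto simp: Y_def grouplike_group_def)
  qed
  moreover have "finite Y" using X(2) by (simp add: Y_def)
  moreover have "card Y = card X" unfolding Y_def by (rule card_image[OF inj])
  ultimately have *: "\<not> p dvd card X" if "prime p" "p \<in> {2, 3}" for p
    using G.prime_order_element[of Y p] no that by (auto simp: grouplike_group_def)
  show ?thesis using *[of 2] *[of 3] by (simp add: two_is_prime_nat)
qed

text \<open>
  The labels \<open>Irr\<close> of irreducible corepresentations, with the decomposition of tensor products, satisfy the axioms
  used in the combinatorial part: Frobenius reciprocity is the bending of homomorphisms.
\<close>

theorem fusion_rules:
  assumes odd: "\<And>t. irr t \<Longrightarrow> odd (dim_row t)"
    and no: "\<And>g. grouplike g \<Longrightarrow> group.ord grouplike_group g \<notin> {2, 3}"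
  shows "odd_fusion_rules Irr (1\<^sub>m 1) (\<lambda>a. can (star a)) dim_row (\<lambda>a b. dec (a \<boxtimes> b))"
proof
  show "1\<^sub>m 1 \<in> Irr" by (rule one_Irr)
  show "dim_row (1\<^sub>m 1 :: 'h mat) = 1" by simp
  fix a assume a: "a \<in> Irr"
  note ac = Irr_D(3)[OF a] and as = can_star_isom[OF a]
  show "can (star a) \<in> Irr" "dim_row (can (star a)) = dim_row a" by (rule as)+
  show "can (star (can (star a))) = a" by (rule dual_dual_Irr[OF a])
  show "dec (1\<^sub>m 1 \<boxtimes> a) = {#a#}" "dec (a \<boxtimes> 1\<^sub>m 1) = {#a#}"
    unfolding kron_one_left kron_one_right by (rule dec_Irr_self[OF a])+
  show "odd (dim_row a)" by (rule odd[OF Irr_D(1)[OF a]])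
  fix b assume b: "b \<in> Irr"
  note bc = Irr_D(3)[OF b] and bs = can_star_isom[OF b]
  show "(\<Sum>c\<in>#dec (a \<boxtimes> b). dim_row c) = dim_row a * dim_row b"
    using dec_degree[OF corep_kron[OF ac bc]] by simp
  show "c \<in> Irr" if "c \<in># dec (a \<boxtimes> b)" for c by (rule dec_Irr[OF corep_kron[OF ac bc] that])
  fix c assume c: "c \<in> Irr"
  note cc = Irr_D(3)[OF c]
  show "(\<Sum>e\<in>#dec (a \<boxtimes> b). dec (e \<boxtimes> c)) = (\<Sum>e\<in>#dec (b \<boxtimes> c). dec (a \<boxtimes> e))"
    unfolding dec_kron_left[OF corep_kron[OF ac bc] cc, symmetric] dec_kron_right[OF corep_kron[OF bc cc] ac, symmetric] kron_assoc ..
  have "count (dec (a \<boxtimes> b)) c = hdim (a \<boxtimes> b) c" by (rule dec_count(2)[OF corep_kron[OF ac bc] c])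
  also have "\<dots> = hdim a (c \<boxtimes> star b)" by (rule hdim_bend_right[OF ac bc cc])
  also have "\<dots> = hdim a (c \<boxtimes> can (star b))"
    by (rule hdim_isom_right[OF corep_kron[OF cc bs(1)] corep_kron[OF cc Irr_D(3)[OF bs(2)]] ac
        isom_kron(2)[OF bs(1) Irr_D(3)[OF bs(2)] cc bs(3)]])
  also have "\<dots> = count (dec (c \<boxtimes> can (star b))) a"
    by (rule dec_count(1)[OF corep_kron[OF cc Irr_D(3)[OF bs(2)]] a, symmetric])
  finally show "count (dec (a \<boxtimes> b)) c = count (dec (c \<boxtimes> can (star b))) a" .
  have "count (dec (can (star a) \<boxtimes> b)) c = hdim (can (star a) \<boxtimes> b) c"
    by (rule dec_count(2)[OF corep_kron[OF Irr_D(3)[OF as(2)] bc] c])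
  also have "\<dots> = hdim (star a \<boxtimes> b) c"
    by (rule hdim_isom_left[OF corep_kron[OF Irr_D(3)[OF as(2)] bc] corep_kron[OF as(1) bc] cc
        isom_kron(1)[OF Irr_D(3)[OF as(2)] as(1) bc isom_sym[OF as(3)]]])
  also have "\<dots> = hdim b (a \<boxtimes> c)" by (rule hdim_bend_left[OF bc ac cc])
  also have "\<dots> = count (dec (a \<boxtimes> c)) b" by (rule dec_count(1)[OF corep_kron[OF ac cc] b, symmetric])
  finally show "count (dec (can (star a) \<boxtimes> b)) c = count (dec (a \<boxtimes> c)) b" .
next
  fix X :: "'h mat set"
  assume X: "X \<subseteq> {g \<in> Irr. dim_row g = 1}" "finite X" "1\<^sub>m 1 \<in> X" "\<And>g. g \<in> X \<Longrightarrow> can (star g) \<in> X"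
    "\<And>g h k. g \<in> X \<Longrightarrow> h \<in> X \<Longrightarrow> k \<in># dec (g \<boxtimes> h) \<Longrightarrow> k \<in> X"
  show "odd (card X) \<and> \<not> 3 dvd card X" by (rule card_grouplike_labels[OF no X(1-3)]) (use X(4,5) in blast)+
qed


section \<open>Matrix multiplication as a homomorphism\<close>

text \<open>A generalized inverse of a nonzero homomorphism from an irreducible comodule is a left inverse.\<close>

lemma homs_section:
  assumes x: "irr x" and E: "corep E" and h: "hdim x E \<noteq> 0"
  obtains B L where "B \<in> homs x E" "L \<in> homs E x" "L * B = 1\<^sub>m (dim_row x)"
proof -
  note xc = irr_corep[OF x]
  obtain B where B: "B \<in> homs x E" "B \<noteq> 0\<^sub>m (dim_row E) (dim_row x)"
    using hdim_zero[of x E] h by blast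
  obtain L where L: "L \<in> homs E x" "B * L * B = B" by (rule homs_regular[OF xc E B(1)])
  note Bc = homsD(4)[OF B(1)] and Lc = homsD(4)[OF L(1)]
  obtain k where k: "L * B = k \<cdot>\<^sub>m 1\<^sub>m (dim_row x)"
    using homs_comp[OF xc E xc L(1) B(1)] x unfolding irr_def by blast
  have "B * (L * B) = B" using L(2) assoc_mult_mat[OF Bc Lc Bc] by simp
  then have "k \<cdot>\<^sub>m B = B" unfolding k mult_smult_one[OF Bc] .
  then have "k = 1" by (rule smult_eq_self[OF _ Bc B(2)])
  then have "L * B = 1\<^sub>m (dim_row x)" unfolding k by (intro eq_matI) auto
  then show thesis using that B(1) L(1) by blast
qed

definition evaluation :: "nat \<Rightarrow> 'k mat" where
  "evaluation n = mat 1 (n * n) (\<lambda>(_,k). if k div n = k mod n then 1 else 0)"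

text \<open>
  Multiplication of \<open>n\<close> by \<open>n\<close> matrices, written as a matrix acting on tensor products of column vectors: the inner
  two of four tensor factors are contracted.
\<close>

definition contraction :: "nat \<Rightarrow> 'k mat" where
  "contraction n = (1\<^sub>m n \<boxtimes> evaluation n) \<boxtimes> 1\<^sub>m n"

definition vec_of :: "nat \<Rightarrow> 'k mat \<Rightarrow> 'k mat" where
  "vec_of n X = mat (n * n) 1 (\<lambda>(k,_). X $$ (k div n, k mod n))"

definition mat_of :: "nat \<Rightarrow> 'k mat \<Rightarrow> 'k mat" where
  "mat_of n v = mat n n (\<lambda>(i,j). v $$ (i * n + j, 0))"

lemma vec_of_carrier: "vec_of n X \<in> carrier_mat (n * n) 1" and mat_of_carrier: "mat_of n v \<in> carrier_mat n n"
  by (simp_all add: vec_of_def mat_of_def)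

lemma vec_of_index: "i < n \<Longrightarrow> j < n \<Longrightarrow> vec_of n X $$ (i * n + j, 0) = X $$ (i,j)"
  using pair_index_lt[of i n j n] by (simp add: vec_of_def)

lemma vec_of_mat_of: "v \<in> carrier_mat (n * n) 1 \<Longrightarrow> vec_of n (mat_of n v) = v"
  by (rule eq_matI) (auto simp: vec_of_def mat_of_def div_mod_lt)

lemma mat_of_vec_of: "X \<in> carrier_mat n n \<Longrightarrow> mat_of n (vec_of n X) = X"
  by (rule eq_matI) (auto simp: mat_of_def vec_of_index)

lemma vec_of_inj: "X \<in> carrier_mat n n \<Longrightarrow> Y \<in> carrier_mat n n \<Longrightarrow> vec_of n X = vec_of n Y \<Longrightarrow> X = Y"
  using mat_of_vec_of by metis

lemma vec_of_add: "X \<in> carrier_mat n n \<Longrightarrow> Y \<in> carrier_mat n n \<Longrightarrow> vec_of n (X + Y) = vec_of n X + vec_of n Y"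
  by (rule eq_matI) (auto simp: vec_of_def div_mod_lt)

lemma mat_of_add: "v \<in> carrier_mat (n * n) 1 \<Longrightarrow> w \<in> carrier_mat (n * n) 1 \<Longrightarrow> mat_of n (v + w) = mat_of n v + mat_of n w"
  by (rule eq_matI) (auto simp: mat_of_def pair_index_lt)

lemma evaluation_carrier: "evaluation n \<in> carrier_mat 1 (n * n)"
  by (simp add: evaluation_def)

lemma contraction_carrier: "contraction n \<in> carrier_mat (n * n) ((n * n) * (n * n))"
proof -
  have "contraction n \<in> carrier_mat (n * 1 * n) (n * (n * n) * n)"
    unfolding contraction_def by (intro kron_carrier evaluation_carrier) auto
  then show ?thesis by (simp add: mult_ac)
qed

lemma contraction_index:
  assumes "i < n" "j < n" "a < n" "b < n" "b' < n" "c < n"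
  shows "contraction n $$ (i * n + j, (a * n + b) * (n * n) + (b' * n + c)) = (if i = a \<and> b = b' \<and> j = c then 1 else 0)"
proof -
  have l: "(a * n + b) * (n * n) + (b' * n + c) = (a * (n * n) + (b * n + b')) * n + c" by (simp add: algebra_simps)
  have lt: "b * n + b' < n * n" "i * n + j < n * n" using assms by (intro pair_index_lt; simp)+
  then have lt': "a * (n * n) + (b * n + b') < n * (n * n)" using assms by (intro pair_index_lt; simp)+
  then have lt'': "(a * (n * n) + (b * n + b')) * n + c < n * (n * n) * n" using assms by (intro pair_index_lt; simp)+
  have e1: "(1\<^sub>m n \<boxtimes> evaluation n) \<in> carrier_mat (n * 1) (n * (n * n))" by (intro kron_carrier evaluation_carrier) auto
  have "contraction n $$ (i * n + j, (a * (n * n) + (b * n + b')) * n + c)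
      = (1\<^sub>m n \<boxtimes> evaluation n) $$ (i, a * (n * n) + (b * n + b')) * (1\<^sub>m n :: 'k mat) $$ (j, c)"
    unfolding contraction_def using lt'' lt assms by (subst kron_index[OF e1 one_carrier_mat]) simp_all
  also have "(1\<^sub>m n \<boxtimes> evaluation n) $$ (i, a * (n * n) + (b * n + b')) = (1\<^sub>m n :: 'k mat) $$ (i, a) * evaluation n $$ (0, b * n + b')"
    using lt' lt assms by (subst kron_index[OF one_carrier_mat evaluation_carrier]) simp_all
  finally show ?thesis unfolding l using assms lt by (simp add: evaluation_def)
qed

lemma contraction_mult:
  assumes X: "X \<in> carrier_mat n n" and Y: "Y \<in> carrier_mat n n"
  shows "contraction n * (vec_of n X \<boxtimes> vec_of n Y) = vec_of n (X * Y)"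
proof (rule eq_matI)
  fix k l assume "k < dim_row (vec_of n (X * Y))" "l < dim_col (vec_of n (X * Y))"
  then have k: "k < n * n" and l: "l = 0" by (simp_all add: vec_of_def)
  define i j where "i = k div n" and "j = k mod n"
  have ij: "i < n" "j < n" "k = i * n + j" using div_mod_lt[OF k] by (simp_all add: i_def j_def)
  have v: "vec_of n X \<boxtimes> vec_of n Y \<in> carrier_mat ((n * n) * (n * n)) 1"
    using kron_carrier[OF vec_of_carrier[of n X] vec_of_carrier[of n Y]] by simp
  have kr: "(vec_of n X \<boxtimes> vec_of n Y) $$ ((a * n + b) * (n * n) + (b' * n + c), 0) = X $$ (a,b) * Y $$ (b',c)"
    if "a < n" "b < n" "b' < n" "c < n" for a b b' c
  proof -
    have "a * n + b < n * n" "b' * n + c < n * n" using that by (intro pair_index_lt; simp)+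
    then show ?thesis
      using that pair_index_lt[of "a * n + b" "n * n" "b' * n + c" "n * n"]
      by (subst kron_index[OF vec_of_carrier vec_of_carrier]) (simp_all add: vec_of_index)
  qed
  have "(contraction n * (vec_of n X \<boxtimes> vec_of n Y)) $$ (k,0) =
      (\<Sum>m<(n * n) * (n * n). contraction n $$ (k,m) * (vec_of n X \<boxtimes> vec_of n Y) $$ (m,0))"
    by (rule mult_index[OF contraction_carrier v k]) simp
  also have "\<dots> = (\<Sum>a<n. \<Sum>b<n. \<Sum>b'<n. \<Sum>c<n. (if i = a \<and> b = b' \<and> j = c then 1 else 0) * (X $$ (a,b) * Y $$ (b',c)))"
    unfolding sum_pair_index ij(3) using ij(1,2) by (intro sum.cong refl) (simp add: contraction_index kr)
  also have "\<dots> = (\<Sum>a<n. \<Sum>b<n. \<Sum>b'<n. if i = a \<and> b = b' then X $$ (a,b) * Y $$ (b',j) else 0)"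
  proof (intro sum.cong refl)
    fix a b b'
    show "(\<Sum>c<n. (if i = a \<and> b = b' \<and> j = c then 1 else 0) * (X $$ (a,b) * Y $$ (b',c))) =
        (if i = a \<and> b = b' then X $$ (a,b) * Y $$ (b',j) else 0)"
      using ij(2) by (cases "i = a \<and> b = b'") (auto simp: if_distrib[of "\<lambda>z. z * _"] sum.delta' cong: if_cong)
  qed
  also have "\<dots> = (\<Sum>a<n. \<Sum>b<n. if i = a then X $$ (a,b) * Y $$ (b,j) else 0)"
  proof (intro sum.cong refl)
    fix a b assume "b \<in> {..<n}"
    then show "(\<Sum>b'<n. if i = a \<and> b = b' then X $$ (a,b) * Y $$ (b',j) else 0) = (if i = a then X $$ (a,b) * Y $$ (b,j) else 0)"
      by (cases "i = a") (auto simp: sum.delta')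
  qed
  also have "\<dots> = (\<Sum>b<n. X $$ (i,b) * Y $$ (b,j))"
    using ij(1) by (subst sum.swap) (simp add: sum.delta')
  also have "\<dots> = (X * Y) $$ (i,j)" by (rule mult_index[OF X Y ij(1,2), symmetric])
  finally show "(contraction n * (vec_of n X \<boxtimes> vec_of n Y)) $$ (k,l) = vec_of n (X * Y) $$ (k,l)"
    using k l by (simp add: vec_of_def i_def j_def)
qed (use contraction_carrier[of n] in \<open>auto simp: vec_of_def\<close>)

lemma evaluation_hom:
  assumes u: "corep u"
  shows "evaluation (dim_row u) \<in> homs (star u \<boxtimes> u) (1\<^sub>m 1)"
proof -
  define n where "n = dim_row u"
  have d: "dim_row (star u) = n" using corepD(1)[OF u] by (simp add: n_def)
  have e: "evaluation n $$ (0, a * n + b) = (if a = b then 1 else 0)" if "a < n" "b < n" for a b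
    using pair_index_lt[OF that] that by (simp add: evaluation_def)
  have c: "evaluation n \<in> carrier_mat (dim_row (1\<^sub>m 1 :: 'h mat)) (dim_row (star u) * dim_row u)"
    using evaluation_carrier[of n] d by (simp add: n_def)
  have "(\<Sum>a'<n. \<Sum>b'<n. scale (evaluation n $$ (0, a' * n + b')) (star u $$ (a',a) * u $$ (b',b))) = (if a = b then 1 else 0)"
    if ab: "a < n" "b < n" for a b
  proof -
    have "(\<Sum>a'<n. \<Sum>b'<n. scale (evaluation n $$ (0, a' * n + b')) (star u $$ (a',a) * u $$ (b',b)))
        = (\<Sum>a'<n. \<Sum>b'<n. if a' = b' then S (u $$ (a,a')) * u $$ (b',b) else 0)"
      using ab corepD(1)[OF u] by (intro sum.cong refl) (simp add: e[unfolded n_def] n_def)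
    also have "\<dots> = (\<Sum>a'<n. S (u $$ (a,a')) * u $$ (a',b))" by (simp add: sum.delta')
    also have "\<dots> = (if a = b then 1 else 0)" using antip_inverse_index(2)[OF u] ab by (simp add: n_def)
    finally show ?thesis .
  qed
  then show ?thesis
    unfolding homs_kron_source[OF corep_star[OF u] u corep_one c[unfolded n_def]]
    using corepD(1)[OF u] by (simp add: e n_def[symmetric])
qed

text \<open>
  The inner two factors of \<open>u \<otimes> u* \<otimes> u \<otimes> u*\<close> are contracted by the evaluation, a homomorphism to the trivial comodule.
\<close>

lemma contraction_hom:
  assumes u: "corep u"
  shows "contraction (dim_row u) \<in> homs ((u \<boxtimes> star u) \<boxtimes> (u \<boxtimes> star u)) (u \<boxtimes> star u)"
proof -
  note s = corep_star[OF u]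
  have d: "dim_row (star u) = dim_row u" using corepD(1)[OF u] by simp
  have "1\<^sub>m (dim_row u) \<boxtimes> evaluation (dim_row u) \<in> homs (u \<boxtimes> (star u \<boxtimes> u)) (u \<boxtimes> 1\<^sub>m 1)"
    by (rule homs_kron[OF u corep_kron[OF s u] u corep_one homs_one[OF u] evaluation_hom[OF u]])
  then have "contraction (dim_row u) \<in> homs ((u \<boxtimes> (star u \<boxtimes> u)) \<boxtimes> star u) ((u \<boxtimes> 1\<^sub>m 1) \<boxtimes> star u)"
    unfolding contraction_def
    using homs_kron[OF corep_kron[OF u corep_kron[OF s u]] s corep_kron[OF u corep_one] s _ homs_one[OF s]] d by simp
  then show ?thesis unfolding kron_one_right by (simp add: kron_assoc)
qed

text \<open>
  The product of an \<open>x\<close>-component and a \<open>y\<close>-component of the matrix algebra has a \<open>z\<close>-component only if \<open>z\<close> occurs in \<open>x \<otimes> y\<close>.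
\<close>

lemma product_component_zero:
  assumes u: "corep u" and c: "corep x" "corep y" "corep z"
    and B: "B \<in> homs x (u \<boxtimes> star u)" and B': "B' \<in> homs y (u \<boxtimes> star u)" and L: "L \<in> homs (u \<boxtimes> star u) z"
    and h: "hdim (x \<boxtimes> y) z = 0" and v: "\<alpha> \<in> carrier_mat (dim_row x) 1" "\<beta> \<in> carrier_mat (dim_row y) 1"
  shows "L * (contraction (dim_row u) * ((B * \<alpha>) \<boxtimes> (B' * \<beta>))) = 0\<^sub>m (dim_row z) 1"
proof -
  define E where "E = u \<boxtimes> star u"
  define M where "M = contraction (dim_row u)"
  have E: "corep E" unfolding E_def by (rule corep_kron[OF u corep_star[OF u]])
  note B = B[folded E_def] and B' = B'[folded E_def] and L = L[folded E_def]
  have M: "M \<in> homs (E \<boxtimes> E) E" using contraction_hom[OF u] by (simp add: M_def E_def)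
  have BB: "B \<boxtimes> B' \<in> homs (x \<boxtimes> y) (E \<boxtimes> E)" by (rule homs_kron[OF c(1,2) E E B B'])
  have "L * (M * (B \<boxtimes> B')) \<in> homs (x \<boxtimes> y) z"
    by (intro homs_comp[OF corep_kron[OF c(1,2)] E c(3) L] homs_comp[OF corep_kron[OF c(1,2)] corep_kron[OF E E] E M BB])
  then have z: "L * (M * (B \<boxtimes> B')) = 0\<^sub>m (dim_row z) (dim_row x * dim_row y)"
    using homs_trivial[OF corep_kron[OF c(1,2)] c(3) h] by simp
  note Bc = homsD(4)[OF B] and Bc' = homsD(4)[OF B'] and Lc = homsD(4)[OF L] and Mc = homsD(4)[OF M] and BBc = homsD(4)[OF BB]
  have ab: "\<alpha> \<boxtimes> \<beta> \<in> carrier_mat (dim_row x * dim_row y) 1" using kron_carrier[OF v] by simp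
  have "(B * \<alpha>) \<boxtimes> (B' * \<beta>) = (B \<boxtimes> B') * (\<alpha> \<boxtimes> \<beta>)"
    by (rule kron_mult[OF Bc v(1) Bc' v(2), symmetric]) (rule mult.commute)
  then have "L * (M * ((B * \<alpha>) \<boxtimes> (B' * \<beta>))) = L * (M * (B \<boxtimes> B')) * (\<alpha> \<boxtimes> \<beta>)"
    using Lc Mc Bc Bc' v BBc ab by (simp add: mat_assoc)
  then show ?thesis unfolding z by (simp add: M_def left_mult_zero_mat[OF ab])
qed


lemma sum_three_blocks:
  fixes f :: "nat \<Rightarrow> 'k"
  shows "(\<Sum>k<9. f k) = (\<Sum>k<1. f k) + (\<Sum>k<3. f (1 + k)) + (\<Sum>k<5. f (4 + k))"
  by (simp add: eval_nat_numeral)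

text \<open>
  The three inclusions together form a square matrix, and a left inverse of a square matrix is a right inverse. The sizes
  \<open>1\<close>, \<open>3\<close>, \<open>5\<close> are those of the constituents of \<open>u \<otimes> u*\<close>.
\<close>

lemma three_blocks_complete:
  fixes B1 :: "'k mat"
  assumes B: "B1 \<in> carrier_mat 9 1" "B2 \<in> carrier_mat 9 3" "B3 \<in> carrier_mat 9 5"
    and L: "L1 \<in> carrier_mat 1 9" "L2 \<in> carrier_mat 3 9" "L3 \<in> carrier_mat 5 9"
    and 1: "L1 * B1 = 1\<^sub>m 1" "L2 * B2 = 1\<^sub>m 3" "L3 * B3 = 1\<^sub>m 5"
    and 0: "L1 * B2 = 0\<^sub>m 1 3" "L1 * B3 = 0\<^sub>m 1 5" "L2 * B1 = 0\<^sub>m 3 1" "L2 * B3 = 0\<^sub>m 3 5"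
      "L3 * B1 = 0\<^sub>m 5 1" "L3 * B2 = 0\<^sub>m 5 3"
  shows "B1 * L1 + B2 * L2 + B3 * L3 = 1\<^sub>m 9"
proof -
  define P where "P = mat 9 9 (\<lambda>(i,j). if j < 1 then B1 $$ (i,j) else if j < 4 then B2 $$ (i,j-1) else B3 $$ (i,j-4))"
  define Q where "Q = mat 9 9 (\<lambda>(i,j). if i < 1 then L1 $$ (i,j) else if i < 4 then L2 $$ (i-1,j) else L3 $$ (i-4,j))"
  have P: "P \<in> carrier_mat 9 9" and Q: "Q \<in> carrier_mat 9 9" by (simp_all add: P_def Q_def)
  have "Q * P = 1\<^sub>m 9"
  proof (rule eq_matI)
    fix i j assume "i < dim_row (1\<^sub>m 9 :: 'k mat)" "j < dim_col (1\<^sub>m 9 :: 'k mat)"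
    then have ij: "i < 9" "j < 9" by auto
    have e: "(Q * P) $$ (i,j) = (\<Sum>k<9. Q $$ (i,k) * P $$ (k,j))" by (rule mult_index[OF Q P ij])
    consider "i < 1" | "1 \<le> i" "i < 4" | "4 \<le> i" by linarith
    then show "(Q * P) $$ (i,j) = (1\<^sub>m 9 :: 'k mat) $$ (i,j)"
    proof cases
      assume i: "i < 1"
      consider "j < 1" | "1 \<le> j" "j < 4" | "4 \<le> j" by linarith
      then show ?thesis
      proof cases
        assume j: "j < 1"
        have "(Q * P) $$ (i,j) = (L1 * B1) $$ (i,j)" unfolding e mult_index[OF L(1) B(1) i j]
          using i j by (intro sum.cong) (auto simp: P_def Q_def)
        then show ?thesis using 1 i j by simp
      next
        assume j: "1 \<le> j" "j < 4"
        then have j': "j - 1 < 3" by simp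
        have "(Q * P) $$ (i,j) = (L1 * B2) $$ (i,j-1)" unfolding e mult_index[OF L(1) B(2) i j']
          using i j by (intro sum.cong) (auto simp: P_def Q_def)
        then show ?thesis using 0 i j j' by simp
      next
        assume j: "4 \<le> j"
        then have j': "j - 4 < 5" using ij by simp
        have "(Q * P) $$ (i,j) = (L1 * B3) $$ (i,j-4)" unfolding e mult_index[OF L(1) B(3) i j']
          using i j ij by (intro sum.cong) (auto simp: P_def Q_def)
        then show ?thesis using 0 i j j' ij by simp
      qed
    next
      assume i: "1 \<le> i" "i < 4"
      then have i': "i - 1 < 3" by simp
      consider "j < 1" | "1 \<le> j" "j < 4" | "4 \<le> j" by linarith
      then show ?thesis
      proof cases
        assume j: "j < 1"
        have "(Q * P) $$ (i,j) = (L2 * B1) $$ (i-1,j)" unfolding e mult_index[OF L(2) B(1) i' j]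
          using i j by (intro sum.cong) (auto simp: P_def Q_def)
        then show ?thesis using 0 i i' j by simp
      next
        assume j: "1 \<le> j" "j < 4"
        then have j': "j - 1 < 3" by simp
        have "(Q * P) $$ (i,j) = (L2 * B2) $$ (i-1,j-1)" unfolding e mult_index[OF L(2) B(2) i' j']
          using i j by (intro sum.cong) (auto simp: P_def Q_def)
        then show ?thesis using 1 i i' j j' by auto
      next
        assume j: "4 \<le> j"
        then have j': "j - 4 < 5" using ij by simp
        have "(Q * P) $$ (i,j) = (L2 * B3) $$ (i-1,j-4)" unfolding e mult_index[OF L(2) B(3) i' j']
          using i j ij by (intro sum.cong) (auto simp: P_def Q_def)
        then show ?thesis using 0 i i' j j' ij by simp
      qed
    next
      assume i: "4 \<le> i"
      then have i': "i - 4 < 5" using ij by simp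
      consider "j < 1" | "1 \<le> j" "j < 4" | "4 \<le> j" by linarith
      then show ?thesis
      proof cases
        assume j: "j < 1"
        have "(Q * P) $$ (i,j) = (L3 * B1) $$ (i-4,j)" unfolding e mult_index[OF L(3) B(1) i' j]
          using i j ij by (intro sum.cong) (auto simp: P_def Q_def)
        then show ?thesis using 0 i i' j ij by simp
      next
        assume j: "1 \<le> j" "j < 4"
        then have j': "j - 1 < 3" by simp
        have "(Q * P) $$ (i,j) = (L3 * B2) $$ (i-4,j-1)" unfolding e mult_index[OF L(3) B(2) i' j']
          using i j ij by (intro sum.cong) (auto simp: P_def Q_def)
        then show ?thesis using 0 i i' j j' ij by simp
      next
        assume j: "4 \<le> j"
        then have j': "j - 4 < 5" using ij by simp
        have "(Q * P) $$ (i,j) = (L3 * B3) $$ (i-4,j-4)" unfolding e mult_index[OF L(3) B(3) i' j']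
          using i j ij by (intro sum.cong) (auto simp: P_def Q_def)
        then show ?thesis using 1 i i' j j' ij by auto
      qed
    qed
  qed (use P Q in auto)
  then have "P * Q = 1\<^sub>m 9" using mat_mult_left_right_inverse[OF Q P] by simp
  moreover have "P * Q = B1 * L1 + B2 * L2 + B3 * L3"
  proof (rule eq_matI)
    fix i j assume "i < dim_row (B1 * L1 + B2 * L2 + B3 * L3)" "j < dim_col (B1 * L1 + B2 * L2 + B3 * L3)"
    then have ij: "i < 9" "j < 9" using B(3) L(3) by auto
    have "(B1 * L1 + B2 * L2 + B3 * L3) $$ (i,j) = (B1 * L1) $$ (i,j) + (B2 * L2) $$ (i,j) + (B3 * L3) $$ (i,j)"
      using ij B L by simp
    then show "(P * Q) $$ (i,j) = (B1 * L1 + B2 * L2 + B3 * L3) $$ (i,j)"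
      unfolding mult_index[OF P Q ij] mult_index[OF B(1) L(1) ij] mult_index[OF B(2) L(2) ij] mult_index[OF B(3) L(3) ij]
        sum_three_blocks
      using ij by (simp add: P_def Q_def)
  qed (use P Q B L in auto)
  ultimately show ?thesis by simp
qed

text \<open>
  \<open>A\<close> consists of the matrices without \<open>p\<close>-component and \<open>W\<close> of those with only a \<open>p\<close>-component. The five hypotheses on
  constituents are what makes \<open>A A\<close> avoid \<open>p\<close> and \<open>A W\<close>, \<open>W A\<close> avoid \<open>1\<close> and \<open>q\<close>.
\<close>

theorem exceptional_square_impossible:
  assumes u: "u \<in> Irr" "dim_row u = 3" and p: "p \<in> Irr" "dim_row p = 3" and q: "q \<in> Irr" "dim_row q = 5"
    and sq: "dec (u \<boxtimes> star u) = {#1\<^sub>m 1, p, q#}"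
    and no: "p \<notin># dec (q \<boxtimes> q)" "q \<notin># dec (q \<boxtimes> p)" "q \<notin># dec (p \<boxtimes> q)"
      "1\<^sub>m 1 \<notin># dec (q \<boxtimes> p)" "1\<^sub>m 1 \<notin># dec (p \<boxtimes> q)"
  shows False
proof -
  define e where "e = (1\<^sub>m 1 :: 'h mat)"
  have eI: "e \<in> Irr" "dim_row e = 1" using one_Irr by (simp_all add: e_def)
  note uc = Irr_D(3)[OF u(1)] and ec = Irr_D(3)[OF eI(1)] and pc = Irr_D(3)[OF p(1)] and qc = Irr_D(3)[OF q(1)]
  define E where "E = u \<boxtimes> star u"
  have E: "corep E" "dim_row E = 9"
    using corep_kron[OF uc corep_star[OF uc]] u(2) corepD(1)[OF uc] by (simp_all add: E_def)
  have ne: "e \<noteq> p" "e \<noteq> q" "p \<noteq> q" "p \<noteq> e" "q \<noteq> e" "q \<noteq> p" using eI p q by auto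
  have mem: "hdim x E \<noteq> 0" if "x \<in> {e, p, q}" for x
  proof -
    have "x \<in># dec E" unfolding E_def sq using that by (auto simp: e_def)
    then show ?thesis using dec_count(1)[OF E(1), of x] eI p q that by (auto simp flip: count_greater_zero_iff)
  qed
  obtain B1 L1 where B1: "B1 \<in> homs e E" and L1: "L1 \<in> homs E e" and LB1: "L1 * B1 = 1\<^sub>m (dim_row e)"
    using homs_section[OF Irr_D(1)[OF eI(1)] E(1) mem] by blast
  obtain Bp Lp where Bp: "Bp \<in> homs p E" and Lp: "Lp \<in> homs E p" and LBp: "Lp * Bp = 1\<^sub>m (dim_row p)"
    using homs_section[OF Irr_D(1)[OF p(1)] E(1) mem] by blast
  obtain Bq Lq where Bq: "Bq \<in> homs q E" and Lq: "Lq \<in> homs E q" and LBq: "Lq * Bq = 1\<^sub>m (dim_row q)"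
    using homs_section[OF Irr_D(1)[OF q(1)] E(1) mem] by blast
  have cross: "L * B = 0\<^sub>m (dim_row y) (dim_row x)" if "B \<in> homs x E" "L \<in> homs E y" "x \<in> Irr" "y \<in> Irr" "x \<noteq> y" for B L x y
    using homs_trivial[OF Irr_D(3)[OF that(3)] Irr_D(3)[OF that(4)] _ homs_comp[OF Irr_D(3)[OF that(3)] E(1) Irr_D(3)[OF that(4)] that(2,1)]]
      hdim_Irr[OF that(3,4)] that(5) by simp
  note car = homsD(4)[OF B1, unfolded E eI] homsD(4)[OF Bp, unfolded E p] homsD(4)[OF Bq, unfolded E q]
    homsD(4)[OF L1, unfolded E eI] homsD(4)[OF Lp, unfolded E p] homsD(4)[OF Lq, unfolded E q]
  note one = LB1[unfolded eI] LBp[unfolded p] LBq[unfolded q]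
  note zero = cross[OF Bp L1 p(1) eI(1) ne(4), unfolded p eI] cross[OF Bq L1 q(1) eI(1) ne(5), unfolded q eI]
    cross[OF B1 Lp eI(1) p(1) ne(1), unfolded p eI] cross[OF Bq Lp q(1) p(1) ne(6), unfolded p q]
    cross[OF B1 Lq eI(1) q(1) ne(2), unfolded q eI] cross[OF Bp Lq p(1) q(1) ne(3), unfolded p q]
  have complete: "B1 * L1 + Bp * Lp + Bq * Lq = 1\<^sub>m 9" by (rule three_blocks_complete[OF car one zero])
  define A where "A = {X \<in> carrier_mat 3 3. Lp * vec_of 3 X = 0\<^sub>m 3 1}"
  define W where "W = {X \<in> carrier_mat 3 3. L1 * vec_of 3 X = 0\<^sub>m 1 1 \<and> Lq * vec_of 3 X = 0\<^sub>m 5 1}"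
  have vc: "vec_of 3 X \<in> carrier_mat 9 1" for X using vec_of_carrier[of 3 X] by simp
  have expand: "v = B1 * (L1 * v) + Bp * (Lp * v) + Bq * (Lq * v)" if v: "v \<in> carrier_mat 9 1" for v
  proof -
    have c: "B1 * L1 \<in> carrier_mat 9 9" "Bp * Lp \<in> carrier_mat 9 9" "Bq * Lq \<in> carrier_mat 9 9" using car by auto
    have "v = (B1 * L1 + Bp * Lp + Bq * Lq) * v" unfolding complete using v by simp
    also have "\<dots> = B1 * L1 * v + Bp * Lp * v + Bq * Lq * v"
      unfolding add_mult_distrib_mat[OF add_carrier_mat[OF c(2)] c(3) v] add_mult_distrib_mat[OF c(1,2) v] ..
    finally show ?thesis using car v by (simp add: mat_assoc)
  qed
  have A_form: "vec_of 3 X = B1 * (L1 * vec_of 3 X) + Bq * (Lq * vec_of 3 X)" if "X \<in> A" for X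
  proof -
    have z: "Bp * (Lp * vec_of 3 X) = 0\<^sub>m 9 1" using that car by (simp add: A_def)
    show ?thesis using expand[OF vc[of X]] car vc[of X] unfolding z by simp
  qed
  have W_form: "vec_of 3 X = Bp * (Lp * vec_of 3 X)" if "X \<in> W" for X
  proof -
    have z: "B1 * (L1 * vec_of 3 X) = 0\<^sub>m 9 1" "Bq * (Lq * vec_of 3 X) = 0\<^sub>m 9 1" using that car by (simp_all add: W_def)
    show ?thesis using expand[OF vc[of X]] car vc[of X] unfolding z by simp
  qed
  have Lv: "L1 * vec_of 3 X \<in> carrier_mat 1 1" "Lp * vec_of 3 X \<in> carrier_mat 3 1" "Lq * vec_of 3 X \<in> carrier_mat 5 1" for X
    using car vc[of X] by auto
  have prod: "L * (contraction 3 * ((B * \<alpha>) \<boxtimes> (B' * \<beta>))) = 0\<^sub>m (dim_row z) 1"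
    if "B \<in> homs x E" "B' \<in> homs y E" "L \<in> homs E z" "x \<in> Irr" "y \<in> Irr" "z \<in> Irr" "z \<notin># dec (x \<boxtimes> y)"
      "\<alpha> \<in> carrier_mat (dim_row x) 1" "\<beta> \<in> carrier_mat (dim_row y) 1" for B B' L x y z \<alpha> \<beta>
  proof -
    note c = Irr_D(3)[OF that(4)] Irr_D(3)[OF that(5)] Irr_D(3)[OF that(6)]
    have "hdim (x \<boxtimes> y) z = 0" using dec_count(2)[OF corep_kron[OF c(1,2)] that(6)] that(7) by (simp add: not_in_iff)
    from product_component_zero[OF uc c that(1-3)[unfolded E_def] this that(8,9)] show ?thesis unfolding u(2) .
  qed
  have de: "dec (e \<boxtimes> x) = {#x#}" "dec (x \<boxtimes> e) = {#x#}" if "x \<in> Irr" for x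
    unfolding e_def kron_one_left kron_one_right by (rule dec_Irr_self[OF that])+
  have Mc: "contraction 3 \<in> carrier_mat 9 (9 * 9)" using contraction_carrier[of 3] by simp
  have dist: "L * (contraction 3 * ((v + v') \<boxtimes> w)) = L * (contraction 3 * (v \<boxtimes> w)) + L * (contraction 3 * (v' \<boxtimes> w))"
    "L * (contraction 3 * (w \<boxtimes> (v + v'))) = L * (contraction 3 * (w \<boxtimes> v)) + L * (contraction 3 * (w \<boxtimes> v'))"
    if "L \<in> carrier_mat m 9" "v \<in> carrier_mat 9 1" "v' \<in> carrier_mat 9 1" "w \<in> carrier_mat 9 1" for L v v' w m
  proof -
    have k: "v \<boxtimes> w \<in> carrier_mat (9 * 9) 1" "v' \<boxtimes> w \<in> carrier_mat (9 * 9) 1" "w \<boxtimes> v \<in> carrier_mat (9 * 9) 1" "w \<boxtimes> v' \<in> carrier_mat (9 * 9) 1"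
      using kron_carrier[OF that(2,4)] kron_carrier[OF that(3,4)] kron_carrier[OF that(4,2)] kron_carrier[OF that(4,3)] by simp_all
    note mk = mult_carrier_mat[OF Mc]
    show "L * (contraction 3 * ((v + v') \<boxtimes> w)) = L * (contraction 3 * (v \<boxtimes> w)) + L * (contraction 3 * (v' \<boxtimes> w))"
      unfolding kron_add_left[OF that(2,3)] mult_add_distrib_mat[OF Mc k(1,2)] mult_add_distrib_mat[OF that(1) mk[OF k(1)] mk[OF k(2)]] ..
    show "L * (contraction 3 * (w \<boxtimes> (v + v'))) = L * (contraction 3 * (w \<boxtimes> v)) + L * (contraction 3 * (w \<boxtimes> v'))"
      unfolding kron_add_right[OF that(2,3)] mult_add_distrib_mat[OF Mc k(3,4)] mult_add_distrib_mat[OF that(1) mk[OF k(3)] mk[OF k(4)]] ..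
  qed
  have vm: "vec_of 3 (X * Y) = contraction 3 * (vec_of 3 X \<boxtimes> vec_of 3 Y)" if "X \<in> carrier_mat 3 3" "Y \<in> carrier_mat 3 3" for X Y
    using contraction_mult[OF that] by simp
  have AD: "X \<in> carrier_mat 3 3" "Lp * vec_of 3 X = 0\<^sub>m 3 1" if "X \<in> A" for X using that by (auto simp: A_def)
  have WD: "X \<in> carrier_mat 3 3" "L1 * vec_of 3 X = 0\<^sub>m 1 1" "Lq * vec_of 3 X = 0\<^sub>m 5 1" if "X \<in> W" for X using that by (auto simp: W_def)
  note nz = de[OF eI(1)] de[OF p(1)] de[OF q(1)]
  have AA: "X * Y \<in> A" if X: "X \<in> A" and Y: "Y \<in> A" for X Y
  proof -
    define a a' b b' where "a = L1 * vec_of 3 X" and "a' = Lq * vec_of 3 X" and "b = L1 * vec_of 3 Y" and "b' = Lq * vec_of 3 Y"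
    have c: "a \<in> carrier_mat (dim_row e) 1" "a' \<in> carrier_mat (dim_row q) 1" "b \<in> carrier_mat (dim_row e) 1" "b' \<in> carrier_mat (dim_row q) 1"
      using Lv eI q by (auto simp: a_def a'_def b_def b'_def)
    have s: "B1 * a \<in> carrier_mat 9 1" "Bq * a' \<in> carrier_mat 9 1" "B1 * b \<in> carrier_mat 9 1" "Bq * b' \<in> carrier_mat 9 1"
      using c car eI q by auto
    have "Lp * vec_of 3 (X * Y) = Lp * (contraction 3 * ((B1 * a + Bq * a') \<boxtimes> (B1 * b + Bq * b')))"
      unfolding vm[OF AD(1)[OF X] AD(1)[OF Y]] a_def a'_def b_def b'_def A_form[OF X, symmetric] A_form[OF Y, symmetric] ..
    also have "\<dots> = 0\<^sub>m 3 1"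
      unfolding dist(1)[OF car(5) s(1,2) add_carrier_mat[OF s(4)]] dist(2)[OF car(5) s(3,4) s(1)] dist(2)[OF car(5) s(3,4) s(2)]
      using prod[OF B1 B1 Lp eI(1) eI(1) p(1) _ c(1,3)] prod[OF B1 Bq Lp eI(1) q(1) p(1) _ c(1,4)]
        prod[OF Bq B1 Lp q(1) eI(1) p(1) _ c(2,3)] prod[OF Bq Bq Lp q(1) q(1) p(1) _ c(2,4)] nz no(1) ne p(2) by simp
    finally show ?thesis using AD(1)[OF X] AD(1)[OF Y] by (simp add: A_def)
  qed
  have AW: "X * Y \<in> W" if X: "X \<in> A" and Y: "Y \<in> W" for X Y
  proof -
    define a a' b where "a = L1 * vec_of 3 X" and "a' = Lq * vec_of 3 X" and "b = Lp * vec_of 3 Y"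
    have c: "a \<in> carrier_mat (dim_row e) 1" "a' \<in> carrier_mat (dim_row q) 1" "b \<in> carrier_mat (dim_row p) 1"
      using Lv eI p q by (auto simp: a_def a'_def b_def)
    have s: "B1 * a \<in> carrier_mat 9 1" "Bq * a' \<in> carrier_mat 9 1" "Bp * b \<in> carrier_mat 9 1"
      using c car eI p q by auto
    have f: "vec_of 3 (X * Y) = contraction 3 * ((B1 * a + Bq * a') \<boxtimes> (Bp * b))"
      unfolding vm[OF AD(1)[OF X] WD(1)[OF Y]] a_def a'_def b_def A_form[OF X, symmetric] W_form[OF Y, symmetric] ..
    have "L1 * vec_of 3 (X * Y) = 0\<^sub>m 1 1"
      unfolding f dist(1)[OF car(4) s(1,2,3)]
      using prod[OF B1 Bp L1 eI(1) p(1) eI(1) _ c(1,3)] prod[OF Bq Bp L1 q(1) p(1) eI(1) _ c(2,3)] nz no(4)[folded e_def] ne eI(2) by simp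
    moreover have "Lq * vec_of 3 (X * Y) = 0\<^sub>m 5 1"
      unfolding f dist(1)[OF car(6) s(1,2,3)]
      using prod[OF B1 Bp Lq eI(1) p(1) q(1) _ c(1,3)] prod[OF Bq Bp Lq q(1) p(1) q(1) _ c(2,3)] nz no(2) ne q(2) by simp
    ultimately show ?thesis using AD(1)[OF X] WD(1)[OF Y] by (simp add: W_def)
  qed
  have WA: "X * Y \<in> W" if X: "X \<in> W" and Y: "Y \<in> A" for X Y
  proof -
    define a a' b where "a = L1 * vec_of 3 Y" and "a' = Lq * vec_of 3 Y" and "b = Lp * vec_of 3 X"
    have c: "a \<in> carrier_mat (dim_row e) 1" "a' \<in> carrier_mat (dim_row q) 1" "b \<in> carrier_mat (dim_row p) 1"
      using Lv eI p q by (auto simp: a_def a'_def b_def)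
    have s: "B1 * a \<in> carrier_mat 9 1" "Bq * a' \<in> carrier_mat 9 1" "Bp * b \<in> carrier_mat 9 1"
      using c car eI p q by auto
    have f: "vec_of 3 (X * Y) = contraction 3 * ((Bp * b) \<boxtimes> (B1 * a + Bq * a'))"
      unfolding vm[OF WD(1)[OF X] AD(1)[OF Y]] a_def a'_def b_def A_form[OF Y, symmetric] W_form[OF X, symmetric] ..
    have "L1 * vec_of 3 (X * Y) = 0\<^sub>m 1 1"
      unfolding f dist(2)[OF car(4) s(1,2,3)]
      using prod[OF Bp B1 L1 p(1) eI(1) eI(1) _ c(3,1)] prod[OF Bp Bq L1 p(1) q(1) eI(1) _ c(3,2)] nz no(5)[folded e_def] ne eI(2) by simp
    moreover have "Lq * vec_of 3 (X * Y) = 0\<^sub>m 5 1"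
      unfolding f dist(2)[OF car(6) s(1,2,3)]
      using prod[OF Bp B1 Lq p(1) eI(1) q(1) _ c(3,1)] prod[OF Bp Bq Lq p(1) q(1) q(1) _ c(3,2)] nz no(3) ne q(2) by simp
    ultimately show ?thesis using AD(1)[OF Y] WD(1)[OF X] by (simp add: W_def)
  qed
  have in_A: "mat_of 3 (B1 * a + Bq * b) \<in> A" if "a \<in> carrier_mat 1 1" "b \<in> carrier_mat 5 1" for a b
  proof -
    have s: "B1 * a \<in> carrier_mat 9 1" "Bq * b \<in> carrier_mat 9 1" using that car by auto
    have "Lp * (B1 * a + Bq * b) = Lp * B1 * a + Lp * Bq * b"
      unfolding mult_add_distrib_mat[OF car(5) s] using that car by (simp add: mat_assoc)
    also have "\<dots> = 0\<^sub>m 3 1" unfolding zero using that by simp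
    finally show ?thesis using vec_of_mat_of[of "B1 * a + Bq * b" 3] s mat_of_carrier by (simp add: A_def)
  qed
  have in_W: "mat_of 3 (Bp * a) \<in> W" if "a \<in> carrier_mat 3 1" for a
  proof -
    have s: "Bp * a \<in> carrier_mat 9 1" using that car by auto
    have "L1 * (Bp * a) = L1 * Bp * a" "Lq * (Bp * a) = Lq * Bp * a" using that car by (simp_all add: mat_assoc)
    then have "L1 * (Bp * a) = 0\<^sub>m 1 1" "Lq * (Bp * a) = 0\<^sub>m 5 1" unfolding zero using that by simp_all
    then show ?thesis using vec_of_mat_of[of "Bp * a" 3] s mat_of_carrier by (simp add: W_def)
  qed
  interpret split_subalgebra A W "\<lambda>i a b. Lp $$ (i, a * 3 + b)"
  proof
    fix X :: "'k mat"
    have "Lp * vec_of 3 X = 0\<^sub>m 3 1 \<longleftrightarrow> (\<forall>i<3. (Lp * vec_of 3 X) $$ (i,0) = 0)"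
      using mat_eq_iff_index[OF Lv(2)[of X], of "0\<^sub>m 3 1"] by simp
    also have "\<dots> \<longleftrightarrow> (\<forall>i<3. (\<Sum>a<3. \<Sum>b<3. Lp $$ (i, a * 3 + b) * X $$ (a,b)) = 0)"
    proof -
      have "(Lp * vec_of 3 X) $$ (i,0) = (\<Sum>a<3. \<Sum>b<3. Lp $$ (i, a * 3 + b) * X $$ (a,b))" if i: "i < 3" for i
      proof -
        have "(Lp * vec_of 3 X) $$ (i,0) = (\<Sum>k<3*3. Lp $$ (i,k) * vec_of 3 X $$ (k,0))"
          using mult_index[OF car(5) vc i, of 0] by simp
        also have "\<dots> = (\<Sum>a<3. \<Sum>b<3. Lp $$ (i, a * 3 + b) * X $$ (a,b))"
          unfolding sum_pair_index by (intro sum.cong refl) (simp add: vec_of_index)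
        finally show ?thesis .
      qed
      then show ?thesis by simp
    qed
    finally show "X \<in> A \<longleftrightarrow> X \<in> carrier_mat 3 3 \<and> (\<forall>i<3. (\<Sum>a<3. \<Sum>b<3. Lp $$ (i, a * 3 + b) * X $$ (a,b)) = 0)"
      by (simp add: A_def)
    show "\<exists>a\<in>A. \<exists>w\<in>W. X = a + w" if X: "X \<in> carrier_mat 3 3"
    proof (intro bexI)
      have s: "B1 * (L1 * vec_of 3 X) + Bq * (Lq * vec_of 3 X) \<in> carrier_mat (3*3) 1" "Bp * (Lp * vec_of 3 X) \<in> carrier_mat (3*3) 1"
        "B1 * (L1 * vec_of 3 X) \<in> carrier_mat 9 1" "Bq * (Lq * vec_of 3 X) \<in> carrier_mat 9 1"
        using car Lv[of X] by auto
      have "vec_of 3 X = B1 * (L1 * vec_of 3 X) + Bq * (Lq * vec_of 3 X) + Bp * (Lp * vec_of 3 X)"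
        using expand[OF vc[of X]] assoc_add_mat[OF s(3,4), of "Bp * (Lp * vec_of 3 X)"] assoc_add_mat[OF s(3), of "Bp * (Lp * vec_of 3 X)" "Bq * (Lq * vec_of 3 X)"]
          comm_add_mat[OF s(4), of "Bp * (Lp * vec_of 3 X)"] s by simp
      then have "mat_of 3 (vec_of 3 X) = mat_of 3 (B1 * (L1 * vec_of 3 X) + Bq * (Lq * vec_of 3 X)) + mat_of 3 (Bp * (Lp * vec_of 3 X))"
        using mat_of_add[OF s(1,2)] by simp
      then show "X = mat_of 3 (B1 * (L1 * vec_of 3 X) + Bq * (Lq * vec_of 3 X)) + mat_of 3 (Bp * (Lp * vec_of 3 X))"
        unfolding mat_of_vec_of[OF X] .
    qed (rule in_A[OF Lv(1,3)] in_W[OF Lv(2)])+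
    show "X = 0\<^sub>m 3 3" if X: "X \<in> A" "X \<in> W"
    proof -
      have "vec_of 3 X = 0\<^sub>m 9 1"
        using W_form[OF X(2)] AD(2)[OF X(1)] car by simp
      also have "0\<^sub>m 9 1 = vec_of 3 (0\<^sub>m 3 3)" by (rule eq_matI) (auto simp: vec_of_def div_mod_lt)
      finally show ?thesis using vec_of_inj[OF AD(1)[OF X(1)] zero_carrier_mat] by blast
    qed
    fix Y :: "'k mat"
    show "X + Y \<in> W" if X: "X \<in> W" and Y: "Y \<in> W"
      using WD[OF X] WD[OF Y] vec_of_add[OF WD(1)[OF X] WD(1)[OF Y]]
        mult_add_distrib_mat[OF car(4) vc[of X] vc[of Y]] mult_add_distrib_mat[OF car(6) vc[of X] vc[of Y]] by (simp add: W_def)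
  next
    show "W \<subseteq> carrier_mat 3 3" by (auto simp: W_def)
    define a where "a = mat 3 1 (\<lambda>_. 1 :: 'k)"
    have a: "a \<in> carrier_mat 3 1" by (simp add: a_def)
    show "\<exists>w\<in>W. w \<noteq> 0\<^sub>m 3 3"
    proof (rule bexI[OF _ in_W[OF a]], rule notI)
      assume h: "mat_of 3 (Bp * a) = 0\<^sub>m 3 3"
      have "Bp * a = vec_of 3 (mat_of 3 (Bp * a))" using vec_of_mat_of[of "Bp * a" 3] car a by simp
      also have "\<dots> = 0\<^sub>m 9 1" unfolding h by (rule eq_matI) (auto simp: vec_of_def div_mod_lt)
      finally have z: "Bp * a = 0\<^sub>m 9 1" .
      have "a = Lp * Bp * a" unfolding one using a by simp
      also have "\<dots> = Lp * (Bp * a)" using car a by (simp add: mat_assoc)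
      finally have "a = 0\<^sub>m 3 1" unfolding z using car by simp
      then have "a $$ (0,0) = 0" by simp
      then show False by (simp add: a_def)
    qed
  qed (fact AA AW WA)+
  show False by (rule no_complementary_bimodule)
qed


lemma coeff_one: "coeff (1\<^sub>m 1) = span {1}"
  by (simp add: coeff_def lessThan_Suc)

text \<open>
  The alternatives of \<open>degree_three_dichotomy\<close>, translated back to subcoalgebras; the second one is impossible.
\<close>

theorem simple_subcoalgebra_families:
  assumes C: "simple_subcoalgebra C" "dim C = 9"
    and odd: "\<And>D. simple_subcoalgebra D \<Longrightarrow> fin_dim D \<Longrightarrow> odd (dim D)"
    and no: "\<And>g. grouplike g \<Longrightarrow> group.ord grouplike_group g \<notin> {2, 3}"
  obtains c d where "coeff (c 0) = span {1}" "\<And>n. irr (c n)" "\<And>n. dim_row (c n) = 2 * n + 1"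
    "\<And>n. 1 \<le> n \<Longrightarrow> irr (d n)" "\<And>n. 1 \<le> n \<Longrightarrow> dim_row (d n) = 2 * n + 1"
    "\<And>n. 1 \<le> n \<Longrightarrow> coeff (c n) \<cdot> coeff (c 1) = coeff (c (n - 1)) + coeff (d n) + coeff (c (Suc n))"
proof -
  have odd': "odd (dim_row t)" if "irr t" for t
    using odd[OF coeff_simple[OF that] fin_dim_coeff] dim_coeff[OF that] by simp
  interpret F: odd_fusion_rules Irr "1\<^sub>m 1" "\<lambda>a. can (star a)" dim_row "\<lambda>a b. dec (a \<boxtimes> b)"
    by (rule fusion_rules[OF odd' no])
  obtain t where t: "t \<in> Irr" "coeff t = C" using simple_subcoalgebra_irr[OF C(1)] C(2) by auto
  have "(dim_row t)\<^sup>2 = 3\<^sup>2" using dim_coeff[OF Irr_D(1)[OF t(1)]] t(2) C(2) by simp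
  then have "dim_row t = 3" by (simp only: power2_eq_iff_nonneg[of "dim_row t" 3] zero_le)
  from t(1) this show thesis
  proof (cases rule: F.degree_three_dichotomy)
    case (1 c d)
    show thesis
    proof (rule that[of c d])
      show "coeff (c 0) = span {1}" using 1(1) coeff_one by simp
      show "irr (c n)" "dim_row (c n) = 2 * n + 1" for n using Irr_D(1)[OF 1(2)] 1(3) by auto
      fix n :: nat assume n: "1 \<le> n"
      have d: "d n \<in> Irr" "dim_row (d n) = 2 * n + 1" "dec (c n \<boxtimes> c 1) = {#c (n - 1), d n, c (Suc n)#}" using 1(4)[OF n] by auto
      show "irr (d n)" "dim_row (d n) = 2 * n + 1" using Irr_D(1)[OF d(1)] d(2) by auto
      note cc = Irr_D(3)[OF 1(2)[of n]] Irr_D(3)[OF 1(2)[of 1]]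
      show "coeff (c n) \<cdot> coeff (c 1) = coeff (c (n - 1)) + coeff (d n) + coeff (c (Suc n))"
        unfolding coeff_kron[OF cc, symmetric] coeff_dec[OF corep_kron[OF cc]] d(3) by (simp add: add.assoc)
    qed
  next
    case (2 u p q)
    have us: "dec (u \<boxtimes> star u) = {#1\<^sub>m 1, p, q#}"
    proof -
      note s = can_star_isom[OF 2(1)] and uc = Irr_D(3)[OF 2(1)]
      have "dec (u \<boxtimes> star u) = dec (u \<boxtimes> can (star u))"
        by (rule dec_isom[OF corep_kron[OF uc s(1)] corep_kron[OF uc Irr_D(3)[OF s(2)]] isom_kron(2)[OF s(1) Irr_D(3)[OF s(2)] uc s(3)]])
      then show ?thesis using 2(7) by simp
    qed
    have "1\<^sub>m 1 \<notin># dec (a \<boxtimes> b)" if ab: "a \<in> Irr" "b \<in> Irr" "dim_row a \<noteq> dim_row b" for a b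
    proof -
      note s = can_star_isom[OF ab(1)]
      have "count (dec (a \<boxtimes> b)) (1\<^sub>m 1) = count (dec (can (star a) \<boxtimes> 1\<^sub>m 1)) b"
        using F.frobenius_left[OF s(2) ab(2) one_Irr] dual_dual_Irr[OF ab(1)] by simp
      also have "\<dots> = count {#can (star a)#} b" unfolding F.mul_one[OF s(2)] ..
      also have "\<dots> = 0" using s(4) ab(3) by auto
      finally show ?thesis by (simp add: not_in_iff)
    qed
    then have "1\<^sub>m 1 \<notin># dec (q \<boxtimes> p)" "1\<^sub>m 1 \<notin># dec (p \<boxtimes> q)" using 2 by auto
    then have False using exceptional_square_impossible[OF 2(1,4) 2(2,5) 2(3,6) us 2(8-10)] by blast
    then show thesis ..
  qed
qed

end

theorem theorem3p1:
  fixes scale :: "'k::alg_closed_field \<Rightarrow> 'h::ring_1 \<Rightarrow> 'h"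
    and \<Delta> :: "'h \<Rightarrow> ('h \<Rightarrow> 'h \<Rightarrow> 'k) \<Rightarrow> 'k"
    and \<epsilon> :: "'h \<Rightarrow> 'k"
    and S :: "'h \<Rightarrow> 'h"
  assumes "hopf_algebra scale \<Delta> \<epsilon> S"
    and "coalgebra.cosemisimple scale \<Delta>"
    and "\<exists>C. coalgebra.simple_subcoalgebra scale \<Delta> C \<and> vector_space.dim scale C = 9"
    and "\<not> (\<exists>D. coalgebra.simple_subcoalgebra scale \<Delta> D \<and> kspace.fin_dim scale D \<and>
               even (vector_space.dim scale D))"
  shows "(\<exists>g. coalgebra.grouplike scale \<Delta> \<epsilon> g \<and>
              group.ord (bialgebra.grouplike_group scale \<Delta> \<epsilon>) g \<in> {2, 3}) \<or>
         (\<exists>C D :: nat \<Rightarrow> 'h set.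
            C 1 = module.span scale {1} \<and>
            (\<forall>n\<ge>1. coalgebra.simple_subcoalgebra scale \<Delta> (C (2 * n + 1)) \<and>
                   coalgebra.simple_subcoalgebra scale \<Delta> (D (2 * n + 1)) \<and>
                   vector_space.dim scale (C (2 * n + 1)) = (2 * n + 1)\<^sup>2 \<and>
                   vector_space.dim scale (D (2 * n + 1)) = (2 * n + 1)\<^sup>2) \<and>
            (\<forall>n\<ge>1. unital_algebra.subspace_prod scale (C (2 * n + 1)) (C 3) =
                   C (2 * n - 1) + D (2 * n + 1) + C (2 * n + 3)))"
proof -
  interpret cosemisimple_hopf_algebra scale \<Delta> \<epsilon> S
    by (intro cosemisimple_hopf_algebra.intro cosemisimple_hopf_algebra_axioms.intro assms(1,2))
  obtain C0 where C0: "simple_subcoalgebra C0" "dim C0 = 9" using assms(3) by blast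
  show ?thesis
    unfolding disj_imp
  proof
    assume no: "\<not> (\<exists>g. grouplike g \<and> group.ord grouplike_group g \<in> {2, 3})"
    obtain c d where c: "coeff (c 0) = span {1}" "\<And>n. irr (c n)" "\<And>n. dim_row (c n) = 2 * n + 1"
      and d: "\<And>n. 1 \<le> n \<Longrightarrow> irr (d n)" "\<And>n. 1 \<le> n \<Longrightarrow> dim_row (d n) = 2 * n + 1"
      and cd: "\<And>n. 1 \<le> n \<Longrightarrow> coeff (c n) \<cdot> coeff (c 1) = coeff (c (n - 1)) + coeff (d n) + coeff (c (Suc n))"
      by (rule simple_subcoalgebra_families[OF C0]) (use assms(4) no in blast)+
    define C where "C = (\<lambda>m. coeff (c (m div 2)))"
    define D where "D = (\<lambda>m. coeff (d (m div 2)))"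
    have ix: "C (2 * n + 1) = coeff (c n)" "D (2 * n + 1) = coeff (d n)" "C (2 * n + 3) = coeff (c (Suc n))" for n
      by (simp_all add: C_def D_def)
    have "C (2 * n - 1) = coeff (c (n - 1))" if "1 \<le> n" for n
      using that by (cases n) (simp_all add: C_def)
    moreover have "C 1 = span {1}" "C 3 = coeff (c 1)" using c(1) by (simp_all add: C_def)
    ultimately show "\<exists>C D :: nat \<Rightarrow> 'h set.
            C 1 = module.span scale {1} \<and>
            (\<forall>n\<ge>1. coalgebra.simple_subcoalgebra scale \<Delta> (C (2 * n + 1)) \<and>
                   coalgebra.simple_subcoalgebra scale \<Delta> (D (2 * n + 1)) \<and>
                   vector_space.dim scale (C (2 * n + 1)) = (2 * n + 1)\<^sup>2 \<and>
                   vector_space.dim scale (D (2 * n + 1)) = (2 * n + 1)\<^sup>2) \<and>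
            (\<forall>n\<ge>1. unital_algebra.subspace_prod scale (C (2 * n + 1)) (C 3) =
                   C (2 * n - 1) + D (2 * n + 1) + C (2 * n + 3))"
      using coeff_simple[OF c(2)] coeff_simple[OF d(1)] dim_coeff[OF c(2)] dim_coeff[OF d(1)] c(3) d(2) cd
      by (intro exI[of _ C] exI[of _ D]) (simp only: ix, simp)
  qed
qed

end
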